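(* Assume that $\mathfrak{m}\in L^\infty(0,\infty)$ and that $\mathfrak{m}(\lambda)=\lambda\int_0^\infty e^{-\lambda t}\Psi(t)\,dt$, $\lambda\in(0,\infty)$, where $\Psi\in L^\infty(0,\infty)$. Then the operator $T_{\mathfrak{m}}$ is bounded (a) from $\ell^p(\mathbb{Z},\omega)$ into itself, for every $1<p<\infty$ and $\omega\in A_p(\mathbb{Z})$; (b) from $\ell^1(\mathbb{Z},\omega)$ into $\ell^{1,\infty}(\mathbb{Z},\omega)$, for every $\omega\in A_1(\mathbb{Z})$; (c) from $\mathcal{H}^p(\mathbb{Z})$ into itself, for every $0<p\leq1$.
   Context: $\mathbb{N}=\{0,1,2,\dots\}$. $\mathbb{Z}$ carries the distance $|n-m|$ and the counting measure $\mu$; $B_{\mathbb{Z}}(n_0,r_0)$ denotes the ball in $\mathbb{Z}$ with center $n_0$ and radius $r_0$. For $0<p\leq\infty$, $\ell^p(\mathbb{Z})$ is the usual space of complex sequences on $\mathbb{Z}$ with (quasi)norm $\|\cdot\|_p$. Multiplier: for $f\in\ell^1(\mathbb{Z})$, $\mathcal{F}_{\mathbb{Z}}(f)(\theta)=\sum_{n\in\mathbb{Z}}f(n)e^{in\theta}$, $\theta\in(-\pi,\pi)$, extended to $\ell^2(\mathbb{Z})$ as an (up to a normalization constant) isometry into $L^2(-\pi,\pi)$, with inverse $\mathcal{F}_{\mathbb{Z}}^{-1}(\varphi)(n)=\frac1{2\pi}\int_{-\pi}^\pi\varphi(\theta)e^{-in\theta}\,d\theta$. For $\mathfrak{m}\in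 L^\infty(0,\infty)$, the spectral multiplier associated with the discrete Laplacian $(\Delta_df)(n)=-f(n+1)+2f(n)-f(n-1)$ is $T_{\mathfrak{m}}f=\mathcal{F}_{\mathbb{Z}}^{-1}[\mathfrak{m}(2(1-\cos\theta))\mathcal{F}_{\mathbb{Z}}(f)]$, $f\in\ell^2(\mathbb{Z})$; it is bounded on $\ell^2(\mathbb{Z})$. Weighted spaces: for a nonnegative sequence $\omega$ on $\mathbb{Z}$ and $1\leq p<\infty$, $\ell^p(\mathbb{Z},\omega)$ is the space of complex sequences with $\|f\|_{p;\omega}=\big(\sum_n|f(n)|^p\omega(n)\big)^{1/p}<\infty$, and $\ell^{1,\infty}(\mathbb{Z},\omega)$ is the space of those with $\|f\|_{1,\infty;\omega}=\sup_{\lambda>0}\lambda\,\omega(\{n\in\mathbb{Z}:|f(n)|>\lambda\})<\infty$, where $\omega(E)=\sum_{n\in E}\omega(n)$. A nonnegative sequence $\omega$ belongs to $A_p(\mathbb{Z})$ when there is $C>0$ such that for all $M,N\in\mathbb{Z}$, $M\leq N$: $\big(\sum_{k=M}^N\omega(k)\big)\big(\sum_{k=M}^N\omega(k)^{-1/(p-1)}\big)^{p-1}\leq C(N-M+1)^p$ if $1<p<\infty$, and $\big(\sum_{k=M}^N\omega(k)\big)\sup_{M\leq k\leq N}\omega(k)^{-1}\leq C(N-M+1)$ if $p=1$. Boundedness of $T_{\mathfrak{m}}$ on $\ell^p(\mathbb{Z},\omega)$ (respectively from $\ell^1(\mathbb{Z},\omega)$ into $\ell^{1,\infty}(\mathbb{Z},\omega)$)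 means that $T_{\mathfrak{m}}$ can be extended from $\ell^2(\mathbb{Z})\cap\ell^p(\mathbb{Z},\omega)$ to $\ell^p(\mathbb{Z},\omega)$ (with $p=1$ in the second case) as a bounded operator between the indicated spaces. Discrete Hardy space $\mathcal{H}^p(\mathbb{Z})$, $0<p\leq1$. A complex sequence $\mathfrak{b}$ is an $(H,p,\infty)$-atom when there exist $n_0\in\mathbb{Z}$ and $r_0\geq1$ such that: (i) the support of $\mathfrak{b}$ is contained in $B_{\mathbb{Z}}(n_0,r_0)$; (ii) $\|\mathfrak{b}\|_\infty\leq\mu(B_{\mathbb{Z}}(n_0,r_0))^{-1/p}$; (iii) $\sum_{n\in\mathbb{Z}}n^\alpha\mathfrak{b}(n)=0$ for every $\alpha\in\mathbb{N}$ with $\alpha\leq 1/p-1$. For $\alpha>0$, $\mathcal{L}_\alpha$ is the space of complex sequences $\mathfrak{a}$ with $\|\mathfrak{a}\|_{\mathcal{L}_\alpha}=\sup_{n\neq m}|\mathfrak{a}(n)-\mathfrak{a}(m)|/|n-m|^\alpha<\infty$, and $(\mathcal{L}_\alpha)'$ is its dual. For $0<p<1$ every $(H,p,\infty)$-atom $\mathfrak{b}$ defines an element of $(\mathcal{L}_{1/p-1})'$ by $\mathfrak{a}\mapsto\sum_{n\in\mathbb{Z}}\mathfrak{a}(n)\mathfrak{b}(n)$. For $0<p<1$, $\mathcal{H}^p(\mathbb{Z})$ consists of those $h\in(\mathcal{L}_{1/p-1})'$ for which there are $(H,p,\infty)$-atoms $\mathfrak{b}_j$ and $\lambda_j>0$,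 $j\in\mathbb{N}$, with $\sum_j\lambda_j^p<\infty$ and $h=\sum_j\lambda_j\mathfrak{b}_j$ in $(\mathcal{L}_{1/p-1})'$. The series then also converges in $\ell^p(\mathbb{Z})$, and $h$ is identified with its sum, the sequence $h(n)=\sum_j\lambda_j\mathfrak{b}_j(n)$; so $\mathcal{H}^p(\mathbb{Z})\subset\ell^p(\mathbb{Z})\subset\ell^2(\mathbb{Z})$. For $p=1$, $\mathcal{H}^1(\mathbb{Z})$ consists of those $h\in\ell^1(\mathbb{Z})$ with $h=\sum_j\lambda_j\mathfrak{b}_j$ in $\ell^1(\mathbb{Z})$, $\mathfrak{b}_j$ being $(H,1,\infty)$-atoms, $\lambda_j>0$, $\sum_j\lambda_j<\infty$. In both cases $\|h\|_{\mathcal{H}^p(\mathbb{Z})}=\inf\big(\sum_j\lambda_j^p\big)^{1/p}$, the infimum being over all such representations of $h$ (with $\lambda_j\geq0$). *)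

theory Defs
  imports "HOL-Analysis.Analysis"
begin

text \<open>
  Norms and quasinorms take values in \<^typ>\<open>ennreal\<close>, with value \<open>top\<close> for sequences outside
  the space; the spaces are the sets where the norm is finite.
\<close>

text \<open>Positive powers on \<open>[0,\<infinity>]\<close>; only used with \<open>a > 0\<close>.\<close>

definition epowr :: "ennreal \<Rightarrow> real \<Rightarrow> ennreal" where
  "epowr x a = (if x = top then top else ennreal (enn2real x powr a))"


section \<open>Sequence spaces and weights\<close>

definition lp_norm :: "real \<Rightarrow> (int \<Rightarrow> real) \<Rightarrow> (int \<Rightarrow> complex) \<Rightarrow> ennreal" where
  "lp_norm p \<omega> f = epowr (\<Sum>\<^sub>\<infinity>n\<in>UNIV. ennreal (norm (f n) powr p * \<omega> n)) (1 / p)"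

definition lp_space :: "real \<Rightarrow> (int \<Rightarrow> real) \<Rightarrow> (int \<Rightarrow> complex) set" where
  "lp_space p \<omega> = {f. lp_norm p \<omega> f < top}"

abbreviation unit_weight :: "int \<Rightarrow> real" where
  "unit_weight \<equiv> (\<lambda>_. 1)"

definition weak_l1_norm :: "(int \<Rightarrow> real) \<Rightarrow> (int \<Rightarrow> complex) \<Rightarrow> ennreal" where
  "weak_l1_norm \<omega> f =
     (SUP l\<in>{0<..}. ennreal l * (\<Sum>\<^sub>\<infinity>n\<in>{n. l < norm (f n)}. ennreal (\<omega> n)))"

text \<open>
  The left-hand sides of the \<open>A\<^sub>p\<close> conditions are evaluated in \<open>[0,\<infinity>]\<close>, where \<open>inverse 0 = \<infinity>\<close>
  and \<open>0 * \<infinity> = 0\<close>.  Consequently a weight in \<open>A\<^sub>p\<close> that vanishes somewhere vanishes identically.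
\<close>

definition Ap_weight :: "real \<Rightarrow> (int \<Rightarrow> real) \<Rightarrow> bool" where
  "Ap_weight p \<omega> \<longleftrightarrow> (\<forall>n. 0 \<le> \<omega> n) \<and>
     (\<exists>C>0. \<forall>M N. M \<le> N \<longrightarrow>
        (if p = 1
         then (\<Sum>k=M..N. ennreal (\<omega> k)) * (SUP k\<in>{M..N}. inverse (ennreal (\<omega> k)))
                \<le> ennreal (C * of_int (N - M + 1))
         else (\<Sum>k=M..N. ennreal (\<omega> k))
                * epowr (\<Sum>k=M..N. epowr (inverse (ennreal (\<omega> k))) (1 / (p - 1))) (p - 1)
                \<le> ennreal (C * of_int (N - M + 1) powr p)))"


section \<open>Spectral multipliers of the discrete Laplacian\<close>

definition Linf_pos :: "(real \<Rightarrow> complex) set" where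
  "Linf_pos = {f. f \<in> borel_measurable (lebesgue_on {0<..}) \<and>
                  (\<exists>B. AE x in lebesgue_on {0<..}. norm (f x) \<le> B)}"

definition fourier_l1 :: "(int \<Rightarrow> complex) \<Rightarrow> real \<Rightarrow> complex" where
  "fourier_l1 f \<theta> = (\<Sum>\<^sub>\<infinity>n\<in>UNIV. f n * cis (of_int n * \<theta>))"

definition L2_norm_pi :: "(real \<Rightarrow> complex) \<Rightarrow> ennreal" where
  "L2_norm_pi \<phi> =
     epowr (\<integral>\<^sup>+\<theta>. ennreal ((norm (\<phi> \<theta>))\<^sup>2) \<partial>lebesgue_on {-pi<..<pi}) (1 / 2)"

definition L2_pi :: "(real \<Rightarrow> complex) set" where
  "L2_pi = {\<phi>. \<phi> \<in> borel_measurable (lebesgue_on {-pi<..<pi}) \<and> L2_norm_pi \<phi> < top}"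

text \<open>
  Extension by density of \<^const>\<open>fourier_l1\<close>: the closure of its graph in \<open>\<ell>\<^sup>2 \<times> L\<^sup>2(-\<pi>,\<pi>)\<close>.
  The second component is determined up to equality almost everywhere, hence the choice
  operator in \<open>fourier_l2\<close>, on which the multiplier operator below does not depend.
\<close>

definition is_fourier_l2 :: "(int \<Rightarrow> complex) \<Rightarrow> (real \<Rightarrow> complex) \<Rightarrow> bool" where
  "is_fourier_l2 f \<phi> \<longleftrightarrow> \<phi> \<in> L2_pi \<and>
     (\<exists>g :: nat \<Rightarrow> int \<Rightarrow> complex.
        (\<forall>k. g k \<in> lp_space 1 unit_weight) \<and>
        (\<lambda>k. lp_norm 2 unit_weight (\<lambda>n. g k n - f n)) \<longlonglongrightarrow> 0 \<and>
        (\<lambda>k. L2_norm_pi (\<lambda>\<theta>. fourier_l1 (g k) \<theta> - \<phi> \<theta>)) \<longlonglongrightarrow> 0)"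

definition fourier_l2 :: "(int \<Rightarrow> complex) \<Rightarrow> real \<Rightarrow> complex" where
  "fourier_l2 f = (SOME \<phi>. is_fourier_l2 f \<phi>)"

definition inv_fourier :: "(real \<Rightarrow> complex) \<Rightarrow> int \<Rightarrow> complex" where
  "inv_fourier \<phi> n =
     (1 / (2 * of_real pi)) *
     (LINT \<theta>|lebesgue_on {-pi<..<pi}. \<phi> \<theta> * cis (- (of_int n * \<theta>)))"

definition multiplier_op :: "(real \<Rightarrow> complex) \<Rightarrow> (int \<Rightarrow> complex) \<Rightarrow> int \<Rightarrow> complex" where
  "multiplier_op m f = inv_fourier (\<lambda>\<theta>. m (2 * (1 - cos \<theta>)) * fourier_l2 f \<theta>)"

definition linear_op_on ::
    "(int \<Rightarrow> complex) set \<Rightarrow> ((int \<Rightarrow> complex) \<Rightarrow> int \<Rightarrow> complex) \<Rightarrow> bool" where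
  "linear_op_on X S \<longleftrightarrow>
     (\<forall>f\<in>X. \<forall>g\<in>X. S (\<lambda>n. f n + g n) = (\<lambda>n. S f n + S g n)) \<and>
     (\<forall>c. \<forall>f\<in>X. S (\<lambda>n. c * f n) = (\<lambda>n. c * S f n))"

text \<open>
  \<open>T\<close>, given on \<open>\<ell>\<^sup>2\<close>, extends from \<open>\<ell>\<^sup>2 \<inter> \<ell>\<^sup>p(\<omega>)\<close> to a bounded linear operator on \<open>\<ell>\<^sup>p(\<omega>)\<close>,
  the target space being \<open>{f. target_norm f < \<infinity>}\<close>.
\<close>

definition extends_boundedly ::
    "((int \<Rightarrow> complex) \<Rightarrow> int \<Rightarrow> complex) \<Rightarrow> real \<Rightarrow> (int \<Rightarrow> real) \<Rightarrow>
     ((int \<Rightarrow> complex) \<Rightarrow> ennreal) \<Rightarrow> bool" where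
  "extends_boundedly T p \<omega> target_norm \<longleftrightarrow>
     (\<exists>S. linear_op_on (lp_space p \<omega>) S \<and>
          (\<forall>f \<in> lp_space 2 unit_weight \<inter> lp_space p \<omega>. S f = T f) \<and>
          (\<exists>C::real. \<forall>f \<in> lp_space p \<omega>. target_norm (S f) \<le> ennreal C * lp_norm p \<omega> f))"


section \<open>Discrete Hardy spaces\<close>

definition ball_Z :: "int \<Rightarrow> real \<Rightarrow> int set" where
  "ball_Z n0 r0 = {n. \<bar>of_int (n - n0)\<bar> < r0}"

definition hardy_atom :: "real \<Rightarrow> (int \<Rightarrow> complex) \<Rightarrow> bool" where
  "hardy_atom p b \<longleftrightarrow>
     (\<exists>(n0::int) (r0::real). 1 \<le> r0 \<and>
        {n. b n \<noteq> 0} \<subseteq> ball_Z n0 r0 \<and>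
        (\<forall>n. norm (b n) \<le> real (card (ball_Z n0 r0)) powr (- 1 / p)) \<and>
        (\<forall>\<alpha>::nat. real \<alpha> \<le> 1 / p - 1 \<longrightarrow> (\<Sum>\<^sub>\<infinity>n\<in>UNIV. of_int n ^ \<alpha> * b n) = 0))"

definition lip_norm :: "real \<Rightarrow> (int \<Rightarrow> complex) \<Rightarrow> ennreal" where
  "lip_norm \<alpha> a =
     (SUP (n, m)\<in>{(n, m). n \<noteq> m}. ennreal (norm (a n - a m) / \<bar>of_int (n - m)\<bar> powr \<alpha>))"

definition lip_space :: "real \<Rightarrow> (int \<Rightarrow> complex) set" where
  "lip_space \<alpha> = {a. lip_norm \<alpha> a < top}"

text \<open>
  Functionals on \<^const>\<open>lip_space\<close> are represented by total functions, whose values outside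
  that space are irrelevant.
\<close>

definition lip_dual_norm :: "real \<Rightarrow> ((int \<Rightarrow> complex) \<Rightarrow> complex) \<Rightarrow> ennreal" where
  "lip_dual_norm \<alpha> \<Phi> = (SUP a\<in>{a. lip_norm \<alpha> a \<le> 1}. ennreal (norm (\<Phi> a)))"

definition lip_dual :: "real \<Rightarrow> ((int \<Rightarrow> complex) \<Rightarrow> complex) set" where
  "lip_dual \<alpha> = {\<Phi>.
     (\<forall>f \<in> lip_space \<alpha>. \<forall>g \<in> lip_space \<alpha>. \<Phi> (\<lambda>n. f n + g n) = \<Phi> f + \<Phi> g) \<and>
     (\<forall>c. \<forall>f \<in> lip_space \<alpha>. \<Phi> (\<lambda>n. c * f n) = c * \<Phi> f) \<and>
     lip_dual_norm \<alpha> \<Phi> < top}"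

definition seq_functional :: "(int \<Rightarrow> complex) \<Rightarrow> (int \<Rightarrow> complex) \<Rightarrow> complex" where
  "seq_functional b a = (\<Sum>\<^sub>\<infinity>n\<in>UNIV. a n * b n)"

text \<open>
  For \<open>p < 1\<close> the element of the Hardy space is the functional \<open>\<Phi>\<close>, the sum of the series in the
  dual of \<^term>\<open>lip_space (1 / p - 1)\<close>, and the sequence \<open>h\<close> is the pointwise sum it is
  identified with.  The unit sequences belong to \<^const>\<open>lip_space\<close> and \<open>h n\<close> is the value
  of \<open>\<Phi>\<close> at the \<open>n\<close>-th one.
\<close>

definition atomic_rep ::
    "real \<Rightarrow> (int \<Rightarrow> complex) \<Rightarrow> (nat \<Rightarrow> real) \<Rightarrow> (nat \<Rightarrow> int \<Rightarrow> complex) \<Rightarrow> bool" where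
  "atomic_rep p h cs bs \<longleftrightarrow>
     (\<forall>j. hardy_atom p (bs j)) \<and>
     summable (\<lambda>j. cs j powr p) \<and>
     (if p = 1
      then h \<in> lp_space 1 unit_weight \<and>
           (\<lambda>N. lp_norm 1 unit_weight (\<lambda>n. h n - (\<Sum>j<N. of_real (cs j) * bs j n))) \<longlonglongrightarrow> 0
      else (\<exists>\<Phi> \<in> lip_dual (1 / p - 1).
             (\<lambda>N. lip_dual_norm (1 / p - 1)
                    (\<lambda>a. \<Phi> a - (\<Sum>j<N. of_real (cs j) * seq_functional (bs j) a))) \<longlonglongrightarrow> 0) \<and>
           (\<forall>n. (\<lambda>j. of_real (cs j) * bs j n) sums h n))"

definition hardy_space :: "real \<Rightarrow> (int \<Rightarrow> complex) set" where
  "hardy_space p = {h. \<exists>cs bs. (\<forall>j. 0 < cs j) \<and> atomic_rep p h cs bs}"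

definition hardy_norm :: "real \<Rightarrow> (int \<Rightarrow> complex) \<Rightarrow> ennreal" where
  "hardy_norm p h =
     (INF (cs, bs)\<in>{(cs, bs). (\<forall>j. 0 \<le> cs j) \<and> atomic_rep p h cs bs}.
        ennreal ((\<Sum>j. cs j powr p) powr (1 / p)))"

end

theory Submission
  imports Defs "HOL-Complex_Analysis.Complex_Analysis" "HOL-Library.Function_Algebras"
begin

text \<open>
  On \<open>\<ell>\<^sup>2\<close> the operator \<open>T\<close> with multiplier \<open>m\<close> is the convolution with the Fourier coefficients \<open>K\<close> of the
  bounded function \<open>m (2 * (1 - cos \<theta>))\<close>; see \<open>multiplier_op_eq_conv\<close>. The theorem holds because \<open>K\<close> is a
  Calderon-Zygmund kernel: its differences satisfy \<open>\<bar>D\<^sup>j K(n)\<bar> \<le> C / \<bar>n\<bar> ^ (j + 1)\<close> for every \<open>j\<close>. By hypothesis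
  \<open>m\<close> is a superposition of the functions \<open>\<lambda> * exp (- t * \<lambda>)\<close> with bounded density \<open>\<Psi>\<close>, so \<open>K\<close> is a
  superposition of time derivatives of the heat kernel. In the Fourier integral of the latter the path is
  moved off the real axis, along rays of small slope. There \<open>2 - 2 * cos z\<close> keeps a positive real part, while
  \<open>exp (- (\<i> * n * z))\<close> decays exponentially in \<open>\<bar>n\<bar>\<close>. Integrating in \<open>t\<close> and then along the rays gives the
  bound, \<open>kernel_difference_bound\<close>.

  The rest concerns an arbitrary such kernel, the locale \<open>calderon_zygmund_kernel\<close>. For \<open>1 < p\<close>, the
  Calderon-Zygmund decomposition gives the weak-type inequality for the counting measure. Through the
  recursion of Lerner and Ombrosi it yields a pointwise bound of \<open>T f\<close> by averages of \<open>f\<close> over a sparse family of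
  intervals, \<open>sparse_domination\<close>. Sparse operators are bounded on \<open>\<ell>\<^sup>p(w)\<close> for weights in \<open>A\<^sub>p\<close>: the condition on
  the weight allows every interval to be replaced by its own part, these parts are disjoint, and maximal
  functions with respect to \<open>w\<close> and its dual weight finish the proof, \<open>Ap_bound\<close>. A weight in \<open>A\<^sub>1\<close> is
  in \<open>A\<^sub>2\<close>, and the Calderon-Zygmund decomposition with this weight turns the \<open>\<ell>\<^sup>2(w)\<close> bound into
  the weak-type inequality, \<open>A1_bound\<close>. All this is proved for sequences of finite support and carries over by
  truncation, \<open>weighted_bounds\<close>.

  For Hardy spaces it suffices that the image of an atom is a sum of atoms with uniformly controlled
  coefficients, \<open>atom_image\<close>. An atom \<open>b\<close> with \<open>N\<close> vanishing moments is an \<open>N\<close>-th difference \<open>D\<^sup>N a\<close>, so \<open>T b = D\<^sup>N (T a)\<close>.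
  Cutting \<open>T a\<close>, and not \<open>T b\<close>, into pieces by smooth functions at dyadic distances keeps the moments. The far
  pieces are multiples of atoms with geometrically decaying coefficients, by the bounds for \<open>D\<^sup>j K\<close>
  with \<open>j \<le> N\<close>. The near piece is only square-summable, and a stopping argument that restores the moments,
  \<open>square_atom\<close>, resolves it into atoms.
\<close>

section \<open>Stopping intervals, interval coverings and maximal functions\<close>

text \<open>
  Intervals whose length is a power of two, with an arbitrary left endpoint. Only the halving of a
  given interval matters below, so there is no fixed grid.
\<close>

definition dyad :: "int \<Rightarrow> nat \<Rightarrow> int set" where
  "dyad a k = {a..<a + 2 ^ k}"

lemma finite_dyad [simp, intro]: "finite (dyad a k)"
  by (simp add: dyad_def)

lemma card_dyad [simp]: "card (dyad a k) = 2 ^ k"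
  by (simp add: dyad_def nat_power_eq)

lemma dyad_Suc: "dyad a (Suc k) = dyad a k \<union> dyad (a + 2 ^ k) k"
  "dyad a k \<inter> dyad (a + 2 ^ k) k = {}"
  by (auto simp: dyad_def)

lemma dyad_nonempty: "a \<in> dyad a k"
  by (auto simp: dyad_def)

text \<open>
  The Calderon-Zygmund stopping intervals of \<open>v\<close> inside \<open>dyad a k\<close> at height \<open>l\<close>. An interval is
  recorded by its left endpoint and the exponent of its length.
\<close>

definition stopping_family :: "(int \<Rightarrow> real) \<Rightarrow> real \<Rightarrow> int \<Rightarrow> nat \<Rightarrow> (int \<times> nat) set \<Rightarrow> bool" where
  "stopping_family v l a k \<P> \<longleftrightarrow> finite \<P> \<and>
     (\<forall>(b, j)\<in>\<P>. j < k \<and> dyad b j \<subseteq> dyad a k \<and>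
        l * 2 ^ j < sum v (dyad b j) \<and> sum v (dyad b j) \<le> 2 * l * 2 ^ j) \<and>
     disjoint_family_on (\<lambda>(b, j). dyad b j) \<P> \<and>
     (\<forall>x\<in>dyad a k - (\<Union>(b, j)\<in>\<P>. dyad b j). v x \<le> l)"

text \<open>
  Halve the interval repeatedly and stop at a half as soon as its average exceeds \<open>l\<close>. The parent of
  such a half was not stopped at, so the average over the half is at most \<open>2 * l\<close>. A point that is
  never caught is itself an interval of length one whose average is at most \<open>l\<close>.
\<close>

lemma stopping_family_exists:
  assumes v: "\<And>x. 0 \<le> v x" and "sum v (dyad a k) \<le> l * 2 ^ k"
  shows "\<exists>\<P>. stopping_family v l a k \<P>"
  using assms(2)
proof (induction k arbitrary: a)
  case 0
  have "{a..<a + 1} = {a}" by auto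
  with 0 show ?case
    by (intro exI[of _ "{}"]) (auto simp: stopping_family_def dyad_def disjoint_family_on_def)
next
  case (Suc k)
  have half: "\<exists>\<P>. finite \<P> \<and>
     (\<forall>(b, j)\<in>\<P>. j < Suc k \<and> dyad b j \<subseteq> dyad c k \<and>
        l * 2 ^ j < sum v (dyad b j) \<and> sum v (dyad b j) \<le> 2 * l * 2 ^ j) \<and>
     disjoint_family_on (\<lambda>(b, j). dyad b j) \<P> \<and>
     (\<forall>x\<in>dyad c k - (\<Union>(b, j)\<in>\<P>. dyad b j). v x \<le> l)"
    if sub: "dyad c k \<subseteq> dyad a (Suc k)" for c
  proof (cases "sum v (dyad c k) \<le> l * 2 ^ k")
    case True
    from Suc.IH[OF this] obtain \<P> where "stopping_family v l c k \<P>" ..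
    then show ?thesis
      unfolding stopping_family_def by (intro exI[of _ \<P>]) fastforce
  next
    case False
    have "sum v (dyad c k) \<le> sum v (dyad a (Suc k))"
      by (rule sum_mono2) (use sub v in auto)
    also have "\<dots> \<le> 2 * l * 2 ^ k" using Suc.prems by simp
    finally show ?thesis using False
      by (intro exI[of _ "{(c, k)}"]) (auto simp: disjoint_family_on_def)
  qed
  obtain \<A> where A: "finite \<A>"
     "\<forall>(b, j)\<in>\<A>. j < Suc k \<and> dyad b j \<subseteq> dyad a k \<and>
        l * 2 ^ j < sum v (dyad b j) \<and> sum v (dyad b j) \<le> 2 * l * 2 ^ j"
     "disjoint_family_on (\<lambda>(b, j). dyad b j) \<A>"
     "\<forall>x\<in>dyad a k - (\<Union>(b, j)\<in>\<A>. dyad b j). v x \<le> l"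
    using half[of a] by (auto simp: dyad_Suc)
  obtain \<B> where B: "finite \<B>"
     "\<forall>(b, j)\<in>\<B>. j < Suc k \<and> dyad b j \<subseteq> dyad (a + 2 ^ k) k \<and>
        l * 2 ^ j < sum v (dyad b j) \<and> sum v (dyad b j) \<le> 2 * l * 2 ^ j"
     "disjoint_family_on (\<lambda>(b, j). dyad b j) \<B>"
     "\<forall>x\<in>dyad (a + 2 ^ k) k - (\<Union>(b, j)\<in>\<B>. dyad b j). v x \<le> l"
    using half[of "a + 2 ^ k"] by (auto simp: dyad_Suc)
  have cross: "dyad b j \<inter> dyad b' j' = {}" if "(b, j) \<in> \<A>" "(b', j') \<in> \<B>" for b j b' j'
    using A(2) B(2) that dyad_Suc(2)[of a k] by fastforce
  have "disjoint_family_on (\<lambda>(b, j). dyad b j) (\<A> \<union> \<B>)"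
    unfolding disjoint_family_on_def
  proof (intro ballI impI)
    fix P Q assume "P \<in> \<A> \<union> \<B>" "Q \<in> \<A> \<union> \<B>" "P \<noteq> Q"
    then consider "P \<in> \<A>" "Q \<in> \<A>" | "P \<in> \<B>" "Q \<in> \<B>" | "P \<in> \<A>" "Q \<in> \<B>" | "P \<in> \<B>" "Q \<in> \<A>"
      by blast
    then show "(case P of (b, j) \<Rightarrow> dyad b j) \<inter> (case Q of (b, j) \<Rightarrow> dyad b j) = {}"
    proof cases
      case 1 then show ?thesis using A(3) \<open>P \<noteq> Q\<close> by (auto simp: disjoint_family_on_def)
    next
      case 2 then show ?thesis using B(3) \<open>P \<noteq> Q\<close> by (auto simp: disjoint_family_on_def)
    next
      case 3 then show ?thesis using cross by (cases P; cases Q) simp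
    next
      case 4 then show ?thesis using cross[of "fst Q" "snd Q" "fst P" "snd P"] by (auto simp: case_prod_beta)
    qed
  qed
  then have "stopping_family v l a (Suc k) (\<A> \<union> \<B>)"
    unfolding stopping_family_def using A B by (auto simp: dyad_Suc(1))
  then show ?case ..
qed

lemma stopping_familyD:
  assumes "stopping_family v l a k \<P>"
  shows "finite \<P>"
    and "\<And>b j. (b, j) \<in> \<P> \<Longrightarrow> j < k"
    and "\<And>b j. (b, j) \<in> \<P> \<Longrightarrow> dyad b j \<subseteq> dyad a k"
    and "\<And>b j. (b, j) \<in> \<P> \<Longrightarrow> l * 2 ^ j < sum v (dyad b j)"
    and "\<And>b j. (b, j) \<in> \<P> \<Longrightarrow> sum v (dyad b j) \<le> 2 * l * 2 ^ j"
    and "disjoint_family_on (\<lambda>(b, j). dyad b j) \<P>"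
    and "\<And>x. x \<in> dyad a k \<Longrightarrow> x \<notin> (\<Union>(b, j)\<in>\<P>. dyad b j) \<Longrightarrow> v x \<le> l"
  using assms unfolding stopping_family_def by auto

lemma stopping_family_sum:
  fixes w :: "int \<Rightarrow> real"
  assumes "stopping_family v l a k \<P>" and w: "\<And>x. 0 \<le> w x"
  shows "(\<Sum>(b, j)\<in>\<P>. sum w (dyad b j)) = sum w (\<Union>(b, j)\<in>\<P>. dyad b j)"
    and "(\<Sum>(b, j)\<in>\<P>. sum w (dyad b j)) \<le> sum w (dyad a k)"
proof -
  note D = stopping_familyD[OF assms(1)]
  show eq: "(\<Sum>(b, j)\<in>\<P>. sum w (dyad b j)) = sum w (\<Union>(b, j)\<in>\<P>. dyad b j)"
    using D(6) by (subst sum.UNION_disjoint)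
      (auto simp: D(1) disjoint_family_on_def case_prod_beta)
  show "(\<Sum>(b, j)\<in>\<P>. sum w (dyad b j)) \<le> sum w (dyad a k)"
    unfolding eq by (rule sum_mono2) (use D(3) w in auto)
qed

text \<open>
  Take a subfamily with the same union and the least number of members. Among its intervals through a
  point, one that reaches furthest to the left and one that reaches furthest to the right cover all
  the others, so there are no others.
\<close>

lemma interval_subcover:
  fixes \<I> :: "(int \<times> int) set"
  assumes "finite \<I>"
  obtains \<J> where "\<J> \<subseteq> \<I>" "(\<Union>(l, r)\<in>\<J>. {l..r}) = (\<Union>(l, r)\<in>\<I>. {l..r})"
    "\<And>x. card {J \<in> \<J>. x \<in> {fst J..snd J}} \<le> 2"
proof -
  define good where "good \<J> \<longleftrightarrow> \<J> \<subseteq> \<I> \<and> (\<Union>(l, r)\<in>\<J>. {l..r}) = (\<Union>(l, r)\<in>\<I>. {l..r})" for \<J>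
  have "good \<I>" by (simp add: good_def)
  then obtain \<J> where J: "good \<J>" and min: "\<And>\<K>. good \<K> \<Longrightarrow> card \<J> \<le> card \<K>"
    using arg_min_natI[of good \<I> card] arg_min_nat_le[of good _ card] by metis
  have "finite \<J>" using J assms finite_subset by (auto simp: good_def)
  have "card {J \<in> \<J>. x \<in> {fst J..snd J}} \<le> 2" for x
  proof (rule ccontr)
    define X where "X = {J \<in> \<J>. x \<in> {fst J..snd J}}"
    assume "\<not> ?thesis"
    then have c: "card X > 2" by (simp add: X_def)
    have finX: "finite X" using \<open>finite \<J>\<close> by (simp add: X_def)
    have ne: "X \<noteq> {}" using c by auto
    obtain A where A: "A \<in> X" "\<And>J. J \<in> X \<Longrightarrow> fst A \<le> fst J"
      using finX ne by (metis (mono_tags, lifting) arg_min_if_finite(1) arg_min_least)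
    obtain B where B: "B \<in> X" "\<And>J. J \<in> X \<Longrightarrow> snd J \<le> snd B"
    proof -
      have "finite (snd ` X)" "snd ` X \<noteq> {}" using finX ne by auto
      then have "Max (snd ` X) \<in> snd ` X" by (rule Max_in)
      then obtain B where "B \<in> X" "snd B = Max (snd ` X)" by auto
      then show ?thesis using that finX by (metis Max_ge finite_imageI image_eqI)
    qed
    let ?K = "(\<J> - X) \<union> {A, B}"
    have "y \<in> (\<Union>(l, r)\<in>?K. {l..r})" if "y \<in> (\<Union>(l, r)\<in>\<J>. {l..r})" for y
    proof -
      from that obtain J where J': "J \<in> \<J>" "y \<in> {fst J..snd J}" by auto
      show ?thesis
      proof (cases "J \<in> X")
        case False then show ?thesis using J' by force
      next
        case True
        then have "fst A \<le> y" "y \<le> snd B" "fst B \<le> x" "x \<le> snd A"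
          using A B J' by (force simp: X_def)+
        then have "y \<in> {fst A..snd A} \<or> y \<in> {fst B..snd B}" by auto
        then show ?thesis by force
      qed
    qed
    then have "(\<Union>(l, r)\<in>\<J>. {l..r}) \<subseteq> (\<Union>(l, r)\<in>?K. {l..r})"
      by (rule subsetI)
    moreover have "?K \<subseteq> \<J>" using A B by (auto simp: X_def)
    moreover from this have "(\<Union>(l, r)\<in>?K. {l..r}) \<subseteq> (\<Union>(l, r)\<in>\<J>. {l..r})"
      by (rule UN_mono) (rule subset_refl)
    ultimately have "(\<Union>(l, r)\<in>?K. {l..r}) = (\<Union>(l, r)\<in>\<J>. {l..r})"
      by (intro subset_antisym)
    then have "good ?K" using J \<open>?K \<subseteq> \<J>\<close> by (auto simp: good_def)
    then have "card \<J> \<le> card ?K" by (rule min)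
    also have "\<dots> \<le> card (\<J> - X) + card {A, B}" by (rule card_Un_le)
    also have "card (\<J> - X) = card \<J> - card X"
      using \<open>finite \<J>\<close> by (intro card_Diff_subset) (auto simp: X_def finX)
    also have "card {A, B} \<le> 2" by (simp add: card_insert_if)
    finally have "card \<J> \<le> card \<J> - card X + 2" by simp
    moreover have "card X \<le> card \<J>" using \<open>finite \<J>\<close> by (intro card_mono) (auto simp: X_def)
    ultimately show False using c by simp
  qed
  then show ?thesis using that J by (auto simp: good_def)
qed

lemma sum_UN_le:
  fixes w :: "'b \<Rightarrow> real"
  assumes "finite I" "\<And>i. i \<in> I \<Longrightarrow> finite (A i)" "\<And>x. 0 \<le> w x"
  shows "sum w (\<Union>i\<in>I. A i) \<le> (\<Sum>i\<in>I. sum w (A i))"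
  using assms(1,2)
proof (induction I)
  case (insert i I)
  have "sum w (A i \<union> (\<Union>i\<in>I. A i)) \<le> sum w (A i) + sum w (\<Union>i\<in>I. A i)"
    using insert.prems insert.hyps assms(3)
    by (subst sum_Un) (auto intro!: sum_nonneg)
  then show ?case using insert by simp
qed simp

text \<open>
  The weak-type inequality for the noncentred maximal function with respect to an arbitrary measure
  \<open>w\<close>. A covering of overlap two takes the place of the Vitali covering lemma, which would ask for a
  doubling measure.
\<close>

lemma maximal_weak:
  fixes v w :: "int \<Rightarrow> real"
  assumes fin: "finite \<I>" and v: "\<And>x. 0 \<le> v x" and w: "\<And>x. 0 \<le> w x" and l: "0 \<le> l"
    and I: "\<And>a b. (a, b) \<in> \<I> \<Longrightarrow> l * sum w {a..b} \<le> sum v {a..b}"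
  shows "l * sum w (\<Union>(a, b)\<in>\<I>. {a..b}) \<le> 2 * sum v (\<Union>(a, b)\<in>\<I>. {a..b})"
proof -
  obtain \<J> where J: "\<J> \<subseteq> \<I>" "(\<Union>(l, r)\<in>\<J>. {l..r}) = (\<Union>(l, r)\<in>\<I>. {l..r})"
    "\<And>x. card {J \<in> \<J>. x \<in> {fst J..snd J}} \<le> 2"
    by (rule interval_subcover[OF fin]) blast
  have finJ: "finite \<J>" using J(1) fin finite_subset by blast
  define U where "U = (\<Union>(a, b)\<in>\<J>. {a..b})"
  have finU: "finite U" using finJ by (auto simp: U_def)
  have "l * sum w U \<le> l * (\<Sum>J\<in>\<J>. sum w {fst J..snd J})"
  proof (intro mult_left_mono l)
    show "sum w U \<le> (\<Sum>J\<in>\<J>. sum w {fst J..snd J})"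
      unfolding U_def using sum_UN_le[of \<J> "\<lambda>J. {fst J..snd J}" w] finJ w
      by (simp add: case_prod_beta)
  qed
  also have "\<dots> = (\<Sum>J\<in>\<J>. l * sum w {fst J..snd J})" by (simp add: sum_distrib_left)
  also have "\<dots> \<le> (\<Sum>J\<in>\<J>. sum v {fst J..snd J})"
    by (intro sum_mono I) (use J(1) in auto)
  also have "\<dots> = (\<Sum>J\<in>\<J>. \<Sum>x\<in>U. if x \<in> {fst J..snd J} then v x else 0)"
  proof (rule sum.cong[OF refl])
    fix J assume "J \<in> \<J>"
    then have "{fst J..snd J} \<subseteq> U" by (auto simp: U_def)
    then show "sum v {fst J..snd J} = (\<Sum>x\<in>U. if x \<in> {fst J..snd J} then v x else 0)"
      using sum.inter_restrict[OF finU, of v "{fst J..snd J}"] by (simp only: Int_absorb1)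
  qed
  also have "\<dots> = (\<Sum>x\<in>U. \<Sum>J\<in>\<J>. if x \<in> {fst J..snd J} then v x else 0)"
    by (rule sum.swap)
  also have "\<dots> = (\<Sum>x\<in>U. real (card {J \<in> \<J>. x \<in> {fst J..snd J}}) * v x)"
    using finJ by (intro sum.cong refl) (simp add: sum.If_cases Int_def conj_commute)
  also have "\<dots> \<le> (\<Sum>x\<in>U. 2 * v x)"
    by (intro sum_mono mult_right_mono v) (use J(3) of_nat_mono in fastforce)
  finally show ?thesis using J(2) by (simp add: U_def sum_distrib_left)
qed

lemma weighted_Young:
  fixes a b p :: real
  assumes p: "1 < p" and ab: "0 \<le> a" "0 \<le> b"
  shows "a * b \<le> a powr p / p + b powr (p / (p - 1)) * (p - 1) / p"
  using Youngs_inequality[OF p, of "p / (p - 1)" a b] p ab by (simp add: field_simps)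

lemma layer_cake_integral:
  fixes M r V :: real
  assumes "0 < r" "0 \<le> M" "M \<le> V"
  shows "((\<lambda>t. if t \<le> M then r * t powr (r - 1) else 0) has_integral M powr r) {0..V}"
proof -
  have "((\<lambda>t. r * t powr (r - 1)) has_integral M powr r) {0..M}"
    using has_integral_mult_right[OF has_integral_powr_from_0[of "r - 1" M], of r] assms by simp
  then have "((\<lambda>t. if t \<in> {0..M} then r * t powr (r - 1) else 0) has_integral M powr r) {0..V}"
    by (subst has_integral_restrict) (use assms in auto)
  then show ?thesis
    by (rule has_integral_eq[rotated]) auto
qed

text \<open>
  Doob's argument: integrating the weak-type inequality against \<open>p * t powr (p - 2)\<close> bounds the left-hand
  side by a multiple of \<open>\<Sum>x. \<phi> x * M x powr (p - 1) * w x\<close>. Young's inequality turns this into the right-hand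
  side plus \<open>(p - 1) / p\<close> times the left-hand side, which is absorbed.
\<close>

lemma Doob_Lp:
  fixes w \<phi> M :: "'a \<Rightarrow> real" and p :: real
  assumes fin: "finite X" and p: "1 < p"
    and w: "\<And>x. x \<in> X \<Longrightarrow> 0 \<le> w x" and \<phi>: "\<And>x. x \<in> X \<Longrightarrow> 0 \<le> \<phi> x"
    and M: "\<And>x. x \<in> X \<Longrightarrow> 0 \<le> M x"
    and weak: "\<And>t. 0 < t \<Longrightarrow> t * (\<Sum>x\<in>{x\<in>X. t \<le> M x}. w x) \<le> 2 * (\<Sum>x\<in>{x\<in>X. t \<le> M x}. \<phi> x * w x)"
  shows "(\<Sum>x\<in>X. M x powr p * w x) \<le> (2 * p / (p - 1)) powr p * (\<Sum>x\<in>X. \<phi> x powr p * w x)"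
proof -
  \<comment> \<open>A common upper limit for the integrals over the level sets of \<open>M\<close>.\<close>
  define V where "V = (\<Sum>x\<in>X. M x)"
  have V: "M x \<le> V" if "x \<in> X" for x
    unfolding V_def using that fin M by (intro member_le_sum) auto
  define c where "c = 2 * p / (p - 1)"
  have c: "0 < c" using p by (simp add: c_def)
  have L: "((\<lambda>t. \<Sum>x\<in>X. (if t \<le> M x then p * t powr (p - 1) else 0) * w x) has_integral
        (\<Sum>x\<in>X. M x powr p * w x)) {0..V}"
    by (intro has_integral_sum fin has_integral_mult_left layer_cake_integral)
       (use p M V in auto)
  have R: "((\<lambda>t. \<Sum>x\<in>X. (c * (if t \<le> M x then (p - 1) * t powr (p - 1 - 1) else 0)) * (\<phi> x * w x))
        has_integral (\<Sum>x\<in>X. (c * (M x powr (p - 1))) * (\<phi> x * w x))) {0..V}"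
    by (intro has_integral_sum fin has_integral_mult_left has_integral_mult_right
          layer_cake_integral) (use p M V in auto)
  have "(\<Sum>x\<in>X. M x powr p * w x) \<le> (\<Sum>x\<in>X. (c * (M x powr (p - 1))) * (\<phi> x * w x))"
  proof (rule has_integral_le[OF L R])
    fix t assume t: "t \<in> {0..V}"
    show "(\<Sum>x\<in>X. (if t \<le> M x then p * t powr (p - 1) else 0) * w x) \<le>
      (\<Sum>x\<in>X. (c * (if t \<le> M x then (p - 1) * t powr (p - 1 - 1) else 0)) * (\<phi> x * w x))"
    proof (cases "t = 0")
      case True then show ?thesis using p by (simp cong: if_cong)
    next
      case False
      then have t0: "0 < t" using t by simp
      define Y where "Y = {x \<in> X. t \<le> M x}"
      have filter: "(\<Sum>x\<in>X. (if t \<le> M x then A else 0) * h x) = A * sum h Y" for A :: real and h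
      proof -
        have "(\<Sum>x\<in>X. (if t \<le> M x then A else 0) * h x) = (\<Sum>x\<in>X. if t \<le> M x then A * h x else 0)"
          by (intro sum.cong) auto
        also have "\<dots> = A * sum h Y"
          unfolding Y_def sum.inter_filter[OF fin, symmetric] by (simp add: sum_distrib_left)
        finally show ?thesis .
      qed
      have pw: "t powr (p - 1) = t powr (p - 2) * t"
        using powr_add[of t "p - 2" 1] t0 by simp
      have "(\<Sum>x\<in>X. (if t \<le> M x then p * t powr (p - 1) else 0) * w x) =
            p * t powr (p - 2) * (t * sum w Y)"
        unfolding filter pw by simp
      also have "\<dots> \<le> p * t powr (p - 2) * (2 * (\<Sum>x\<in>Y. \<phi> x * w x))"
        using p weak[OF t0] unfolding Y_def by (intro mult_left_mono) auto
      also have "\<dots> = c * ((p - 1) * t powr (p - 1 - 1) * (\<Sum>x\<in>Y. \<phi> x * w x))"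
        using p by (simp add: c_def)
      also have "\<dots> = (\<Sum>x\<in>X. (c * (if t \<le> M x then (p - 1) * t powr (p - 1 - 1) else 0)) * (\<phi> x * w x))"
        unfolding filter[symmetric] by (simp add: sum_distrib_left mult.assoc)
      finally show ?thesis .
    qed
  qed
  also have "\<dots> = (\<Sum>x\<in>X. (c * \<phi> x) * M x powr (p - 1) * w x)"
    by (simp add: mult_ac)
  also have "\<dots> \<le> (\<Sum>x\<in>X. ((c * \<phi> x) powr p / p + M x powr p * (p - 1) / p) * w x)"
  proof (intro sum_mono mult_right_mono w)
    fix x assume x: "x \<in> X"
    show "c * \<phi> x * M x powr (p - 1) \<le> (c * \<phi> x) powr p / p + M x powr p * (p - 1) / p"
      using weighted_Young[OF p, of "c * \<phi> x" "M x powr (p - 1)"] x c \<phi> p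
      by (simp add: powr_powr)
  qed
  also have "\<dots> = (\<Sum>x\<in>X. (c powr p / p) * (\<phi> x powr p * w x) + (p - 1) / p * (M x powr p * w x))"
    using c \<phi> by (intro sum.cong refl) (simp add: powr_mult algebra_simps add_divide_distrib)
  also have "\<dots> = c powr p / p * (\<Sum>x\<in>X. \<phi> x powr p * w x) + (p - 1) / p * (\<Sum>x\<in>X. M x powr p * w x)"
    by (simp add: sum.distrib sum_distrib_left)
  finally have "(\<Sum>x\<in>X. M x powr p * w x) * (1 - (p - 1) / p) \<le> c powr p / p * (\<Sum>x\<in>X. \<phi> x powr p * w x)"
    by (simp add: algebra_simps)
  moreover have "1 - (p - 1) / p = 1 / p" using p by (simp add: field_simps)
  ultimately show ?thesis using p by (simp add: c_def field_simps)
qed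

section \<open>Convolution kernels\<close>

definition supported_in :: "(int \<Rightarrow> complex) \<Rightarrow> int set \<Rightarrow> bool" where
  "supported_in f A \<longleftrightarrow> finite A \<and> (\<forall>k. k \<notin> A \<longrightarrow> f k = 0)"

definition cut :: "int set \<Rightarrow> (int \<Rightarrow> complex) \<Rightarrow> int \<Rightarrow> complex" where
  "cut A f k = (if k \<in> A then f k else 0)"

text \<open>
  The sum has the default value \<open>0\<close> where it does not converge; it is used for \<open>f\<close> of finite
  support, and for \<open>f\<close> and \<open>K\<close> both square-summable.
\<close>

definition conv :: "(int \<Rightarrow> complex) \<Rightarrow> (int \<Rightarrow> complex) \<Rightarrow> int \<Rightarrow> complex" where
  "conv K f n = (\<Sum>\<^sub>\<infinity>k\<in>UNIV. K (n - k) * f k)"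

definition bdiff :: "(int \<Rightarrow> complex) \<Rightarrow> int \<Rightarrow> complex" where
  "bdiff f n = f n - f (n - 1)"

lemma supported_in_cut [simp]: "finite A \<Longrightarrow> supported_in (cut A f) A"
  by (simp add: supported_in_def cut_def)

lemma supported_in_mono: "supported_in f A \<Longrightarrow> A \<subseteq> B \<Longrightarrow> finite B \<Longrightarrow> supported_in f B"
  by (auto simp: supported_in_def)

lemma conv_finite:
  assumes "supported_in f A"
  shows "conv K f n = (\<Sum>k\<in>A. K (n - k) * f k)"
proof -
  have "conv K f n = (\<Sum>\<^sub>\<infinity>k\<in>A. K (n - k) * f k)"
    unfolding conv_def by (rule infsum_cong_neutral) (use assms in \<open>auto simp: supported_in_def\<close>)
  then show ?thesis using assms by (simp add: supported_in_def)
qed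

text \<open>
  The kernels of the singular integrals considered here. The difference of order one gives the
  regularity behind the weighted estimates, while the Hardy spaces of small exponent call for
  differences of arbitrarily high order.
\<close>

locale calderon_zygmund_kernel =
  fixes K :: "int \<Rightarrow> complex"
  assumes kernel_decay: "\<exists>C. \<forall>n. norm ((bdiff ^^ j) K n) * of_int \<bar>n\<bar> ^ Suc j \<le> C"
    and l2_bounded: "\<exists>B\<ge>0. \<forall>f A F. supported_in f A \<longrightarrow> finite F \<longrightarrow>
        (\<Sum>n\<in>F. (norm (conv K f n))\<^sup>2) \<le> B * (\<Sum>k\<in>A. (norm (f k))\<^sup>2)"

section \<open>Weighted estimates\<close>

text \<open>
  The interval three times as long as \<open>dyad a k\<close> with the same centre.
\<close>

definition tri :: "int \<Rightarrow> nat \<Rightarrow> int set" where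
  "tri a k = {a - 2 ^ k..a + 2 * 2 ^ k - 1}"

lemma finite_tri [simp, intro]: "finite (tri a k)"
  by (simp add: tri_def)

lemma dyad_subset_tri: "dyad a k \<subseteq> tri a k"
  by (auto simp: dyad_def tri_def)

lemma tri_mono:
  assumes "dyad b j \<subseteq> dyad a k" "j \<le> k"
  shows "tri b j \<subseteq> tri a k"
proof -
  have "b \<in> dyad b j" "b + 2 ^ j - 1 \<in> dyad b j" by (auto simp: dyad_def)
  then have "b \<in> dyad a k" "b + 2 ^ j - 1 \<in> dyad a k" using assms(1) by blast+
  moreover have "(2::int) ^ j \<le> 2 ^ k" using assms(2) by (simp add: power_increasing)
  ultimately show ?thesis by (auto simp: dyad_def tri_def)
qed

lemma dyad_cover:
  assumes "finite (A :: int set)"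
  obtains a k0 where "\<And>k. k0 \<le> k \<Longrightarrow> A \<subseteq> dyad a k"
proof -
  obtain l r where lr: "A \<subseteq> {l..r}"
  proof (cases "A = {}")
    case True then show ?thesis using that by blast
  next
    case False
    then have "A \<subseteq> {Min A..Max A}" using assms by auto
    then show ?thesis by (rule that)
  qed
  have "A \<subseteq> dyad l k" if "nat (r - l + 1) \<le> k" for k
  proof -
    have "int k < 2 ^ k" using of_nat_less_two_power[of k, where 'a=int] by simp
    then have "r < l + 2 ^ k" using that by linarith
    then show ?thesis using lr by (auto simp: dyad_def)
  qed
  then show ?thesis using that by blast
qed

text \<open>
  Off the triple the weight \<open>2 ^ k / (z - a)\<^sup>2\<close> is at most \<open>1 / (2 ^ k * 4 ^ i)\<close> on the annulus at distance about
  \<open>2 ^ (k + i)\<close>, and the mass of \<open>v\<close> there is at most \<open>B\<close> times the length of an interval around the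
  annulus. The contributions decay geometrically in \<open>i\<close>.
\<close>

lemma annulus_sum:
  fixes v :: "int \<Rightarrow> real"
  assumes v: "\<And>x. 0 \<le> v x" and A: "finite A" "A \<inter> tri a k = {}"
    and B: "\<And>l r. l \<le> a \<Longrightarrow> a + 2 ^ k - 1 \<le> r \<Longrightarrow> sum v {l..r} \<le> B * of_int (r - l + 1)"
    and B0: "0 \<le> B"
  shows "(\<Sum>z\<in>A. v z * (2 ^ k / (of_int (z - a))\<^sup>2)) \<le> 10 * B"
proof -
  obtain n where n: "\<And>z. z \<in> A \<Longrightarrow> \<bar>z - a\<bar> < 2 ^ (k + n)"
  proof -
    define m where "m = (\<Sum>z\<in>A. nat \<bar>z - a\<bar>)"
    have "\<bar>z - a\<bar> < 2 ^ (k + m)" if "z \<in> A" for z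
    proof -
      have "nat \<bar>z - a\<bar> \<le> m" unfolding m_def using that A by (intro member_le_sum) auto
      then have "\<bar>z - a\<bar> \<le> int m" by linarith
      also have "\<dots> < 2 ^ m" by simp
      also have "\<dots> \<le> 2 ^ (k + m)" by (simp add: power_increasing)
      finally show ?thesis .
    qed
    then show ?thesis using that by blast
  qed
  define J where "J i = {a - 2 ^ (k + i + 1)..a + 2 ^ (k + i + 1)}" for i
  have pt: "v z * (2 ^ k / (of_int (z - a))\<^sup>2)
      \<le> (\<Sum>i<n. if z \<in> J i then v z * (1 / (2 ^ k * 4 ^ i)) else 0)" if "z \<in> A" for z
  proof -
    have ge: "2 ^ k \<le> \<bar>z - a\<bar>" using that A(2) by (auto simp: tri_def disjoint_iff abs_if)
    have pos: "1 \<le> nat \<bar>z - a\<bar>" using ge by (smt (verit) zero_less_power nat_1_add_1 nat_mono nat_one_as_int)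
    obtain i where i: "2 ^ i \<le> nat \<bar>z - a\<bar>" "nat \<bar>z - a\<bar> < 2 ^ (i + 1)"
      using ex_power_ivl1[of 2 "nat \<bar>z - a\<bar>"] pos by auto
    have i1: "2 ^ i \<le> \<bar>z - a\<bar>" and i2: "\<bar>z - a\<bar> < 2 ^ (i + 1)"
      using i by (auto simp: nat_less_iff le_nat_iff)
    have "(2::int) ^ k < 2 ^ (i + 1)" using ge i2 by linarith
    then have "k < i + 1" by (rule power_less_imp_less_exp[rotated]) simp
    then obtain i' where i': "i = k + i'" using le_Suc_ex by (auto simp: less_Suc_eq_le)
    have "(2::int) ^ i < 2 ^ (k + n)" using n[OF that] i1 by linarith
    then have "i < k + n" by (rule power_less_imp_less_exp[rotated]) simp
    then have "i' < n" by (simp add: i')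
    have mem: "z \<in> J i'" using i2 by (auto simp: J_def i' abs_if split: if_splits)
    have "(2::real) ^ i \<le> \<bar>of_int (z - a)\<bar>"
      using i1 by (metis of_int_abs of_int_le_iff of_int_numeral of_int_power)
    then have "((2::real) ^ i)\<^sup>2 \<le> (of_int (z - a))\<^sup>2"
      by (metis abs_le_square_iff abs_of_nonneg zero_le_numeral zero_le_power)
    then have "2 ^ k / (of_int (z - a))\<^sup>2 \<le> 2 ^ k / ((2::real) ^ i)\<^sup>2"
      using pos by (intro divide_left_mono mult_pos_pos) auto
    also have "((2::real) ^ i)\<^sup>2 = 2 ^ k * (2 ^ k * 4 ^ i')"
    proof -
      have "(4::real) ^ i' = 2 ^ i' * 2 ^ i'" by (simp add: power_mult_distrib[symmetric])
      then show ?thesis by (simp add: i' power_add power2_eq_square)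
    qed
    finally have "v z * (2 ^ k / (of_int (z - a))\<^sup>2) \<le> v z * (1 / (2 ^ k * 4 ^ i'))"
      by (intro mult_left_mono v) simp
    also have "\<dots> = (if z \<in> J i' then v z * (1 / (2 ^ k * 4 ^ i')) else 0)" using mem by simp
    also have "\<dots> \<le> (\<Sum>i<n. if z \<in> J i then v z * (1 / (2 ^ k * 4 ^ i)) else 0)"
      by (rule member_le_sum) (use \<open>i' < n\<close> v in auto)
    finally show ?thesis .
  qed
  have "(\<Sum>z\<in>A. v z * (2 ^ k / (of_int (z - a))\<^sup>2))
     \<le> (\<Sum>z\<in>A. \<Sum>i<n. if z \<in> J i then v z * (1 / (2 ^ k * 4 ^ i)) else 0)"
    by (rule sum_mono) (rule pt)
  also have "\<dots> = (\<Sum>i<n. \<Sum>z\<in>A. if z \<in> J i then v z * (1 / (2 ^ k * 4 ^ i)) else 0)"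
    by (rule sum.swap)
  also have "\<dots> \<le> (\<Sum>i<n. 5 * B * (1 / 2) ^ i)"
  proof (rule sum_mono)
    fix i assume "i \<in> {..<n}"
    have "(\<Sum>z\<in>A. if z \<in> J i then v z * (1 / (2 ^ k * 4 ^ i)) else 0) = sum v (A \<inter> J i) * (1 / (2 ^ k * 4 ^ i))"
      using A(1) by (simp add: sum.inter_restrict[symmetric] sum_distrib_right sum_divide_distrib)
    also have "\<dots> \<le> sum v (J i) * (1 / (2 ^ k * 4 ^ i))"
      by (intro mult_right_mono sum_mono2) (auto simp: J_def v)
    also have "\<dots> \<le> (B * of_int (2 * 2 ^ (k + i + 1) + 1)) * (1 / (2 ^ k * 4 ^ i))"
    proof (intro mult_right_mono)
      have "(2::int) ^ k \<le> 2 ^ (k + i + 1)" by (rule power_increasing) auto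
      then have "a + 2 ^ k - 1 \<le> a + 2 ^ (k + i + 1)" by simp
      from B[OF _ this, of "a - 2 ^ (k + i + 1)"]
      show "sum v (J i) \<le> B * of_int (2 * 2 ^ (k + i + 1) + 1)"
        unfolding J_def by (simp add: algebra_simps)
    qed simp
    also have "\<dots> \<le> (B * (5 * (2 ^ k * 2 ^ i))) * (1 / (2 ^ k * 4 ^ i))"
    proof (intro mult_right_mono mult_left_mono B0)
      have "(1::real) \<le> 2 ^ k * 2 ^ i"
        using mult_mono[of 1 "2 ^ k :: real" 1 "2 ^ i"] by simp
      then show "of_int (2 * 2 ^ (k + i + 1) + 1) \<le> (5::real) * (2 ^ k * 2 ^ i)"
        by (simp add: power_add mult.commute)
    qed simp
    also have "\<dots> = 5 * B * (1 / 2) ^ i"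
    proof -
      have "(4::real) ^ i = 2 ^ i * 2 ^ i" by (simp add: power_mult_distrib[symmetric])
      then show ?thesis by (simp add: field_simps power_one_over)
    qed
    finally show "(\<Sum>z\<in>A. if z \<in> J i then v z * (1 / (2 ^ k * 4 ^ i)) else 0) \<le> 5 * B * (1 / 2) ^ i" .
  qed
  also have "\<dots> = 5 * B * (\<Sum>i<n. (1 / 2) ^ i)" by (simp add: sum_distrib_left)
  also have "\<dots> \<le> 5 * B * 2"
  proof (intro mult_left_mono)
    show "(\<Sum>i<n. (1 / 2 :: real) ^ i) \<le> 2"
      using geometric_sum[of "1/2::real" n] by simp
  qed (use B0 in simp)
  finally show ?thesis by simp
qed

lemma conv_add:
  assumes "supported_in f A" "supported_in g A"
  shows "conv K (\<lambda>x. f x + g x) n = conv K f n + conv K g n"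
proof -
  have "supported_in (\<lambda>x. f x + g x) A" using assms by (auto simp: supported_in_def)
  then show ?thesis using assms by (simp add: conv_finite sum.distrib algebra_simps)
qed

lemma conv_sum:
  assumes "\<And>i. i \<in> I \<Longrightarrow> supported_in (f i) A" "finite I" "finite A"
  shows "conv K (\<lambda>x. \<Sum>i\<in>I. f i x) n = (\<Sum>i\<in>I. conv K (f i) n)"
proof -
  have "supported_in (\<lambda>x. \<Sum>i\<in>I. f i x) A"
    using assms by (auto simp: supported_in_def intro!: sum.neutral)
  then have "conv K (\<lambda>x. \<Sum>i\<in>I. f i x) n = (\<Sum>i\<in>I. \<Sum>k\<in>A. K (n - k) * f i k)"
    by (subst sum.swap) (simp add: conv_finite sum_distrib_left)
  also have "\<dots> = (\<Sum>i\<in>I. conv K (f i) n)"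
    by (intro sum.cong refl) (simp add: conv_finite[OF assms(1)])
  finally show ?thesis .
qed

context calderon_zygmund_kernel
begin

text \<open>
  Walk from one argument of \<open>K\<close> to the other in at most \<open>2 ^ k\<close> unit steps. As \<open>z\<close> lies outside the triple,
  the walk stays at distance at least \<open>\<bar>z - a\<bar> / 2\<close> from the origin, so each step costs at most a
  constant times \<open>1 / (z - a)\<^sup>2\<close>.
\<close>

lemma kernel_smooth:
  obtains D where "0 \<le> D"
    "\<And>a k x x' z. x \<in> dyad a k \<Longrightarrow> x' \<in> dyad a k \<Longrightarrow> z \<notin> tri a k \<Longrightarrow>
        norm (K (x - z) - K (x' - z)) \<le> D * (2 ^ k / (of_int (z - a))\<^sup>2)"
    "\<And>a k x x' z. x \<in> dyad a k \<Longrightarrow> x' \<in> dyad a k \<Longrightarrow> z \<notin> tri a k \<Longrightarrow>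
        norm (K (z - x) - K (z - x')) \<le> D * (2 ^ k / (of_int (z - a))\<^sup>2)"
proof -
  obtain C where C: "\<And>n. norm (bdiff K n) * of_int \<bar>n\<bar> ^ 2 \<le> C"
    using kernel_decay[of 1] by (auto simp: numeral_2_eq_2)
  have C0: "0 \<le> C" using C[of 0] by simp
  have step: "norm (K s - K (s + int i)) \<le> real i * (C / d\<^sup>2)"
    if d: "0 < d" "\<And>n. s \<le> n \<Longrightarrow> n \<le> s + int i \<Longrightarrow> d \<le> of_int \<bar>n\<bar>" for s i d
    using d(2)
  proof (induction i)
    case (Suc i)
    have "norm (K s - K (s + int (Suc i))) \<le>
        norm (K s - K (s + int i)) + norm (bdiff K (s + int (Suc i)))"
      unfolding bdiff_def by (rule order_trans[OF _ norm_triangle_ineq4])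
        (simp add: algebra_simps)
    also have "\<dots> \<le> real i * (C / d\<^sup>2) + C / d\<^sup>2"
    proof (rule add_mono)
      show "norm (K s - K (s + int i)) \<le> real i * (C / d\<^sup>2)"
        using Suc.prems by (intro Suc.IH) auto
      have *: "d\<^sup>2 \<le> (of_int \<bar>s + int (Suc i)\<bar>)\<^sup>2"
        using d(1) Suc.prems[of "s + int (Suc i)"] by (intro power_mono) auto
      have "norm (bdiff K (s + int (Suc i))) * d\<^sup>2 \<le> norm (bdiff K (s + int (Suc i))) * (of_int \<bar>s + int (Suc i)\<bar>)\<^sup>2"
        by (rule mult_left_mono[OF *]) simp
      also have "\<dots> \<le> C" by (rule C)
      finally show "norm (bdiff K (s + int (Suc i))) \<le> C / d\<^sup>2"
        using d(1) by (simp add: field_simps)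
    qed
    finally show ?case by (simp add: algebra_simps add_divide_distrib)
  qed simp
  have gen: "norm (K s - K t) \<le> of_int \<bar>s - t\<bar> * (C / d\<^sup>2)"
    if d: "0 < d" "\<And>n. min s t \<le> n \<Longrightarrow> n \<le> max s t \<Longrightarrow> d \<le> of_int \<bar>n\<bar>" for s t d
  proof (cases "s \<le> t")
    case True
    then show ?thesis using step[OF d(1), of s "nat (t - s)"] d(2) by (simp add: min_def max_def)
  next
    case False
    then show ?thesis using step[OF d(1), of t "nat (s - t)"] d(2)
      by (simp add: min_def max_def norm_minus_commute)
  qed
  have main: "norm (K s - K t) \<le> (4 * C) * (2 ^ k / (of_int (z - a))\<^sup>2)"
    if z: "z \<notin> tri a k" and st: "\<bar>s - t\<bar> \<le> 2 ^ k"
      and far: "\<And>n. min s t \<le> n \<Longrightarrow> n \<le> max s t \<Longrightarrow> \<bar>z - a\<bar> \<le> 2 * \<bar>n\<bar>" for a k s t z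
  proof -
    have za: "z \<noteq> a" using z by (auto simp: tri_def)
    have st': "of_int \<bar>s - t\<bar> \<le> (2::real) ^ k"
      using st by (metis of_int_le_iff of_int_numeral of_int_power)
    have "norm (K s - K t) \<le> of_int \<bar>s - t\<bar> * (C / (of_int \<bar>z - a\<bar> / 2)\<^sup>2)"
    proof (rule gen)
      fix n assume "min s t \<le> n" "n \<le> max s t"
      then have "\<bar>z - a\<bar> \<le> 2 * \<bar>n\<bar>" by (rule far)
      then have "real_of_int \<bar>z - a\<bar> \<le> real_of_int (2 * \<bar>n\<bar>)" by (simp only: of_int_le_iff)
      then show "real_of_int \<bar>z - a\<bar> / 2 \<le> of_int \<bar>n\<bar>" by simp
    qed (use za in simp)
    also have "\<dots> \<le> 2 ^ k * (C / (of_int \<bar>z - a\<bar> / 2)\<^sup>2)"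
      by (intro mult_right_mono st') (use C0 in simp)
    also have "\<dots> = (4 * C) * (2 ^ k / (of_int (z - a))\<^sup>2)"
      by (simp add: power_divide)
    finally show ?thesis .
  qed
  show ?thesis
  proof (rule that[of "4 * C"])
    show "0 \<le> 4 * C" using C0 by simp
  next
    fix a k x x' z assume *: "x \<in> dyad a k" "x' \<in> dyad a k" "z \<notin> tri a k"
    define p where "p = (2::int) ^ k"
    have x: "a \<le> x" "x < a + p" "a \<le> x'" "x' < a + p" and z: "z < a - p \<or> a + 2 * p \<le> z"
      using * by (auto simp: dyad_def tri_def p_def)
    show "norm (K (x - z) - K (x' - z)) \<le> 4 * C * (2 ^ k / (of_int (z - a))\<^sup>2)"
    proof (rule main[OF *(3)])
      show "\<bar>x - z - (x' - z)\<bar> \<le> 2 ^ k" using x unfolding p_def[symmetric] by linarith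
      show "\<bar>z - a\<bar> \<le> 2 * \<bar>n\<bar>" if "min (x - z) (x' - z) \<le> n" "n \<le> max (x - z) (x' - z)" for n
        using x z that by (smt (verit))
    qed
    show "norm (K (z - x) - K (z - x')) \<le> 4 * C * (2 ^ k / (of_int (z - a))\<^sup>2)"
    proof (rule main[OF *(3)])
      show "\<bar>z - x - (z - x')\<bar> \<le> 2 ^ k" using x unfolding p_def[symmetric] by linarith
      show "\<bar>z - a\<bar> \<le> 2 * \<bar>n\<bar>" if "min (z - x) (z - x') \<le> n" "n \<le> max (z - x) (z - x')" for n
        using x z that by (smt (verit))
    qed
  qed
qed

lemma conv_const_zero [simp]: "conv K (\<lambda>_. 0) n = 0"
  by (simp add: conv_def)

text \<open>
  The Calderon-Zygmund decomposition \<open>f = g + (\<Sum>P. h P)\<close> at height \<open>l\<close>. The good part is bounded by \<open>2 * l\<close>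
  and is treated by the \<open>L\<^sup>2\<close> bound and Chebyshev's inequality. The triples of the stopping
  intervals have small measure. Off the triples the mean zero of \<open>h P\<close> lets the regularity of the kernel
  act. The \<open>A\<^sub>1\<close> condition enters whenever an average of \<open>w\<close> is replaced by a value of \<open>w\<close>.
\<close>

lemma weak_type:
  fixes w :: "int \<Rightarrow> real"
  assumes w: "\<And>x. 0 \<le> w x" and C1: "0 \<le> C1"
    and A1: "\<And>l r x. l \<le> x \<Longrightarrow> x \<le> r \<Longrightarrow> sum w {l..r} \<le> C1 * of_int (r - l + 1) * w x"
    and B: "0 \<le> B"
    and L2: "\<And>f A F. supported_in f A \<Longrightarrow> finite F \<Longrightarrow>
        (\<Sum>n\<in>F. (norm (conv K f n))\<^sup>2 * w n) \<le> B * (\<Sum>k\<in>A. (norm (f k))\<^sup>2 * w k)"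
  shows "\<exists>C\<ge>0. \<forall>f A F l. supported_in f A \<longrightarrow> finite F \<longrightarrow> 0 < l \<longrightarrow>
           l * (\<Sum>n\<in>{n\<in>F. l < norm (conv K f n)}. w n) \<le> C * (\<Sum>k\<in>A. norm (f k) * w k)"
proof -
  obtain D where D: "0 \<le> D"
    "\<And>a k x x' z. x \<in> dyad a k \<Longrightarrow> x' \<in> dyad a k \<Longrightarrow> z \<notin> tri a k \<Longrightarrow>
        norm (K (z - x) - K (z - x')) \<le> D * (2 ^ k / (of_int (z - a))\<^sup>2)"
    by (rule kernel_smooth) blast
  define C where "C = 8 * B * (1 + C1) + 3 * C1 + 20 * D * C1 * (1 + C1)"
  have main: "l * sum w {n\<in>F. l < norm (conv K f n)} \<le> C * (\<Sum>x\<in>A. norm (f x) * w x)"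
    if fA: "supported_in f A" and F: "finite F" and l: "0 < l" for f A F l
  proof -
    have finA: "finite A" using fA by (simp add: supported_in_def)
    \<comment> \<open>The starting interval contains the support and is so long that the average of \<open>norm \<circ> f\<close> over
      it is at most \<open>l\<close>.\<close>
    obtain a k0 where k0: "\<And>k. k0 \<le> k \<Longrightarrow> A \<subseteq> dyad a k"
      by (rule dyad_cover[OF finA]) blast
    obtain k1 :: nat where k1: "(\<Sum>x\<in>A. norm (f x)) / l < 2 ^ k1"
      using real_arch_pow[of 2 "(\<Sum>x\<in>A. norm (f x)) / l"] by auto
    define k where "k = max k0 k1"
    define Q where "Q = dyad a k"
    have AQ: "A \<subseteq> Q" using k0[of k] by (simp add: k_def Q_def)
    have finQ [simp]: "finite Q" by (simp add: Q_def)
    have fQ: "supported_in f Q" using supported_in_mono[OF fA AQ] by simp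
    have toQ: "(\<Sum>x\<in>A. norm (f x) * h x) = (\<Sum>x\<in>Q. norm (f x) * h x)" for h
      by (rule sum.mono_neutral_left) (use AQ fA in \<open>auto simp: supported_in_def\<close>)
    have "(2::real) ^ k1 \<le> 2 ^ k" by (simp add: k_def power_increasing)
    then have "l * 2 ^ k1 \<le> l * 2 ^ k" using l by (intro mult_left_mono) auto
    moreover have "(\<Sum>x\<in>A. norm (f x)) < l * 2 ^ k1" using k1 l by (simp add: divide_less_eq mult.commute)
    ultimately have "(\<Sum>x\<in>A. norm (f x)) \<le> l * 2 ^ k" by linarith
    then have "(\<Sum>x\<in>dyad a k. norm (f x)) \<le> l * 2 ^ k" using toQ[of "\<lambda>_. 1"] by (simp add: Q_def)
    then obtain \<P> where P: "stopping_family (\<lambda>x. norm (f x)) l a k \<P>"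
      using stopping_family_exists[of "\<lambda>x. norm (f x)" a k l] by auto
    note PD = stopping_familyD[OF P]
    define U where "U = (\<Union>(b, j)\<in>\<P>. dyad b j)"
    have UQ: "U \<subseteq> Q" using PD(3) by (auto simp: U_def Q_def)
    define av where "av P = (\<Sum>x\<in>dyad (fst P) (snd P). f x) / 2 ^ snd P" for P :: "int \<times> nat"
    define h where "h P x = (if x \<in> dyad (fst P) (snd P) then f x - av P else 0)" for P x
    define g where "g x = f x - (\<Sum>P\<in>\<P>. h P x)" for x
    have nav: "norm (av (b, j)) * 2 ^ j \<le> (\<Sum>x\<in>dyad b j. norm (f x))" for b j
      using norm_sum[of f "dyad b j"] by (simp add: av_def norm_divide norm_power)
    have hsum: "(\<Sum>P\<in>\<P>. h P x) = h (b, j) x" if "(b, j) \<in> \<P>" "x \<in> dyad b j" for b j x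
    proof -
      have "h P x = 0" if "P \<in> \<P> - {(b, j)}" for P
        using disjoint_family_onD[OF PD(6), of P "(b, j)"] that \<open>(b, j) \<in> \<P>\<close> \<open>x \<in> dyad b j\<close>
        by (auto simp: h_def case_prod_beta)
      then have "(\<Sum>P\<in>\<P>. h P x) = (\<Sum>P\<in>{(b, j)}. h P x)"
        using \<open>(b, j) \<in> \<P>\<close> PD(1) by (intro sum.mono_neutral_right) auto
      then show ?thesis by simp
    qed
    have g_in: "g x = av (b, j)" if "(b, j) \<in> \<P>" "x \<in> dyad b j" for b j x
      using that unfolding g_def hsum[OF that] by (simp add: h_def)
    have g_out: "g x = f x" if "x \<notin> U" for x
    proof -
      have "h P x = 0" if "P \<in> \<P>" for P
        using that \<open>x \<notin> U\<close> by (cases P) (auto simp: U_def h_def)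
      then show ?thesis by (simp add: g_def)
    qed
    have g_supp: "supported_in g Q"
      using UQ fQ by (simp add: supported_in_def) (metis g_out subsetD)
    have h_supp: "supported_in (h P) Q" if "P \<in> \<P>" for P
      using that UQ by (cases P) (auto simp: supported_in_def h_def U_def)
    have h_supp': "supported_in (h P) (dyad (fst P) (snd P))" for P
      by (simp add: supported_in_def h_def)
    have g_bd: "norm (g x) \<le> 2 * l" for x
    proof (cases "x \<in> U")
      case True
      then obtain b j where bj: "(b, j) \<in> \<P>" "x \<in> dyad b j" by (auto simp: U_def)
      have "norm (av (b, j)) * 2 ^ j \<le> (2 * l) * 2 ^ j"
        by (rule order_trans[OF nav PD(5)[OF bj(1)]])
      then have "norm (av (b, j)) \<le> 2 * l" by (rule mult_right_le_imp_le) simp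
      then show ?thesis by (simp add: g_in[OF bj])
    next
      case False
      show ?thesis
      proof (cases "x \<in> Q")
        case True
        then show ?thesis using PD(7)[of x] False l by (simp add: U_def Q_def g_out)
      next
        case False
        then show ?thesis using g_supp l by (simp add: supported_in_def)
      qed
    qed
    define S where "S P = (\<Sum>x\<in>dyad (fst P) (snd P). norm (f x) * w x)" for P
    have S0: "0 \<le> S P" for P by (auto simp: S_def intro!: sum_nonneg mult_nonneg_nonneg w)
    define T where "T = (\<Sum>x\<in>Q. norm (f x) * w x)"
    have ST: "(\<Sum>P\<in>\<P>. S P) \<le> T"
      using stopping_family_sum(2)[OF P, of "\<lambda>x. norm (f x) * w x"] w
      by (simp add: S_def T_def Q_def case_prod_beta)
    have T0: "0 \<le> T" by (auto simp: T_def intro!: sum_nonneg mult_nonneg_nonneg w)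
    have w_dyad: "sum w (dyad b j) \<le> C1 * 2 ^ j * w y" if "y \<in> dyad b j" for b j y
      using A1[of b y "b + 2 ^ j - 1"] that by (simp add: dyad_def atLeastLessThanPlusOne_atLeastAtMost_int flip: atLeastLessThanPlusOne_atLeastAtMost_int)
    have w_tri: "sum w (tri b j) \<le> 3 * C1 * 2 ^ j * w y" if "y \<in> dyad b j" for b j y
      using A1[of "b - 2 ^ j" y "b + 2 * 2 ^ j - 1"] that by (simp add: dyad_def tri_def algebra_simps)
    have av_w: "norm (av (b, j)) * sum w (dyad b j) \<le> C1 * S (b, j)" for b j
    proof -
      have "norm (av (b, j)) * sum w (dyad b j) * 2 ^ j
          \<le> (\<Sum>x\<in>dyad b j. norm (f x)) * sum w (dyad b j)"
        using mult_right_mono[OF nav[of b j], of "sum w (dyad b j)"] by (simp add: sum_nonneg w mult_ac)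
      also have "\<dots> \<le> (\<Sum>x\<in>dyad b j. norm (f x) * (C1 * 2 ^ j * w x))"
        unfolding sum_distrib_right by (intro sum_mono mult_left_mono w_dyad) auto
      also have "\<dots> = C1 * S (b, j) * 2 ^ j" by (simp add: S_def sum_distrib_left sum_distrib_right mult_ac)
      finally show ?thesis by (rule mult_right_le_imp_le) simp
    qed
    have g_w: "(\<Sum>x\<in>Q. norm (g x) * w x) \<le> (1 + C1) * T"
    proof -
      have "(\<Sum>x\<in>Q. norm (g x) * w x) = (\<Sum>x\<in>Q - U. norm (g x) * w x) + (\<Sum>x\<in>U. norm (g x) * w x)"
        using UQ by (simp add: sum.subset_diff)
      also have "(\<Sum>x\<in>Q - U. norm (g x) * w x) = (\<Sum>x\<in>Q - U. norm (f x) * w x)"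
        by (simp add: g_out)
      also have "\<dots> \<le> T" unfolding T_def by (rule sum_mono2) (use w in auto)
      also have "(\<Sum>x\<in>U. norm (g x) * w x) = (\<Sum>P\<in>\<P>. \<Sum>x\<in>dyad (fst P) (snd P). norm (g x) * w x)"
        using stopping_family_sum(1)[OF P, of "\<lambda>x. norm (g x) * w x"] w by (simp add: U_def case_prod_beta)
      also have "\<dots> = (\<Sum>P\<in>\<P>. norm (av P) * sum w (dyad (fst P) (snd P)))"
        by (intro sum.cong refl) (auto simp: g_in sum_distrib_left)
      also have "\<dots> \<le> (\<Sum>P\<in>\<P>. C1 * S P)"
        by (intro sum_mono) (use av_w in auto)
      also have "\<dots> \<le> C1 * T" using ST C1 by (simp add: sum_distrib_left[symmetric] mult_left_mono)
      finally show ?thesis by (simp add: algebra_simps)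
    qed
    define U3 where "U3 = (\<Union>P\<in>\<P>. tri (fst P) (snd P))"
    define E1 where "E1 = {n\<in>F. l / 2 < norm (conv K g n)}"
    define E3 where "E3 = {n\<in>F - U3. l / 2 < norm (\<Sum>P\<in>\<P>. conv K (h P) n)}"
    have split: "conv K f n = conv K g n + (\<Sum>P\<in>\<P>. conv K (h P) n)" for n
    proof -
      have "conv K f n = conv K (\<lambda>x. g x + (\<Sum>P\<in>\<P>. h P x)) n" by (simp add: g_def)
      also have "\<dots> = conv K g n + conv K (\<lambda>x. \<Sum>P\<in>\<P>. h P x) n"
        using g_supp h_supp by (intro conv_add[where A = Q]) (auto simp: supported_in_def intro!: sum.neutral)
      also have "conv K (\<lambda>x. \<Sum>P\<in>\<P>. h P x) n = (\<Sum>P\<in>\<P>. conv K (h P) n)"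
        by (rule conv_sum[where A = Q]) (use h_supp PD(1) in auto)
      finally show ?thesis .
    qed
    have sub: "{n\<in>F. l < norm (conv K f n)} \<subseteq> E1 \<union> U3 \<union> E3"
    proof
      fix n assume n: "n \<in> {n\<in>F. l < norm (conv K f n)}"
      then have "l < norm (conv K g n) + norm (\<Sum>P\<in>\<P>. conv K (h P) n)"
        using norm_triangle_ineq[of "conv K g n" "\<Sum>P\<in>\<P>. conv K (h P) n"] by (simp add: split)
      then show "n \<in> E1 \<union> U3 \<union> E3" using n by (auto simp: E1_def E3_def)
    qed
    have fin: "finite E1" "finite U3" "finite E3" using F PD(1) by (auto simp: E1_def U3_def E3_def)
    have "sum w {n\<in>F. l < norm (conv K f n)} \<le> sum w (E1 \<union> U3 \<union> E3)"
      by (rule sum_mono2) (use sub fin w in auto)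
    also have "\<dots> \<le> sum w (E1 \<union> U3) + sum w E3"
      using fin w by (subst sum_Un) (auto intro!: sum_nonneg)
    also have "sum w (E1 \<union> U3) \<le> sum w E1 + sum w U3"
      using fin w by (subst sum_Un) (auto intro!: sum_nonneg)
    finally have tot: "l * sum w {n\<in>F. l < norm (conv K f n)} \<le> l * sum w E1 + l * sum w U3 + l * sum w E3"
      using l by (simp add: distrib_left[symmetric])
    have e1: "l * sum w E1 \<le> 8 * B * (1 + C1) * T"
    proof -
      have "(l / 2)\<^sup>2 * sum w E1 \<le> (\<Sum>n\<in>E1. (norm (conv K g n))\<^sup>2 * w n)"
        unfolding sum_distrib_left
        by (intro sum_mono mult_right_mono w power_mono) (use l in \<open>auto simp: E1_def\<close>)
      also have "\<dots> \<le> B * (\<Sum>x\<in>Q. (norm (g x))\<^sup>2 * w x)" by (rule L2[OF g_supp fin(1)])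
      also have "\<dots> \<le> B * (\<Sum>x\<in>Q. (2 * l) * (norm (g x) * w x))"
        unfolding power2_eq_square
        by (intro mult_left_mono sum_mono B) (simp add: g_bd mult_right_mono mult.assoc[symmetric] w)
      also have "\<dots> = 2 * l * B * (\<Sum>x\<in>Q. norm (g x) * w x)" by (simp add: sum_distrib_left mult_ac)
      also have "\<dots> \<le> 2 * l * B * ((1 + C1) * T)" by (intro mult_left_mono g_w) (use l B in simp)
      finally have "(l * sum w E1) * (l / 4) \<le> (8 * B * (1 + C1) * T) * (l / 4)"
        by (simp add: power2_eq_square mult_ac)
      then show ?thesis by (rule mult_right_le_imp_le) (use l in simp)
    qed
    have e2: "l * sum w U3 \<le> 3 * C1 * T"
    proof -
      have one: "l * sum w (tri b j) \<le> 3 * C1 * S (b, j)" if "(b, j) \<in> \<P>" for b j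
      proof -
        have "l * sum w (tri b j) * 2 ^ j \<le> (\<Sum>x\<in>dyad b j. norm (f x)) * sum w (tri b j)"
          using mult_right_mono[OF less_imp_le[OF PD(4)[OF that]], of "sum w (tri b j)"]
          by (simp add: sum_nonneg w mult_ac)
        also have "\<dots> \<le> (\<Sum>x\<in>dyad b j. norm (f x) * (3 * C1 * 2 ^ j * w x))"
          unfolding sum_distrib_right by (intro sum_mono mult_left_mono w_tri) auto
        also have "\<dots> = 3 * C1 * S (b, j) * 2 ^ j" by (simp add: S_def sum_distrib_left sum_distrib_right mult_ac)
        finally show ?thesis by (rule mult_right_le_imp_le) simp
      qed
      have "l * sum w U3 \<le> l * (\<Sum>P\<in>\<P>. sum w (tri (fst P) (snd P)))"
        unfolding U3_def using l by (intro mult_left_mono sum_UN_le) (auto simp: PD(1) w)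
      also have "\<dots> \<le> (\<Sum>P\<in>\<P>. 3 * C1 * S P)"
        by (subst sum_distrib_left, intro sum_mono) (use one in auto)
      also have "\<dots> = 3 * C1 * (\<Sum>P\<in>\<P>. S P)" by (simp add: sum_distrib_left)
      also have "\<dots> \<le> 3 * C1 * T" by (intro mult_left_mono ST) (use C1 in simp)
      finally show ?thesis .
    qed
    have h_cancel: "(\<Sum>y\<in>dyad b j. h (b, j) y) = 0" for b j
      by (simp add: h_def av_def sum_subtractf)
    have h_w: "(\<Sum>y\<in>dyad b j. norm (h (b, j) y) * w y) \<le> (1 + C1) * S (b, j)" for b j
    proof -
      have "(\<Sum>y\<in>dyad b j. norm (h (b, j) y) * w y)
          \<le> (\<Sum>y\<in>dyad b j. norm (f y) * w y + norm (av (b, j)) * w y)"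
        unfolding distrib_right[symmetric]
        by (intro sum_mono mult_right_mono w) (simp add: h_def norm_triangle_ineq4)
      also have "\<dots> = S (b, j) + norm (av (b, j)) * sum w (dyad b j)"
        by (simp add: S_def sum.distrib sum_distrib_left)
      also have "\<dots> \<le> S (b, j) + C1 * S (b, j)" using av_w[of b j] by simp
      finally show ?thesis by (simp add: algebra_simps)
    qed
    have far: "(\<Sum>n\<in>F - tri b j. norm (conv K (h (b, j)) n) * w n) \<le> 10 * D * C1 * (1 + C1) * S (b, j)"
      if bj: "(b, j) \<in> \<P>" for b j
    proof -
      have pt: "norm (conv K (h (b, j)) n) \<le> (\<Sum>y\<in>dyad b j. norm (h (b, j) y) * (D * (2 ^ j / (of_int (n - b))\<^sup>2)))"
        if "n \<in> F - tri b j" for n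
      proof -
        have "conv K (h (b, j)) n = (\<Sum>y\<in>dyad b j. K (n - y) * h (b, j) y) - K (n - b) * (\<Sum>y\<in>dyad b j. h (b, j) y)"
          using conv_finite[OF h_supp'[of "(b, j)"], of K n] by (simp add: h_cancel)
        also have "\<dots> = (\<Sum>y\<in>dyad b j. h (b, j) y * (K (n - y) - K (n - b)))"
          by (simp add: sum_distrib_left sum_subtractf[symmetric] algebra_simps)
        finally have "norm (conv K (h (b, j)) n) \<le> (\<Sum>y\<in>dyad b j. norm (h (b, j) y * (K (n - y) - K (n - b))))"
          by (simp add: norm_sum)
        also have "\<dots> \<le> (\<Sum>y\<in>dyad b j. norm (h (b, j) y) * (D * (2 ^ j / (of_int (n - b))\<^sup>2)))"
          unfolding norm_mult using that by (intro sum_mono mult_left_mono D(2)) (auto intro: dyad_nonempty)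
        finally show ?thesis .
      qed
      have ann: "(\<Sum>n\<in>F - tri b j. w n * (2 ^ j / (of_int (n - b))\<^sup>2)) \<le> 10 * (C1 * w y)"
        if y: "y \<in> dyad b j" for y
      proof (rule annulus_sum)
        fix l r :: int assume "l \<le> b" "b + 2 ^ j - 1 \<le> r"
        then have "l \<le> y" "y \<le> r" using y by (auto simp: dyad_def)
        from A1[OF this] show "sum w {l..r} \<le> C1 * w y * of_int (r - l + 1)" by (simp add: mult_ac)
      qed (use w C1 F in auto)
      have "(\<Sum>n\<in>F - tri b j. norm (conv K (h (b, j)) n) * w n)
          \<le> (\<Sum>n\<in>F - tri b j. (\<Sum>y\<in>dyad b j. norm (h (b, j) y) * (D * (2 ^ j / (of_int (n - b))\<^sup>2))) * w n)"
        by (intro sum_mono mult_right_mono pt w)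
      also have "\<dots> = (\<Sum>y\<in>dyad b j. norm (h (b, j) y) * D * (\<Sum>n\<in>F - tri b j. w n * (2 ^ j / (of_int (n - b))\<^sup>2)))"
        unfolding sum_distrib_right sum_distrib_left by (subst sum.swap) (simp add: mult_ac)
      also have "\<dots> \<le> (\<Sum>y\<in>dyad b j. norm (h (b, j) y) * D * (10 * (C1 * w y)))"
        by (intro sum_mono mult_left_mono ann) (use D in auto)
      also have "\<dots> = 10 * D * C1 * (\<Sum>y\<in>dyad b j. norm (h (b, j) y) * w y)"
        by (simp add: sum_distrib_left mult_ac)
      also have "\<dots> \<le> 10 * D * C1 * ((1 + C1) * S (b, j))"
        by (intro mult_left_mono h_w) (use D C1 in simp)
      finally show ?thesis by (simp add: mult.assoc)
    qed
    have e3: "l * sum w E3 \<le> 20 * D * C1 * (1 + C1) * T"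
    proof -
      have "(l / 2) * sum w E3 \<le> (\<Sum>n\<in>E3. norm (\<Sum>P\<in>\<P>. conv K (h P) n) * w n)"
        unfolding sum_distrib_left by (intro sum_mono mult_right_mono w) (auto simp: E3_def)
      also have "\<dots> \<le> (\<Sum>n\<in>E3. \<Sum>P\<in>\<P>. norm (conv K (h P) n) * w n)"
        unfolding sum_distrib_right[symmetric] by (intro sum_mono mult_right_mono w norm_sum)
      also have "\<dots> = (\<Sum>P\<in>\<P>. \<Sum>n\<in>E3. norm (conv K (h P) n) * w n)" by (rule sum.swap)
      also have "\<dots> \<le> (\<Sum>P\<in>\<P>. \<Sum>n\<in>F - tri (fst P) (snd P). norm (conv K (h P) n) * w n)"
        by (intro sum_mono sum_mono2) (auto simp: F E3_def U3_def w)
      also have "\<dots> \<le> (\<Sum>P\<in>\<P>. 10 * D * C1 * (1 + C1) * S P)"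
        by (intro sum_mono) (use far in auto)
      also have "\<dots> = 10 * D * C1 * (1 + C1) * (\<Sum>P\<in>\<P>. S P)" by (simp add: sum_distrib_left)
      also have "\<dots> \<le> 10 * D * C1 * (1 + C1) * T"
        by (intro mult_left_mono ST) (use D C1 in simp)
      finally show ?thesis by simp
    qed
    have "l * sum w {n\<in>F. l < norm (conv K f n)} \<le> C * T"
      using tot e1 e2 e3 by (simp add: C_def algebra_simps)
    then show ?thesis by (simp add: toQ T_def)
  qed
  have "0 \<le> C" using B C1 D by (simp add: C_def)
  then show ?thesis using main by blast
qed

end

text \<open>
  The intervals of a sparse family may be nested and may overlap heavily, but each owns at least
  half of itself, namely \<open>E P\<close>, and the owned parts are disjoint.
\<close>

definition sparse_family :: "int \<Rightarrow> nat \<Rightarrow> (int \<times> nat) set \<Rightarrow> (int \<times> nat \<Rightarrow> int set) \<Rightarrow> bool" where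
  "sparse_family a k \<S> E \<longleftrightarrow> finite \<S> \<and> (a, k) \<in> \<S> \<and>
     (\<forall>P\<in>\<S>. snd P \<le> k \<and> dyad (fst P) (snd P) \<subseteq> dyad a k \<and>
        E P \<subseteq> dyad (fst P) (snd P) \<and> 2 ^ snd P \<le> 2 * card (E P)) \<and>
     disjoint_family_on E \<S>"

definition tri_avg :: "(int \<Rightarrow> complex) \<Rightarrow> int \<times> nat \<Rightarrow> real" where
  "tri_avg f P = (\<Sum>x\<in>tri (fst P) (snd P). norm (f x)) / (3 * 2 ^ snd P)"

lemma tri_avg_nonneg: "0 \<le> tri_avg f P"
  by (simp add: tri_avg_def sum_nonneg)

lemma sparse_familyD:
  assumes "sparse_family a k \<S> E"
  shows "finite \<S>" "(a, k) \<in> \<S>"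
    and "\<And>P. P \<in> \<S> \<Longrightarrow> snd P \<le> k"
    and "\<And>P. P \<in> \<S> \<Longrightarrow> dyad (fst P) (snd P) \<subseteq> dyad a k"
    and "\<And>P. P \<in> \<S> \<Longrightarrow> E P \<subseteq> dyad (fst P) (snd P)"
    and "\<And>P. P \<in> \<S> \<Longrightarrow> 2 ^ snd P \<le> 2 * card (E P)"
    and "disjoint_family_on E \<S>"
  using assms unfolding sparse_family_def by blast+

text \<open>
  A member of one of the given families lies inside the interval of that family, and these intervals
  are disjoint. So every member has a unique owner \<open>own R\<close>, from which it takes its part \<open>E (own R) R\<close>.
\<close>

lemma sparse_family_glue:
  assumes "finite \<P>" "T \<subseteq> dyad a k" "2 ^ k \<le> 2 * card T"
    and P: "\<And>P. P \<in> \<P> \<Longrightarrow> snd P < k \<and> dyad (fst P) (snd P) \<subseteq> dyad a k \<and>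
               dyad (fst P) (snd P) \<inter> T = {}"
    and dis: "disjoint_family_on (\<lambda>P. dyad (fst P) (snd P)) \<P>"
    and sp: "\<And>P. P \<in> \<P> \<Longrightarrow> sparse_family (fst P) (snd P) (\<S> P) (E P)"
  obtains E' where "sparse_family a k (insert (a, k) (\<Union>P\<in>\<P>. \<S> P)) E'"
proof -
  note D = sparse_familyD[OF sp]
  define own where "own R = (THE P. P \<in> \<P> \<and> R \<in> \<S> P)" for R
  have nonempty: "dyad (fst R) (snd R) \<noteq> {}" for R using dyad_nonempty by blast
  have own: "own R = P" if "P \<in> \<P>" "R \<in> \<S> P" for P R
    unfolding own_def
  proof (rule the_equality)
    fix P' assume P': "P' \<in> \<P> \<and> R \<in> \<S> P'"
    show "P' = P"
    proof (rule ccontr)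
      assume "P' \<noteq> P"
      then have "dyad (fst P') (snd P') \<inter> dyad (fst P) (snd P) = {}"
        using disjoint_family_onD[OF dis] P' that by blast
      moreover have "dyad (fst R) (snd R) \<subseteq> dyad (fst P') (snd P')" using D(4) P' by blast
      moreover have "dyad (fst R) (snd R) \<subseteq> dyad (fst P) (snd P)" using D(4) that by blast
      ultimately show False using nonempty[of R] by blast
    qed
  qed (use that in simp)
  define E' where "E' R = (if R = (a, k) then T else E (own R) R)" for R
  have ne: "R \<noteq> (a, k)" if "P \<in> \<P>" "R \<in> \<S> P" for P R
    using D(3)[OF that] P[OF that(1)] by auto
  have E'_sub: "E' R \<subseteq> dyad (fst P) (snd P)" if "P \<in> \<P>" "R \<in> \<S> P" for P R
    using ne[OF that] own[OF that] D(4)[OF that] D(5)[OF that] by (auto simp: E'_def)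
  have "disjoint_family_on E' (insert (a, k) (\<Union>P\<in>\<P>. \<S> P))"
    unfolding disjoint_family_on_def
  proof (intro ballI impI)
    fix R R' assume R: "R \<in> insert (a, k) (\<Union>P\<in>\<P>. \<S> P)" "R' \<in> insert (a, k) (\<Union>P\<in>\<P>. \<S> P)" "R \<noteq> R'"
    have *: "E' (a, k) \<inter> E' R = {}" if "P \<in> \<P>" "R \<in> \<S> P" for P R
      using E'_sub[OF that] P[OF that(1)] by (auto simp: E'_def)
    have **: "E' R \<inter> E' R' = {}" if "P \<in> \<P>" "R \<in> \<S> P" "P' \<in> \<P>" "R' \<in> \<S> P'" for P P'
    proof (cases "P = P'")
      case True
      then show ?thesis
        using disjoint_family_onD[OF D(7)[OF that(1)], of R R'] that R(3)
          ne[OF that(1,2)] ne[OF that(3,4)]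
        by (simp add: E'_def own[OF that(1,2)] own[OF that(3,4)])
    next
      case False
      then have "dyad (fst P') (snd P') \<inter> dyad (fst P) (snd P) = {}"
        using disjoint_family_onD[OF dis] that by blast
      then show ?thesis using E'_sub[OF that(1,2)] E'_sub[OF that(3,4)] by blast
    qed
    show "E' R \<inter> E' R' = {}"
      using R * ** by blast
  qed
  moreover have "finite (insert (a, k) (\<Union>P\<in>\<P>. \<S> P))" using assms(1) D(1) by blast
  moreover have "snd R \<le> k \<and> dyad (fst R) (snd R) \<subseteq> dyad a k \<and> E' R \<subseteq> dyad (fst R) (snd R) \<and>
      2 ^ snd R \<le> 2 * card (E' R)" if "R \<in> insert (a, k) (\<Union>P\<in>\<P>. \<S> P)" for R
  proof (cases "R = (a, k)")
    case True then show ?thesis using assms(2,3) by (simp add: E'_def)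
  next
    case False
    then have "R \<in> (\<Union>P\<in>\<P>. \<S> P)" using that by simp
    then obtain P' where P': "P' \<in> \<P>" "R \<in> \<S> P'" by (rule UN_E)
    then have "E' R = E P' R" using False own by (simp add: E'_def)
    then show ?thesis using D(3-6)[OF P'] P[OF P'(1)] by auto
  qed
  ultimately have "sparse_family a k (insert (a, k) (\<Union>P\<in>\<P>. \<S> P)) E'"
    unfolding sparse_family_def by (intro conjI ballI) (simp_all del: insert_iff, simp)
  then show ?thesis by (rule that)
qed

lemma cut_eq_zero:
  assumes "tri_avg f (a, k) = 0"
  shows "cut (tri a k) f = (\<lambda>_. 0)"
proof -
  have "(\<Sum>x\<in>tri a k. norm (f x)) = 0" using assms by (simp add: tri_avg_def)
  then have "\<forall>x\<in>tri a k. norm (f x) = 0" by (subst (asm) sum_nonneg_eq_0_iff) auto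
  then show ?thesis by (auto simp: cut_def fun_eq_iff)
qed

context calderon_zygmund_kernel
begin

lemma weak_type_unweighted:
  "\<exists>W\<ge>0. \<forall>f A F l. supported_in f A \<longrightarrow> finite F \<longrightarrow> 0 < l \<longrightarrow>
      l * real (card {n\<in>F. l < norm (conv K f n)}) \<le> W * (\<Sum>k\<in>A. norm (f k))"
proof -
  obtain B where B: "0 \<le> B" "\<And>f A F. supported_in f A \<Longrightarrow> finite F \<Longrightarrow>
        (\<Sum>n\<in>F. (norm (conv K f n))\<^sup>2) \<le> B * (\<Sum>k\<in>A. (norm (f k))\<^sup>2)"
    using l2_bounded by blast
  have "\<exists>C\<ge>0. \<forall>f A F l. supported_in f A \<longrightarrow> finite F \<longrightarrow> 0 < l \<longrightarrow>
           l * (\<Sum>n\<in>{n\<in>F. l < norm (conv K f n)}. 1) \<le> C * (\<Sum>k\<in>A. norm (f k) * 1)"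
    by (rule weak_type[where ?C1.0 = 1 and B = B]) (use B in auto)
  then show ?thesis by simp
qed

text \<open>
  The recursion of Lerner and Ombrosi. On \<open>Q = dyad a k\<close>, with \<open>3Q\<close> its triple, call a point exceptional
  if \<open>T(f 1\<^bsub>3Q\<^esub>)\<close> or the maximal function of \<open>f 1\<^bsub>3Q\<^esub>\<close> exceeds \<open>\<Lambda>\<close> times the average of \<open>f\<close> over \<open>3Q\<close>. By
  the weak-type inequalities the exceptional points make up at most an eighth of \<open>Q\<close>. Stopping at density
  \<open>1 / 4\<close> covers them by disjoint intervals \<open>P\<close> that fill at most half of \<open>Q\<close>, while at least half of each
  \<open>P\<close> is not exceptional. Outside the \<open>P\<close> the claim is clear. Inside \<open>P\<close> the recursion handles
  \<open>T(f 1\<^bsub>3P\<^esub>)\<close>, and \<open>T(f 1\<^bsub>3Q - 3P\<^esub>)\<close> is compared with its value at a point \<open>x'\<close> of \<open>P\<close> which is not exceptional: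
  it oscillates little, by the regularity of the kernel and the bound on the maximal function at \<open>x'\<close>.
\<close>

lemma sparse_domination:
  "\<exists>C\<ge>0. \<forall>f a k. \<exists>\<S> E. sparse_family a k \<S> E \<and>
     (\<forall>x\<in>dyad a k. norm (conv K (cut (tri a k) f) x) \<le>
        C * (\<Sum>P\<in>{P\<in>\<S>. x \<in> dyad (fst P) (snd P)}. tri_avg f P))"
proof -
  obtain W where W: "0 \<le> W" "\<And>f A F l. supported_in f A \<Longrightarrow> finite F \<Longrightarrow> 0 < l \<Longrightarrow>
      l * real (card {n\<in>F. l < norm (conv K f n)}) \<le> W * (\<Sum>k\<in>A. norm (f k))"
    using weak_type_unweighted by blast
  obtain D where D: "0 \<le> D"
    "\<And>a k x x' z. x \<in> dyad a k \<Longrightarrow> x' \<in> dyad a k \<Longrightarrow> z \<notin> tri a k \<Longrightarrow>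
        norm (K (x - z) - K (x' - z)) \<le> D * (2 ^ k / (of_int (z - a))\<^sup>2)"
    by (rule kernel_smooth) blast
  \<comment> \<open>The two weak-type inequalities give \<open>(3 * W + 6) / \<Lambda>\<close>, which is to be \<open>1 / 8\<close>.\<close>
  define \<Lambda> where "\<Lambda> = 24 * W + 48"
  have \<Lambda>: "0 < \<Lambda>" using W by (simp add: \<Lambda>_def)
  \<comment> \<open>One \<open>10 * D * \<Lambda>\<close> for the oscillation, one \<open>\<Lambda>\<close> for the value at \<open>x'\<close>, one \<open>\<Lambda>\<close> for the term added to
    the left-hand side of the claim proved by induction.\<close>
  define C where "C = (10 * D + 2) * \<Lambda>"
  have C0: "0 \<le> C" using D \<Lambda> by (simp add: C_def)
  have weak: "real (card {x\<in>dyad a k. \<Lambda> * tri_avg f (a, k) < norm (conv K (cut (tri a k) f) x)}) * \<Lambda>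
      \<le> 3 * W * 2 ^ k" for f a k
  proof (cases "tri_avg f (a, k) = 0")
    case True
    show ?thesis unfolding cut_eq_zero[OF True] using True W by simp
  next
    case False
    then have pos: "0 < tri_avg f (a, k)" using tri_avg_nonneg[of f "(a, k)"] by linarith
    have "(\<Lambda> * tri_avg f (a, k)) * real (card {x\<in>dyad a k. \<Lambda> * tri_avg f (a, k) < norm (conv K (cut (tri a k) f) x)})
       \<le> W * (\<Sum>x\<in>tri a k. norm (cut (tri a k) f x))"
      by (rule W(2)) (use pos \<Lambda> in auto)
    also have "(\<Sum>x\<in>tri a k. norm (cut (tri a k) f x)) = tri_avg f (a, k) * (3 * 2 ^ k)"
      by (simp add: tri_avg_def cut_def)
    finally have "(real (card {x\<in>dyad a k. \<Lambda> * tri_avg f (a, k) < norm (conv K (cut (tri a k) f) x)}) * \<Lambda>) * tri_avg f (a, k)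
        \<le> (3 * W * 2 ^ k) * tri_avg f (a, k)"
      by (simp add: mult_ac)
    then show ?thesis by (rule mult_right_le_imp_le) (rule pos)
  qed
  \<comment> \<open>The summand \<open>\<Lambda> * tri_avg f (a, k)\<close> pays, one level up, for the value of \<open>T(f 1\<^bsub>3P\<^esub>)\<close> at \<open>x'\<close>.\<close>
  have "\<exists>\<S> E. sparse_family a k \<S> E \<and>
     (\<forall>x\<in>dyad a k. norm (conv K (cut (tri a k) f) x) + \<Lambda> * tri_avg f (a, k) \<le>
        C * (\<Sum>P\<in>{P\<in>\<S>. x \<in> dyad (fst P) (snd P)}. tri_avg f P))" for f a k
  proof (induction k arbitrary: a rule: less_induct)
    case (less k)
    define Q where "Q = dyad a k"
    define fQ where "fQ = cut (tri a k) f"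
    define \<alpha> where "\<alpha> = \<Lambda> * tri_avg f (a, k)"
    have \<alpha>0: "0 \<le> \<alpha>" using \<Lambda> by (simp add: \<alpha>_def tri_avg_nonneg)
    have fQ_supp: "supported_in fQ (tri a k)" by (simp add: fQ_def)
    define E1 where "E1 = {x\<in>Q. \<alpha> < norm (conv K fQ x)}"
    define E2 where "E2 = {x\<in>Q. \<exists>l r. l \<le> x \<and> x \<le> r \<and> \<alpha> * of_int (r - l + 1) < (\<Sum>z\<in>{l..r}. norm (fQ z))}"
    have fin: "finite E1" "finite E2" by (auto simp: E1_def E2_def Q_def)
    have fQ_sum: "(\<Sum>z\<in>X. norm (fQ z)) \<le> tri_avg f (a, k) * (3 * 2 ^ k)" if "finite X" for X
    proof -
      have "(\<Sum>z\<in>X. norm (fQ z)) = (\<Sum>z\<in>X \<inter> tri a k. norm (fQ z))"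
        by (rule sum.mono_neutral_right) (use that in \<open>auto simp: fQ_def cut_def\<close>)
      also have "\<dots> \<le> (\<Sum>z\<in>tri a k. norm (fQ z))" by (rule sum_mono2) auto
      finally show ?thesis by (simp add: fQ_def cut_def tri_avg_def)
    qed
    have c1: "real (card E1) * \<Lambda> \<le> 3 * W * 2 ^ k"
      using weak[of a k f] by (simp add: E1_def Q_def \<alpha>_def fQ_def)
    have c2: "real (card E2) * \<Lambda> \<le> 6 * 2 ^ k"
    proof (cases "tri_avg f (a, k) = 0")
      case True
      then have "fQ = (\<lambda>_. 0)" by (simp add: fQ_def cut_eq_zero)
      then have "E2 = {}" using True by (simp add: E2_def \<alpha>_def)
      then show ?thesis by simp
    next
      case False
      then have pos: "0 < tri_avg f (a, k)" using tri_avg_nonneg[of f "(a, k)"] by linarith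
      have "\<exists>l r. l \<le> x \<and> x \<le> r \<and> \<alpha> * of_int (r - l + 1) < (\<Sum>z\<in>{l..r}. norm (fQ z))" if "x \<in> E2" for x
        using that by (simp add: E2_def)
      then obtain L R where LR: "\<And>x. x \<in> E2 \<Longrightarrow> L x \<le> x \<and> x \<le> R x \<and> \<alpha> * of_int (R x - L x + 1) < (\<Sum>z\<in>{L x..R x}. norm (fQ z))"
        by metis
      define \<I> where "\<I> = (\<lambda>x. (L x, R x)) ` E2"
      have finI: "finite \<I>" using fin by (simp add: \<I>_def)
      have "\<alpha> * (\<Sum>x\<in>(\<Union>(l, r)\<in>\<I>. {l..r}). 1) \<le> 2 * (\<Sum>x\<in>(\<Union>(l, r)\<in>\<I>. {l..r}). norm (fQ x))"
      proof (rule maximal_weak[OF finI])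
        fix l r assume "(l, r) \<in> \<I>"
        then obtain x where "x \<in> E2" "l = L x" "r = R x" by (auto simp: \<I>_def)
        then show "\<alpha> * (\<Sum>x\<in>{l..r}. 1) \<le> (\<Sum>x\<in>{l..r}. norm (fQ x))"
          using LR[of x] by (simp add: of_nat_nat)
      qed (use \<alpha>0 in auto)
      also have "\<dots> \<le> 2 * (tri_avg f (a, k) * (3 * 2 ^ k))"
        by (intro mult_left_mono fQ_sum) (use finI in auto)
      finally have "\<alpha> * real (card (\<Union>(l, r)\<in>\<I>. {l..r})) \<le> 2 * (tri_avg f (a, k) * (3 * 2 ^ k))" by simp
      moreover have "card E2 \<le> card (\<Union>(l, r)\<in>\<I>. {l..r})"
        by (rule card_mono) (use finI LR in \<open>fastforce simp: \<I>_def\<close>)+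
      then have "\<alpha> * real (card E2) \<le> \<alpha> * real (card (\<Union>(l, r)\<in>\<I>. {l..r}))"
        by (intro mult_left_mono \<alpha>0) simp
      ultimately have "(real (card E2) * \<Lambda>) * tri_avg f (a, k) \<le> (6 * 2 ^ k) * tri_avg f (a, k)"
        by (simp add: \<alpha>_def mult_ac)
      then show ?thesis by (rule mult_right_le_imp_le) (rule pos)
    qed
    define Exc where "Exc = E1 \<union> E2"
    have cEx: "8 * real (card Exc) \<le> 2 ^ k"
    proof -
      have "real (card Exc) \<le> real (card E1) + real (card E2)"
        unfolding Exc_def using card_Un_le[of E1 E2] by linarith
      then have "real (card Exc) * \<Lambda> \<le> (real (card E1) + real (card E2)) * \<Lambda>"
        using \<Lambda> by (intro mult_right_mono) auto
      also have "\<dots> \<le> 3 * W * 2 ^ k + 6 * 2 ^ k" using c1 c2 by (simp add: distrib_right)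
      also have "\<dots> = 2 ^ k / 8 * \<Lambda>" by (simp add: \<Lambda>_def field_simps)
      finally have "real (card Exc) \<le> 2 ^ k / 8" by (rule mult_right_le_imp_le) (rule \<Lambda>)
      then show ?thesis by simp
    qed
    define v where "v x = (if x \<in> Exc then 1 else 0 :: real)" for x
    have v0: "0 \<le> v x" for x by (simp add: v_def)
    have vsum: "sum v X = real (card (Exc \<inter> X))" if "finite X" for X
      using that by (simp add: v_def sum.If_cases Int_commute)
    have "Exc \<subseteq> Q" by (auto simp: Exc_def E1_def E2_def)
    have "sum v (dyad a k) \<le> 1 / 4 * 2 ^ k"
      using cEx \<open>Exc \<subseteq> Q\<close> by (simp add: vsum Q_def Int_absorb2)
    then obtain \<P> where P: "stopping_family v (1 / 4) a k \<P>"
      using stopping_family_exists[of v a k "1/4"] v0 by blast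
    note PD = stopping_familyD[OF P]
    have Pcard: "2 ^ snd P < 4 * real (card (Exc \<inter> dyad (fst P) (snd P)))"
      "2 * real (card (Exc \<inter> dyad (fst P) (snd P))) \<le> 2 ^ snd P" if "P \<in> \<P>" for P
      using PD(4)[of "fst P" "snd P"] PD(5)[of "fst P" "snd P"] that by (simp_all add: vsum)
    define U where "U = (\<Union>P\<in>\<P>. dyad (fst P) (snd P))"
    have U_eq: "U = (\<Union>(b, j)\<in>\<P>. dyad b j)" by (simp add: U_def case_prod_beta)
    have ExcU: "Exc \<subseteq> U"
    proof
      fix x assume x: "x \<in> Exc"
      show "x \<in> U"
      proof (rule ccontr)
        assume "x \<notin> U"
        then have "v x \<le> 1 / 4" using PD(7)[of x] x \<open>Exc \<subseteq> Q\<close> by (auto simp: U_eq Q_def)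
        then show False using x by (simp add: v_def)
      qed
    qed
    have UQ: "U \<subseteq> Q" using PD(3) unfolding U_def Q_def by fastforce
    have finU: "finite U" using UQ finite_subset by (auto simp: Q_def)
    have cardU: "2 * card U \<le> 2 ^ k"
    proof -
      have "real (card U) = (\<Sum>P\<in>\<P>. 2 ^ snd P)"
        using stopping_family_sum(1)[OF P, of "\<lambda>_. 1"] by (simp add: U_eq case_prod_beta)
      also have "\<dots> \<le> (\<Sum>P\<in>\<P>. 4 * sum v (dyad (fst P) (snd P)))"
        by (intro sum_mono) (use Pcard(1) in \<open>simp add: vsum less_imp_le\<close>)
      also have "\<dots> \<le> 4 * sum v (dyad a k)"
        using stopping_family_sum(2)[OF P, of v] by (simp add: sum_distrib_left[symmetric] v_def case_prod_beta)
      also have "\<dots> \<le> 2 ^ k / 2" using cEx \<open>Exc \<subseteq> Q\<close> by (simp add: vsum Q_def Int_absorb2)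
      finally have "real (2 * card U) \<le> real (2 ^ k)" by simp
      then show ?thesis by (simp only: of_nat_le_iff)
    qed
    have IH: "\<exists>\<S> E. sparse_family (fst P) (snd P) \<S> E \<and>
     (\<forall>x\<in>dyad (fst P) (snd P). norm (conv K (cut (tri (fst P) (snd P)) f) x) + \<Lambda> * tri_avg f P \<le>
        C * (\<Sum>R\<in>{R\<in>\<S>. x \<in> dyad (fst R) (snd R)}. tri_avg f R))" if "P \<in> \<P>" for P
      using less.IH[of "snd P" "fst P"] PD(2)[of "fst P" "snd P"] that by simp
    define good where "good P SE \<longleftrightarrow> sparse_family (fst P) (snd P) (fst SE) (snd SE) \<and>
     (\<forall>x\<in>dyad (fst P) (snd P). norm (conv K (cut (tri (fst P) (snd P)) f) x) + \<Lambda> * tri_avg f P \<le>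
        C * (\<Sum>R\<in>{R\<in>fst SE. x \<in> dyad (fst R) (snd R)}. tri_avg f R))" for P SE
    have "\<forall>P\<in>\<P>. \<exists>SE. good P SE" using IH by (auto simp: good_def)
    then obtain SE' where SE': "\<forall>P\<in>\<P>. good P (SE' P)" by (rule bchoice[THEN exE])
    define \<S> where "\<S> P = fst (SE' P)" for P
    define E where "E P = snd (SE' P)" for P
    have SE: "\<And>P. P \<in> \<P> \<Longrightarrow> sparse_family (fst P) (snd P) (\<S> P) (E P)"
      "\<And>P x. P \<in> \<P> \<Longrightarrow> x \<in> dyad (fst P) (snd P) \<Longrightarrow>
         norm (conv K (cut (tri (fst P) (snd P)) f) x) + \<Lambda> * tri_avg f P \<le>
        C * (\<Sum>R\<in>{R\<in>\<S> P. x \<in> dyad (fst R) (snd R)}. tri_avg f R)"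
      using SE' by (auto simp: good_def \<S>_def E_def)
    have subP: "snd P < k \<and> dyad (fst P) (snd P) \<subseteq> dyad a k" if "P \<in> \<P>" for P
      using PD(2,3)[of "fst P" "snd P"] that by simp
    obtain E' where E': "sparse_family a k (insert (a, k) (\<Union>P\<in>\<P>. \<S> P)) E'"
    proof (rule sparse_family_glue[where E = E and \<S> = \<S> and \<P> = \<P> and T = "Q - U" and a = a and k = k])
      show "2 ^ k \<le> 2 * card (Q - U)"
        using cardU UQ finU by (simp add: card_Diff_subset Q_def)
      show "disjoint_family_on (\<lambda>P. dyad (fst P) (snd P)) \<P>"
        using PD(6) by (simp add: case_prod_beta')
      show "snd P < k \<and> dyad (fst P) (snd P) \<subseteq> dyad a k \<and> dyad (fst P) (snd P) \<inter> (Q - U) = {}"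
        if "P \<in> \<P>" for P using subP[OF that] that by (auto simp: U_def)
    qed (use PD(1) SE(1) in \<open>auto simp: Q_def\<close>)
    define \<T> where "\<T> = insert (a, k) (\<Union>P\<in>\<P>. \<S> P)"
    have finT: "finite \<T>" using sparse_familyD(1)[OF E'] by (simp add: \<T>_def)
    have aT: "(a, k) \<in> \<T>" by (simp add: \<T>_def)
    have ST: "\<S> P \<subseteq> \<T>" if "P \<in> \<P>" for P using that by (auto simp: \<T>_def)
    have bound: "norm (conv K fQ x) + \<alpha> \<le> C * (\<Sum>R\<in>{R\<in>\<T>. x \<in> dyad (fst R) (snd R)}. tri_avg f R)"
      if x: "x \<in> Q" for x
    proof (cases "x \<in> U")
      case False
      then have "x \<notin> E1" using ExcU by (auto simp: Exc_def)
      then have "norm (conv K fQ x) + \<alpha> \<le> 2 * \<alpha>" using x by (simp add: E1_def)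
      also have "\<dots> \<le> C * tri_avg f (a, k)"
        using D \<Lambda> tri_avg_nonneg[of f "(a, k)"] by (simp add: C_def \<alpha>_def algebra_simps)
      also have "\<dots> \<le> C * (\<Sum>R\<in>{R\<in>\<T>. x \<in> dyad (fst R) (snd R)}. tri_avg f R)"
        by (intro mult_left_mono C0 member_le_sum)
           (use finT x in \<open>auto simp: aT Q_def tri_avg_nonneg\<close>)
      finally show ?thesis .
    next
      case True
      then obtain P where PP: "P \<in> \<P>" "x \<in> dyad (fst P) (snd P)" by (auto simp: U_def)
      define b where "b = fst P"
      define j where "j = snd P"
      have Pbj: "P = (b, j)" by (simp add: b_def j_def)
      have jk: "j < k" "dyad b j \<subseteq> dyad a k" using subP[OF PP(1)] by (simp_all add: b_def j_def)
      have xP: "x \<in> dyad b j" using PP by (simp add: b_def j_def)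
      define fP where "fP = cut (tri b j) f"
      \<comment> \<open>The exceptional points fill at most half of \<open>P\<close> and the points of \<open>Bad\<close> at most an eighth, so
        some \<open>x'\<close> is in neither set.\<close>
      define Bad where "Bad = {y\<in>dyad b j. \<Lambda> * tri_avg f (b, j) < norm (conv K fP y)}"
      have "real (card Bad) * \<Lambda> \<le> 3 * W * 2 ^ j" using weak[of b j f] by (simp add: Bad_def fP_def)
      also have "\<dots> \<le> 2 ^ j / 8 * \<Lambda>" by (simp add: \<Lambda>_def field_simps)
      finally have bad: "real (card Bad) \<le> 2 ^ j / 8" by (rule mult_right_le_imp_le) (rule \<Lambda>)
      have "\<exists>x'. x' \<in> dyad b j \<and> x' \<notin> Bad \<and> x' \<notin> Exc"
      proof (rule ccontr)
        assume "\<not> ?thesis"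
        then have "dyad b j \<subseteq> Bad \<union> (Exc \<inter> dyad b j)" by blast
        then have "card (dyad b j) \<le> card (Bad \<union> (Exc \<inter> dyad b j))"
          by (rule card_mono[rotated]) (simp add: Bad_def)
        also have "\<dots> \<le> card Bad + card (Exc \<inter> dyad b j)" by (rule card_Un_le)
        finally have "real (2 ^ j) \<le> real (card Bad + card (Exc \<inter> dyad b j))"
          by (simp only: of_nat_le_iff card_dyad)
        then have "2 ^ j \<le> real (card Bad) + real (card (Exc \<inter> dyad b j))" by simp
        moreover have "(0::real) < 2 ^ j" by simp
        ultimately show False using bad Pcard(2)[OF PP(1)] unfolding b_def[symmetric] j_def[symmetric]
          by linarith
      qed
      then obtain x' where x': "x' \<in> dyad b j" "x' \<notin> Bad" "x' \<notin> Exc" by blast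
      have x'Q: "x' \<in> Q" using x'(1) jk by (auto simp: Q_def)
      have m1: "norm (conv K fQ x') \<le> \<alpha>" using x'(3) x'Q by (auto simp: Exc_def E1_def)
      have m2: "(\<Sum>z\<in>{l..r}. norm (fQ z)) \<le> \<alpha> * of_int (r - l + 1)" if "l \<le> x'" "x' \<le> r" for l r
        using x'(3) x'Q that by (auto simp: Exc_def E2_def not_less)
      have m3: "norm (conv K fP x') \<le> \<Lambda> * tri_avg f (b, j)" using x'(1,2) by (auto simp: Bad_def)
      have tri_sub: "tri b j \<subseteq> tri a k" using jk by (intro tri_mono) auto
      define gg where "gg = cut (tri a k - tri b j) f"
      have gg_supp: "supported_in gg (tri a k - tri b j)" by (simp add: gg_def)
      have "fQ = (\<lambda>x. fP x + gg x)"
        using tri_sub by (auto simp: fQ_def fP_def gg_def cut_def fun_eq_iff)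
      then have split: "conv K fQ y = conv K fP y + conv K gg y" for y
      proof -
        have "supported_in fP (tri a k)" "supported_in gg (tri a k)"
          using tri_sub by (auto simp: supported_in_def fP_def gg_def cut_def)
        from conv_add[OF this] show ?thesis by (simp only: \<open>fQ = (\<lambda>x. fP x + gg x)\<close>)
      qed
      have osc: "norm (conv K gg x - conv K gg x') \<le> 10 * D * \<alpha>"
      proof -
        have "conv K gg x - conv K gg x' = (\<Sum>z\<in>tri a k - tri b j. (K (x - z) - K (x' - z)) * gg z)"
          by (simp add: conv_finite[OF gg_supp] sum_subtractf algebra_simps)
        then have "norm (conv K gg x - conv K gg x') \<le> (\<Sum>z\<in>tri a k - tri b j. norm ((K (x - z) - K (x' - z)) * gg z))"
          by (simp add: norm_sum)
        also have "\<dots> \<le> (\<Sum>z\<in>tri a k - tri b j. (D * (2 ^ j / (of_int (z - b))\<^sup>2)) * norm (fQ z))"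
        proof (intro sum_mono)
          fix z assume z: "z \<in> tri a k - tri b j"
          have "norm (gg z) = norm (fQ z)" using z by (simp add: gg_def fQ_def cut_def)
          moreover have "norm (K (x - z) - K (x' - z)) \<le> D * (2 ^ j / (of_int (z - b))\<^sup>2)"
            using z D(2)[OF xP x'(1), of z] by blast
          ultimately show "norm ((K (x - z) - K (x' - z)) * gg z) \<le> (D * (2 ^ j / (of_int (z - b))\<^sup>2)) * norm (fQ z)"
            using mult_right_mono[OF _ norm_ge_zero] by (simp only: norm_mult)
        qed
        also have "\<dots> = D * (\<Sum>z\<in>tri a k - tri b j. norm (fQ z) * (2 ^ j / (of_int (z - b))\<^sup>2))"
          by (simp add: sum_distrib_left mult_ac)
        also have "\<dots> \<le> D * (10 * \<alpha>)"
        proof (intro mult_left_mono annulus_sum)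
          fix l r assume "l \<le> b" "b + 2 ^ j - 1 \<le> r"
          then show "(\<Sum>z\<in>{l..r}. norm (fQ z)) \<le> \<alpha> * of_int (r - l + 1)"
            using x'(1) by (intro m2) (auto simp: dyad_def)
        qed (use \<alpha>0 D in auto)
        finally show ?thesis by simp
      qed
      have "conv K fQ x = conv K fP x + ((conv K gg x - conv K gg x') + (conv K fQ x' - conv K fP x'))"
        by (simp add: split)
      then have "norm (conv K fQ x) \<le> norm (conv K fP x) + (norm (conv K gg x - conv K gg x') + (norm (conv K fQ x') + norm (conv K fP x')))"
        by (smt (verit) norm_triangle_ineq norm_triangle_ineq4)
      also have "\<dots> \<le> norm (conv K fP x) + (10 * D * \<alpha> + (\<alpha> + \<Lambda> * tri_avg f (b, j)))"
        using osc m1 m3 by linarith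
      finally have "norm (conv K fQ x) + \<alpha> \<le> (norm (conv K fP x) + \<Lambda> * tri_avg f (b, j)) + C * tri_avg f (a, k)"
        by (simp add: C_def \<alpha>_def algebra_simps)
      also have "\<dots> \<le> C * (\<Sum>R\<in>{R\<in>\<S> P. x \<in> dyad (fst R) (snd R)}. tri_avg f R) + C * tri_avg f (a, k)"
        using SE(2)[OF PP] by (simp add: Pbj fP_def)
      also have "\<dots> = C * (\<Sum>R\<in>insert (a, k) {R\<in>\<S> P. x \<in> dyad (fst R) (snd R)}. tri_avg f R)"
      proof -
        have "(a, k) \<notin> \<S> P" using sparse_familyD(3)[OF SE(1)[OF PP(1)], of "(a, k)"] jk by (auto simp: j_def)
        moreover have "finite (\<S> P)" using sparse_familyD(1)[OF SE(1)[OF PP(1)]] .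
        ultimately show ?thesis by (simp add: algebra_simps)
      qed
      also have "\<dots> \<le> C * (\<Sum>R\<in>{R\<in>\<T>. x \<in> dyad (fst R) (snd R)}. tri_avg f R)"
        by (intro mult_left_mono C0 sum_mono2)
           (use finT x aT ST[OF PP(1)] in \<open>auto simp: Q_def tri_avg_nonneg\<close>)
      finally show ?thesis .
    qed
    show ?case
      using E' bound unfolding \<T>_def fQ_def \<alpha>_def Q_def by blast
  qed
  then have "\<exists>\<S> E. sparse_family a k \<S> E \<and>
     (\<forall>x\<in>dyad a k. norm (conv K (cut (tri a k) f) x) \<le>
        C * (\<Sum>P\<in>{P\<in>\<S>. x \<in> dyad (fst P) (snd P)}. tri_avg f P))" for f a k
    using \<Lambda> tri_avg_nonneg[of f "(a, k)"]
    by (meson add_increasing2 mult_nonneg_nonneg less_imp_le order_trans le_add_same_cancel1)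
  then show ?thesis using C0 by blast
qed

end

lemma sum_Holder:
  fixes u v :: "'a \<Rightarrow> real"
  assumes fin: "finite E" and p: "1 < p" and uv: "\<And>x. x \<in> E \<Longrightarrow> 0 < u x" "\<And>x. x \<in> E \<Longrightarrow> 0 < v x"
  shows "(\<Sum>x\<in>E. u x powr (1 / p) * v x powr ((p - 1) / p)) \<le> sum u E powr (1 / p) * sum v E powr ((p - 1) / p)"
proof (cases "E = {}")
  case False
  define U where "U = sum u E"
  define V where "V = sum v E"
  have U: "0 < U" and V: "0 < V" using False fin uv by (auto simp: U_def V_def intro!: sum_pos)
  have "(\<Sum>x\<in>E. u x powr (1 / p) * v x powr ((p - 1) / p)) / (U powr (1 / p) * V powr ((p - 1) / p))
      = (\<Sum>x\<in>E. (u x / U) powr (1 / p) * (v x / V) powr ((p - 1) / p))"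
    unfolding sum_divide_distrib using uv U V
    by (intro sum.cong refl) (simp add: powr_divide less_imp_le)
  also have "\<dots> \<le> (\<Sum>x\<in>E. 1 / p * (u x / U) + (p - 1) / p * (v x / V))"
    using p U V uv by (intro sum_mono Youngs_inequality_0) (auto simp: field_simps)
  also have "\<dots> = 1"
  proof -
    have "(\<Sum>x\<in>E. 1 / p * (u x / U)) = 1 / p" "(\<Sum>x\<in>E. (p - 1) / p * (v x / V)) = (p - 1) / p"
      using U V by (simp_all add: sum_distrib_left[symmetric] sum_divide_distrib[symmetric]
          U_def[symmetric] V_def[symmetric] del: times_divide_eq_right times_divide_eq_left)
    moreover have "1 / p + (p - 1) / p = 1" using p by (simp add: field_simps)
    ultimately show ?thesis by (simp only: sum.distrib)
  qed
  finally show ?thesis using U V by (simp add: U_def V_def)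
qed simp

text \<open>
  Here \<open>W\<close>, \<open>S\<close> are the masses on an interval of length \<open>n\<close> of the weight \<open>w\<close> and of its dual
  \<open>w powr (- 1 / (p - 1))\<close>, and \<open>We\<close>, \<open>Se\<close> those on a subset of \<open>e\<close> points. The \<open>A\<^sub>p\<close> condition on the interval
  and Hoelder's inequality on the subset make the masses on the subset comparable with those on the interval.
  The factor \<open>6\<close> arises because a major subset has half the length of an interval and a sixth of the
  length of its triple.
\<close>

lemma Ap_sparse_factor:
  fixes p C W S We Se n e :: real
  assumes p: "1 < p" and C: "0 < C"
    and pos: "0 < We" "We \<le> W" "0 < Se" "Se \<le> S" "0 < n" "0 < e" and ne: "n \<le> 6 * e"
    and Ap: "W * S powr (p - 1) \<le> C * n powr p"
    and E: "e powr p \<le> We * Se powr (p - 1)"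
  shows "S * W / n \<le> ((6 powr p * C) powr (1 / (p - 1))) powr (1 / p) * (6 powr p * C) powr ((p - 1) / p)
            * C powr (1 / p) * (Se powr (1 / p) * We powr ((p - 1) / p))"
proof -
  define G where "G = 6 powr p * C"
  have G: "0 < G" using C by (simp add: G_def)
  have W: "0 < W" and S: "0 < S" using pos by linarith+
  have key: "C * n powr p \<le> G * (We * Se powr (p - 1))"
  proof -
    have "n powr p \<le> (6 * e) powr p" using ne p pos by (intro powr_mono2) auto
    also have "\<dots> = 6 powr p * e powr p" using pos by (simp add: powr_mult)
    also have "\<dots> \<le> 6 powr p * (We * Se powr (p - 1))" by (intro mult_left_mono E) simp
    finally have "C * n powr p \<le> C * (6 powr p * (We * Se powr (p - 1)))" using C by simp
    then show ?thesis by (simp add: G_def mult_ac)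
  qed
  have W_le: "W \<le> G * We"
  proof -
    have "W * Se powr (p - 1) \<le> W * S powr (p - 1)"
      using p pos W by (intro mult_left_mono powr_mono2) auto
    also have "\<dots> \<le> (G * We) * Se powr (p - 1)" using Ap key by (simp add: mult_ac)
    finally show ?thesis using pos by simp
  qed
  have S_le: "S \<le> G powr (1 / (p - 1)) * Se"
  proof -
    have "We * S powr (p - 1) \<le> W * S powr (p - 1)" using pos by (intro mult_right_mono) auto
    also have "\<dots> \<le> We * (G * Se powr (p - 1))" using Ap key by (simp add: mult_ac)
    finally have "S powr (p - 1) \<le> G * Se powr (p - 1)" using pos by simp
    then have "(S powr (p - 1)) powr (1 / (p - 1)) \<le> (G * Se powr (p - 1)) powr (1 / (p - 1))"
      using p by (intro powr_mono2) auto
    then show ?thesis using p S pos G by (simp add: powr_powr powr_mult)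
  qed
  have WS: "W powr (1 / p) * S powr ((p - 1) / p) \<le> C powr (1 / p) * n"
  proof -
    have "(W * S powr (p - 1)) powr (1 / p) \<le> (C * n powr p) powr (1 / p)"
      using p W S by (intro powr_mono2 Ap) auto
    then show ?thesis using p W S C pos by (simp add: powr_mult powr_powr)
  qed
  have one: "x powr (1 / p) * x powr ((p - 1) / p) = x" if "0 < x" for x :: real
    using p that by (simp add: powr_add[symmetric] add_divide_distrib[symmetric])
  have "S * W = (S powr (1 / p) * W powr ((p - 1) / p)) * (W powr (1 / p) * S powr ((p - 1) / p))"
    using one[OF S] one[OF W] by (metis (no_types, opaque_lifting) mult.assoc mult.commute)
  also have "\<dots> \<le> ((G powr (1 / (p - 1)) * Se) powr (1 / p) * (G * We) powr ((p - 1) / p)) * (C powr (1 / p) * n)"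
    using p S W pos by (intro mult_mono powr_mono2 S_le W_le WS) auto
  also have "\<dots> = ((G powr (1 / (p - 1))) powr (1 / p) * G powr ((p - 1) / p)
            * C powr (1 / p) * (Se powr (1 / p) * We powr ((p - 1) / p))) * n"
    using G pos by (simp add: powr_mult mult_ac)
  finally show ?thesis using pos by (simp add: G_def divide_le_eq)
qed

text \<open>
  On \<open>E P\<close> the average over the triple of \<open>P\<close> is at most the maximal function \<open>M\<close>. The sets \<open>E P\<close>
  are disjoint, so the sum is at most the integral of \<open>M powr p\<close>, to which Doob's inequality applies.
\<close>

lemma sparse_maximal:
  fixes w \<phi> :: "int \<Rightarrow> real"
  assumes sp: "sparse_family a k \<S> E" and p: "1 < p" and w: "\<And>x. 0 < w x" and \<phi>: "\<And>x. 0 \<le> \<phi> x"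
  shows "(\<Sum>P\<in>\<S>. ((\<Sum>x\<in>tri (fst P) (snd P). \<phi> x * w x) / sum w (tri (fst P) (snd P))) powr p * sum w (E P))
       \<le> (2 * p / (p - 1)) powr p * (\<Sum>x\<in>tri a k. \<phi> x powr p * w x)"
proof -
  note D = sparse_familyD[OF sp]
  have w0: "0 \<le> w x" for x using w[of x] by simp
  define A where "A P = (\<Sum>x\<in>tri (fst P) (snd P). \<phi> x * w x) / sum w (tri (fst P) (snd P))" for P
  have A0: "0 \<le> A P" for P using w0 \<phi> by (simp add: A_def sum_nonneg)
  define M where "M x = Max (insert 0 (A ` {P\<in>\<S>. x \<in> tri (fst P) (snd P)}))" for x
  have finM: "finite (insert 0 (A ` {P\<in>\<S>. x \<in> tri (fst P) (snd P)}))" for x using D(1) by simp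
  have M0: "0 \<le> M x" for x unfolding M_def using finM by (intro Max_ge) auto
  have MA: "A P \<le> M x" if "P \<in> \<S>" "x \<in> tri (fst P) (snd P)" for P x
    unfolding M_def using finM that by (intro Max_ge) auto
  define X where "X = tri a k"
  have triX: "tri (fst P) (snd P) \<subseteq> X" if "P \<in> \<S>" for P
    unfolding X_def using D(3,4)[OF that] by (intro tri_mono) auto
  have EX: "E P \<subseteq> tri (fst P) (snd P)" if "P \<in> \<S>" for P
    using D(5)[OF that] dyad_subset_tri by blast
  have "(\<Sum>P\<in>\<S>. A P powr p * sum w (E P)) \<le> (\<Sum>P\<in>\<S>. \<Sum>x\<in>E P. M x powr p * w x)"
    unfolding sum_distrib_left using p EX
    by (intro sum_mono mult_right_mono powr_mono2) (auto intro: MA less_imp_le[OF w] A0)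
  also have "\<dots> = (\<Sum>x\<in>(\<Union>P\<in>\<S>. E P). M x powr p * w x)"
    using D(1) D(7) finite_subset[OF D(5) finite_dyad]
    by (subst sum.UNION_disjoint) (auto simp: disjoint_family_on_def)
  also have "\<dots> \<le> (\<Sum>x\<in>X. M x powr p * w x)"
  proof (rule sum_mono2)
    show "(\<Union>P\<in>\<S>. E P) \<subseteq> X" using EX triX by blast
  qed (use w0 in \<open>auto simp: X_def\<close>)
  also have "\<dots> \<le> (2 * p / (p - 1)) powr p * (\<Sum>x\<in>X. \<phi> x powr p * w x)"
  proof (rule Doob_Lp[OF _ p])
    fix t :: real assume t: "0 < t"
    define \<I> where "\<I> = (\<lambda>P. (fst P - 2 ^ snd P, fst P + 2 * 2 ^ snd P - 1)) ` {P\<in>\<S>. t \<le> A P}"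
    have finI: "finite \<I>" using D(1) by (simp add: \<I>_def)
    have U: "(\<Union>(l, r)\<in>\<I>. {l..r}) = (\<Union>P\<in>{P\<in>\<S>. t \<le> A P}. tri (fst P) (snd P))"
      by (auto simp: \<I>_def tri_def)
    have eq: "{x\<in>X. t \<le> M x} = (\<Union>(l, r)\<in>\<I>. {l..r})"
    proof (intro equalityI subsetI)
      fix x assume x: "x \<in> {x\<in>X. t \<le> M x}"
      have "M x \<in> insert 0 (A ` {P\<in>\<S>. x \<in> tri (fst P) (snd P)})"
        unfolding M_def by (rule Max_in[OF finM]) simp
      then show "x \<in> (\<Union>(l, r)\<in>\<I>. {l..r})" unfolding U using x t by fastforce
    next
      fix x assume "x \<in> (\<Union>(l, r)\<in>\<I>. {l..r})"
      then obtain P where P: "P \<in> \<S>" "t \<le> A P" "x \<in> tri (fst P) (snd P)" unfolding U by blast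
      then show "x \<in> {x\<in>X. t \<le> M x}" using MA[OF P(1,3)] triX[OF P(1)] by auto
    qed
    show "t * (\<Sum>x\<in>{x\<in>X. t \<le> M x}. w x) \<le> 2 * (\<Sum>x\<in>{x\<in>X. t \<le> M x}. \<phi> x * w x)"
      unfolding eq
    proof (rule maximal_weak[OF finI])
      fix l r assume "(l, r) \<in> \<I>"
      then obtain P where P: "P \<in> \<S>" "t \<le> A P" "{l..r} = tri (fst P) (snd P)"
        by (auto simp: \<I>_def tri_def)
      have "0 < sum w (tri (fst P) (snd P))"
        using w dyad_subset_tri dyad_nonempty[of "fst P" "snd P"] by (intro sum_pos) fast+
      then show "t * sum w {l..r} \<le> (\<Sum>x\<in>{l..r}. \<phi> x * w x)"
        using P(2) by (simp add: P(3) A_def pos_le_divide_eq)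
    qed (use t w \<phi> in \<open>auto intro: less_imp_le mult_nonneg_nonneg\<close>)
  qed (use w \<phi> M0 in \<open>auto simp: X_def less_imp_le\<close>)
  finally show ?thesis by (simp add: A_def X_def)
qed

text \<open>
  Pass from averages with respect to the counting measure to averages \<open>A P\<close>, \<open>G P\<close> with respect to \<open>\<sigma>\<close>
  and \<open>w\<close>. The \<open>A\<^sub>p\<close> condition pays for the change with a factor that contains only masses of the disjoint sets
  \<open>E P\<close>. The maximal function bounds for \<open>\<sigma>\<close> with exponent \<open>p\<close> and for \<open>w\<close> with the conjugate
  exponent then sum up. The parameter \<open>\<delta>\<close> of Young's inequality is left free for a later absorption.
\<close>

lemma sparse_form_bound:
  fixes w :: "int \<Rightarrow> real" and p :: real
  defines "\<sigma> \<equiv> \<lambda>x. w x powr (- 1 / (p - 1))"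
  assumes p: "1 < p" and w: "\<And>x. 0 < w x" and C: "0 < C"
    and Ap: "\<And>l r. l \<le> r \<Longrightarrow> sum w {l..r} * sum \<sigma> {l..r} powr (p - 1) \<le> C * of_int (r - l + 1) powr p"
  shows "\<exists>C'\<ge>0. \<forall>a k \<S> E \<phi> g \<delta>. sparse_family a k \<S> E \<longrightarrow> (\<forall>x. 0 \<le> \<phi> x) \<longrightarrow> (\<forall>x. 0 \<le> g x) \<longrightarrow> 0 < \<delta> \<longrightarrow>
     (\<Sum>P\<in>\<S>. (\<Sum>x\<in>tri (fst P) (snd P). \<phi> x * \<sigma> x) / (3 * 2 ^ snd P) * (\<Sum>x\<in>dyad (fst P) (snd P). g x * w x))
     \<le> C' * (\<delta> powr p * (\<Sum>x\<in>tri a k. \<phi> x powr p * \<sigma> x)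
              + \<delta> powr (- p / (p - 1)) * (\<Sum>x\<in>tri a k. g x powr (p / (p - 1)) * w x))"
proof -
  define q where "q = p / (p - 1)"
  have q: "1 < q" and q1: "1 / q = (p - 1) / p" using p by (auto simp: q_def)
  have \<sigma>: "0 < \<sigma> x" for x using w[of x] by (simp add: \<sigma>_def)
  have w0: "0 \<le> w x" and \<sigma>0: "0 \<le> \<sigma> x" for x using w[of x] \<sigma>[of x] by simp_all
  define H where "H = ((6 powr p * C) powr (1 / (p - 1))) powr (1 / p) * (6 powr p * C) powr ((p - 1) / p) * C powr (1 / p)"
  have H: "0 \<le> H" by (simp add: H_def)
  define Cp where "Cp r = (2 * r / (r - 1)) powr r" for r :: real
  define C' where "C' = H * (Cp p + Cp q)"
  have "(\<Sum>P\<in>\<S>. (\<Sum>x\<in>tri (fst P) (snd P). \<phi> x * \<sigma> x) / (3 * 2 ^ snd P) * (\<Sum>x\<in>dyad (fst P) (snd P). g x * w x))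
     \<le> C' * (\<delta> powr p * (\<Sum>x\<in>tri a k. \<phi> x powr p * \<sigma> x)
              + \<delta> powr (- p / (p - 1)) * (\<Sum>x\<in>tri a k. g x powr (p / (p - 1)) * w x))"
    if sp: "sparse_family a k \<S> E" and \<phi>: "\<And>x. 0 \<le> \<phi> x" and g: "\<And>x. 0 \<le> g x" and \<delta>: "0 < \<delta>"
    for a k \<S> E \<phi> g \<delta>
  proof -
    note D = sparse_familyD[OF sp]
    define A where "A P = (\<Sum>x\<in>tri (fst P) (snd P). \<phi> x * \<sigma> x) / sum \<sigma> (tri (fst P) (snd P))" for P
    define G where "G P = (\<Sum>x\<in>tri (fst P) (snd P). g x * w x) / sum w (tri (fst P) (snd P))" for P
    have A0: "0 \<le> A P" for P using \<sigma>0 \<phi> by (simp add: A_def sum_nonneg)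
    have G0: "0 \<le> G P" for P using w0 g by (simp add: G_def sum_nonneg)
    have bound1: "(\<Sum>x\<in>tri (fst P) (snd P). \<phi> x * \<sigma> x) / (3 * 2 ^ snd P) * (\<Sum>x\<in>dyad (fst P) (snd P). g x * w x)
       \<le> H * (\<delta> powr p * (A P powr p * sum \<sigma> (E P)) + \<delta> powr (- q) * (G P powr q * sum w (E P)))"
      if P: "P \<in> \<S>" for P
    proof -
      define I where "I = tri (fst P) (snd P)"
      have EI: "E P \<subseteq> I" using D(5)[OF P] dyad_subset_tri unfolding I_def by blast
      have finE: "finite (E P)" using EI finite_subset by (auto simp: I_def)
      have neE: "E P \<noteq> {}" using D(6)[OF P] by auto
      have e: "2 ^ snd P \<le> 2 * real (card (E P))" using D(6)[OF P] of_nat_mono[where 'a=real] by fastforce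
      have pos: "0 < sum w (E P)" "0 < sum \<sigma> (E P)" using finE neE w \<sigma> by (auto intro!: sum_pos)
      have le: "sum w (E P) \<le> sum w I" "sum \<sigma> (E P) \<le> sum \<sigma> I"
        using EI w \<sigma> by (auto intro!: sum_mono2 simp: I_def less_imp_le)
      have "sum \<sigma> I * sum w I / (3 * 2 ^ snd P) \<le> H * (sum \<sigma> (E P) powr (1 / p) * sum w (E P) powr ((p - 1) / p))"
        unfolding H_def
      proof (rule Ap_sparse_factor[OF p C pos(1) le(1) pos(2) le(2), where e = "real (card (E P))"])
        show "sum w I * sum \<sigma> I powr (p - 1) \<le> C * (3 * 2 ^ snd P) powr p"
        proof -
          have "sum w I * sum \<sigma> I powr (p - 1) \<le> C * of_int (fst P + 2 * 2 ^ snd P - 1 - (fst P - 2 ^ snd P) + 1) powr p"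
            unfolding I_def tri_def by (rule Ap) simp
          then show ?thesis by simp
        qed
        have "card (E P) > 0" using finE neE by (simp add: card_gt_0_iff)
        then show "0 < real (card (E P))" by simp
        have "real (card (E P)) = (\<Sum>x\<in>E P. w x powr (1 / p) * \<sigma> x powr ((p - 1) / p))"
        proof -
          have "w x powr (1 / p) * \<sigma> x powr ((p - 1) / p) = 1" for x
            using p w[of x] by (simp add: \<sigma>_def powr_powr powr_add[symmetric])
          then show ?thesis by simp
        qed
        also have "\<dots> \<le> sum w (E P) powr (1 / p) * sum \<sigma> (E P) powr ((p - 1) / p)"
          by (rule sum_Holder) (use finE p w \<sigma> in auto)
        finally have "real (card (E P)) powr p \<le> (sum w (E P) powr (1 / p) * sum \<sigma> (E P) powr ((p - 1) / p)) powr p"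
          using p by (intro powr_mono2) auto
        then show "real (card (E P)) powr p \<le> sum w (E P) * sum \<sigma> (E P) powr (p - 1)"
          using p pos by (simp add: powr_mult powr_powr)
      qed (use e in auto)
      note factor = this
      have AS: "(\<Sum>x\<in>I. \<phi> x * \<sigma> x) = A P * sum \<sigma> I" and GW: "(\<Sum>x\<in>I. g x * w x) = G P * sum w I"
        using pos le by (simp_all add: A_def G_def I_def)
      have "(\<Sum>x\<in>I. \<phi> x * \<sigma> x) / (3 * 2 ^ snd P) * (\<Sum>x\<in>dyad (fst P) (snd P). g x * w x)
          \<le> (\<Sum>x\<in>I. \<phi> x * \<sigma> x) / (3 * 2 ^ snd P) * (\<Sum>x\<in>I. g x * w x)"
        by (intro mult_left_mono sum_mono2 divide_nonneg_nonneg sum_nonneg)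
          (use dyad_subset_tri \<phi> g w \<sigma> in \<open>auto simp: I_def less_imp_le\<close>)
      also have "\<dots> = A P * G P * (sum \<sigma> I * sum w I / (3 * 2 ^ snd P))" unfolding AS GW by simp
      also have "\<dots> \<le> A P * G P * (H * (sum \<sigma> (E P) powr (1 / p) * sum w (E P) powr ((p - 1) / p)))"
        by (intro mult_left_mono factor mult_nonneg_nonneg A0 G0)
      also have "\<dots> = H * ((\<delta> * A P * sum \<sigma> (E P) powr (1 / p)) * (inverse \<delta> * G P * sum w (E P) powr (1 / q)))"
        using \<delta> by (simp add: q1 field_simps)
      also have "\<dots> \<le> H * ((\<delta> * A P * sum \<sigma> (E P) powr (1 / p)) powr p / p + (inverse \<delta> * G P * sum w (E P) powr (1 / q)) powr q / q)"
        by (intro mult_left_mono Youngs_inequality H) (use p q q1 A0 G0 \<delta> in \<open>auto simp: field_simps\<close>)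
      also have "\<dots> \<le> H * ((\<delta> * A P * sum \<sigma> (E P) powr (1 / p)) powr p + (inverse \<delta> * G P * sum w (E P) powr (1 / q)) powr q)"
      proof (intro mult_left_mono add_mono H)
        have "x / r \<le> x" if "0 \<le> x" "1 < r" for x r :: real
          using that mult_left_mono[of 1 r x] by (simp add: divide_le_eq)
        then show "(\<delta> * A P * sum \<sigma> (E P) powr (1 / p)) powr p / p \<le> (\<delta> * A P * sum \<sigma> (E P) powr (1 / p)) powr p"
          "(inverse \<delta> * G P * sum w (E P) powr (1 / q)) powr q / q \<le> (inverse \<delta> * G P * sum w (E P) powr (1 / q)) powr q"
          using p q by auto
      qed
      also have "\<dots> = H * (\<delta> powr p * (A P powr p * sum \<sigma> (E P)) + \<delta> powr (- q) * (G P powr q * sum w (E P)))"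
        using \<delta> A0 G0 p q pos by (simp add: powr_mult powr_powr powr_minus inverse_powr mult_ac)
      finally show ?thesis by (simp add: I_def)
    qed
    have SA: "(\<Sum>P\<in>\<S>. A P powr p * sum \<sigma> (E P)) \<le> Cp p * (\<Sum>x\<in>tri a k. \<phi> x powr p * \<sigma> x)"
      unfolding A_def Cp_def by (rule sparse_maximal[OF sp p \<sigma> \<phi>])
    have SG: "(\<Sum>P\<in>\<S>. G P powr q * sum w (E P)) \<le> Cp q * (\<Sum>x\<in>tri a k. g x powr q * w x)"
      unfolding G_def Cp_def by (rule sparse_maximal[OF sp q w g])
    have nn: "0 \<le> (\<Sum>x\<in>tri a k. \<phi> x powr p * \<sigma> x)" "0 \<le> (\<Sum>x\<in>tri a k. g x powr q * w x)"
      using w0 \<sigma>0 by (simp_all add: sum_nonneg)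
    have "(\<Sum>P\<in>\<S>. (\<Sum>x\<in>tri (fst P) (snd P). \<phi> x * \<sigma> x) / (3 * 2 ^ snd P) * (\<Sum>x\<in>dyad (fst P) (snd P). g x * w x))
       \<le> (\<Sum>P\<in>\<S>. H * (\<delta> powr p * (A P powr p * sum \<sigma> (E P)) + \<delta> powr (- q) * (G P powr q * sum w (E P))))"
      by (intro sum_mono bound1)
    also have "\<dots> = H * (\<delta> powr p * (\<Sum>P\<in>\<S>. A P powr p * sum \<sigma> (E P)) + \<delta> powr (- q) * (\<Sum>P\<in>\<S>. G P powr q * sum w (E P)))"
      by (simp only: sum_distrib_left[symmetric] sum.distrib)
    also have "\<dots> \<le> H * (\<delta> powr p * (Cp p * (\<Sum>x\<in>tri a k. \<phi> x powr p * \<sigma> x)) + \<delta> powr (- q) * (Cp q * (\<Sum>x\<in>tri a k. g x powr q * w x)))"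
      by (intro mult_left_mono add_mono SA SG H) auto
    also have "\<dots> \<le> H * (\<delta> powr p * ((Cp p + Cp q) * (\<Sum>x\<in>tri a k. \<phi> x powr p * \<sigma> x)) + \<delta> powr (- q) * ((Cp p + Cp q) * (\<Sum>x\<in>tri a k. g x powr q * w x)))"
      by (intro mult_left_mono add_mono mult_right_mono H nn) (auto simp: Cp_def)
    finally show ?thesis by (simp add: C'_def q_def algebra_simps)
  qed
  moreover have "0 \<le> C'" using H by (simp add: C'_def Cp_def)
  ultimately show ?thesis by blast
qed

context calderon_zygmund_kernel
begin

text \<open>
  Test the sparse bound for \<open>T f\<close> against \<open>g = \<bar>T f\<bar> powr (p - 1)\<close>, cut to a finite interval \<open>Q\<close>. The norm of
  \<open>g\<close> with the conjugate exponent is the left-hand side \<open>Z\<close> itself, which is finite, and \<open>\<delta>\<close>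
  is so large that at most half of it is left on the right.
\<close>

lemma Ap_bound:
  fixes w :: "int \<Rightarrow> real" and p :: real
  assumes p: "1 < p" and w: "\<And>x. 0 < w x" and C: "0 < C"
    and Ap: "\<And>l r. l \<le> r \<Longrightarrow> sum w {l..r} * (\<Sum>x\<in>{l..r}. w x powr (- 1 / (p - 1))) powr (p - 1)
               \<le> C * of_int (r - l + 1) powr p"
  shows "\<exists>B\<ge>0. \<forall>f A F. supported_in f A \<longrightarrow> finite F \<longrightarrow>
     (\<Sum>n\<in>F. norm (conv K f n) powr p * w n) \<le> B * (\<Sum>k\<in>A. norm (f k) powr p * w k)"
proof -
  define \<sigma> where "\<sigma> x = w x powr (- 1 / (p - 1))" for x
  have \<sigma>: "0 < \<sigma> x" for x using w[of x] by (simp add: \<sigma>_def)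
  obtain C0 where C0: "0 \<le> C0" "\<And>f a k. \<exists>\<S> E. sparse_family a k \<S> E \<and>
     (\<forall>x\<in>dyad a k. norm (conv K (cut (tri a k) f) x) \<le>
        C0 * (\<Sum>P\<in>{P\<in>\<S>. x \<in> dyad (fst P) (snd P)}. tri_avg f P))"
    using sparse_domination by blast
  obtain C1 where C1: "0 \<le> C1" "\<And>a k \<S> E \<phi> g \<delta>. sparse_family a k \<S> E \<Longrightarrow> (\<And>x. 0 \<le> \<phi> x) \<Longrightarrow> (\<And>x. 0 \<le> g x) \<Longrightarrow> 0 < \<delta> \<Longrightarrow>
     (\<Sum>P\<in>\<S>. (\<Sum>x\<in>tri (fst P) (snd P). \<phi> x * \<sigma> x) / (3 * 2 ^ snd P) * (\<Sum>x\<in>dyad (fst P) (snd P). g x * w x))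
     \<le> C1 * (\<delta> powr p * (\<Sum>x\<in>tri a k. \<phi> x powr p * \<sigma> x)
              + \<delta> powr (- p / (p - 1)) * (\<Sum>x\<in>tri a k. g x powr (p / (p - 1)) * w x))"
    using sparse_form_bound[OF p w C Ap] unfolding \<sigma>_def by blast
  define \<delta> where "\<delta> = (2 * C0 * C1 + 1) powr ((p - 1) / p)"
  have \<delta>: "0 < \<delta>" using mult_nonneg_nonneg[OF C0(1) C1(1)] by (simp add: \<delta>_def)
  have \<delta>q: "C0 * C1 * \<delta> powr (- p / (p - 1)) \<le> 1 / 2"
  proof -
    have c: "0 < 2 * C0 * C1 + 1" using C0(1) C1(1) by (simp add: add_nonneg_pos)
    have "\<delta> powr (- p / (p - 1)) = inverse (2 * C0 * C1 + 1)"
      using p c by (simp add: \<delta>_def powr_powr powr_minus)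
    moreover have "C0 * C1 * inverse (2 * C0 * C1 + 1) \<le> 1 / 2" using c by (simp add: field_simps)
    ultimately show ?thesis by (simp only:)
  qed
  define B where "B = 2 * (C0 * C1 * \<delta> powr p)"
  have "(\<Sum>n\<in>F. norm (conv K f n) powr p * w n) \<le> B * (\<Sum>k\<in>A. norm (f k) powr p * w k)"
    if fA: "supported_in f A" and F: "finite F" for f A F
  proof -
    have finA: "finite A" using fA by (simp add: supported_in_def)
    obtain a k where Q0: "A \<union> F \<subseteq> dyad a k"
    proof -
      have "finite (A \<union> F)" using finA F by simp
      then show ?thesis by (rule dyad_cover) (use that in blast)
    qed
    define Q where "Q = dyad a k"
    have AQ: "A \<subseteq> Q" and FQ: "F \<subseteq> Q" using Q0 by (auto simp: Q_def)
    have finQ: "finite Q" by (simp add: Q_def)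
    have cutf: "cut (tri a k) f = f"
      using AQ fA dyad_subset_tri[of a k] by (auto simp: cut_def Q_def supported_in_def fun_eq_iff)
    obtain \<S> E where SE: "sparse_family a k \<S> E"
      "\<And>x. x \<in> Q \<Longrightarrow> norm (conv K f x) \<le> C0 * (\<Sum>P\<in>{P\<in>\<S>. x \<in> dyad (fst P) (snd P)}. tri_avg f P)"
      using C0(2)[of a k f] unfolding cutf Q_def by blast
    note D = sparse_familyD[OF SE(1)]
    define h where "h x = norm (conv K f x)" for x
    define g where "g x = (if x \<in> Q then h x powr (p - 1) else 0)" for x
    \<comment> \<open>The function whose integral against \<open>\<sigma>\<close> is the integral of \<open>norm \<circ> f\<close>.\<close>
    define \<phi> where "\<phi> x = norm (f x) / \<sigma> x" for x
    define Z where "Z = (\<Sum>x\<in>Q. h x powr p * w x)"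
    have h0: "0 \<le> h x" for x by (simp add: h_def)
    have g0: "0 \<le> g x" for x by (simp add: g_def)
    have "Z = (\<Sum>x\<in>Q. h x * (g x * w x))"
    proof -
      have "h x powr p = h x * h x powr (p - 1)" for x
        using h0[of x] p by (cases "h x = 0") (simp_all add: powr_diff)
      then show ?thesis by (simp add: Z_def g_def mult_ac)
    qed
    also have "\<dots> \<le> (\<Sum>x\<in>Q. (C0 * (\<Sum>P\<in>{P\<in>\<S>. x \<in> dyad (fst P) (snd P)}. tri_avg f P)) * (g x * w x))"
      using SE(2) g0 w by (intro sum_mono mult_right_mono) (auto simp: h_def less_imp_le)
    also have "\<dots> = C0 * (\<Sum>x\<in>Q. \<Sum>P\<in>\<S>. if x \<in> dyad (fst P) (snd P) then tri_avg f P * (g x * w x) else 0)"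
    proof -
      have "(C0 * (\<Sum>P\<in>{P\<in>\<S>. x \<in> dyad (fst P) (snd P)}. tri_avg f P)) * (g x * w x)
          = C0 * (\<Sum>P\<in>\<S>. if x \<in> dyad (fst P) (snd P) then tri_avg f P * (g x * w x) else 0)" for x
        unfolding sum.inter_filter[OF D(1), symmetric] by (simp only: sum_distrib_right mult.assoc)
      then show ?thesis by (simp only: sum_distrib_left[of C0 _ Q])
    qed
    also have "\<dots> = C0 * (\<Sum>P\<in>\<S>. \<Sum>x\<in>Q. if x \<in> dyad (fst P) (snd P) then tri_avg f P * (g x * w x) else 0)"
      by (subst sum.swap) simp
    also have "\<dots> = C0 * (\<Sum>P\<in>\<S>. tri_avg f P * (\<Sum>x\<in>dyad (fst P) (snd P). g x * w x))"
    proof (intro arg_cong[of _ _ "\<lambda>x. C0 * x"] sum.cong refl)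
      fix P assume "P \<in> \<S>"
      then have "Q \<inter> dyad (fst P) (snd P) = dyad (fst P) (snd P)" using D(4) unfolding Q_def by blast
      then show "(\<Sum>x\<in>Q. if x \<in> dyad (fst P) (snd P) then tri_avg f P * (g x * w x) else 0)
          = tri_avg f P * (\<Sum>x\<in>dyad (fst P) (snd P). g x * w x)"
        using finQ by (simp add: sum.inter_restrict[symmetric] sum_distrib_left)
    qed
    also have "\<dots> = C0 * (\<Sum>P\<in>\<S>. (\<Sum>x\<in>tri (fst P) (snd P). \<phi> x * \<sigma> x) / (3 * 2 ^ snd P) * (\<Sum>x\<in>dyad (fst P) (snd P). g x * w x))"
      using \<sigma> by (simp add: tri_avg_def \<phi>_def less_imp_neq[symmetric])
    also have "\<dots> \<le> C0 * (C1 * (\<delta> powr p * (\<Sum>x\<in>tri a k. \<phi> x powr p * \<sigma> x)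
              + \<delta> powr (- p / (p - 1)) * (\<Sum>x\<in>tri a k. g x powr (p / (p - 1)) * w x)))"
      using g0 \<sigma> by (intro mult_left_mono C0(1) C1(2)[OF SE(1)] \<delta>) (auto simp: \<phi>_def less_imp_le)
    also have "(\<Sum>x\<in>tri a k. g x powr (p / (p - 1)) * w x) = Z"
    proof -
      have "(\<Sum>x\<in>tri a k. g x powr (p / (p - 1)) * w x) = (\<Sum>x\<in>Q. g x powr (p / (p - 1)) * w x)"
        by (rule sum.mono_neutral_right) (use dyad_subset_tri in \<open>auto simp: Q_def g_def\<close>)
      then show ?thesis using p by (simp add: Z_def g_def powr_powr)
    qed
    also have "(\<Sum>x\<in>tri a k. \<phi> x powr p * \<sigma> x) = (\<Sum>x\<in>A. norm (f x) powr p * w x)"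
    proof -
      have "\<phi> x powr p * \<sigma> x = norm (f x) powr p * w x" for x
      proof -
        have "- 1 / (p - 1) * p = - 1 / (p - 1) + - 1" using p by (simp add: field_simps)
        then have "\<sigma> x powr p = w x powr (- 1 / (p - 1) + - 1)" by (simp only: \<sigma>_def powr_powr)
        also have "\<dots> = \<sigma> x * inverse (w x)"
          using w[of x] unfolding powr_add by (simp add: \<sigma>_def powr_minus)
        finally have "\<sigma> x powr p = \<sigma> x * inverse (w x)" .
        then show ?thesis using \<sigma>[of x] w[of x] by (simp add: \<phi>_def powr_divide field_simps)
      qed
      then have "(\<Sum>x\<in>tri a k. \<phi> x powr p * \<sigma> x) = (\<Sum>x\<in>tri a k. norm (f x) powr p * w x)" by simp
      also have "\<dots> = (\<Sum>x\<in>A. norm (f x) powr p * w x)"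
        by (rule sum.mono_neutral_right)
          (use AQ dyad_subset_tri[of a k] fA in \<open>auto simp: Q_def supported_in_def\<close>)
      finally show ?thesis .
    qed
    finally have "Z \<le> C0 * C1 * \<delta> powr p * (\<Sum>x\<in>A. norm (f x) powr p * w x) + C0 * C1 * \<delta> powr (- p / (p - 1)) * Z"
      by (simp add: algebra_simps)
    moreover have Z0: "0 \<le> Z" using w by (simp add: Z_def sum_nonneg less_imp_le)
    then have "C0 * C1 * \<delta> powr (- p / (p - 1)) * Z \<le> 1 / 2 * Z" by (intro mult_right_mono \<delta>q)
    ultimately have "Z \<le> B * (\<Sum>x\<in>A. norm (f x) powr p * w x)" by (simp add: B_def)
    moreover have "(\<Sum>n\<in>F. norm (conv K f n) powr p * w n) \<le> Z"
      unfolding Z_def h_def by (rule sum_mono2) (use finQ FQ w in \<open>auto simp: less_imp_le\<close>)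
    ultimately show ?thesis by linarith
  qed
  moreover have "0 \<le> B" using C0(1) C1(1) by (simp add: B_def)
  ultimately show ?thesis by blast
qed

text \<open>
  A weight in \<open>A\<^sub>1\<close> belongs to \<open>A\<^sub>2\<close>, so the case \<open>p = 2\<close> above supplies the \<open>L\<^sup>2\<close> bound from which the
  weak-type inequality follows.
\<close>

lemma A1_bound:
  fixes w :: "int \<Rightarrow> real"
  assumes w: "\<And>x. 0 < w x" and C: "0 < C"
    and A1: "\<And>l r x. l \<le> x \<Longrightarrow> x \<le> r \<Longrightarrow> sum w {l..r} \<le> C * of_int (r - l + 1) * w x"
  shows "\<exists>B\<ge>0. \<forall>f A F l. supported_in f A \<longrightarrow> finite F \<longrightarrow> 0 < l \<longrightarrow>
           l * (\<Sum>n\<in>{n\<in>F. l < norm (conv K f n)}. w n) \<le> B * (\<Sum>k\<in>A. norm (f k) * w k)"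
proof -
  have "\<exists>B\<ge>0. \<forall>f A F. supported_in f A \<longrightarrow> finite F \<longrightarrow>
     (\<Sum>n\<in>F. norm (conv K f n) powr 2 * w n) \<le> B * (\<Sum>k\<in>A. norm (f k) powr 2 * w k)"
  proof (rule Ap_bound[OF _ w C])
    fix l r :: int assume lr: "l \<le> r"
    define n where "n = real_of_int (r - l + 1)"
    define W where "W = sum w {l..r}"
    have W: "0 < W" using lr w by (auto simp: W_def intro!: sum_pos)
    have "inverse (w x) \<le> C * n / W" if "x \<in> {l..r}" for x
      using A1[of l x r] that W w[of x] by (simp add: n_def W_def field_simps)
    then have "(\<Sum>x\<in>{l..r}. inverse (w x)) \<le> (\<Sum>x\<in>{l..r}. C * n / W)" by (rule sum_mono)
    also have "\<dots> = n * (C * n / W)" using lr by (simp add: n_def of_nat_nat)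
    finally have "W * (\<Sum>x\<in>{l..r}. inverse (w x)) \<le> C * n\<^sup>2"
      using W by (simp add: field_simps power2_eq_square)
    moreover have "0 \<le> (\<Sum>x\<in>{l..r}. inverse (w x))" using w by (intro sum_nonneg) (simp add: less_imp_le)
    moreover have "0 < n" using lr by (simp add: n_def)
    ultimately show "sum w {l..r} * (\<Sum>x\<in>{l..r}. w x powr (- 1 / (2 - 1))) powr (2 - 1) \<le> C * of_int (r - l + 1) powr 2"
      using w by (simp add: W_def n_def powr_minus less_imp_le flip: powr_numeral)
  qed simp
  then obtain B where "0 \<le> B" "\<And>f A F. supported_in f A \<Longrightarrow> finite F \<Longrightarrow>
     (\<Sum>n\<in>F. (norm (conv K f n))\<^sup>2 * w n) \<le> B * (\<Sum>k\<in>A. (norm (f k))\<^sup>2 * w k)"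
    by auto
  then show ?thesis
    by (intro weak_type[where ?C1.0 = C and B = B]) (use w C A1 in \<open>auto simp: less_imp_le\<close>)
qed

end

section \<open>Finite differences and vanishing moments\<close>

lemma bdiff_pow_add: "(bdiff ^^ j) (\<lambda>n. f n + g n) n = (bdiff ^^ j) f n + (bdiff ^^ j) g n"
  by (induction j arbitrary: n) (simp_all add: bdiff_def algebra_simps)

lemma bdiff_pow_mult: "(bdiff ^^ j) (\<lambda>n. c * f n) n = c * (bdiff ^^ j) f n"
  by (induction j arbitrary: n) (simp_all add: bdiff_def algebra_simps)

lemma bdiff_pow_diff: "(bdiff ^^ j) (\<lambda>n. f n - g n) n = (bdiff ^^ j) f n - (bdiff ^^ j) g n"
  by (induction j arbitrary: n) (simp_all add: bdiff_def)

lemma bdiff_pow_shift: "(bdiff ^^ j) (\<lambda>n. f (n - a)) n = (bdiff ^^ j) f (n - a)"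
  by (induction j arbitrary: n) (simp_all add: bdiff_def algebra_simps)

lemma bdiff_pow_Suc: "(bdiff ^^ Suc j) f = (bdiff ^^ j) (bdiff f)"
  by (simp add: funpow_swap1)

lemma bdiff_pow_cong:
  assumes "\<And>m. n - int j \<le> m \<Longrightarrow> m \<le> n \<Longrightarrow> f m = g m"
  shows "(bdiff ^^ j) f n = (bdiff ^^ j) g n"
  using assms
proof (induction j arbitrary: n)
  case (Suc j)
  have "(bdiff ^^ j) f n = (bdiff ^^ j) g n" "(bdiff ^^ j) f (n - 1) = (bdiff ^^ j) g (n - 1)"
    using Suc.prems by (auto intro!: Suc.IH)
  then show ?case by (simp add: bdiff_def[of "(bdiff ^^ j) f"] bdiff_def[of "(bdiff ^^ j) g"])
qed simp

lemma bdiff_pow_zero [simp]: "(bdiff ^^ j) (\<lambda>_. 0) n = 0"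
  using bdiff_pow_mult[of j 0 "\<lambda>_. 0" n] by simp

lemma supported_in_bdiff_pow:
  assumes "supported_in f {l..r}"
  shows "supported_in ((bdiff ^^ j) f) {l..r + int j}"
  unfolding supported_in_def
proof (intro conjI allI impI)
  fix n assume n: "n \<notin> {l..r + int j}"
  have "(bdiff ^^ j) f n = (bdiff ^^ j) (\<lambda>_. 0) n"
    by (rule bdiff_pow_cong) (use n assms in \<open>auto simp: supported_in_def\<close>)
  then show "(bdiff ^^ j) f n = 0" by simp
qed simp

lemma bdiff_pow_Leibniz:
  assumes "0 \<le> F" "0 \<le> G" "0 \<le> t"
    and f: "\<And>j m. j \<le> N \<Longrightarrow> n - int N \<le> m \<Longrightarrow> m \<le> n \<Longrightarrow> norm ((bdiff ^^ j) f m) \<le> F * t ^ j"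
    and g: "\<And>j m. j \<le> N \<Longrightarrow> n - int N \<le> m \<Longrightarrow> m \<le> n \<Longrightarrow> norm ((bdiff ^^ j) g m) \<le> G * t ^ j"
  shows "norm ((bdiff ^^ N) (\<lambda>m. f m * g m) n) \<le> 2 ^ N * F * G * t ^ N"
  using assms
proof (induction N arbitrary: f g F G)
  case 0
  then show ?case
    using mult_mono[of "norm (f n)" F "norm (g n)" G] "0.prems"(4)[of 0 n] "0.prems"(5)[of 0 n]
    by (simp add: norm_mult)
next
  case (Suc N)
  have split: "bdiff (\<lambda>m. f m * g m) = (\<lambda>m. bdiff f m * g m + f (m - 1) * bdiff g m)"
    by (simp add: bdiff_def fun_eq_iff algebra_simps)
  have "norm ((bdiff ^^ Suc N) (\<lambda>m. f m * g m) n)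
      \<le> norm ((bdiff ^^ N) (\<lambda>m. bdiff f m * g m) n) + norm ((bdiff ^^ N) (\<lambda>m. f (m - 1) * bdiff g m) n)"
    unfolding bdiff_pow_Suc split bdiff_pow_add by (rule norm_triangle_ineq)
  also have "norm ((bdiff ^^ N) (\<lambda>m. bdiff f m * g m) n) \<le> 2 ^ N * (F * t) * G * t ^ N"
  proof (rule Suc.IH)
    fix j m assume jm: "j \<le> N" "n - int N \<le> m" "m \<le> n"
    show "norm ((bdiff ^^ j) (bdiff f) m) \<le> F * t * t ^ j"
      using Suc.prems(4)[of "Suc j" m] jm unfolding bdiff_pow_Suc by (simp add: mult_ac)
    show "norm ((bdiff ^^ j) g m) \<le> G * t ^ j"
      using Suc.prems(5)[of j m] jm by simp
  qed (use Suc.prems in auto)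
  also have "norm ((bdiff ^^ N) (\<lambda>m. f (m - 1) * bdiff g m) n) \<le> 2 ^ N * F * (G * t) * t ^ N"
  proof (rule Suc.IH)
    fix j m assume jm: "j \<le> N" "n - int N \<le> m" "m \<le> n"
    show "norm ((bdiff ^^ j) (\<lambda>m. f (m - 1)) m) \<le> F * t ^ j"
      using Suc.prems(4)[of j "m - 1"] jm unfolding bdiff_pow_shift by simp
    show "norm ((bdiff ^^ j) (bdiff g) m) \<le> G * t * t ^ j"
      using Suc.prems(5)[of "Suc j" m] jm unfolding bdiff_pow_Suc by (simp add: mult_ac)
  qed (use Suc.prems in auto)
  finally show ?case by (simp add: mult_ac)
qed

definition vanishing_moments :: "nat \<Rightarrow> (int \<Rightarrow> complex) \<Rightarrow> bool" where
  "vanishing_moments N b \<longleftrightarrow> (\<forall>i<N. (\<Sum>\<^sub>\<infinity>n\<in>UNIV. of_int n ^ i * b n) = 0)"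

lemma moment_finite:
  assumes "supported_in b A"
  shows "(\<Sum>\<^sub>\<infinity>n\<in>UNIV. of_int n ^ i * b n) = (\<Sum>n\<in>A. of_int n ^ i * b n)"
proof -
  have "(\<Sum>\<^sub>\<infinity>n\<in>UNIV. of_int n ^ i * b n) = (\<Sum>\<^sub>\<infinity>n\<in>A. of_int n ^ i * b n)"
    by (rule infsum_cong_neutral) (use assms in \<open>auto simp: supported_in_def\<close>)
  then show ?thesis using assms by (simp add: supported_in_def)
qed

lemma vanishing_moments_finite:
  assumes "supported_in b A"
  shows "vanishing_moments N b \<longleftrightarrow> (\<forall>i<N. (\<Sum>n\<in>A. of_int n ^ i * b n) = 0)"
  by (simp add: vanishing_moments_def moment_finite[OF assms])

lemma vanishing_moments_diff:
  assumes "supported_in f A" "supported_in g A" "vanishing_moments N f" "vanishing_moments N g"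
  shows "vanishing_moments N (\<lambda>n. f n - g n)"
proof -
  have "supported_in (\<lambda>n. f n - g n) A" using assms(1,2) by (auto simp: supported_in_def)
  then show ?thesis using assms
    by (simp add: vanishing_moments_finite algebra_simps sum_subtractf)
qed

lemma vanishing_moments_sum:
  assumes "\<And>i. i \<in> I \<Longrightarrow> supported_in (f i) A" "finite A" "\<And>i. i \<in> I \<Longrightarrow> vanishing_moments N (f i)"
  shows "vanishing_moments N (\<lambda>n. \<Sum>i\<in>I. f i n)"
proof -
  have "supported_in (\<lambda>n. \<Sum>i\<in>I. f i n) A"
    using assms(1,2) by (auto simp: supported_in_def intro!: sum.neutral)
  moreover have "(\<Sum>n\<in>A. of_int n ^ k * (\<Sum>i\<in>I. f i n)) = 0" if "k < N" for k
  proof -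
    have "(\<Sum>n\<in>A. of_int n ^ k * (\<Sum>i\<in>I. f i n)) = (\<Sum>i\<in>I. \<Sum>n\<in>A. of_int n ^ k * f i n)"
      by (subst sum.swap) (simp add: sum_distrib_left)
    also have "\<dots> = 0"
    proof (rule sum.neutral, rule ballI)
      fix i assume i: "i \<in> I"
      show "(\<Sum>n\<in>A. of_int n ^ k * f i n) = 0"
        using assms(3)[OF i] that vanishing_moments_finite[OF assms(1)[OF i]] by blast
    qed
    finally show ?thesis .
  qed
  ultimately show ?thesis by (simp add: vanishing_moments_finite)
qed

text \<open>
  Summation by parts: shifting the second term of the difference expands \<open>(n + 1) ^ i\<close>, and the leading
  terms cancel. A difference has one vanishing moment more than the sequence itself.
\<close>

lemma moment_bdiff:
  assumes "supported_in a {l..r}"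
  shows "(\<Sum>\<^sub>\<infinity>n\<in>UNIV. of_int n ^ i * bdiff a n)
       = - (\<Sum>j<i. of_nat (i choose j) * (\<Sum>\<^sub>\<infinity>n\<in>UNIV. of_int n ^ j * a n))"
proof -
  have fin: "supported_in a {l..r + 1}" and fin0: "supported_in a {l - 1..r}"
    using assms by (auto simp: supported_in_def)
  have "supported_in (bdiff a) {l..r + 1}"
    using supported_in_bdiff_pow[OF assms, of 1] by simp
  then have "(\<Sum>\<^sub>\<infinity>n\<in>UNIV. of_int n ^ i * bdiff a n) = (\<Sum>n\<in>{l..r + 1}. of_int n ^ i * bdiff a n)"
    by (rule moment_finite)
  also have "\<dots> = (\<Sum>n\<in>{l..r + 1}. of_int n ^ i * a n) - (\<Sum>n\<in>{l..r + 1}. of_int n ^ i * a (n - 1))"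
    by (simp add: bdiff_def algebra_simps sum_subtractf)
  also have "(\<Sum>n\<in>{l..r + 1}. of_int n ^ i * a (n - 1)) = (\<Sum>n\<in>{l - 1..r}. of_int (n + 1) ^ i * a n)"
    by (rule sum.reindex_bij_witness[of _ "\<lambda>n. n + 1" "\<lambda>n. n - 1"]) auto
  also have "\<dots> = (\<Sum>n\<in>{l..r + 1}. of_int (n + 1) ^ i * a n)"
    by (rule sum.mono_neutral_cong) (use assms in \<open>auto simp: supported_in_def\<close>)
  also have "(\<Sum>n\<in>{l..r + 1}. of_int (n + 1) ^ i * a n)
      = (\<Sum>n\<in>{l..r + 1}. \<Sum>j\<le>i. of_nat (i choose j) * (of_int n ^ j * a n))"
    unfolding of_int_add of_int_1 binomial_ring by (simp add: sum_distrib_right mult.assoc)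
  also have "\<dots> = (\<Sum>j\<le>i. of_nat (i choose j) * (\<Sum>n\<in>{l..r + 1}. of_int n ^ j * a n))"
    by (subst sum.swap) (simp add: sum_distrib_left)
  also have "\<dots> = (\<Sum>j<i. of_nat (i choose j) * (\<Sum>n\<in>{l..r + 1}. of_int n ^ j * a n)) + (\<Sum>n\<in>{l..r + 1}. of_int n ^ i * a n)"
    by (simp add: lessThan_Suc_atMost[symmetric])
  finally show ?thesis by (simp add: moment_finite[OF fin])
qed

lemma vanishing_moments_bdiff:
  assumes "supported_in a {l..r}"
  shows "vanishing_moments (Suc N) (bdiff a) \<longleftrightarrow> vanishing_moments N a"
proof
  assume "vanishing_moments N a"
  then show "vanishing_moments (Suc N) (bdiff a)"
    unfolding vanishing_moments_def moment_bdiff[OF assms] by simp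
next
  assume *: "vanishing_moments (Suc N) (bdiff a)"
  have "(\<Sum>\<^sub>\<infinity>n\<in>UNIV. of_int n ^ j * a n) = 0" if "j < N" for j
    using that
  proof (induction j rule: less_induct)
    case (less j)
    have "(\<Sum>\<^sub>\<infinity>n\<in>UNIV. of_int n ^ Suc j * bdiff a n) = 0"
      using * less.prems unfolding vanishing_moments_def by (simp only: Suc_less_eq)
    then have "(\<Sum>i<Suc j. of_nat (Suc j choose i) * (\<Sum>\<^sub>\<infinity>n\<in>UNIV. of_int n ^ i * a n)) = 0"
      unfolding moment_bdiff[OF assms, of "Suc j"] by (simp only: neg_equal_0_iff_equal)
    moreover have "(\<Sum>i<j. of_nat (Suc j choose i) * (\<Sum>\<^sub>\<infinity>n\<in>UNIV. of_int n ^ i * a n)) = 0"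
      using less by (intro sum.neutral) auto
    ultimately show ?case by (simp del: of_nat_Suc)
  qed
  then show "vanishing_moments N a" by (simp add: vanishing_moments_def)
qed

lemma vanishing_moments_bdiff_pow:
  assumes "supported_in a {l..r}"
  shows "vanishing_moments (i + M) ((bdiff ^^ i) a) \<longleftrightarrow> vanishing_moments M a"
proof (induction i)
  case (Suc i)
  then show ?case
    using vanishing_moments_bdiff[OF supported_in_bdiff_pow[OF assms, of i], of "i + M"] by simp
qed simp

text \<open>
  Summing repeatedly inverts the difference operator. Each vanishing moment keeps one more partial sum
  inside the interval, at the price of a factor equal to the length of the interval.
\<close>

lemma antidifference:
  assumes "supported_in b {l..r}" "vanishing_moments N b"
  shows "\<exists>a. supported_in a {l..r} \<and> (bdiff ^^ N) a = b \<and>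
     (\<Sum>n\<in>{l..r}. norm (a n)) \<le> of_nat (nat (r - l + 1)) ^ N * (\<Sum>n\<in>{l..r}. norm (b n))"
  using assms
proof (induction N arbitrary: b)
  case 0
  then show ?case by (intro exI[of _ b]) simp
next
  case (Suc N)
  define a where "a n = (\<Sum>k\<in>{l..min n r}. b k)" for n
  have sum0: "(\<Sum>k\<in>{l..r}. b k) = 0"
  proof -
    have "(\<Sum>n\<in>{l..r}. of_int n ^ 0 * b n) = 0"
      using Suc.prems(2) vanishing_moments_finite[OF Suc.prems(1), of "Suc N"] by blast
    then show ?thesis by simp
  qed
  have a_supp: "supported_in a {l..r}"
    unfolding supported_in_def
  proof (intro conjI allI impI)
    fix n assume "n \<notin> {l..r}"
    then consider "n < l" | "r < n" by fastforce
    then show "a n = 0" by cases (use sum0 in \<open>auto simp: a_def min_def\<close>)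
  qed simp
  have diff: "bdiff a = b"
  proof
    fix n
    consider "n < l" | "r < n" | "l \<le> n" "n \<le> r" by linarith
    then show "bdiff a n = b n"
    proof cases
      case 3
      then have "{l..n} = insert n {l..n - 1}" by auto
      then show ?thesis using 3 by (simp add: bdiff_def a_def min_def)
    next
      case 2
      then have "min n r = r" "min (n - 1) r = r" by auto
      then have "bdiff a n = 0" by (simp add: bdiff_def a_def)
      then show ?thesis using 2 Suc.prems(1) by (simp add: supported_in_def)
    qed (use Suc.prems a_supp in \<open>auto simp: bdiff_def supported_in_def\<close>)
  qed
  have bound: "(\<Sum>n\<in>{l..r}. norm (a n)) \<le> of_nat (nat (r - l + 1)) * (\<Sum>n\<in>{l..r}. norm (b n))"
  proof -
    have "norm (a n) \<le> (\<Sum>n\<in>{l..r}. norm (b n))" for n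
      unfolding a_def by (rule order_trans[OF norm_sum sum_mono2]) auto
    then have "(\<Sum>n\<in>{l..r}. norm (a n)) \<le> (\<Sum>_\<in>{l..r}. (\<Sum>n\<in>{l..r}. norm (b n)))" by (intro sum_mono)
    then show ?thesis by (simp add: algebra_simps)
  qed
  have "vanishing_moments N a"
    using Suc.prems(2) vanishing_moments_bdiff[OF a_supp, of N] by (simp add: diff)
  from Suc.IH[OF a_supp this] obtain a' where a': "supported_in a' {l..r}" "(bdiff ^^ N) a' = a"
    "(\<Sum>n\<in>{l..r}. norm (a' n)) \<le> of_nat (nat (r - l + 1)) ^ N * (\<Sum>n\<in>{l..r}. norm (a n))" by blast
  have "(bdiff ^^ Suc N) a' = b" using a'(2) diff by simp
  moreover have "(\<Sum>n\<in>{l..r}. norm (a' n)) \<le> of_nat (nat (r - l + 1)) ^ Suc N * (\<Sum>n\<in>{l..r}. norm (b n))"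
    using order_trans[OF a'(3) mult_left_mono[OF bound, of "of_nat (nat (r - l + 1)) ^ N"]]
    by (simp add: mult_ac)
  ultimately show ?case using a'(1) by blast
qed

definition moving_avg :: "nat \<Rightarrow> (int \<Rightarrow> complex) \<Rightarrow> int \<Rightarrow> complex" where
  "moving_avg s f n = (\<Sum>i<s. f (n - int i)) / of_nat s"

text \<open>
  Repeated averaging of the Heaviside step gives a discrete B-spline ramp from \<open>0\<close> to \<open>1\<close>: its transition
  takes place on a scale \<open>s\<close>, and differences up to order \<open>N\<close> gain a factor \<open>2 / s\<close> each.
\<close>

definition spline :: "nat \<Rightarrow> nat \<Rightarrow> int \<Rightarrow> complex" where
  "spline N s = (moving_avg s ^^ N) (\<lambda>n. if 0 \<le> n then 1 else 0)"

lemma bdiff_pow_moving_avg: "(bdiff ^^ j) (moving_avg s f) = moving_avg s ((bdiff ^^ j) f)"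
proof (induction j)
  case (Suc j)
  then show ?case
    by (simp add: bdiff_def moving_avg_def fun_eq_iff sum_subtractf diff_divide_distrib algebra_simps)
qed simp

lemma norm_moving_avg:
  assumes "1 \<le> s" "\<And>n. norm (f n) \<le> B"
  shows "norm (moving_avg s f n) \<le> B"
proof -
  have "norm (\<Sum>i<s. f (n - int i)) \<le> (\<Sum>i<s. B)"
    by (rule order_trans[OF norm_sum sum_mono]) (rule assms(2))
  then show ?thesis using assms(1) by (simp add: moving_avg_def norm_divide divide_le_eq mult.commute)
qed

lemma bdiff_moving_avg:
  assumes "1 \<le> s"
  shows "bdiff (moving_avg s f) n = (f n - f (n - int s)) / of_nat s"
proof -
  have "(\<Sum>i<s. f (n - int i)) - (\<Sum>i<s. f (n - 1 - int i)) = f n - f (n - int s)"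
  proof (induction s)
    case (Suc s)
    then show ?case by (simp add: algebra_simps)
  qed simp
  then show ?thesis by (simp add: bdiff_def moving_avg_def diff_divide_distrib[symmetric])
qed

lemma spline_values:
  assumes "1 \<le> s"
  shows "n < 0 \<Longrightarrow> spline N s n = 0" and "int (N * s) \<le> n \<Longrightarrow> spline N s n = 1"
proof -
  have "(n < 0 \<longrightarrow> spline N s n = 0) \<and> (int (N * s) \<le> n \<longrightarrow> spline N s n = 1)"
  proof (induction N arbitrary: n)
    case 0
    then show ?case by (simp add: spline_def)
  next
    case (Suc N)
    have eq: "spline (Suc N) s n = (\<Sum>i<s. spline N s (n - int i)) / of_nat s"
      by (simp add: spline_def moving_avg_def)
    show ?case unfolding eq using assms Suc by (auto simp: algebra_simps)
  qed
  then show "n < 0 \<Longrightarrow> spline N s n = 0" and "int (N * s) \<le> n \<Longrightarrow> spline N s n = 1" by auto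
qed

lemma bdiff_pow_spline:
  assumes "1 \<le> s" "j \<le> N"
  shows "norm ((bdiff ^^ j) (spline N s) n) \<le> (2 / of_nat s) ^ j"
  using assms(2)
proof (induction N arbitrary: j n)
  case 0
  then show ?case by (simp add: spline_def)
next
  case (Suc N)
  have eq: "spline (Suc N) s = moving_avg s (spline N s)" by (simp add: spline_def)
  show ?case
  proof (cases j)
    case 0
    have "norm (spline N s m) \<le> 1" for m using Suc.IH[of 0 m] by simp
    then show ?thesis unfolding eq 0 using norm_moving_avg[OF assms(1)] by simp
  next
    case (Suc i)
    define h where "h = (bdiff ^^ i) (spline N s)"
    have h: "norm (h m) \<le> (2 / of_nat s) ^ i" for m
      unfolding h_def by (rule Suc.IH) (use Suc Suc.prems in simp)
    have "(bdiff ^^ j) (spline (Suc N) s) n = (h n - h (n - int s)) / of_nat s"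
      unfolding eq Suc using bdiff_moving_avg[OF assms(1), of h n] by (simp add: bdiff_pow_moving_avg h_def)
    also have "norm \<dots> \<le> ((2 / of_nat s) ^ i + (2 / of_nat s) ^ i) / of_nat s"
      unfolding norm_divide norm_of_nat
      by (intro divide_right_mono order_trans[OF norm_triangle_ineq4] add_mono h) simp
    finally show ?thesis by (simp add: Suc mult_2[symmetric] power_divide mult.commute)
  qed
qed

section \<open>Sums of atoms\<close>

text \<open>
  The number of exponents \<open>\<alpha>\<close> with \<open>\<alpha> \<le> 1 / p - 1\<close>, that is, of the moments that vanish for an atom.
\<close>

definition moment_count :: "real \<Rightarrow> nat" where
  "moment_count p = nat \<lfloor>1 / p\<rfloor>"

lemma moment_count:
  assumes "0 < p" "p \<le> 1"
  shows "1 \<le> moment_count p" "1 < (1 + of_nat (moment_count p)) * p"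
    "real i \<le> 1 / p - 1 \<longleftrightarrow> i < moment_count p"
proof -
  have "1 \<le> 1 / p" using assms by simp
  then have 1: "1 \<le> \<lfloor>1 / p\<rfloor>" by linarith
  then obtain m where m': "\<lfloor>1 / p\<rfloor> = int m" using zero_le_imp_eq_int[OF order_trans[OF zero_le_one 1]] by blast
  show "1 \<le> moment_count p" using 1 unfolding moment_count_def m' by simp
  have m: "real (moment_count p) = of_int \<lfloor>1 / p\<rfloor>" unfolding moment_count_def m' by simp
  have "1 / p < 1 + real (moment_count p)" unfolding m by linarith
  then show "1 < (1 + of_nat (moment_count p)) * p" using assms by (simp add: field_simps)
  have "real i \<le> 1 / p - 1 \<longleftrightarrow> int i + 1 \<le> \<lfloor>1 / p\<rfloor>" by linarith
  also have "\<dots> \<longleftrightarrow> i < moment_count p" using 1 by (auto simp: moment_count_def)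
  finally show "real i \<le> 1 / p - 1 \<longleftrightarrow> i < moment_count p" .
qed

lemma ball_Z_interval:
  assumes "1 \<le> r0"
  defines "R \<equiv> nat (\<lceil>r0\<rceil> - 1)"
  shows "ball_Z n0 r0 = {n0 - int R..n0 + int R}"
proof -
  have R: "int R = \<lceil>r0\<rceil> - 1" using assms by (simp add: le_ceiling_iff)
  have "\<bar>real_of_int (n - n0)\<bar> < r0 \<longleftrightarrow> \<bar>n - n0\<bar> \<le> int R" for n
    using less_ceiling_iff[of "\<bar>n - n0\<bar>" r0] unfolding R of_int_abs by linarith
  then have "ball_Z n0 r0 = {n. \<bar>n - n0\<bar> \<le> int R}" unfolding ball_Z_def by (simp only:)
  also have "\<dots> = {n0 - int R..n0 + int R}" by (auto simp: abs_le_iff)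
  finally show ?thesis .
qed

text \<open>
  A ball of radius \<open>r0\<close> is the integer interval of radius \<open>R = \<lceil>r0\<rceil> - 1\<close>, with \<open>2 * R + 1\<close> points.
\<close>

lemma hardy_atomE:
  assumes p: "0 < p" "p \<le> 1" and "hardy_atom p b"
  obtains n0 and R :: nat where "supported_in b {n0 - int R..n0 + int R}"
    "\<And>n. norm (b n) \<le> (2 * real R + 1) powr (- 1 / p)" "vanishing_moments (moment_count p) b"
proof -
  obtain n0 :: int and r0 :: real where b: "1 \<le> r0" "{n. b n \<noteq> 0} \<subseteq> ball_Z n0 r0"
    "\<And>n. norm (b n) \<le> real (card (ball_Z n0 r0)) powr (- 1 / p)"
    "\<And>\<alpha>::nat. real \<alpha> \<le> 1 / p - 1 \<Longrightarrow> (\<Sum>\<^sub>\<infinity>n\<in>UNIV. of_int n ^ \<alpha> * b n) = 0"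
    using assms(3) unfolding hardy_atom_def by blast
  define R where "R = nat (\<lceil>r0\<rceil> - 1)"
  have ball: "ball_Z n0 r0 = {n0 - int R..n0 + int R}"
    unfolding R_def by (rule ball_Z_interval[OF b(1)])
  have "card (ball_Z n0 r0) = 2 * R + 1" unfolding ball by simp
  then have card: "real (card (ball_Z n0 r0)) = 2 * real R + 1" by simp
  show ?thesis
  proof (rule that[of n0 R])
    show "supported_in b {n0 - int R..n0 + int R}"
      using b(2) unfolding ball supported_in_def by auto
    show "norm (b n) \<le> (2 * real R + 1) powr (- 1 / p)" for n using b(3)[of n] by (simp add: card)
    show "vanishing_moments (moment_count p) b"
      using b(4) moment_count(3)[OF p] by (simp add: vanishing_moments_def)
  qed
qed

text \<open>
  An interval need not be a ball, since balls have an odd number of points. It is contained in a ball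
  with at most twice as many points, whence the factor \<open>2\<close> in the size condition.
\<close>

lemma hardy_atomI:
  assumes p: "0 < p" "p \<le> 1" and b: "supported_in b {l..r}" "l \<le> r"
    "\<And>n. norm (b n) \<le> (2 * of_int (r - l + 1)) powr (- 1 / p)" "vanishing_moments (moment_count p) b"
  shows "hardy_atom p b"
proof -
  define n0 where "n0 = (l + r) div 2"
  define R where "R = nat ((r - l + 1) div 2)"
  define r0 where "r0 = real R + 1"
  have R': "nat (\<lceil>r0\<rceil> - 1) = R"
  proof -
    have "r0 = of_int (int R + 1)" by (simp add: r0_def)
    then have "\<lceil>r0\<rceil> = int R + 1" by (metis ceiling_of_int)
    then show ?thesis by simp
  qed
  have ball: "ball_Z n0 r0 = {n0 - int R..n0 + int R}"
    using ball_Z_interval[of r0 n0] unfolding R' by (simp add: r0_def)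
  have R: "int R = (r - l + 1) div 2" using b(2) by (simp add: R_def)
  have sub: "{l..r} \<subseteq> ball_Z n0 r0" unfolding ball R by (auto simp: n0_def)
  have "card (ball_Z n0 r0) = 2 * R + 1" unfolding ball by simp
  then have "int (card (ball_Z n0 r0)) \<le> 2 * (r - l + 1)" using R b(2) by simp
  then have card: "real (card (ball_Z n0 r0)) \<le> 2 * of_int (r - l + 1)" by linarith
  have pos: "0 < real (card (ball_Z n0 r0))" unfolding ball by simp
  have powr: "(2 * of_int (r - l + 1)) powr (- 1 / p) \<le> real (card (ball_Z n0 r0)) powr (- 1 / p)"
    using p by (intro powr_mono2' card pos) auto
  show ?thesis unfolding hardy_atom_def
  proof (intro exI[of _ n0] exI[of _ r0] conjI allI impI)
    show "1 \<le> r0" by (simp add: r0_def)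
    show "{n. b n \<noteq> 0} \<subseteq> ball_Z n0 r0" using b(1) sub unfolding supported_in_def by blast
    show "norm (b n) \<le> real (card (ball_Z n0 r0)) powr (- 1 / p)" for n
      by (rule order_trans[OF b(3) powr])
    show "(\<Sum>\<^sub>\<infinity>n\<in>UNIV. of_int n ^ \<alpha> * b n) = 0" if "real \<alpha> \<le> 1 / p - 1" for \<alpha>
      using b(4) that moment_count(3)[OF p] by (simp add: vanishing_moments_def)
  qed
qed

lemma hardy_atom_zero:
  assumes "0 < p" "p \<le> 1"
  shows "hardy_atom p (\<lambda>_. 0)"
  by (rule hardy_atomI[OF assms, where l = 0 and r = 0]) (auto simp: supported_in_def vanishing_moments_def)

lemma hardy_atom_norm_le_1:
  assumes p: "0 < p" "p \<le> 1" and "hardy_atom p b"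
  shows "norm (b n) \<le> 1"
proof -
  obtain n0 and R :: nat where "norm (b n) \<le> (2 * real R + 1) powr (- 1 / p)"
    using hardy_atomE[OF assms] by metis
  also have "\<dots> \<le> (2 * real R + 1) powr 0" using p by (intro powr_mono) auto
  also have "\<dots> = 1" by simp
  finally show ?thesis .
qed

text \<open>
  Membership in the Hardy space with \<open>p\<close>-th power of the quasinorm at most \<open>c\<close>, expressed by pointwise
  convergence only. Zero coefficients are admitted, so finite sums of atoms are covered.
\<close>

definition atomic_sum :: "real \<Rightarrow> (int \<Rightarrow> complex) \<Rightarrow> real \<Rightarrow> bool" where
  "atomic_sum p g c \<longleftrightarrow> (\<exists>\<mu> b. (\<forall>i::nat. 0 \<le> \<mu> i \<and> hardy_atom p (b i)) \<and> summable (\<lambda>i. \<mu> i powr p) \<and>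
     (\<Sum>i. \<mu> i powr p) \<le> c \<and> (\<forall>n. (\<lambda>i. of_real (\<mu> i) * b i n) sums g n))"

lemma atomic_sum_mono: "atomic_sum p g c \<Longrightarrow> c \<le> c' \<Longrightarrow> atomic_sum p g c'"
  unfolding atomic_sum_def by (meson order_trans)

text \<open>
  For \<open>p \<le> 1\<close> the spaces \<open>\<ell>\<^sup>p\<close> are contained in \<open>\<ell>\<^sup>1\<close>, because the coefficients are bounded.
\<close>

lemma powr_summable_imp_summable:
  fixes \<mu> :: "nat \<Rightarrow> real"
  assumes p: "0 < p" "p \<le> 1" and \<mu>: "\<And>i. 0 \<le> \<mu> i" and s: "summable (\<lambda>i. \<mu> i powr p)"
  shows "\<exists>M\<ge>0. \<forall>i. \<mu> i \<le> M * \<mu> i powr p" "summable \<mu>"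
proof -
  define S where "S = (\<Sum>i. \<mu> i powr p)"
  have S0: "0 \<le> S" unfolding S_def by (rule suminf_nonneg[OF s]) simp
  have le: "\<mu> i powr p \<le> S" for i
    unfolding S_def using sum_le_suminf[OF s, of "{i}"] by simp
  have M: "\<mu> i \<le> S powr ((1 - p) / p) * \<mu> i powr p" for i
  proof -
    have "\<mu> i = \<mu> i powr (1 - p) * \<mu> i powr p" using \<mu>[of i] by (simp add: powr_add[symmetric])
    also have "\<mu> i powr (1 - p) = (\<mu> i powr p) powr ((1 - p) / p)" using p by (simp add: powr_powr)
    also have "\<dots> * \<mu> i powr p \<le> S powr ((1 - p) / p) * \<mu> i powr p"
      using p le by (intro mult_right_mono powr_mono2) auto
    finally show ?thesis .
  qed
  then show "\<exists>M\<ge>0. \<forall>i. \<mu> i \<le> M * \<mu> i powr p" by (intro exI[of _ "S powr ((1 - p) / p)"]) simp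
  show "summable \<mu>"
    by (rule summable_comparison_test'[OF summable_mult[OF s, of "S powr ((1 - p) / p)"]])
      (use M \<mu> in auto)
qed

text \<open>
  Enumerate the double family of atoms by the pairing function. The double series converges absolutely
  at every point, as atoms are bounded by \<open>1\<close>, so it may be summed in any order.
\<close>

lemma atomic_sum_countable:
  assumes p: "0 < p" "p \<le> 1" and g: "\<And>j. atomic_sum p (g j) (c j)"
    and c: "summable c" and h: "\<And>n. (\<lambda>j. g j n) sums h n"
  shows "atomic_sum p h (\<Sum>j. c j)"
proof -
  have "\<forall>j. \<exists>mb. (\<forall>i::nat. 0 \<le> fst mb i \<and> hardy_atom p (snd mb i)) \<and> summable (\<lambda>i. fst mb i powr p) \<and>
     (\<Sum>i. fst mb i powr p) \<le> c j \<and> (\<forall>n. (\<lambda>i. of_real (fst mb i) * snd mb i n) sums g j n)"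
    using g unfolding atomic_sum_def by simp
  then obtain mb where mb: "\<And>j. (\<forall>i::nat. 0 \<le> fst (mb j) i \<and> hardy_atom p (snd (mb j) i)) \<and> summable (\<lambda>i. fst (mb j) i powr p) \<and>
     (\<Sum>i. fst (mb j) i powr p) \<le> c j \<and> (\<forall>n. (\<lambda>i. of_real (fst (mb j) i) * snd (mb j) i n) sums g j n)"
    by (rule choice[THEN exE]) blast
  define \<mu> where "\<mu> j i = fst (mb j) i" for j i
  define b where "b j i = snd (mb j) i" for j i
  have \<mu>0: "0 \<le> \<mu> j i" and b: "hardy_atom p (b j i)" and s: "summable (\<lambda>i. \<mu> j i powr p)"
    and le: "(\<Sum>i. \<mu> j i powr p) \<le> c j" and gs: "(\<lambda>i. of_real (\<mu> j i) * b j i n) sums g j n" for j i n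
    using mb[of j] by (auto simp: \<mu>_def b_def)
  define t where "t j = (\<Sum>i. \<mu> j i powr p)" for j
  have t0: "0 \<le> t j" for j unfolding t_def by (rule suminf_nonneg[OF s]) simp
  have t_sum: "summable t"
    by (rule summable_comparison_test'[OF c]) (use t0 le in \<open>auto simp: t_def\<close>)
  have row: "((\<lambda>i. \<mu> j i powr p) has_sum t j) UNIV" for j
    using s[of j] by (intro norm_summable_imp_has_sum) (auto simp: t_def summable_sums)
  have t_has: "(t has_sum (\<Sum>j. t j)) UNIV"
    using t_sum t0 by (intro norm_summable_imp_has_sum) (auto simp: summable_sums)
  have summ: "(\<lambda>(j, i). \<mu> j i powr p) summable_on UNIV \<times> UNIV"
    by (rule summable_on_SigmaI[where g = t]) (use row t_has in \<open>auto simp: summable_on_def\<close>)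
  have tot: "((\<lambda>(j, i). \<mu> j i powr p) has_sum (\<Sum>j. t j)) (UNIV \<times> UNIV)"
    by (rule has_sum_SigmaI[OF _ t_has summ]) (use row in auto)
  have bij: "bij_betw prod_decode UNIV (UNIV \<times> UNIV)"
    using bij_prod_decode by simp
  define \<nu> where "\<nu> k = \<mu> (fst (prod_decode k)) (snd (prod_decode k))" for k
  define d where "d k = b (fst (prod_decode k)) (snd (prod_decode k))" for k
  have "((\<lambda>k. \<nu> k powr p) has_sum (\<Sum>j. t j)) UNIV"
    using tot unfolding has_sum_reindex_bij_betw[OF bij, symmetric] by (simp add: \<nu>_def case_prod_beta)
  then have \<nu>_sums: "(\<lambda>k. \<nu> k powr p) sums (\<Sum>j. t j)" by (rule has_sum_imp_sums)
  have \<nu>0: "0 \<le> \<nu> k" for k by (simp add: \<nu>_def \<mu>0)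
  obtain M where M: "0 \<le> M" "\<And>k. \<nu> k \<le> M * \<nu> k powr p"
    using powr_summable_imp_summable(1)[OF p \<nu>0 sums_summable[OF \<nu>_sums]] by blast
  have M': "\<mu> j i \<le> M * \<mu> j i powr p" for j i
    using M(2)[of "prod_encode (j, i)"] by (simp add: \<nu>_def)
  have pt: "(\<lambda>k. of_real (\<nu> k) * d k n) sums h n" for n
  proof -
    define G where "G j i = of_real (\<mu> j i) * b j i n" for j i
    have G_le: "norm (G j i) \<le> M * \<mu> j i powr p" for j i
    proof -
      have "norm (G j i) \<le> \<mu> j i * 1"
        unfolding G_def norm_mult using \<mu>0[of j i] hardy_atom_norm_le_1[OF p b]
        by (intro mult_mono) auto
      then show ?thesis using M'[of j i] by simp
    qed
    have "(\<lambda>x. M * (case x of (j, i) \<Rightarrow> \<mu> j i powr p)) summable_on UNIV \<times> UNIV"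
      by (rule summable_on_cmult_right[OF summ])
    then have "(\<lambda>x. norm (case x of (j, i) \<Rightarrow> G j i)) summable_on UNIV \<times> UNIV"
      by (rule summable_on_comparison_test) (use G_le in auto)
    then have Gs: "(\<lambda>(j, i). G j i) summable_on UNIV \<times> UNIV"
      by (rule abs_summable_summable)
    have grow: "infsum (G j) UNIV = g j n" for j
    proof -
      have "G j summable_on UNIV" by (rule summable_on_SigmaD1[OF Gs]) simp
      then have "G j sums infsum (G j) UNIV" by (intro has_sum_imp_sums) (simp add: has_sum_infsum)
      moreover have "(\<lambda>i. G j i) sums g j n" unfolding G_def by (rule gs)
      ultimately show ?thesis by (rule sums_unique2)
    qed
    have "(\<lambda>j. infsum (G j) UNIV) summable_on UNIV" by (rule summable_on_Sigma_banach[OF Gs])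
    then have "(\<lambda>j. g j n) sums infsum (\<lambda>j. g j n) UNIV"
      unfolding grow by (intro has_sum_imp_sums) (simp add: has_sum_infsum)
    then have hn: "h n = infsum (\<lambda>j. g j n) UNIV" using h sums_unique2 by blast
    have "h n = infsum (\<lambda>(j, i). G j i) (UNIV \<times> UNIV)"
      using infsum_Sigma'_banach[OF Gs] unfolding grow hn by simp
    then have "((\<lambda>(j, i). G j i) has_sum h n) (UNIV \<times> UNIV)" using Gs by (simp add: has_sum_infsum)
    then have "((\<lambda>k. of_real (\<nu> k) * d k n) has_sum h n) UNIV"
      unfolding has_sum_reindex_bij_betw[OF bij, symmetric] by (simp add: \<nu>_def d_def G_def case_prod_beta)
    then show ?thesis by (rule has_sum_imp_sums)
  qed
  have "(\<Sum>j. t j) \<le> (\<Sum>j. c j)" by (rule suminf_le[OF _ t_sum c]) (simp add: t_def le)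
  then show ?thesis
    unfolding atomic_sum_def using \<nu>0 b pt \<nu>_sums
    by (intro exI[of _ \<nu>] exI[of _ d]) (auto simp: d_def sums_iff)
qed

text \<open>
  A bounded sequence with vanishing moments, supported in an interval, is a multiple of an atom.
\<close>

lemma atomic_sum_bounded:
  assumes p: "0 < p" "p \<le> 1" and g: "supported_in g {l..r}" "l \<le> r" "\<And>n. norm (g n) \<le> G"
    and mom: "vanishing_moments (moment_count p) g"
  shows "atomic_sum p g (G powr p * (2 * of_int (r - l + 1)))"
proof -
  define X where "X = 2 * real_of_int (r - l + 1)"
  have X: "0 < X" using g(2) by (simp add: X_def)
  have G0: "0 \<le> G" using g(3)[of 0] norm_ge_zero order_trans by blast
  define \<kappa> where "\<kappa> = G * X powr (1 / p)"
  define b where "b n = g n / of_real \<kappa>" for n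
  have l0: "0 \<le> \<kappa>" using G0 by (simp add: \<kappa>_def)
  have g0: "g n = 0" if "\<kappa> = 0" for n using that g(3)[of n] X by (simp add: \<kappa>_def)
  have atom: "hardy_atom p b"
  proof (rule hardy_atomI[OF p])
    show "supported_in b {l..r}" using g(1) by (auto simp: supported_in_def b_def)
    show "l \<le> r" by fact
    show "norm (b n) \<le> (2 * of_int (r - l + 1)) powr (- 1 / p)" for n
    proof (cases "\<kappa> = 0")
      case True then show ?thesis by (simp add: b_def)
    next
      case False
      then have "0 < G" using G0 by (auto simp: \<kappa>_def)
      have "norm (b n) \<le> G / \<kappa>" unfolding b_def norm_divide using g(3) l0 by (simp add: divide_right_mono)
      also have "\<dots> = X powr (- 1 / p)" using \<open>0 < G\<close> X by (simp add: \<kappa>_def powr_minus field_simps)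
      finally show ?thesis by (simp add: X_def)
    qed
    have "supported_in b {l..r}" using g(1) by (auto simp: supported_in_def b_def)
    then show "vanishing_moments (moment_count p) b"
      using mom g(1) by (simp add: vanishing_moments_finite b_def sum_divide_distrib[symmetric])
  qed
  define \<mu> where "\<mu> i = (if i = 0 then \<kappa> else 0)" for i :: nat
  define d where "d i = (if i = 0 then b else (\<lambda>_. 0))" for i :: nat
  have s: "(\<lambda>i. \<mu> i powr p) sums (\<kappa> powr p)"
    using sums_single[of 0 "\<lambda>_. \<kappa> powr p"] p by (simp add: \<mu>_def if_distrib[of "\<lambda>x. x powr p"] cong: if_cong)
  have pt: "(\<lambda>i. of_real (\<mu> i) * d i n) sums g n" for n
  proof -
    have "(\<lambda>i. of_real (\<mu> i) * d i n) = (\<lambda>i. if i = 0 then g n else 0)"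
      using g0 by (auto simp: \<mu>_def d_def b_def fun_eq_iff)
    then show ?thesis using sums_single[of 0 "\<lambda>_. g n"] by simp
  qed
  have "\<kappa> powr p = G powr p * X"
    using G0 X p by (simp add: \<kappa>_def powr_mult powr_powr)
  then show ?thesis
    unfolding atomic_sum_def using s pt l0 atom hardy_atom_zero[OF p]
    by (intro exI[of _ \<mu>] exI[of _ d]) (auto simp: \<mu>_def d_def X_def sums_iff)
qed

lemma atomic_sum_zero:
  assumes p: "0 < p" "p \<le> 1" and "0 \<le> c"
  shows "atomic_sum p (\<lambda>_. 0) c"
proof -
  have "atomic_sum p (\<lambda>_. 0) (0 powr p * (2 * of_int (0 - 0 + 1)))"
    by (rule atomic_sum_bounded[OF p]) (auto simp: supported_in_def vanishing_moments_def)
  then show ?thesis using assms by (auto elim!: atomic_sum_mono)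
qed

lemma atomic_sum_add:
  assumes p: "0 < p" "p \<le> 1" and "atomic_sum p f c" "atomic_sum p g d"
  shows "atomic_sum p (\<lambda>n. f n + g n) (c + d)"
proof -
  define F where "F i = (if i = 0 then f else if i = 1 then g else (\<lambda>_. 0))" for i :: nat
  define C where "C i = (if i = 0 then c else if i = 1 then d else 0)" for i :: nat
  have C: "C sums (c + d)"
    using sums_finite[of "{0, 1}" C] by (simp add: C_def)
  have "atomic_sum p (\<lambda>n. f n + g n) (\<Sum>j. C j)"
  proof (rule atomic_sum_countable[OF p])
    show "atomic_sum p (F j) (C j)" for j
      using assms(3,4) atomic_sum_zero[OF p] by (auto simp: F_def C_def)
    show "summable C" using C by (simp add: sums_iff)
    show "(\<lambda>j. F j n) sums (f n + g n)" for n
      using sums_finite[of "{0, 1}" "\<lambda>j. F j n"] by (simp add: F_def)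
  qed
  then show ?thesis using C by (simp add: sums_iff)
qed

lemma atomic_sum_sum:
  assumes p: "0 < p" "p \<le> 1" and "finite I" "\<And>i. i \<in> I \<Longrightarrow> atomic_sum p (f i) (c i)"
  shows "atomic_sum p (\<lambda>n. \<Sum>i\<in>I. f i n) (\<Sum>i\<in>I. c i)"
  using assms(3,4)
proof (induction I)
  case empty
  then show ?case using atomic_sum_zero[OF p, of 0] by simp
next
  case (insert i I)
  then show ?case using atomic_sum_add[OF p, of "f i" "c i"] by simp
qed

lemma atomic_sum_scale:
  assumes p: "0 < p" "p \<le> 1" and "0 \<le> s" "atomic_sum p g c"
  shows "atomic_sum p (\<lambda>n. of_real s * g n) (s powr p * c)"
proof -
  obtain \<mu> b where b: "\<And>i::nat. 0 \<le> \<mu> i \<and> hardy_atom p (b i)" "summable (\<lambda>i. \<mu> i powr p)"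
     "(\<Sum>i. \<mu> i powr p) \<le> c" "\<And>n. (\<lambda>i. of_real (\<mu> i) * b i n) sums g n"
    using assms(4) unfolding atomic_sum_def by blast
  have eq: "(s * \<mu> i) powr p = s powr p * \<mu> i powr p" for i
    using assms(3) b(1) by (simp add: powr_mult)
  have "(\<Sum>i. (s * \<mu> i) powr p) = s powr p * (\<Sum>i. \<mu> i powr p)"
    unfolding eq by (rule suminf_mult[OF b(2)])
  also have "\<dots> \<le> s powr p * c" by (intro mult_left_mono b(3)) simp
  finally have 1: "(\<Sum>i. (s * \<mu> i) powr p) \<le> s powr p * c" .
  have 2: "(\<lambda>i. of_real (s * \<mu> i) * b i n) sums (of_real s * g n)" for n
    using sums_mult[OF b(4)[of n], of "of_real s"] by (simp add: mult.assoc)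
  have 3: "summable (\<lambda>i. (s * \<mu> i) powr p)" unfolding eq by (rule summable_mult[OF b(2)])
  show ?thesis unfolding atomic_sum_def
    using 1 2 3 b(1) assms(3) by (intro exI[of _ "\<lambda>i. s * \<mu> i"] exI[of _ b]) auto
qed

section \<open>Square-integrable atoms\<close>

text \<open>
  One moment at a time. If \<open>g'\<close> has \<open>i\<close> vanishing moments, write it as the \<open>i\<close>-th difference of some \<open>d\<close>. Subtract
  from \<open>d\<close> the multiple of a smooth bump \<open>B\<close> that carries the total mass of \<open>d\<close>: its \<open>i\<close>-th difference then has
  \<open>i + 1\<close> vanishing moments. The bump lives on the scale of the interval, so the correction is as small
  as the mean value of \<open>norm \<circ> g\<close>. On intervals with fewer than \<open>2 * N\<close> points \<open>c = g\<close> will do.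
\<close>

lemma moment_correction:
  assumes N: "1 \<le> N"
  shows "\<exists>C\<ge>0. \<forall>a l g. 1 \<le> l \<longrightarrow> supported_in g {a..a + int l - 1} \<longrightarrow>
     (\<exists>c. supported_in c {a..a + int l - 1} \<and> vanishing_moments N (\<lambda>n. g n - c n) \<and>
       (\<forall>n. norm (c n) \<le> C / real l * (\<Sum>n\<in>{a..a + int l - 1}. norm (g n))))"
proof -
  have main: "\<exists>C\<ge>0. \<forall>a l g. 2 * N \<le> l \<longrightarrow> supported_in g {a..a + int l - 1} \<longrightarrow>
     (\<exists>c. supported_in c {a..a + int l - 1} \<and> vanishing_moments i (\<lambda>n. g n - c n) \<and>
       (\<forall>n. norm (c n) \<le> C / real l * (\<Sum>n\<in>{a..a + int l - 1}. norm (g n))))" if "i \<le> N" for i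
    using that
  proof (induction i)
    case 0
    show ?case
      by (intro exI[of _ "0::real"] conjI allI impI, simp, rule exI[of _ "\<lambda>_. 0"])
         (auto simp: supported_in_def vanishing_moments_def)
  next
    case (Suc i)
    then obtain C where C: "0 \<le> C" "\<And>a l g. 2 * N \<le> l \<Longrightarrow> supported_in g {a..a + int l - 1} \<Longrightarrow>
     (\<exists>c. supported_in c {a..a + int l - 1} \<and> vanishing_moments i (\<lambda>n. g n - c n) \<and>
       (\<forall>n. norm (c n) \<le> C / real l * (\<Sum>n\<in>{a..a + int l - 1}. norm (g n))))" by auto
    define C' where "C' = C + (1 + C) * (8 * real N) ^ Suc i"
    have "\<exists>c. supported_in c {a..a + int l - 1} \<and> vanishing_moments (Suc i) (\<lambda>n. g n - c n) \<and>
       (\<forall>n. norm (c n) \<le> C' / real l * (\<Sum>n\<in>{a..a + int l - 1}. norm (g n)))"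
      if l: "2 * N \<le> l" and g: "supported_in g {a..a + int l - 1}" for a l g
    proof -
      define P where "P = {a..a + int l - 1}"
      define S where "S = (\<Sum>n\<in>P. norm (g n))"
      have S0: "0 \<le> S" by (simp add: S_def sum_nonneg)
      have l0: "0 < real l" using l N by simp
      obtain c where c: "supported_in c P" "vanishing_moments i (\<lambda>n. g n - c n)"
        "\<And>n. norm (c n) \<le> C / real l * S"
        using C(2)[OF l g] by (auto simp: P_def S_def)
      define g' where "g' n = g n - c n" for n
      have g': "supported_in g' P" using g c(1) by (auto simp: supported_in_def g'_def P_def)
      have g'_eq: "g' = (\<lambda>n. g n - c n)" by (simp add: g'_def fun_eq_iff)
      have cardP: "card P = l" by (simp add: P_def)
      have g'_sum: "(\<Sum>n\<in>P. norm (g' n)) \<le> (1 + C) * S"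
      proof -
        have "(\<Sum>n\<in>P. norm (g' n)) \<le> (\<Sum>n\<in>P. norm (g n) + C / real l * S)"
          unfolding g'_def using c(3) by (intro sum_mono order_trans[OF norm_triangle_ineq4] add_mono) auto
        also have "\<dots> = (1 + C) * S" using l0 by (simp add: sum.distrib S_def cardP algebra_simps)
        finally show ?thesis .
      qed
      obtain d where d: "supported_in d P" "(bdiff ^^ i) d = g'"
        "(\<Sum>n\<in>P. norm (d n)) \<le> of_nat (nat (a + int l - 1 - a + 1)) ^ i * (\<Sum>n\<in>P. norm (g' n))"
        using antidifference[OF g'[unfolded P_def], of i] c(2) unfolding P_def g'_eq[symmetric] by blast
      define mass where "mass = (\<Sum>n\<in>P. d n)"
      have mass: "norm mass \<le> real l ^ i * ((1 + C) * S)"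
      proof -
        have "norm mass \<le> (\<Sum>n\<in>P. norm (d n))" unfolding mass_def by (rule norm_sum)
        also have "\<dots> \<le> real l ^ i * (\<Sum>n\<in>P. norm (g' n))" using d(3) by simp
        also have "\<dots> \<le> real l ^ i * ((1 + C) * S)" by (intro mult_left_mono g'_sum) simp
        finally show ?thesis .
      qed
      \<comment> \<open>The bump has support of length \<open>N * s\<close>; its differences of order up to \<open>N\<close> must fit into the interval.\<close>
      define s where "s = l div (2 * N)"
      have s1: "1 \<le> s" using l N by (simp add: s_def div_greater_zero_iff Suc_le_eq)
      have sl: "2 * N * s \<le> l" by (simp add: s_def)
      have Ns: "N \<le> N * s" using s1 by simp
      have ls: "real l \<le> 4 * real N * real s"
      proof -
        have "l < 2 * N * s + 2 * N"
          using N dividend_less_times_div[of "2 * N" l] by (simp add: s_def)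
        then have "l \<le> 4 * N * s" using Ns by linarith
        then have "real l \<le> real (4 * N * s)" by (simp only: of_nat_le_iff)
        then show ?thesis by simp
      qed
      define B where "B n = bdiff (spline N s) (n - a)" for n
      define P' where "P' = {a..a + int (N * s)}"
      have B: "supported_in B P'"
        unfolding supported_in_def
      proof (intro conjI allI impI)
        fix n assume "n \<notin> P'"
        then consider "n - a < 0" | "int (N * s) \<le> n - a - 1" by (fastforce simp: P'_def)
        then show "B n = 0"
          by cases (simp_all add: B_def bdiff_def spline_values[OF s1])
      qed (simp add: P'_def)
      have sub: "a + int (N * s) + int i \<le> a + int l - 1"
        using sl Ns Suc.prems by linarith
      have P'P: "P' \<subseteq> P" using sub by (auto simp: P_def P'_def)
      have iB: "supported_in ((bdiff ^^ i) B) P"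
        by (rule supported_in_mono[OF supported_in_bdiff_pow[OF B[unfolded P'_def], of i]])
          (use sub in \<open>auto simp: P_def\<close>)
      have iB_le: "norm ((bdiff ^^ i) B n) \<le> (8 * real N / real l) ^ Suc i" for n
      proof -
        have "(bdiff ^^ i) B n = (bdiff ^^ Suc i) (spline N s) (n - a)"
          unfolding B_def bdiff_pow_shift bdiff_pow_Suc ..
        also have "norm \<dots> \<le> (2 / real s) ^ Suc i"
          by (rule bdiff_pow_spline[OF s1 Suc.prems])
        also have "\<dots> \<le> (8 * real N / real l) ^ Suc i"
        proof (intro power_mono)
          show "2 / real s \<le> 8 * real N / real l" using ls s1 l0 by (simp add: field_simps)
        qed simp
        finally show ?thesis .
      qed
      have B_sum: "(\<Sum>n\<in>P. B n) = 1"
      proof -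
        have tel: "(\<Sum>n\<in>{a..a + int k}. B n) = spline N s (int k) - spline N s (-1)" for k
        proof (induction k)
          case 0
          then show ?case by (simp add: B_def bdiff_def)
        next
          case (Suc k)
          have "{a..a + int (Suc k)} = insert (a + int (Suc k)) {a..a + int k}" by auto
          then show ?case using Suc by (simp add: B_def bdiff_def algebra_simps)
        qed
        have "(\<Sum>n\<in>P. B n) = (\<Sum>n\<in>{a..a + int (N * s)}. B n)"
          by (rule sum.mono_neutral_right) (use P'P B in \<open>auto simp: P'_def supported_in_def P_def\<close>)
        also have "\<dots> = 1" unfolding tel by (simp add: spline_values[OF s1])
        finally show ?thesis .
      qed
      define c' where "c' n = c n + mass * (bdiff ^^ i) B n" for n
      define e where "e n = d n - mass * B n" for n
      have BP: "supported_in B P" by (rule supported_in_mono[OF B P'P]) (simp add: P_def)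
      have e_supp: "supported_in e {a..a + int l - 1}"
        using d(1) BP by (auto simp: supported_in_def e_def P_def)
      have "(\<Sum>n\<in>P. e n) = 0"
        by (simp add: e_def sum_subtractf mass_def[symmetric] sum_distrib_left[symmetric] B_sum)
      then have "vanishing_moments 1 e"
        by (simp add: vanishing_moments_finite[OF e_supp] P_def)
      then have "vanishing_moments (Suc i) ((bdiff ^^ i) e)"
        using vanishing_moments_bdiff_pow[OF e_supp, of i 1] by simp
      moreover have "(bdiff ^^ i) e = (\<lambda>n. g n - c' n)"
      proof
        fix n
        have "(bdiff ^^ i) e n = (bdiff ^^ i) d n - mass * (bdiff ^^ i) B n"
          unfolding e_def bdiff_pow_diff bdiff_pow_mult ..
        then show "(bdiff ^^ i) e n = g n - c' n" by (simp add: d(2) c'_def g'_def)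
      qed
      ultimately have "vanishing_moments (Suc i) (\<lambda>n. g n - c' n)" by simp
      moreover have "supported_in c' P" using c(1) iB by (auto simp: supported_in_def c'_def)
      moreover have "norm (c' n) \<le> C' / real l * S" for n
      proof -
        have "norm (mass * (bdiff ^^ i) B n) \<le> (real l ^ i * ((1 + C) * S)) * (8 * real N / real l) ^ Suc i"
          unfolding norm_mult using C(1) S0 by (intro mult_mono mass iB_le) auto
        also have "\<dots> = (1 + C) * (8 * real N) ^ Suc i / real l * S"
          using l0 by (simp add: power_divide)
        finally have "norm (c' n) \<le> C / real l * S + (1 + C) * (8 * real N) ^ Suc i / real l * S"
          unfolding c'_def using c(3)[of n] norm_triangle_ineq[of "c n" "mass * (bdiff ^^ i) B n"] by linarith
        also have "\<dots> = C' / real l * S" by (simp add: C'_def add_divide_distrib distrib_right)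
        finally show ?thesis .
      qed
      ultimately show ?thesis by (auto simp: P_def S_def)
    qed
    moreover have "0 \<le> C'" using C(1) by (simp add: C'_def)
    ultimately show ?case by blast
  qed
  obtain C where C: "0 \<le> C" "\<And>a l g. 2 * N \<le> l \<Longrightarrow> supported_in g {a..a + int l - 1} \<Longrightarrow>
     (\<exists>c. supported_in c {a..a + int l - 1} \<and> vanishing_moments N (\<lambda>n. g n - c n) \<and>
       (\<forall>n. norm (c n) \<le> C / real l * (\<Sum>n\<in>{a..a + int l - 1}. norm (g n))))"
    using main[OF order_refl] by auto
  have "\<exists>c. supported_in c {a..a + int l - 1} \<and> vanishing_moments N (\<lambda>n. g n - c n) \<and>
       (\<forall>n. norm (c n) \<le> (C + 2 * real N) / real l * (\<Sum>n\<in>{a..a + int l - 1}. norm (g n)))"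
    if l: "1 \<le> l" and g: "supported_in g {a..a + int l - 1}" for a l g
  proof (cases "2 * N \<le> l")
    case True
    have "C / real l * (\<Sum>n\<in>{a..a + int l - 1}. norm (g n)) \<le> (C + 2 * real N) / real l * (\<Sum>n\<in>{a..a + int l - 1}. norm (g n))"
      by (intro mult_right_mono divide_right_mono) (auto intro: sum_nonneg)
    then show ?thesis using C(2)[OF True g] by (meson order_trans)
  next
    case False
    have "norm (g n) \<le> (C + 2 * real N) / real l * (\<Sum>n\<in>{a..a + int l - 1}. norm (g n))" for n
    proof -
      have "norm (g n) \<le> 1 * (\<Sum>n\<in>{a..a + int l - 1}. norm (g n))"
      proof (cases "n \<in> {a..a + int l - 1}")
        case True
        then have "norm (g n) \<le> (\<Sum>n\<in>{a..a + int l - 1}. norm (g n))"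
          by (intro member_le_sum) auto
        then show ?thesis by simp
      next
        case False
        then have "g n = 0" using g by (auto simp: supported_in_def)
        then show ?thesis by (simp add: sum_nonneg)
      qed
      also have "\<dots> \<le> (C + 2 * real N) / real l * (\<Sum>n\<in>{a..a + int l - 1}. norm (g n))"
      proof (intro mult_right_mono)
        have "real l \<le> real (2 * N)" using False by (simp only: of_nat_le_iff)
        then show "1 \<le> (C + 2 * real N) / real l" using C(1) l by (simp add: le_divide_eq)
      qed (simp add: sum_nonneg)
      finally show ?thesis .
    qed
    then show ?thesis using g by (intro exI[of _ g]) (auto simp: vanishing_moments_def)
  qed
  then show ?thesis using C(1) by (intro exI[of _ "C + 2 * real N"]) auto
qed

lemma dyad_interval: "dyad a k = {a..a + int (2 ^ k) - 1}"
  by (auto simp: dyad_def)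

lemma sum_square_le:
  fixes f :: "int \<Rightarrow> real"
  shows "(\<Sum>x\<in>A. f x)\<^sup>2 \<le> real (card A) * (\<Sum>x\<in>A. (f x)\<^sup>2)"
  using Cauchy_Schwarz_ineq_sum[of "\<lambda>_. 1" f A] by simp

text \<open>
  The passage from square-integrable to bounded atoms, by induction on the length of the interval. Stop at
  height \<open>A2\<close>, which is \<open>R\<close> times the mean of the square of \<open>g\<close>. On each stopping interval split \<open>g\<close> into a
  correction \<open>c P\<close> that is bounded by a multiple of \<open>sqrt A2\<close> and a remainder \<open>bad P\<close> whose moments vanish. What
  is left of \<open>g\<close> after removing the remainders is bounded, hence a multiple of an atom. The remainders are
  square-integrable atoms on shorter intervals, up to factors.
\<close>

lemma square_atom:
  assumes p: "0 < p" "p \<le> 1"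
  shows "\<exists>C\<ge>0. \<forall>k a g. supported_in g (dyad a k) \<longrightarrow> vanishing_moments (moment_count p) g \<longrightarrow>
     atomic_sum p g (C * ((2 ^ k) powr (1 - p / 2) * (\<Sum>n\<in>dyad a k. (norm (g n))\<^sup>2) powr (p / 2)))"
proof -
  define N where "N = moment_count p"
  have N: "1 \<le> N" unfolding N_def by (rule moment_count(1)[OF p])
  obtain C0 where C0: "0 \<le> C0" "\<And>a l g. 1 \<le> l \<Longrightarrow> supported_in g {a..a + int l - 1} \<Longrightarrow>
     (\<exists>c. supported_in c {a..a + int l - 1} \<and> vanishing_moments N (\<lambda>n. g n - c n) \<and>
       (\<forall>n. norm (c n) \<le> C0 / real l * (\<Sum>n\<in>{a..a + int l - 1}. norm (g n))))"
    using moment_correction[OF N] by blast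
  define C1 where "C1 = 4 + 4 * C0\<^sup>2"
  define C2 where "C2 = 1 + 2 * C0"
  \<comment> \<open>With this \<open>R\<close> the remainders use up exactly half of the constant \<open>C\<close>, the bounded part the other
    half.\<close>
  define R where "R = (2 * C1 powr (p / 2)) powr (2 / (2 - p))"
  define C where "C = 4 * C2 powr p * R powr (p / 2)"
  have C1: "4 \<le> C1" by (simp add: C1_def)
  have C2: "1 \<le> C2" using C0(1) by (simp add: C2_def)
  have R1: "1 \<le> R"
  proof -
    have "1 \<le> C1 powr (p / 2)" using C1 p by (intro ge_one_powr_ge_zero) auto
    then show ?thesis unfolding R_def using p by (intro ge_one_powr_ge_zero) auto
  qed
  have RC1: "C1 powr (p / 2) * R powr (p / 2 - 1) = 1 / 2"
  proof -
    have pos: "0 < C1 powr (p / 2)" using C1 by simp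
    have ex: "2 / (2 - p) * (p / 2 - 1) = - 1" using p by (simp add: field_simps)
    have "R powr (p / 2 - 1) = (2 * C1 powr (p / 2)) powr (- 1)"
      unfolding R_def powr_powr ex ..
    also have "\<dots> = inverse (2 * C1 powr (p / 2))" using pos by (simp add: powr_minus)
    finally have "C1 powr (p / 2) * R powr (p / 2 - 1) = C1 powr (p / 2) * inverse (2 * C1 powr (p / 2))" by simp
    also have "\<dots> = 1 / 2" using pos by simp
    finally show ?thesis .
  qed
  have C_pos: "0 \<le> C" by (simp add: C_def)
  have "atomic_sum p g (C * ((2 ^ k) powr (1 - p / 2) * (\<Sum>n\<in>dyad a k. (norm (g n))\<^sup>2) powr (p / 2)))"
    if "supported_in g (dyad a k)" "vanishing_moments N g" for k a g
    using that
  proof (induction k arbitrary: a g rule: less_induct)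
    case (less k)
    define X where "X = (2::real) ^ k"
    define G2 where "G2 = (\<Sum>n\<in>dyad a k. (norm (g n))\<^sup>2)"
    define A2 where "A2 = R * G2 / X"
    have X: "0 < X" by (simp add: X_def)
    show ?case
    proof (cases "G2 = 0")
      case True
      have "\<forall>n\<in>dyad a k. (norm (g n))\<^sup>2 = 0"
        using True unfolding G2_def by (subst (asm) sum_nonneg_eq_0_iff) auto
      then have "g = (\<lambda>_. 0)" using less.prems(1) by (auto simp: supported_in_def fun_eq_iff)
      then show ?thesis using atomic_sum_zero[OF p] C_pos by simp
    next
      case False
      have G2: "0 < G2" using False sum_nonneg[of "dyad a k" "\<lambda>n. (norm (g n))\<^sup>2"] by (simp add: G2_def)
      have A2: "0 < A2" using R1 G2 X by (simp add: A2_def)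
      have "G2 \<le> A2 * 2 ^ k" using R1 G2 X mult_right_mono[of 1 R G2] by (simp add: A2_def X_def)
      then obtain \<P> where P: "stopping_family (\<lambda>n. (norm (g n))\<^sup>2) A2 a k \<P>"
        using stopping_family_exists[of "\<lambda>n. (norm (g n))\<^sup>2" a k A2] by (auto simp: G2_def)
      note PD = stopping_familyD[OF P]
      define I where "I P = dyad (fst P) (snd P)" for P :: "int \<times> nat"
      define ell where "ell P = (2::real) ^ snd P" for P :: "int \<times> nat"
      have fin: "finite \<P>" by (rule PD(1))
      have sub: "I P \<subseteq> dyad a k" if "P \<in> \<P>" for P
        using PD(3)[of "fst P" "snd P"] that by (simp add: I_def)
      have jk: "snd P < k" if "P \<in> \<P>" for P
        using PD(2)[of "fst P" "snd P"] that by simp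
      have avg: "(\<Sum>n\<in>I P. (norm (g n))\<^sup>2) \<le> 2 * A2 * ell P" if "P \<in> \<P>" for P
        using PD(5)[of "fst P" "snd P"] that by (simp add: I_def ell_def)
      have disj: "I P \<inter> I P' = {}" if "P \<in> \<P>" "P' \<in> \<P>" "P \<noteq> P'" for P P'
        using disjoint_family_onD[OF PD(6) that] by (simp add: I_def case_prod_beta)
      define gP where "gP P = cut (I P) g" for P
      have "\<exists>c. supported_in c (I P) \<and> vanishing_moments N (\<lambda>n. gP P n - c n) \<and>
         (\<forall>n. norm (c n) \<le> C0 / ell P * (\<Sum>n\<in>I P. norm (gP P n)))" for P
        using C0(2)[of "2 ^ snd P" "gP P" "fst P"]
        by (simp add: I_def gP_def ell_def flip: dyad_interval[unfolded of_nat_power of_nat_numeral])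
      then obtain c where c: "\<And>P. supported_in (c P) (I P)" "\<And>P. vanishing_moments N (\<lambda>n. gP P n - c P n)"
         "\<And>P n. norm (c P n) \<le> C0 / ell P * (\<Sum>n\<in>I P. norm (gP P n))" by metis
      have ell: "0 < ell P" for P by (simp add: ell_def)
      have c_sq: "(norm (c P n))\<^sup>2 \<le> 2 * C0\<^sup>2 * A2" if "P \<in> \<P>" for P n
      proof -
        have "(norm (c P n))\<^sup>2 \<le> (C0 / ell P * (\<Sum>n\<in>I P. norm (gP P n)))\<^sup>2"
          by (intro power_mono c(3)) simp
        also have "\<dots> = (C0 / ell P)\<^sup>2 * (\<Sum>n\<in>I P. norm (g n))\<^sup>2"
          by (simp add: power_mult_distrib power_divide gP_def cut_def)
        also have "\<dots> \<le> (C0 / ell P)\<^sup>2 * (ell P * (2 * A2 * ell P))"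
        proof (intro mult_left_mono)
          have "(\<Sum>n\<in>I P. norm (g n))\<^sup>2 \<le> ell P * (\<Sum>n\<in>I P. (norm (g n))\<^sup>2)"
            using sum_square_le[of "\<lambda>n. norm (g n)" "I P"] by (simp add: I_def ell_def)
          also have "\<dots> \<le> ell P * (2 * A2 * ell P)"
            using avg[OF that] ell[of P] by (intro mult_left_mono) auto
          finally show "(\<Sum>n\<in>I P. norm (g n))\<^sup>2 \<le> ell P * (2 * A2 * ell P)" .
        qed simp
        also have "\<dots> = 2 * C0\<^sup>2 * A2" using ell[of P] by (simp add: power2_eq_square field_simps)
        finally show ?thesis .
      qed
      define bad where "bad P n = gP P n - c P n" for P n
      have bad_eq: "bad P = (\<lambda>n. gP P n - c P n)" for P by (simp add: bad_def fun_eq_iff)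
      have bad_supp: "supported_in (bad P) (I P)" for P
        using c(1)[of P] by (auto simp: supported_in_def bad_def gP_def cut_def)
      have bad_sq: "(\<Sum>n\<in>I P. (norm (bad P n))\<^sup>2) \<le> C1 * A2 * ell P" if "P \<in> \<P>" for P
      proof -
        have sq: "(norm (x - y))\<^sup>2 \<le> 2 * (norm x)\<^sup>2 + 2 * (norm y)\<^sup>2" for x y :: complex
        proof -
          have "(norm (x - y))\<^sup>2 \<le> (norm x + norm y)\<^sup>2" by (intro power_mono norm_triangle_ineq4) simp
          also have "\<dots> \<le> 2 * (norm x)\<^sup>2 + 2 * (norm y)\<^sup>2"
            using sum_squares_bound[of "norm x" "norm y"] by (simp add: power2_sum)
          finally show ?thesis .
        qed
        have "(\<Sum>n\<in>I P. (norm (bad P n))\<^sup>2) \<le> (\<Sum>n\<in>I P. 2 * (norm (g n))\<^sup>2 + 2 * (2 * C0\<^sup>2 * A2))"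
        proof (rule sum_mono)
          fix n assume "n \<in> I P"
          then have "bad P n = g n - c P n" by (simp add: bad_def gP_def cut_def)
          then show "(norm (bad P n))\<^sup>2 \<le> 2 * (norm (g n))\<^sup>2 + 2 * (2 * C0\<^sup>2 * A2)"
            using sq[of "g n" "c P n"] c_sq[OF that, of n] by simp
        qed
        also have "\<dots> = 2 * (\<Sum>n\<in>I P. (norm (g n))\<^sup>2) + 4 * C0\<^sup>2 * A2 * ell P"
          by (simp add: sum.distrib sum_distrib_left I_def ell_def)
        also have "\<dots> \<le> C1 * A2 * ell P" using avg[OF that] by (simp add: C1_def algebra_simps)
        finally show ?thesis .
      qed
      have bad_at: "atomic_sum p (bad P) (C * (C1 powr (p / 2) * A2 powr (p / 2)) * ell P)" if P: "P \<in> \<P>" for P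
      proof (rule atomic_sum_mono)
        show "atomic_sum p (bad P) (C * ((2 ^ snd P) powr (1 - p / 2) * (\<Sum>n\<in>dyad (fst P) (snd P). (norm (bad P n))\<^sup>2) powr (p / 2)))"
          by (rule less.IH[OF jk[OF P]]) (use bad_supp[of P] c(2)[of P] in \<open>auto simp: I_def bad_eq[symmetric]\<close>)
        have "(\<Sum>n\<in>dyad (fst P) (snd P). (norm (bad P n))\<^sup>2) powr (p / 2) \<le> (C1 * A2 * ell P) powr (p / 2)"
          using p bad_sq[OF P] by (intro powr_mono2) (auto simp: I_def intro!: sum_nonneg)
        also have "\<dots> = C1 powr (p / 2) * A2 powr (p / 2) * ell P powr (p / 2)"
          using C1 A2 ell[of P] by (simp add: powr_mult)
        finally have "C * ((2 ^ snd P) powr (1 - p / 2) * (\<Sum>n\<in>dyad (fst P) (snd P). (norm (bad P n))\<^sup>2) powr (p / 2))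
          \<le> C * (ell P powr (1 - p / 2) * (C1 powr (p / 2) * A2 powr (p / 2) * ell P powr (p / 2)))"
          unfolding ell_def by (intro mult_left_mono C_pos) auto
        also have "\<dots> = C * (C1 powr (p / 2) * A2 powr (p / 2)) * (ell P powr (1 - p / 2) * ell P powr (p / 2))"
          by simp
        also have "ell P powr (1 - p / 2) * ell P powr (p / 2) = ell P"
          using ell[of P] by (simp add: powr_add[symmetric])
        finally show "C * ((2 ^ snd P) powr (1 - p / 2) * (\<Sum>n\<in>dyad (fst P) (snd P). (norm (bad P n))\<^sup>2) powr (p / 2))
          \<le> C * (C1 powr (p / 2) * A2 powr (p / 2)) * ell P" .
      qed
      define good where "good n = g n - (\<Sum>P\<in>\<P>. bad P n)" for n
      have bad_sum: "(\<Sum>P\<in>\<P>. bad P n) = g n - c P n" if "P \<in> \<P>" "n \<in> I P" for P n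
      proof -
        have "bad Q n = 0" if "Q \<in> \<P> - {P}" for Q
          using disj[of Q P] that \<open>P \<in> \<P>\<close> \<open>n \<in> I P\<close> bad_supp[of Q] by (auto simp: supported_in_def)
        then have "(\<Sum>P\<in>\<P>. bad P n) = (\<Sum>P\<in>{P}. bad P n)"
          using \<open>P \<in> \<P>\<close> fin by (intro sum.mono_neutral_right) auto
        then show ?thesis using that by (simp add: bad_def gP_def cut_def)
      qed
      have good_le: "norm (good n) \<le> C2 * sqrt A2" for n
      proof (cases "\<exists>P\<in>\<P>. n \<in> I P")
        case True
        then obtain P where P: "P \<in> \<P>" "n \<in> I P" by blast
        have "norm (good n) = norm (c P n)" by (simp add: good_def bad_sum[OF P])
        also have "\<dots> \<le> sqrt (2 * C0\<^sup>2 * A2)" using c_sq[OF P(1), of n] by (rule real_le_rsqrt)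
        also have "\<dots> \<le> sqrt ((2 * C0)\<^sup>2 * A2)" using A2 by (intro real_sqrt_le_mono mult_right_mono) (auto simp: power_mult_distrib)
        also have "\<dots> = 2 * C0 * sqrt A2" using C0(1) by (simp add: real_sqrt_mult)
        also have "\<dots> \<le> C2 * sqrt A2" using A2 by (simp add: C2_def)
        finally show ?thesis .
      next
        case False
        then have "bad P n = 0" if "P \<in> \<P>" for P using bad_supp[of P] that by (auto simp: supported_in_def)
        then have gn: "good n = g n" by (simp add: good_def)
        have "(norm (g n))\<^sup>2 \<le> A2"
        proof (cases "n \<in> dyad a k")
          case True
          then show ?thesis using False PD(7)[of n] by (simp add: I_def case_prod_beta)
        next
          case False
          then show ?thesis using less.prems(1) A2 by (auto simp: supported_in_def)
        qed
        then have "norm (g n) \<le> 1 * sqrt A2" by (simp add: real_le_rsqrt)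
        also have "\<dots> \<le> C2 * sqrt A2" using C2 A2 by (intro mult_right_mono) auto
        finally show ?thesis by (simp add: gn)
      qed
      have bad_supp': "supported_in (bad P) (dyad a k)" if "P \<in> \<P>" for P
        using bad_supp[of P] sub[OF that] by (auto intro: supported_in_mono)
      have good_supp: "supported_in good (dyad a k)"
        using less.prems(1) bad_supp' by (auto simp: supported_in_def good_def intro!: sum.neutral)
      have sum_supp: "supported_in (\<lambda>n. \<Sum>P\<in>\<P>. bad P n) (dyad a k)"
        using bad_supp' by (auto simp: supported_in_def intro!: sum.neutral)
      have "vanishing_moments N (\<lambda>n. \<Sum>P\<in>\<P>. bad P n)"
        by (rule vanishing_moments_sum[where A = "dyad a k"]) (use bad_supp' c(2) in \<open>auto simp: bad_eq[symmetric]\<close>)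
      then have good_mom: "vanishing_moments N good"
        unfolding good_def by (rule vanishing_moments_diff[OF less.prems(1) sum_supp less.prems(2)])
      have good_at: "atomic_sum p good ((C2 * sqrt A2) powr p * (2 * of_int (a + 2 ^ k - 1 - a + 1)))"
        by (rule atomic_sum_bounded[OF p]) (use good_supp good_le good_mom in \<open>auto simp: dyad_interval N_def\<close>)
      have at: "atomic_sum p (\<lambda>n. good n + (\<Sum>P\<in>\<P>. bad P n))
          ((C2 * sqrt A2) powr p * (2 * of_int (a + 2 ^ k - 1 - a + 1))
           + (\<Sum>P\<in>\<P>. C * (C1 powr (p / 2) * A2 powr (p / 2)) * ell P))"
        by (intro atomic_sum_add[OF p] good_at atomic_sum_sum[OF p] fin bad_at)
      have eq: "(\<lambda>n. good n + (\<Sum>P\<in>\<P>. bad P n)) = g" by (simp add: good_def)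
      have le: "(C2 * sqrt A2) powr p * (2 * of_int (a + 2 ^ k - 1 - a + 1))
           + (\<Sum>P\<in>\<P>. C * (C1 powr (p / 2) * A2 powr (p / 2)) * ell P)
           \<le> C * ((2 ^ k) powr (1 - p / 2) * G2 powr (p / 2))"
      proof -
        define Y where "Y = X powr (1 - p / 2) * G2 powr (p / 2)"
        have A2p: "A2 powr (p / 2) = R powr (p / 2) * G2 powr (p / 2) * X powr (- (p / 2))"
          using R1 G2 X by (simp add: A2_def powr_mult powr_divide powr_minus field_simps)
        have XX: "X powr (- (p / 2)) * X = X powr (1 - p / 2)"
          using X powr_add[of X "- (p / 2)" 1] by simp
        have "(C2 * sqrt A2) powr p * (2 * of_int (a + 2 ^ k - 1 - a + 1)) = 2 * C2 powr p * A2 powr (p / 2) * X"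
          using C2 A2 by (simp add: powr_mult powr_half_sqrt[symmetric] powr_powr X_def)
        also have "\<dots> = 2 * C2 powr p * R powr (p / 2) * G2 powr (p / 2) * (X powr (- (p / 2)) * X)"
          by (simp add: A2p)
        also have "\<dots> = C / 2 * Y" unfolding XX by (simp add: C_def Y_def)
        finally have 1: "(C2 * sqrt A2) powr p * (2 * of_int (a + 2 ^ k - 1 - a + 1)) = C / 2 * Y" .
        have ell_sum: "(\<Sum>P\<in>\<P>. ell P) \<le> G2 / A2"
        proof -
          have "A2 * (\<Sum>P\<in>\<P>. ell P) \<le> (\<Sum>P\<in>\<P>. \<Sum>n\<in>I P. (norm (g n))\<^sup>2)"
            unfolding sum_distrib_left using PD(4) by (intro sum_mono) (auto simp: ell_def I_def less_imp_le)
          also have "\<dots> \<le> G2"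
            using stopping_family_sum(2)[OF P, of "\<lambda>n. (norm (g n))\<^sup>2"] by (simp add: I_def G2_def case_prod_beta)
          finally show ?thesis using A2 by (simp add: field_simps)
        qed
        have "(\<Sum>P\<in>\<P>. C * (C1 powr (p / 2) * A2 powr (p / 2)) * ell P)
            = C * (C1 powr (p / 2) * A2 powr (p / 2)) * (\<Sum>P\<in>\<P>. ell P)"
          by (simp add: sum_distrib_left)
        also have "\<dots> \<le> C * (C1 powr (p / 2) * A2 powr (p / 2)) * (G2 / A2)"
          by (intro mult_left_mono ell_sum) (use C_pos in simp)
        also have "\<dots> = C * (C1 powr (p / 2) * A2 powr (p / 2 - 1) * G2)"
          using A2 by (simp add: powr_diff)
        also have "A2 powr (p / 2 - 1) = R powr (p / 2 - 1) * (G2 powr (p / 2 - 1) * X powr (1 - p / 2))"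
        proof -
          have "A2 powr (p / 2 - 1) = R powr (p / 2 - 1) * G2 powr (p / 2 - 1) / X powr (p / 2 - 1)"
            using R1 G2 X by (simp add: A2_def powr_mult powr_divide)
          also have "\<dots> = R powr (p / 2 - 1) * G2 powr (p / 2 - 1) * X powr (- (p / 2 - 1))"
            by (simp only: powr_minus divide_inverse)
          finally show ?thesis by simp
        qed
        also have "C * (C1 powr (p / 2) * (R powr (p / 2 - 1) * (G2 powr (p / 2 - 1) * X powr (1 - p / 2))) * G2)
           = C * ((C1 powr (p / 2) * R powr (p / 2 - 1)) * (X powr (1 - p / 2) * (G2 powr (p / 2 - 1) * G2)))"
          by simp
        also have "G2 powr (p / 2 - 1) * G2 = G2 powr (p / 2)"
          using G2 powr_add[of G2 "p / 2 - 1" 1] by simp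
        also have "C * ((C1 powr (p / 2) * R powr (p / 2 - 1)) * (X powr (1 - p / 2) * G2 powr (p / 2))) = C / 2 * Y"
          unfolding RC1 by (simp add: Y_def)
        finally show ?thesis using 1 by (simp add: Y_def X_def)
      qed
      show ?thesis unfolding G2_def[symmetric] by (rule atomic_sum_mono[OF at[unfolded eq] le])
    qed
  qed
  then show ?thesis using C_pos unfolding N_def by blast
qed

section \<open>The image of an atom\<close>

lemma bdiff_conv:
  assumes "supported_in a {l..r}"
  shows "(bdiff ^^ j) (conv K a) = conv K ((bdiff ^^ j) a)"
proof (induction j)
  case (Suc j)
  define f where "f = (bdiff ^^ j) a"
  have f: "supported_in f {l..r + int j}" unfolding f_def by (rule supported_in_bdiff_pow[OF assms])
  have f': "supported_in f {l - 1..r + int j + 1}" by (rule supported_in_mono[OF f]) auto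
  have bf: "supported_in (bdiff f) {l..r + int j + 1}"
    using supported_in_bdiff_pow[OF f, of 1] by simp
  have "bdiff (conv K f) n = conv K (bdiff f) n" for n
  proof -
    have "conv K (bdiff f) n = (\<Sum>k\<in>{l..r + int j + 1}. K (n - k) * f k) - (\<Sum>k\<in>{l..r + int j + 1}. K (n - k) * f (k - 1))"
      unfolding conv_finite[OF bf] by (simp add: bdiff_def algebra_simps sum_subtractf)
    also have "(\<Sum>k\<in>{l..r + int j + 1}. K (n - k) * f (k - 1)) = (\<Sum>k\<in>{l - 1..r + int j}. K (n - 1 - k) * f k)"
      by (rule sum.reindex_bij_witness[of _ "\<lambda>k. k + 1" "\<lambda>k. k - 1"]) auto
    also have "\<dots> = (\<Sum>k\<in>{l..r + int j}. K (n - 1 - k) * f k)"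
      by (rule sum.mono_neutral_right) (use f in \<open>auto simp: supported_in_def\<close>)
    also have "(\<Sum>k\<in>{l..r + int j + 1}. K (n - k) * f k) = (\<Sum>k\<in>{l..r + int j}. K (n - k) * f k)"
      by (rule sum.mono_neutral_right) (use f in \<open>auto simp: supported_in_def\<close>)
    finally show ?thesis unfolding bdiff_def[of "conv K f"] conv_finite[OF f] by simp
  qed
  then have "bdiff (conv K f) = conv K (bdiff f)" by (rule ext)
  then show ?case using Suc by (simp add: f_def)
qed simp

lemma bdiff_pow_conv_kernel:
  assumes "supported_in a A"
  shows "(bdiff ^^ j) (conv K a) n = (\<Sum>k\<in>A. (bdiff ^^ j) K (n - k) * a k)"
proof (induction j arbitrary: n)
  case 0
  then show ?case by (simp add: conv_finite[OF assms])
next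
  case (Suc j)
  have "(bdiff ^^ Suc j) (conv K a) n = (bdiff ^^ j) (conv K a) n - (bdiff ^^ j) (conv K a) (n - 1)"
    by (simp add: bdiff_def[of "(bdiff ^^ j) (conv K a)"])
  also have "\<dots> = (\<Sum>k\<in>A. ((bdiff ^^ j) K (n - k) - (bdiff ^^ j) K (n - 1 - k)) * a k)"
    unfolding Suc by (simp add: sum_subtractf left_diff_distrib)
  also have "\<dots> = (\<Sum>k\<in>A. (bdiff ^^ Suc j) K (n - k) * a k)"
    by (simp add: bdiff_def[of "(bdiff ^^ j) K"] algebra_simps)
  finally show ?case .
qed

text \<open>
  A smooth cutoff, equal to \<open>1\<close> at distance less than \<open>N * s\<close> from the origin and to \<open>0\<close> beyond distance \<open>2 * N * s\<close>.
\<close>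

definition plateau :: "nat \<Rightarrow> nat \<Rightarrow> int \<Rightarrow> complex" where
  "plateau N s n = spline N s (n + 2 * int (N * s)) - spline N s (n - int (N * s))"

lemma plateau_values:
  assumes s: "1 \<le> s"
  shows "- int (N * s) \<le> n \<Longrightarrow> n < int (N * s) \<Longrightarrow> plateau N s n = 1"
    and "n < - 2 * int (N * s) \<Longrightarrow> plateau N s n = 0"
    and "2 * int (N * s) \<le> n \<Longrightarrow> plateau N s n = 0"
proof -
  have nn: "0 \<le> int (N * s)" by simp
  show "- int (N * s) \<le> n \<Longrightarrow> n < int (N * s) \<Longrightarrow> plateau N s n = 1"
    using spline_values(2)[OF s, of N "n + 2 * int (N * s)"] spline_values(1)[OF s, of "n - int (N * s)" N]
    unfolding plateau_def by simp
  show "plateau N s n = 0" if "n < - 2 * int (N * s)"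
  proof -
    have "n + 2 * int (N * s) < 0" "n - int (N * s) < 0" using that nn by linarith+
    then show ?thesis unfolding plateau_def by (simp only: spline_values(1)[OF s] diff_self)
  qed
  show "plateau N s n = 0" if "2 * int (N * s) \<le> n"
  proof -
    have "int (N * s) \<le> n + 2 * int (N * s)" "int (N * s) \<le> n - int (N * s)" using that nn by linarith+
    then show ?thesis unfolding plateau_def by (simp only: spline_values(2)[OF s] diff_self)
  qed
qed

lemma bdiff_pow_plateau:
  assumes "1 \<le> s" "j \<le> N"
  shows "norm ((bdiff ^^ j) (plateau N s) n) \<le> 2 * (2 / real s) ^ j"
proof -
  have "(bdiff ^^ j) (plateau N s) n
      = (bdiff ^^ j) (spline N s) (n - (- 2 * int (N * s))) - (bdiff ^^ j) (spline N s) (n - int (N * s))"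
    unfolding bdiff_pow_shift[symmetric] bdiff_pow_diff[symmetric] plateau_def by simp
  also have "norm \<dots> \<le> (2 / real s) ^ j + (2 / real s) ^ j"
    by (intro order_trans[OF norm_triangle_ineq4] add_mono bdiff_pow_spline assms)
  finally show ?thesis by simp
qed

lemma dyad_length_exists:
  assumes "1 \<le> (m::nat)"
  shows "\<exists>k. m \<le> 2 ^ k \<and> (2::nat) ^ k \<le> 2 * m"
proof -
  obtain i where "2 ^ i \<le> m" "m < 2 ^ (i + 1)" using ex_power_ivl1[of 2 m] assms by auto
  then show ?thesis by (intro exI[of _ "i + 1"]) simp
qed

context calderon_zygmund_kernel
begin

lemma kernel_decay_uniform:
  "\<exists>C\<ge>0. \<forall>j\<le>N. \<forall>n. norm ((bdiff ^^ j) K n) * of_int \<bar>n\<bar> ^ Suc j \<le> C"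
proof -
  have "\<forall>j. \<exists>C. \<forall>n. norm ((bdiff ^^ j) K n) * of_int \<bar>n\<bar> ^ Suc j \<le> C" using kernel_decay by blast
  then obtain c where c: "\<And>j n. norm ((bdiff ^^ j) K n) * of_int \<bar>n\<bar> ^ Suc j \<le> c j" by metis
  have c0: "0 \<le> c j" for j using c[of j 0] by simp
  have "c j \<le> (\<Sum>j\<le>N. c j)" if "j \<le> N" for j using that c0 by (intro member_le_sum) auto
  then show ?thesis using c c0
    by (intro exI[of _ "\<Sum>j\<le>N. c j"]) (auto intro!: sum_nonneg intro: order_trans)
qed

text \<open>
  Write the atom as \<open>b = D\<^sup>N a\<close>, where \<open>D\<close> is the difference operator, so that \<open>T b = D\<^sup>N u\<close> with \<open>u = T a\<close>. Multiply
  \<open>u\<close> by smooth cutoffs \<open>\<eta> i\<close> at distances \<open>\<rho> i\<close> that double with \<open>i\<close>. Then \<open>T b\<close> is the sum of \<open>D\<^sup>N (u * \<eta> 0)\<close> and of the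
  \<open>D\<^sup>N (u * (\<eta> (i + 1) - \<eta> i))\<close>, all of which have \<open>N\<close> vanishing moments because the differences are taken last. The
  kernel bounds make the far pieces multiples of atoms with geometrically decaying coefficients. The near
  piece is square-summable by the \<open>\<ell>\<^sup>2\<close> bound.
\<close>

lemma atom_image:
  assumes p: "0 < p" "p \<le> 1"
  shows "\<exists>C\<ge>0. \<forall>b. hardy_atom p b \<longrightarrow> atomic_sum p (conv K b) C"
proof -
  define N where "N = moment_count p"
  have N: "1 \<le> N" unfolding N_def by (rule moment_count(1)[OF p])
  obtain Ck where Ck: "0 \<le> Ck" "\<And>j n. j \<le> N \<Longrightarrow> norm ((bdiff ^^ j) K n) * of_int \<bar>n\<bar> ^ Suc j \<le> Ck"
    using kernel_decay_uniform[of N] by blast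
  obtain B where B: "0 \<le> B" "\<And>f A F. supported_in f A \<Longrightarrow> finite F \<Longrightarrow>
        (\<Sum>n\<in>F. (norm (conv K f n))\<^sup>2) \<le> B * (\<Sum>k\<in>A. (norm (f k))\<^sup>2)"
    using l2_bounded by blast
  obtain Cs where Cs: "0 \<le> Cs" "\<And>k a g. supported_in g (dyad a k) \<Longrightarrow> vanishing_moments N g \<Longrightarrow>
     atomic_sum p g (Cs * ((2 ^ k) powr (1 - p / 2) * (\<Sum>n\<in>dyad a k. (norm (g n))\<^sup>2) powr (p / 2)))"
    using square_atom[OF p] unfolding N_def by blast
  \<comment> \<open>The constant of the Leibniz rule: \<open>2 ^ N\<close> terms, a factor \<open>4\<close> from the cutoffs, and \<open>s i / 4\<close> as lower
    bound for the distance to the support of \<open>a\<close>.\<close>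
  define H where "H = 2 ^ N * 4 * Ck * 4 ^ Suc N"
  have H: "0 \<le> H" using Ck by (simp add: H_def)
  \<comment> \<open>The ratio of the geometric decay; it is less than \<open>1\<close> since \<open>N\<close> exceeds \<open>1 / p - 1\<close>.\<close>
  define \<theta> where "\<theta> = (2::real) powr (1 - (1 + real N) * p)"
  have \<theta>: "0 < \<theta>" "\<theta> < 1"
    using moment_count(2)[OF p] by (auto simp: \<theta>_def N_def powr_less_one)
  define Cnear where "Cnear = Cs * ((48 * real N) powr (1 - p / 2) * (B + 24 * real N * H\<^sup>2) powr (p / 2))"
  define Cfar where "Cfar = 80 * real N * H powr p"
  define C where "C = Cnear + Cfar * (1 / (1 - \<theta>))"
  have main: "atomic_sum p (conv K b) C" if atom: "hardy_atom p b" for b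
  proof -
    obtain n0 and R :: nat where b: "supported_in b {n0 - int R..n0 + int R}"
      "\<And>n. norm (b n) \<le> (2 * real R + 1) powr (- 1 / p)" "vanishing_moments N b"
      using hardy_atomE[OF p atom] unfolding N_def by metis
    define P where "P = {n0 - int R..n0 + int R}"
    define L where "L = 2 * R + 1"
    have L1: "1 \<le> L" by (simp add: L_def)
    define Lr where "Lr = real L"
    have Lr: "1 \<le> Lr" "0 < Lr" using L1 by (simp_all add: Lr_def)
    have cardP: "card P = L" by (simp add: P_def L_def)
    have b_le: "norm (b n) \<le> Lr powr (- 1 / p)" for n using b(2)[of n] by (simp add: Lr_def L_def add.commute)
    obtain a where a: "supported_in a P" "(bdiff ^^ N) a = b"
      "(\<Sum>n\<in>P. norm (a n)) \<le> of_nat (nat (n0 + int R - (n0 - int R) + 1)) ^ N * (\<Sum>n\<in>P. norm (b n))"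
      using antidifference[OF b(1,3)] unfolding P_def by blast
    define A1 where "A1 = (\<Sum>n\<in>P. norm (a n))"
    have A10: "0 \<le> A1" by (simp add: A1_def sum_nonneg)
    have A1_le: "A1 \<le> Lr ^ Suc N * Lr powr (- 1 / p)"
    proof -
      have "nat (n0 + int R - (n0 - int R) + 1) = L" by (simp add: L_def)
      then have "A1 \<le> Lr ^ N * (\<Sum>n\<in>P. norm (b n))" using a(3) by (simp add: A1_def Lr_def)
      also have "\<dots> \<le> Lr ^ N * (\<Sum>n\<in>P. Lr powr (- 1 / p))"
        using Lr by (intro mult_left_mono sum_mono b_le) auto
      also have "\<dots> = Lr ^ Suc N * Lr powr (- 1 / p)" by (simp add: cardP Lr_def)
      finally show ?thesis .
    qed
    define u where "u = conv K a"
    have Tb: "(bdiff ^^ N) u = conv K b"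
      unfolding u_def using bdiff_conv[of a "n0 - int R" "n0 + int R" N] a(1,2) by (simp add: P_def)
    have u_far: "norm ((bdiff ^^ j) u n) \<le> Ck * A1 / d ^ Suc j"
      if j: "j \<le> N" and d: "0 < d" "real R + d \<le> of_int \<bar>n - n0\<bar>" for j n d
    proof -
      have "norm ((bdiff ^^ j) u n) \<le> (\<Sum>k\<in>P. norm ((bdiff ^^ j) K (n - k) * a k))"
        unfolding u_def bdiff_pow_conv_kernel[OF a(1)] by (rule norm_sum)
      also have "\<dots> \<le> (\<Sum>k\<in>P. Ck / d ^ Suc j * norm (a k))"
        unfolding norm_mult
      proof (intro sum_mono mult_right_mono norm_ge_zero)
        fix k assume "k \<in> P"
        then have "\<bar>n - n0\<bar> \<le> \<bar>n - k\<bar> + int R" by (auto simp: P_def)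
        then have "real_of_int \<bar>n - n0\<bar> \<le> real_of_int (\<bar>n - k\<bar> + int R)" by (simp only: of_int_le_iff)
        then have dk: "d \<le> of_int \<bar>n - k\<bar>" using d(2) by simp
        have "norm ((bdiff ^^ j) K (n - k)) * d ^ Suc j \<le> norm ((bdiff ^^ j) K (n - k)) * of_int \<bar>n - k\<bar> ^ Suc j"
          using d(1) by (intro mult_left_mono power_mono dk) auto
        also have "\<dots> \<le> Ck" by (rule Ck(2)[OF j])
        finally show "norm ((bdiff ^^ j) K (n - k)) \<le> Ck / d ^ Suc j" using d(1) by (simp add: le_divide_eq)
      qed
      also have "\<dots> = Ck * A1 / d ^ Suc j" by (simp add: A1_def sum_distrib_left sum_divide_distrib)
      finally show ?thesis .
    qed
    define s where "s i = 4 * L * 2 ^ i" for i :: nat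
    have s1: "1 \<le> s i" for i using L1 by (simp add: s_def Suc_le_eq)
    define \<rho> where "\<rho> i = int (N * s i)" for i
    have \<rho>4: "4 * int N \<le> \<rho> i" "4 * int L \<le> \<rho> i" for i
    proof -
      have "N * (4 * 1 * 1) \<le> N * s i" unfolding s_def using L1 by (intro mult_le_mono) auto
      then show "4 * int N \<le> \<rho> i" unfolding \<rho>_def by linarith
      have "1 * (4 * L * 1) \<le> N * s i" unfolding s_def using N by (intro mult_le_mono) auto
      then show "4 * int L \<le> \<rho> i" unfolding \<rho>_def by linarith
    qed
    have \<rho>S: "\<rho> (Suc i) = 2 * \<rho> i" for i by (simp add: \<rho>_def s_def)
    have sr: "0 < real (s i)" for i using s1[of i] by simp
    define \<eta> where "\<eta> i n = plateau N (s i) (n - n0)" for i n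
    have \<eta>_diff: "norm ((bdiff ^^ j) (\<eta> i) n) \<le> 2 * (2 / real (s i)) ^ j" if "j \<le> N" for i j n
      unfolding \<eta>_def bdiff_pow_shift by (rule bdiff_pow_plateau[OF s1 that])
    have \<eta>1: "\<eta> i n = 1" if "\<bar>n - n0\<bar> < \<rho> i" for i n
      unfolding \<eta>_def by (rule plateau_values(1)[OF s1]) (use that in \<open>auto simp: \<rho>_def\<close>)
    have \<eta>0: "\<eta> i n = 0" if "2 * \<rho> i < \<bar>n - n0\<bar>" for i n
    proof -
      have "n - n0 < - 2 * int (N * s i) \<or> 2 * int (N * s i) \<le> n - n0"
        using that unfolding \<rho>_def by linarith
      then show ?thesis unfolding \<eta>_def using plateau_values(2,3)[OF s1] by blast
    qed
    have piece: "norm ((bdiff ^^ N) (\<lambda>m. u m * \<psi> m) n) \<le> H * A1 / real (s i) ^ Suc N"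
      if \<psi>: "\<And>j m. j \<le> N \<Longrightarrow> norm ((bdiff ^^ j) \<psi> m) \<le> 4 * (2 / real (s i)) ^ j"
        and far: "\<rho> i - int N \<le> \<bar>n - n0\<bar>" for \<psi> n i
    proof -
      have "norm ((bdiff ^^ N) (\<lambda>m. u m * \<psi> m) n) \<le> 2 ^ N * (Ck * A1 * (4 / real (s i))) * 4 * (4 / real (s i)) ^ N"
      proof (rule bdiff_pow_Leibniz)
        show "0 \<le> Ck * A1 * (4 / real (s i))" using Ck A10 by simp
        fix j m assume jm: "j \<le> N" "n - int N \<le> m" "m \<le> n"
        have "\<bar>n - n0\<bar> \<le> \<bar>m - n0\<bar> + int N" using jm by linarith
        moreover have "v \<le> 2 * y" if "x \<le> y + z" "v - z \<le> x" "4 * z \<le> v" for v x y z :: int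
          using that by linarith
        ultimately have "\<rho> i \<le> 2 * \<bar>m - n0\<bar>" using far \<rho>4(1)[of i] by blast
        then have "real_of_int (\<rho> i) \<le> real_of_int (2 * \<bar>m - n0\<bar>)" by (simp only: of_int_le_iff)
        then have 1: "real_of_int (\<rho> i) \<le> 2 * real_of_int \<bar>m - n0\<bar>" by simp
        have "real_of_int (4 * int L) \<le> real_of_int (\<rho> i)" using \<rho>4(2)[of i] by (simp only: of_int_le_iff)
        then have 2: "4 * real R \<le> real_of_int (\<rho> i)" by (simp add: L_def)
        have \<rho>s: "real (s i) \<le> real_of_int (\<rho> i)" using N mult_right_mono[of 1 "real N" "real (s i)"] by (simp add: \<rho>_def)
        have "norm ((bdiff ^^ j) u m) \<le> Ck * A1 / (real (s i) / 4) ^ Suc j"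
          by (rule u_far[OF jm(1)]) (use sr[of i] 1 2 \<rho>s in auto)
        also have "\<dots> = Ck * A1 * (4 / real (s i)) * (4 / real (s i)) ^ j"
          by (simp add: power_divide)
        finally show "norm ((bdiff ^^ j) u m) \<le> Ck * A1 * (4 / real (s i)) * (4 / real (s i)) ^ j" .
        have "norm ((bdiff ^^ j) \<psi> m) \<le> 4 * (2 / real (s i)) ^ j" by (rule \<psi>[OF jm(1)])
        also have "\<dots> \<le> 4 * (4 / real (s i)) ^ j"
          by (intro mult_left_mono power_mono divide_right_mono) auto
        finally show "norm ((bdiff ^^ j) \<psi> m) \<le> 4 * (4 / real (s i)) ^ j" .
      qed auto
      also have "\<dots> = H * A1 / real (s i) ^ Suc N" by (simp add: H_def power_divide)
      finally show ?thesis .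
    qed
    have small: "H * A1 / real (s i) ^ Suc N \<le> H * Lr powr (- 1 / p) * (1 / 2 ^ i) ^ Suc N" for i
    proof -
      have "A1 / real (s i) ^ Suc N \<le> Lr ^ Suc N * Lr powr (- 1 / p) / (Lr * 2 ^ i) ^ Suc N"
      proof (intro frac_le A1_le power_mono)
        show "Lr * 2 ^ i \<le> real (s i)" using Lr by (simp add: s_def Lr_def)
        show "0 \<le> Lr ^ Suc N * Lr powr (- 1 / p)" using Lr by simp
      qed (use Lr in auto)
      also have "\<dots> = Lr powr (- 1 / p) * (1 / 2 ^ i) ^ Suc N"
        using Lr by (simp add: power_mult_distrib power_one_over power_divide)
      finally have "H * (A1 / real (s i) ^ Suc N) \<le> H * (Lr powr (- 1 / p) * (1 / 2 ^ i) ^ Suc N)"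
        by (rule mult_left_mono[OF _ H])
      then show ?thesis by simp
    qed
    define near where "near = (bdiff ^^ N) (\<lambda>m. u m * \<eta> 0 m)"
    define \<psi> where "\<psi> i m = \<eta> (Suc i) m - \<eta> i m" for i m
    define far where "far i = (bdiff ^^ N) (\<lambda>m. u m * \<psi> i m)" for i
    have cut_supp: "supported_in (\<lambda>m. u m * h m) {n0 - r..n0 + r}"
      if "\<And>m. r < \<bar>m - n0\<bar> \<Longrightarrow> h m = 0" for h :: "int \<Rightarrow> complex" and r
      unfolding supported_in_def using that by (auto simp: abs_if not_le)
    \<comment> \<open>The far pieces: the decay of \<open>u\<close> and its differences gives size \<open>2 powr (- i * (N + 1))\<close> relative to \<open>b\<close>.\<close>
    have \<psi>_diff: "norm ((bdiff ^^ j) (\<psi> i) m) \<le> 4 * (2 / real (s i)) ^ j" if "j \<le> N" for i j m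
    proof -
      have "norm ((bdiff ^^ j) (\<psi> i) m) \<le> 2 * (2 / real (s (Suc i))) ^ j + 2 * (2 / real (s i)) ^ j"
        unfolding \<psi>_def bdiff_pow_diff
        by (intro order_trans[OF norm_triangle_ineq4] add_mono \<eta>_diff that)
      also have "\<dots> \<le> 2 * (2 / real (s i)) ^ j + 2 * (2 / real (s i)) ^ j"
      proof (intro add_mono mult_left_mono power_mono divide_left_mono order_refl)
        show "real (s i) \<le> real (s (Suc i))" by (simp add: s_def)
      qed (use sr[of i] sr[of "Suc i"] in auto)
      finally show ?thesis by simp
    qed
    have far_at: "atomic_sum p (far i) (Cfar * \<theta> ^ i)" for i
    proof (rule atomic_sum_mono)
      define r where "r = 4 * \<rho> i"
      have supp0: "supported_in (\<lambda>m. u m * \<psi> i m) {n0 - r..n0 + r}"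
      proof (rule cut_supp)
        fix m assume "r < \<bar>m - n0\<bar>"
        then show "\<psi> i m = 0"
          using \<eta>0[of i m] \<eta>0[of "Suc i" m] \<rho>4[of i] by (simp add: \<psi>_def \<rho>S r_def)
      qed
      have le: "norm (far i n) \<le> H * Lr powr (- 1 / p) * (1 / 2 ^ i) ^ Suc N" for n
      proof (cases "\<rho> i - int N \<le> \<bar>n - n0\<bar>")
        case True
        show ?thesis unfolding far_def
          by (rule order_trans[OF piece small]) (use \<psi>_diff True in auto)
      next
        case False
        have "far i n = (bdiff ^^ N) (\<lambda>_. 0) n"
          unfolding far_def
        proof (rule bdiff_pow_cong)
          fix m assume "n - int N \<le> m" "m \<le> n"
          then have "\<bar>m - n0\<bar> < \<rho> i" "\<bar>m - n0\<bar> < \<rho> (Suc i)" using False \<rho>4(1)[of i] by (auto simp: \<rho>S)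
          then show "u m * \<psi> i m = 0" by (simp add: \<psi>_def \<eta>1)
        qed
        then show ?thesis using H by simp
      qed
      show "atomic_sum p (far i) ((H * Lr powr (- 1 / p) * (1 / 2 ^ i) ^ Suc N) powr p
              * (2 * of_int (n0 + r + int N - (n0 - r) + 1)))"
      proof (rule atomic_sum_bounded[OF p])
        show "supported_in (far i) {n0 - r..n0 + r + int N}"
          unfolding far_def by (rule supported_in_bdiff_pow[OF supp0])
        show "n0 - r \<le> n0 + r + int N" using \<rho>4(1)[of i] by (simp add: r_def)
        show "vanishing_moments (moment_count p) (far i)"
          using vanishing_moments_bdiff_pow[OF supp0, of N 0]
          by (simp add: far_def N_def vanishing_moments_def[of 0])
      qed (rule le)
      have len: "real_of_int (n0 + r + int N - (n0 - r) + 1) \<le> 10 * real N * real (s i)"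
      proof -
        have "n0 + r + int N - (n0 - r) + 1 \<le> 10 * \<rho> i"
          using \<rho>4[of i] N L1 unfolding r_def by linarith
        then have "real_of_int (n0 + r + int N - (n0 - r) + 1) \<le> real_of_int (10 * \<rho> i)"
          by (simp only: of_int_le_iff)
        then show ?thesis by (simp add: \<rho>_def)
      qed
      have pw: "((1 / 2 ^ i) ^ Suc N) powr p * 2 ^ i = \<theta> ^ i"
      proof -
        have "((1 / 2 ^ i) ^ Suc N :: real) = 2 powr (- (real i * (1 + real N)))"
          by (simp add: powr_minus powr_realpow[symmetric] power_one_over power_mult[symmetric] inverse_eq_divide add_mult_distrib2
              flip: powr_realpow) (simp add: powr_add[symmetric] powr_realpow[symmetric] powr_powr algebra_simps)
        then have "((1 / 2 ^ i) ^ Suc N) powr p * 2 ^ i = 2 powr (- (real i * (1 + real N)) * p) * 2 powr real i"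
          by (simp add: powr_powr powr_realpow)
        also have "\<dots> = 2 powr ((1 - (1 + real N) * p) * real i)"
          by (simp add: powr_add[symmetric] algebra_simps)
        also have "\<dots> = \<theta> ^ i" by (simp add: \<theta>_def powr_realpow[symmetric] powr_powr)
        finally show ?thesis .
      qed
      have "(H * Lr powr (- 1 / p) * (1 / 2 ^ i) ^ Suc N) powr p * (2 * of_int (n0 + r + int N - (n0 - r) + 1))
          \<le> (H * Lr powr (- 1 / p) * (1 / 2 ^ i) ^ Suc N) powr p * (2 * (10 * real N * real (s i)))"
        by (intro mult_left_mono len) auto
      also have "\<dots> = Cfar * (((1 / 2 ^ i) ^ Suc N) powr p * 2 ^ i)"
      proof -
        have "(Lr powr (- 1 / p)) powr p = 1 / Lr"
          unfolding powr_powr using Lr p by (simp add: powr_minus_divide)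
        then have "(H * Lr powr (- 1 / p) * (1 / 2 ^ i) ^ Suc N) powr p
            = H powr p * (1 / Lr) * ((1 / 2 ^ i) ^ Suc N) powr p"
          using H Lr by (simp only: powr_mult)
        then show ?thesis using Lr by (simp add: Cfar_def s_def Lr_def del: power_Suc)
      qed
      finally show "(H * Lr powr (- 1 / p) * (1 / 2 ^ i) ^ Suc N) powr p * (2 * of_int (n0 + r + int N - (n0 - r) + 1))
          \<le> Cfar * \<theta> ^ i" unfolding pw .
    qed
    \<comment> \<open>The near piece: it agrees with \<open>T b\<close> close to the support of \<open>b\<close>, and elsewhere it is bounded like a
      far piece.\<close>
    have near_at: "atomic_sum p near Cnear"
    proof -
      define r where "r = 2 * \<rho> 0"
      have supp0: "supported_in (\<lambda>m. u m * \<eta> 0 m) {n0 - r..n0 + r}"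
        by (rule cut_supp) (simp add: \<eta>0 r_def)
      have supp1: "supported_in near {n0 - r..n0 + r + int N}"
        unfolding near_def by (rule supported_in_bdiff_pow[OF supp0])
      \<comment> \<open>This is \<open>6 * \<rho> 0\<close>; the support of the near piece has length about \<open>4 * \<rho> 0\<close>.\<close>
      define len where "len = 24 * N * L"
      have len1: "1 \<le> len" using N L1 by (simp add: len_def Suc_le_eq)
      have len: "n0 + r + int N - (n0 - r) + 1 \<le> int len"
      proof -
        have "int len = 6 * \<rho> 0" by (simp add: len_def \<rho>_def s_def)
        then show ?thesis using \<rho>4[of 0] N L1 unfolding r_def by linarith
      qed
      obtain k where k: "len \<le> 2 ^ k" "2 ^ k \<le> 2 * len" using dyad_length_exists[OF len1] by blast
      have lenk: "int len \<le> 2 ^ k" using k(1) by (metis of_nat_le_iff of_nat_numeral of_nat_power)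
      then have "n0 + r + int N < n0 - r + 2 ^ k" using len by linarith
      then have sub: "{n0 - r..n0 + r + int N} \<subseteq> dyad (n0 - r) k" by (auto simp: dyad_def)
      have supp: "supported_in near (dyad (n0 - r) k)" by (rule supported_in_mono[OF supp1 sub]) simp
      have mom: "vanishing_moments N near"
        using vanishing_moments_bdiff_pow[OF supp0, of N 0] by (simp add: near_def vanishing_moments_def[of 0])
      define Z where "Z = Lr powr (- 2 / p)"
      have LL: "(Lr powr (- 1 / p))\<^sup>2 = Z"
        unfolding Z_def power2_eq_square powr_add[symmetric] by (simp add: add_divide_distrib[symmetric])
      have pt: "(norm (near n))\<^sup>2 \<le> (norm (conv K b n))\<^sup>2 + H\<^sup>2 * Z" for n
      proof (cases "\<rho> 0 - int N \<le> \<bar>n - n0\<bar>")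
        case True
        have "norm (near n) \<le> H * Lr powr (- 1 / p) * (1 / 2 ^ 0) ^ Suc N"
          unfolding near_def
        proof (rule order_trans[OF piece small])
          fix j m assume "j \<le> N"
          then have "norm ((bdiff ^^ j) (\<eta> 0) m) \<le> 2 * (2 / real (s 0)) ^ j" by (rule \<eta>_diff)
          also have "\<dots> \<le> 4 * (2 / real (s 0)) ^ j" by (intro mult_right_mono) auto
          finally show "norm ((bdiff ^^ j) (\<eta> 0) m) \<le> 4 * (2 / real (s 0)) ^ j" .
        qed (rule True)
        then have "(norm (near n))\<^sup>2 \<le> (H * Lr powr (- 1 / p))\<^sup>2" by (intro power_mono) auto
        then show ?thesis unfolding power_mult_distrib LL by (simp add: add_increasing)
      next
        case False
        have "near n = (bdiff ^^ N) u n"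
          unfolding near_def
        proof (rule bdiff_pow_cong)
          fix m assume "n - int N \<le> m" "m \<le> n"
          then have "\<bar>m - n0\<bar> < \<rho> 0" using False by auto
          then show "u m * \<eta> 0 m = u m" by (simp add: \<eta>1)
        qed
        then show ?thesis by (simp add: Tb Z_def)
      qed
      have "(\<Sum>n\<in>dyad (n0 - r) k. (norm (near n))\<^sup>2) = (\<Sum>n\<in>{n0 - r..n0 + r + int N}. (norm (near n))\<^sup>2)"
        by (rule sum.mono_neutral_right) (use sub supp1 in \<open>auto simp: supported_in_def\<close>)
      also have "\<dots> \<le> (\<Sum>n\<in>{n0 - r..n0 + r + int N}. (norm (conv K b n))\<^sup>2 + H\<^sup>2 * Z)"
        by (rule sum_mono) (rule pt)
      also have "\<dots> = (\<Sum>n\<in>{n0 - r..n0 + r + int N}. (norm (conv K b n))\<^sup>2) + real (card {n0 - r..n0 + r + int N}) * (H\<^sup>2 * Z)"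
        by (simp add: sum.distrib)
      also have "\<dots> \<le> B * (Lr * Z) + (24 * real N * Lr) * (H\<^sup>2 * Z)"
      proof (intro add_mono mult_right_mono)
        have "(\<Sum>n\<in>{n0 - r..n0 + r + int N}. (norm (conv K b n))\<^sup>2) \<le> B * (\<Sum>n\<in>P. (norm (b n))\<^sup>2)"
          by (rule B(2)) (use b(1) in \<open>auto simp: P_def\<close>)
        also have "\<dots> \<le> B * (\<Sum>n\<in>P. Z)"
          unfolding LL[symmetric] by (intro mult_left_mono B(1) sum_mono power_mono b_le) auto
        also have "\<dots> = B * (Lr * Z)" by (simp add: cardP Lr_def)
        finally show "(\<Sum>n\<in>{n0 - r..n0 + r + int N}. (norm (conv K b n))\<^sup>2) \<le> B * (Lr * Z)" .
        have "card {n0 - r..n0 + r + int N} \<le> len" using len by simp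
        then have "real (card {n0 - r..n0 + r + int N}) \<le> real len" by (simp only: of_nat_le_iff)
        then show "real (card {n0 - r..n0 + r + int N}) \<le> 24 * real N * Lr" by (simp add: len_def Lr_def)
      qed (simp add: Z_def)
      also have "\<dots> = (B + 24 * real N * H\<^sup>2) * (Lr * Z)" by (simp add: algebra_simps)
      finally have sq: "(\<Sum>n\<in>dyad (n0 - r) k. (norm (near n))\<^sup>2) \<le> (B + 24 * real N * H\<^sup>2) * (Lr * Z)" .
      have k2: "(2::real) ^ k \<le> 48 * real N * Lr"
      proof -
        have "real (2 ^ k) \<le> real (2 * len)" using k(2) by (simp only: of_nat_le_iff)
        then show ?thesis by (simp add: len_def Lr_def)
      qed
      have "atomic_sum p near (Cs * ((2 ^ k) powr (1 - p / 2) * (\<Sum>n\<in>dyad (n0 - r) k. (norm (near n))\<^sup>2) powr (p / 2)))"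
        by (rule Cs(2)[OF supp mom])
      moreover have "Cs * ((2 ^ k) powr (1 - p / 2) * (\<Sum>n\<in>dyad (n0 - r) k. (norm (near n))\<^sup>2) powr (p / 2)) \<le> Cnear"
      proof -
        have "Cs * ((2 ^ k) powr (1 - p / 2) * (\<Sum>n\<in>dyad (n0 - r) k. (norm (near n))\<^sup>2) powr (p / 2))
           \<le> Cs * ((48 * real N * Lr) powr (1 - p / 2) * ((B + 24 * real N * H\<^sup>2) * (Lr * Z)) powr (p / 2))"
          using p by (intro mult_left_mono mult_mono powr_mono2 Cs(1) sq k2) (auto intro!: sum_nonneg)
        also have "\<dots> = Cs * ((48 * real N) powr (1 - p / 2) * (B + 24 * real N * H\<^sup>2) powr (p / 2) *
             (Lr powr (1 - p / 2) * (Lr * Z) powr (p / 2)))"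
          using B(1) Lr by (simp add: powr_mult Z_def)
        also have "Lr powr (1 - p / 2) * (Lr * Z) powr (p / 2) = 1"
        proof -
          have "(Lr * Z) powr (p / 2) = Lr powr ((1 + - 2 / p) * (p / 2))"
            using Lr unfolding Z_def powr_powr[symmetric] powr_add by simp
          also have "(1 + - 2 / p) * (p / 2) = p / 2 - 1" using p by (simp add: field_simps)
          finally have "Lr powr (1 - p / 2) * (Lr * Z) powr (p / 2) = Lr powr (1 - p / 2 + (p / 2 - 1))"
            by (simp only: powr_add)
          then show ?thesis using Lr by simp
        qed
        finally show ?thesis by (simp add: Cnear_def)
      qed
      ultimately show ?thesis by (rule atomic_sum_mono)
    qed
    define g where "g i = (case i of 0 \<Rightarrow> near | Suc i \<Rightarrow> far i)" for i
    define c where "c i = (case i of 0 \<Rightarrow> Cnear | Suc i \<Rightarrow> Cfar * \<theta> ^ i)" for i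
    have c_sums: "c sums C"
    proof -
      have "(\<lambda>i. Cfar * \<theta> ^ i) sums (Cfar * (1 / (1 - \<theta>)))"
        using \<theta> by (intro sums_mult geometric_sums) auto
      then have "(\<lambda>i. c (Suc i)) sums (C - Cnear)" by (simp add: c_def C_def)
      then show ?thesis using sums_Suc_iff[of c "C - Cnear"] by (simp add: c_def)
    qed
    have "atomic_sum p (conv K b) (\<Sum>i. c i)"
    proof (rule atomic_sum_countable[OF p])
      show "atomic_sum p (g i) (c i)" for i
        using near_at far_at by (simp add: g_def c_def split: nat.split)
      show "summable c" using c_sums by (rule sums_summable)
      show "(\<lambda>i. g i n) sums conv K b n" for n
      proof -
        have partial: "(\<Sum>i<Suc M. g i n) = (bdiff ^^ N) (\<lambda>m. u m * \<eta> M m) n" for M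
        proof (induction M)
          case 0
          then show ?case by (simp add: g_def near_def)
        next
          case (Suc M)
          have "(\<Sum>i<Suc (Suc M). g i n) = (bdiff ^^ N) (\<lambda>m. u m * \<eta> M m) n + (bdiff ^^ N) (\<lambda>m. u m * \<psi> M m) n"
            using Suc by (simp add: g_def far_def)
          also have "\<dots> = (bdiff ^^ N) (\<lambda>m. u m * \<eta> (Suc M) m) n"
            unfolding bdiff_pow_add[symmetric] \<psi>_def by (simp add: algebra_simps)
          finally show ?case .
        qed
        define M0 where "M0 = nat (\<bar>n - n0\<bar> + int N + 1)"
        have ev: "(\<Sum>i<Suc M. g i n) = conv K b n" if "M0 \<le> M" for M
          unfolding partial Tb[symmetric]
        proof (rule bdiff_pow_cong)
          fix m assume m: "n - int N \<le> m" "m \<le> n"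
          have "M < 2 ^ M" by (rule less_exp)
          also have "2 ^ M \<le> N * s M" using N L1 unfolding s_def
            by (metis (no_types, opaque_lifting) One_nat_def Suc_le_eq mult.assoc mult_le_mono1 nat_mult_1 nat_0_less_mult_iff zero_less_numeral)
          finally have "int M < \<rho> M" unfolding \<rho>_def by linarith
          then have "\<bar>m - n0\<bar> < \<rho> M" using m that unfolding M0_def by linarith
          then show "u m * \<eta> M m = u m" by (simp add: \<eta>1)
        qed
        have "(\<lambda>M. \<Sum>i<M. g i n) \<longlonglongrightarrow> conv K b n"
        proof (rule tendsto_eventually)
          show "\<forall>\<^sub>F M in sequentially. (\<Sum>i<M. g i n) = conv K b n"
            unfolding eventually_sequentially
          proof (intro exI[of _ "Suc M0"] allI impI)
            fix M assume "Suc M0 \<le> M"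
            then obtain M' where "M = Suc M'" "M0 \<le> M'" by (cases M) auto
            then show "(\<Sum>i<M. g i n) = conv K b n" using ev by blast
          qed
        qed
        then show ?thesis by (simp add: sums_def)
      qed
    qed
    then show ?thesis using c_sums by (simp add: sums_iff)
  qed
  have "0 \<le> C"
    using Cs(1) B(1) H \<theta> by (auto simp: C_def Cnear_def Cfar_def)
  then show ?thesis using main by blast
qed

end

section \<open>The convolution kernel of the multiplier\<close>

abbreviation circ :: "real measure" where "circ \<equiv> lebesgue_on {- pi<..<pi}"

abbreviation halfline :: "real measure" where "halfline \<equiv> lebesgue_on {0<..}"

lemma sigma_finite_lebesgue_on:
  fixes S :: "real set"
  assumes "S \<in> sets lebesgue"
  shows "sigma_finite_measure (lebesgue_on S)"
proof -
  have "sigma_finite_measure (lebesgue :: real measure)"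
  proof (intro sigma_finite_measure.intro exI[of _ "range (\<lambda>n::nat. {- real n..real n})"] conjI)
    show "\<Union> (range (\<lambda>n::nat. {- real n..real n})) = space lebesgue"
    proof (intro equalityI subsetI)
      fix x :: real
      obtain n :: nat where "\<bar>x\<bar> \<le> real n" using real_arch_simple by blast
      then show "x \<in> \<Union> (range (\<lambda>n::nat. {- real n..real n}))" by (auto simp: abs_le_iff intro!: exI[of _ n])
    qed simp
  qed auto
  then show ?thesis using assms by (rule sigma_finite_measure_restrict_space)
qed

lemma circ_finite: "finite_measure circ"
  by (intro finite_measure_lebesgue_on bounded_set_imp_lmeasurable) auto

lemma measurable_lebesgue_on_id [measurable]: "(\<lambda>x::real. x) \<in> borel_measurable (lebesgue_on S)"
  by (intro measurable_restrict_space1 measurable_completion) simp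

lemma circ_integral_eq:
  fixes f :: "real \<Rightarrow> complex"
  assumes "continuous_on {a..b} f"
  shows "integrable (lebesgue_on {a<..<b}) f" "(LINT x|lebesgue_on {a<..<b}. f x) = integral {a..b} f"
proof -
  have "integrable (lebesgue_on {a..b}) f" by (rule continuous_imp_integrable_real[OF assms])
  then show 1: "integrable (lebesgue_on {a<..<b}) f"
    using set_integrable_subset[of lebesgue "{a..b}" f "{a<..<b}"]
    by (auto simp: integrable_restrict_space set_integrable_def subset_iff)
  have "(LINT x|lebesgue_on {a<..<b}. f x) = integral {a<..<b} f"
    by (rule lebesgue_integral_eq_integral[OF 1]) auto
  also have "\<dots> = integral {a..b} f"
    using integral_open_interval[of a b f] by simp
  finally show "(LINT x|lebesgue_on {a<..<b}. f x) = integral {a..b} f" .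
qed

lemma nn_integral_exp_halfline:
  assumes "0 < a"
  shows "(\<integral>\<^sup>+t. ennreal (exp (- a * t)) \<partial>halfline) = ennreal (1 / a)"
proof -
  have "((\<lambda>x::real. exp (- a * x)) has_integral 1 / a) {0..}"
    using has_integral_exp_minus_to_infinity[OF assms, of 0] by simp
  then have "((\<lambda>x::real. exp (- a * x)) has_integral 1 / a) {0<..}"
    by (subst has_integral_spike_set_eq[of "{0<..}" "{0..}"]) (auto intro: negligible_subset[of "{0}"])
  then have "integral\<^sup>N lborel (\<lambda>x. indicator {0<..} x * exp (- a * x)) = ennreal (1 / a)"
    by (intro nn_integral_has_integral_lebesgue) auto
  moreover have "(\<integral>\<^sup>+t. ennreal (exp (- a * t)) \<partial>halfline) = integral\<^sup>N lborel (\<lambda>x. indicator {0<..} x * exp (- a * x))"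
    by (subst nn_integral_restrict_space)
       (auto simp: nn_integral_completion intro!: nn_integral_cong split: split_indicator)
  ultimately show ?thesis by simp
qed

text \<open>
  Let \<open>G\<close> be an entire primitive of \<open>F\<close>. By periodicity \<open>G (z + 2 * pi) - G z\<close> does not depend on \<open>z\<close>, so the endpoints
  \<open>- pi\<close> and \<open>pi\<close> may be moved to \<open>- pi * (1 + \<i> * c)\<close> and \<open>pi * (1 - \<i> * c)\<close>, which again differ by \<open>2 * pi\<close>. The new path runs along
  two segments that meet at the origin.
\<close>

lemma periodic_integral_shift:
  fixes F :: "complex \<Rightarrow> complex" and c :: real
  assumes hol: "F holomorphic_on UNIV" and per: "\<And>z. F (z + 2 * of_real pi) = F z"
  shows "integral {- pi..pi} (\<lambda>x. F (of_real x)) =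
    integral {0..pi} (\<lambda>x. F (of_real x * (1 - \<i> * of_real c)) * (1 - \<i> * of_real c)
                        + F (- of_real x * (1 + \<i> * of_real c)) * (1 + \<i> * of_real c))"
proof -
  obtain G where G: "\<And>z. (G has_field_derivative F z) (at z)"
    using holomorphic_convex_primitive'[OF convex_UNIV open_UNIV hol] by auto
  have line: "((\<lambda>x. F (of_real x * w) * w) has_integral G (of_real b * w) - G (of_real a * w)) {a..b}"
    if "a \<le> b" for a b :: real and w
  proof (rule fundamental_theorem_of_calculus[OF that])
    fix x assume "x \<in> {a..b}"
    have "((\<lambda>x. of_real x * w) has_vector_derivative w) (at x)"
      by (auto intro!: derivative_eq_intros simp: has_vector_derivative_def scaleR_conv_of_real)
    from field_vector_diff_chain_at[OF this G]
    have "((\<lambda>x. G (of_real x * w)) has_vector_derivative (w * F (of_real x * w))) (at x)"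
      by (simp add: o_def)
    then show "((\<lambda>x. G (of_real x * w)) has_vector_derivative F (of_real x * w) * w) (at x within {a..b})"
      by (simp add: has_vector_derivative_at_within mult.commute)
  qed
  define w1 where "w1 = 1 - \<i> * of_real c"
  define w2 where "w2 = 1 + \<i> * of_real c"
  have "((\<lambda>z. G (z + 2 * of_real pi) - G z) has_field_derivative 0) (at z)" for z
  proof -
    have "((\<lambda>z. G (z + 2 * of_real pi)) has_field_derivative F (z + 2 * of_real pi)) (at z)"
      using G[of "z + 2 * of_real pi"] by (simp add: DERIV_shift)
    from DERIV_diff[OF this G[of z]] show ?thesis by (simp add: per)
  qed
  then obtain k where k: "\<And>z. G (z + 2 * of_real pi) - G z = k"
    using has_field_derivative_zero_constant[of UNIV "\<lambda>z. G (z + 2 * of_real pi) - G z"] by auto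
  have e1: "- of_real pi * w2 + 2 * of_real pi = of_real pi * w1"
    by (simp add: w1_def w2_def algebra_simps)
  have "integral {- pi..pi} (\<lambda>x. F (of_real x)) = G (of_real pi) - G (- of_real pi)"
    using line[of "- pi" pi 1] by (simp add: integral_unique)
  also have "\<dots> = G (of_real pi * w1) - G (- of_real pi * w2)"
    using k[of "- of_real pi"] k[of "- of_real pi * w2"] e1 by (simp add: algebra_simps)
  also have "\<dots> = integral {0..pi} (\<lambda>x. F (of_real x * w1) * w1 + F (of_real x * (- w2)) * w2)"
  proof -
    have "((\<lambda>x. F (of_real x * w1) * w1 - F (of_real x * (- w2)) * (- w2)) has_integral
        (G (of_real pi * w1) - G (of_real 0 * w1)) - (G (of_real pi * (- w2)) - G (of_real 0 * (- w2)))) {0..pi}"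
      by (intro has_integral_diff line) auto
    then show ?thesis by (simp add: integral_unique)
  qed
  finally show ?thesis by (simp only: w1_def w2_def mult_minus_right mult_minus_left)
qed

lemma cosh_le:
  assumes "\<bar>y::real\<bar> \<le> 1"
  shows "(exp y + exp (- y)) / 2 \<le> 1 + y\<^sup>2" "1 \<le> (exp y + exp (- y)) / 2"
proof -
  have e: "exp \<bar>y\<bar> + exp (- \<bar>y\<bar>) = exp y + exp (- y)" by (simp add: abs_if)
  define x where "x = \<bar>y\<bar>"
  have x: "0 \<le> x" "x \<le> 1" using assms by (auto simp: x_def)
  have 1: "exp x \<le> 1 + x + x\<^sup>2" by (rule exp_bound[OF x])
  have "1 \<le> (1 - x + x\<^sup>2) * (1 + x)" using x by (simp add: algebra_simps power2_eq_square)
  also have "\<dots> \<le> (1 - x + x\<^sup>2) * exp x"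
    using x exp_ge_add_one_self[of x] sum_squares_bound[of 1 x]
    by (intro mult_left_mono) (auto simp: power2_eq_square)
  finally have "exp (- x) \<le> 1 - x + x\<^sup>2" by (simp add: exp_minus field_simps)
  then show "(exp y + exp (- y)) / 2 \<le> 1 + y\<^sup>2" using 1 e by (simp add: x_def)
  show "1 \<le> (exp y + exp (- y)) / 2"
    using add_mono[OF exp_ge_add_one_self[of y] exp_ge_add_one_self[of "- y"]] by simp
qed

lemma cos_le_quartic:
  fixes x :: real
  shows "cos x \<le> 1 - x\<^sup>2 / 2 + x ^ 4 / 24"
proof -
  have pos: "cos x \<le> 1 - x\<^sup>2 / 2 + x ^ 4 / 24" if x: "0 < x" for x :: real
  proof -
    obtain t where t: "cos x = (\<Sum>m<4. cos_coeff m * x ^ m) + (cos (t + 1/2 * real 4 * pi) / fact 4) * x ^ 4"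
      using Maclaurin_cos_expansion2[OF x, of 4] by auto
    have "(\<Sum>m<4. cos_coeff m * x ^ m) = 1 - x\<^sup>2 / 2"
    proof -
      have "{..<4::nat} = {0, 1, 2, 3}" by auto
      moreover have "cos_coeff 0 = 1" "cos_coeff 1 = 0" "cos_coeff 2 = - 1 / 2" "cos_coeff 3 = 0"
        by (simp_all add: cos_coeff_def)
      ultimately show ?thesis by simp
    qed
    moreover have "cos (t + 1/2 * real 4 * pi) / fact 4 * x ^ 4 \<le> 1 / 24 * x ^ 4"
      by (intro mult_right_mono) (auto simp: fact_numeral)
    ultimately show ?thesis using t by simp
  qed
  show ?thesis
  proof (cases "x = 0")
    case False
    then show ?thesis using pos[of "\<bar>x\<bar>"] by simp
  qed simp
qed

text \<open>
  On the rays of slope \<open>1 / 4\<close> the symbol of the Laplacian still has a real part comparable with \<open>(Re z)\<^sup>2\<close>. With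
  \<open>x = Re z\<close> and \<open>x\<^sup>2 \<le> 10\<close>, Taylor's formula gives \<open>1 - cos x \<ge> x\<^sup>2 / 12\<close>, of which the growth of the cosine off the
  axis takes away at most \<open>x\<^sup>2 / 16\<close>.
\<close>

lemma symbol_off_axis:
  fixes z :: complex
  assumes im: "\<bar>Im z\<bar> = \<bar>Re z\<bar> / 4" and re: "\<bar>Re z\<bar> \<le> pi"
  defines "L \<equiv> 2 - 2 * cos z"
  shows "(Re z)\<^sup>2 / 24 \<le> Re L"
    and "norm (1 - exp (\<i> * z)) \<le> (2 * exp 5) * \<bar>Re z\<bar>"
    and "norm L \<le> ((2 * exp 5) * \<bar>Re z\<bar>)\<^sup>2"
proof -
  define x where "x = Re z"
  define y where "y = Im z"
  have pi4: "pi < 3.15" using pi_approx(2) by simp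
  have y2: "y\<^sup>2 = x\<^sup>2 / 16"
  proof -
    have "y\<^sup>2 = (\<bar>x\<bar> / 4)\<^sup>2" using im by (metis power2_abs x_def y_def)
    then show ?thesis by (simp add: power_divide)
  qed
  have "pi\<^sup>2 \<le> 3.15\<^sup>2" using pi4 by (intro power_mono) auto
  then have pi2: "pi\<^sup>2 \<le> 10" by (simp add: power2_eq_square)
  have "\<bar>x\<bar>\<^sup>2 \<le> pi\<^sup>2" using re by (intro power_mono) (auto simp: x_def)
  then have x2: "x\<^sup>2 \<le> 10" using pi2 by simp
  have y1: "\<bar>y\<bar> \<le> 1" using im re pi4 by (simp add: x_def y_def)
  define h where "h = (exp y + exp (- y)) / 2"
  have h: "1 \<le> h" "h \<le> 1 + y\<^sup>2" unfolding h_def using cosh_le[OF y1] by auto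
  have "Re L = 2 - 2 * (cos x * h)"
    by (simp add: L_def Re_cos x_def y_def h_def)
  then have "Re L = 2 - 2 * (cos x + cos x * (h - 1))" by (simp add: algebra_simps)
  moreover have "cos x * (h - 1) \<le> 1 * (h - 1)" using h by (intro mult_right_mono) auto
  then have "2 - 2 * (cos x + 1 * (h - 1)) \<le> 2 - 2 * (cos x + cos x * (h - 1))"
    by (intro diff_left_mono mult_left_mono add_left_mono) auto
  ultimately have 1: "2 - 2 * (cos x + (h - 1)) \<le> Re L" by simp
  have "x ^ 4 = x\<^sup>2 * x\<^sup>2" by (simp add: power_numeral_reduce power2_eq_square)
  also have "\<dots> \<le> 10 * x\<^sup>2" using x2 by (intro mult_right_mono) auto
  finally have "cos x \<le> 1 - x\<^sup>2 / 2 + 10 * x\<^sup>2 / 24" using cos_le_quartic[of x] by simp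
  then show "(Re z)\<^sup>2 / 24 \<le> Re L" using 1 h y2 by (simp add: x_def)
  have nz: "norm z \<le> 5 / 4 * \<bar>x\<bar>" using norm_complex_def cmod_le[of z] im by (simp add: x_def)
  have nz5: "norm z \<le> 5" using nz re pi4 by (simp add: x_def)
  have e: "norm (1 - exp w) \<le> (2 * exp 5) * \<bar>x\<bar>" if "norm w = norm z" for w :: complex
  proof -
    have "norm (exp 0 - exp w) \<le> exp 5 * norm (0 - w)"
    proof (rule field_differentiable_bound[of "cball 0 5" exp exp])
      show "norm (exp v) \<le> exp 5" if "v \<in> cball 0 5" for v :: complex
        using that norm_exp[of v] by (meson exp_le_cancel_iff mem_cball_0 order_trans)
    qed (use that nz5 in \<open>auto intro: DERIV_subset[OF DERIV_exp]\<close>)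
    also have "\<dots> \<le> exp 5 * (2 * \<bar>x\<bar>)" using nz that by (intro mult_left_mono) auto
    finally show ?thesis by simp
  qed
  show n1: "norm (1 - exp (\<i> * z)) \<le> (2 * exp 5) * \<bar>Re z\<bar>"
    using e[of "\<i> * z"] by (simp add: norm_mult x_def)
  have n2: "norm (1 - exp (- (\<i> * z))) \<le> (2 * exp 5) * \<bar>Re z\<bar>"
    using e[of "- (\<i> * z)"] by (simp add: norm_mult x_def)
  have "L = (1 - exp (\<i> * z)) * (1 - exp (- (\<i> * z)))"
    by (simp add: L_def cos_exp_eq algebra_simps exp_add[symmetric])
  then have "norm L = norm (1 - exp (\<i> * z)) * norm (1 - exp (- (\<i> * z)))" by (simp add: norm_mult)
  also have "\<dots> \<le> ((2 * exp 5) * \<bar>Re z\<bar>) * ((2 * exp 5) * \<bar>Re z\<bar>)"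
    by (intro mult_mono n1 n2) auto
  finally show "norm L \<le> ((2 * exp 5) * \<bar>Re z\<bar>)\<^sup>2" by (simp add: power2_eq_square)
qed

text \<open>
  For real \<open>z\<close> this is the integrand of the \<open>j\<close>-th difference, at \<open>n\<close>, of the time derivative of the heat kernel, up
  to sign and normalization; the formula extends it to an entire function of \<open>z\<close>.
\<close>

definition heat_factor :: "nat \<Rightarrow> int \<Rightarrow> real \<Rightarrow> complex \<Rightarrow> complex" where
  "heat_factor j n t z =
     (2 - 2 * cos z) * exp (- of_real t * (2 - 2 * cos z)) * ((1 - exp (\<i> * z)) ^ j * exp (- (\<i> * of_int n * z)))"

lemma heat_factor_bound:
  assumes im: "\<bar>Im z\<bar> = \<bar>Re z\<bar> / 4" and re: "\<bar>Re z\<bar> \<le> pi" and t: "0 \<le> t"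
    and sgn: "of_int n * Im z = - (of_int \<bar>n\<bar> * \<bar>Re z\<bar> / 4)"
  shows "norm (heat_factor j n t z) \<le> (2 * exp 5) ^ (j + 2) *
     (\<bar>Re z\<bar> ^ (j + 2) * exp (- ((Re z)\<^sup>2 / 24) * t) * exp (- (of_int \<bar>n\<bar> / 4) * \<bar>Re z\<bar>))"
proof -
  note o = symbol_off_axis[OF im re]
  define a where "a = (2 * exp 5) * \<bar>Re z\<bar>"
  have a0: "0 \<le> a" by (simp add: a_def)
  have "norm (heat_factor j n t z) = norm (2 - 2 * cos z) * exp (Re (- of_real t * (2 - 2 * cos z))) *
     (norm (1 - exp (\<i> * z)) ^ j * exp (of_int n * Im z))"
    by (simp add: heat_factor_def norm_mult norm_power)
  also have "\<dots> \<le> a\<^sup>2 * exp (- ((Re z)\<^sup>2 / 24) * t) * (a ^ j * exp (- (of_int \<bar>n\<bar> / 4) * \<bar>Re z\<bar>))"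
  proof (intro mult_mono power_mono)
    show "norm (2 - 2 * cos z) \<le> a\<^sup>2" using o(3) by (simp add: a_def)
    show "norm (1 - exp (\<i> * z)) \<le> a" using o(2) by (simp add: a_def)
    show "exp (Re (- of_real t * (2 - 2 * cos z))) \<le> exp (- ((Re z)\<^sup>2 / 24) * t)"
      using mult_left_mono[OF o(1) t] by (simp add: mult.commute)
    show "exp (of_int n * Im z) \<le> exp (- (of_int \<bar>n\<bar> / 4) * \<bar>Re z\<bar>)" using sgn by simp
  qed (use a0 in auto)
  also have "\<dots> = a ^ (j + 2) * exp (- ((Re z)\<^sup>2 / 24) * t) * exp (- (of_int \<bar>n\<bar> / 4) * \<bar>Re z\<bar>)"
    by (simp add: power_add power2_eq_square mult_ac)
  finally show ?thesis by (simp add: a_def power_mult_distrib mult_ac)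
qed

text \<open>
  Move the contour to the rays of slope \<open>1 / 4\<close>, in the half plane in which \<open>exp (- (\<i> * n * z))\<close> decays. This gains
  the factor \<open>exp (- (\<bar>n\<bar> / 4) * x)\<close>, while the other factors are, up to constants, as small as on the real axis.
\<close>

lemma heat_kernel_bound:
  assumes t: "0 \<le> t"
  shows "ennreal (norm (LINT x|circ. heat_factor j n t (of_real x))) \<le>
     (\<integral>\<^sup>+x. ennreal (4 * (2 * exp 5) ^ (j + 2) * (x ^ (j + 2) * exp (- (x\<^sup>2 / 24) * t) * exp (- (of_int \<bar>n\<bar> / 4) * x)))
        \<partial>lebesgue_on {0<..<pi})"
proof -
  define F where "F = heat_factor j n t"
  have hol: "F holomorphic_on UNIV"
    unfolding F_def heat_factor_def by (intro holomorphic_intros)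
  have cont: "continuous_on A F" for A
    using holomorphic_on_imp_continuous_on[OF hol] continuous_on_subset by blast
  have per: "F (z + 2 * of_real pi) = F z" for z
  proof -
    have "exp (\<i> * (z + 2 * of_real pi)) = exp (\<i> * z)"
      using exp_plus_2pin[of "\<i> * z" 1] by (simp add: algebra_simps)
    moreover have "exp (- (\<i> * of_int n * (z + 2 * of_real pi))) = exp (- (\<i> * of_int n * z))"
      using exp_plus_2pin[of "- (\<i> * of_int n * z)" "- n"] by (simp add: algebra_simps)
    moreover have "exp (- (\<i> * (z + 2 * of_real pi))) = exp (- (\<i> * z))"
      using exp_plus_2pin[of "- (\<i> * z)" "- 1"] by (simp add: algebra_simps)
    ultimately show ?thesis by (simp only: F_def heat_factor_def cos_exp_eq)
  qed
  define c where "c = (if 0 \<le> n then 1 / 4 else - 1 / 4 :: real)"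
  define w1 where "w1 = 1 - \<i> * of_real c"
  define w2 where "w2 = 1 + \<i> * of_real c"
  define f where "f x = F (of_real x * w1) * w1 + F (- of_real x * w2) * w2" for x :: real
  have cf: "continuous_on {0..pi} f"
    unfolding f_def by (intro continuous_intros continuous_on_compose2[OF cont[of UNIV]]) auto
  have cF: "continuous_on {- pi..pi} (\<lambda>x. F (of_real x))"
    by (intro continuous_on_compose2[OF cont[of UNIV]] continuous_intros) auto
  have "(LINT x|circ. F (of_real x)) = integral {- pi..pi} (\<lambda>x. F (of_real x))"
    by (rule circ_integral_eq(2)[OF cF])
  also have "\<dots> = integral {0..pi} f"
    unfolding f_def w1_def w2_def by (rule periodic_integral_shift[OF hol per])
  also have "\<dots> = (LINT x|lebesgue_on {0<..<pi}. f x)" by (rule circ_integral_eq(2)[OF cf, symmetric])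
  finally have eq: "(LINT x|circ. F (of_real x)) = (LINT x|lebesgue_on {0<..<pi}. f x)" .
  have pt: "norm (f x) \<le> 4 * (2 * exp 5) ^ (j + 2) * (x ^ (j + 2) * exp (- (x\<^sup>2 / 24) * t) * exp (- (of_int \<bar>n\<bar> / 4) * x))"
    if x: "x \<in> {0<..<pi}" for x
  proof -
    define Q where "Q = (2 * exp 5) ^ (j + 2) * (x ^ (j + 2) * exp (- (x\<^sup>2 / 24) * t) * exp (- (of_int \<bar>n\<bar> / 4) * x))"
    have nw: "norm w1 \<le> 2" "norm w2 \<le> 2"
      using norm_triangle_ineq4[of 1 "\<i> * of_real c"] norm_triangle_ineq[of 1 "\<i> * of_real c"]
      by (auto simp: w1_def w2_def norm_mult c_def split: if_splits)
    have b: "norm (F z) \<le> Q" if "\<bar>Re z\<bar> = x" "Im z = - c * x" for z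
    proof -
      have "\<bar>Im z\<bar> = \<bar>Re z\<bar> / 4" using that x by (auto simp: c_def abs_mult)
      moreover have "of_int n * Im z = - (of_int \<bar>n\<bar> * \<bar>Re z\<bar> / 4)" using that x by (auto simp: c_def)
      moreover have "(Re z)\<^sup>2 = x\<^sup>2" using that by (metis power2_abs)
      ultimately show ?thesis
        using heat_factor_bound[of z t n j] that x t by (simp add: F_def Q_def)
    qed
    have "norm (f x) \<le> norm (F (of_real x * w1)) * norm w1 + norm (F (- of_real x * w2)) * norm w2"
      unfolding f_def by (rule order_trans[OF norm_triangle_ineq]) (simp add: norm_mult)
    also have "\<dots> \<le> Q * 2 + Q * 2"
      using x by (intro add_mono mult_mono b nw) (auto simp: w1_def w2_def Q_def)
    also have "\<dots> = 4 * Q" by simp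
    finally show ?thesis by (simp only: Q_def mult.assoc)
  qed
  have "ennreal (norm (LINT x|circ. F (of_real x))) \<le> (\<integral>\<^sup>+x. ennreal (norm (f x)) \<partial>lebesgue_on {0<..<pi})"
    unfolding eq by (rule integral_norm_bound_ennreal[OF circ_integral_eq(1)[OF cf]])
  also have "\<dots> \<le> (\<integral>\<^sup>+x. ennreal (4 * (2 * exp 5) ^ (j + 2) * (x ^ (j + 2) * exp (- (x\<^sup>2 / 24) * t) * exp (- (of_int \<bar>n\<bar> / 4) * x)))
        \<partial>lebesgue_on {0<..<pi})"
    by (intro nn_integral_mono ennreal_leI pt) simp
  finally show ?thesis by (simp add: F_def)
qed

lemma nn_integral_power_exp:
  assumes a: "0 < a"
  shows "(\<integral>\<^sup>+x. ennreal (x ^ j * exp (- a * x)) \<partial>lebesgue_on {0<..<pi}) \<le> ennreal (fact j * (2 / a) ^ Suc j)"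
proof -
  have pt: "x ^ j * exp (- a * x) \<le> fact j * (2 / a) ^ j * exp (- (a / 2) * x)" if "0 < x" for x
  proof -
    have E: "(a / 2 * x) ^ j / fact j \<le> exp (a / 2 * x)"
    proof -
      have s: "summable (\<lambda>n. (a / 2 * x) ^ n /\<^sub>R fact n)" by (rule summable_exp_generic)
      have "(\<Sum>n\<in>{j}. (a / 2 * x) ^ n /\<^sub>R fact n) \<le> (\<Sum>n. (a / 2 * x) ^ n /\<^sub>R fact n)"
        by (rule sum_le_suminf[OF s]) (use a that in auto)
      moreover have "(\<Sum>n\<in>{j}. g n /\<^sub>R fact n) = g j / fact j" for g :: "nat \<Rightarrow> real"
        by (simp add: field_simps)
      ultimately show ?thesis by (simp only: exp_def)
    qed
    have "x ^ j \<le> fact j * (2 / a) ^ j * exp (a / 2 * x)"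
    proof -
      have "(2 / a) ^ j * (a / 2) ^ j = (2 / a * (a / 2)) ^ j" by (rule power_mult_distrib[symmetric])
      also have "2 / a * (a / 2) = 1" using a by simp
      also have "(1::real) ^ j = 1" by (rule power_one)
      finally have A: "(2 / a) ^ j * (a / 2) ^ j = 1" .
      have "x ^ j = fact j * (2 / a) ^ j * ((a / 2 * x) ^ j / fact j)"
      proof -
        have "fact j * c * (d * y / fact j) = (c * d) * y" for c d y :: real by simp
        then have "fact j * (2 / a) ^ j * ((a / 2 * x) ^ j / fact j) = ((2 / a) ^ j * (a / 2) ^ j) * x ^ j"
          unfolding power_mult_distrib by blast
        then show ?thesis unfolding A by simp
      qed
      also have "\<dots> \<le> fact j * (2 / a) ^ j * exp (a / 2 * x)"
        using a by (intro mult_left_mono E) auto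
      finally show ?thesis .
    qed
    then have "x ^ j * exp (- a * x) \<le> fact j * (2 / a) ^ j * exp (a / 2 * x) * exp (- a * x)"
      by (rule mult_right_mono) simp
    also have "\<dots> = fact j * (2 / a) ^ j * exp (- (a / 2) * x)"
      by (simp add: mult.assoc exp_add[symmetric])
    finally show ?thesis .
  qed
  have "(\<integral>\<^sup>+x. ennreal (x ^ j * exp (- a * x)) \<partial>lebesgue_on {0<..<pi})
     \<le> (\<integral>\<^sup>+x. ennreal (fact j * (2 / a) ^ j * exp (- (a / 2) * x)) \<partial>lebesgue_on {0<..<pi})"
    by (intro nn_integral_mono ennreal_leI pt) simp
  also have "\<dots> \<le> (\<integral>\<^sup>+x. ennreal (fact j * (2 / a) ^ j * exp (- (a / 2) * x)) \<partial>halfline)"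
    by (simp add: nn_integral_restrict_space) (intro nn_integral_mono, auto split: split_indicator)
  also have "\<dots> = ennreal (fact j * (2 / a) ^ j) * (\<integral>\<^sup>+x. ennreal (exp (- (a / 2) * x)) \<partial>halfline)"
    using a by (subst nn_integral_cmult[symmetric]) (auto simp: ennreal_mult)
  also have "\<dots> = ennreal (fact j * (2 / a) ^ Suc j)"
    using a by (subst nn_integral_exp_halfline) (auto simp: ennreal_mult[symmetric] field_simps)
  finally show ?thesis .
qed

locale laplace_type_multiplier =
  fixes m \<Psi> :: "real \<Rightarrow> complex"
  assumes \<Psi>: "\<Psi> \<in> Linf_pos"
    and m_eq: "\<And>l. 0 < l \<Longrightarrow> m l = of_real l * (LINT t|halfline. of_real (exp (- l * t)) * \<Psi> t)"
begin

definition bound :: real where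
  "bound = (SOME B. 0 \<le> B \<and> (AE t in halfline. norm (\<Psi> t) \<le> B))"

lemma bound: "0 \<le> bound" "AE t in halfline. norm (\<Psi> t) \<le> bound"
proof -
  obtain B where "AE t in halfline. norm (\<Psi> t) \<le> B" using \<Psi> unfolding Linf_pos_def by blast
  then have "AE t in halfline. norm (\<Psi> t) \<le> max B 0" by (rule AE_mp) (auto intro!: AE_I2)
  then have "\<exists>B\<ge>0. AE t in halfline. norm (\<Psi> t) \<le> B" by (intro exI[of _ "max B 0"]) auto
  then have "0 \<le> bound \<and> (AE t in halfline. norm (\<Psi> t) \<le> bound)" unfolding bound_def by (rule someI_ex)
  then show "0 \<le> bound" "AE t in halfline. norm (\<Psi> t) \<le> bound" by auto
qed

lemma \<Psi>_measurable [measurable]: "\<Psi> \<in> borel_measurable halfline"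
  using \<Psi> by (simp add: Linf_pos_def)

definition lam :: "real \<Rightarrow> real" where "lam \<theta> = 2 * (1 - cos \<theta>)"

lemma lam_nonneg: "0 \<le> lam \<theta>" by (simp add: lam_def)

text \<open>
  At the zeros of \<open>lam\<close> the hypothesis says nothing about \<open>m\<close>; the value \<open>0\<close> is the one that the integral formula
  yields there.
\<close>

definition symbol :: "real \<Rightarrow> complex" where
  "symbol \<theta> = (if lam \<theta> = 0 then 0 else m (lam \<theta>))"

definition heat_symbol :: "real \<Rightarrow> real \<Rightarrow> complex" where
  "heat_symbol \<theta> t = of_real (lam \<theta> * exp (- lam \<theta> * t)) * \<Psi> t"

lemma heat_symbol_measurable [measurable]:
  "(\<lambda>(\<theta>, t). heat_symbol \<theta> t) \<in> borel_measurable (circ \<Otimes>\<^sub>M halfline)"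
  unfolding heat_symbol_def lam_def by measurable

lemma heat_symbol_nn:
  "(\<integral>\<^sup>+t. ennreal (norm (heat_symbol \<theta> t)) \<partial>halfline) \<le> ennreal bound"
proof (cases "lam \<theta> = 0")
  case True
  then show ?thesis by (simp add: heat_symbol_def)
next
  case False
  then have l: "0 < lam \<theta>" using lam_nonneg[of \<theta>] by simp
  have "(\<integral>\<^sup>+t. ennreal (norm (heat_symbol \<theta> t)) \<partial>halfline)
      \<le> (\<integral>\<^sup>+t. ennreal (bound * lam \<theta>) * ennreal (exp (- lam \<theta> * t)) \<partial>halfline)"
  proof (rule nn_integral_mono_AE)
    show "AE t in halfline. ennreal (norm (heat_symbol \<theta> t)) \<le> ennreal (bound * lam \<theta>) * ennreal (exp (- lam \<theta> * t))"
      using bound(2)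
    proof (rule AE_mp, intro AE_I2 impI)
      fix t assume "norm (\<Psi> t) \<le> bound"
      then have "lam \<theta> * exp (- lam \<theta> * t) * norm (\<Psi> t) \<le> lam \<theta> * exp (- lam \<theta> * t) * bound"
        using l by (intro mult_left_mono) auto
      then show "ennreal (norm (heat_symbol \<theta> t)) \<le> ennreal (bound * lam \<theta>) * ennreal (exp (- lam \<theta> * t))"
        using l bound(1) by (simp add: heat_symbol_def norm_mult ennreal_mult[symmetric] mult_ac)
    qed
  qed
  also have "\<dots> = ennreal (bound * lam \<theta>) * ennreal (1 / lam \<theta>)"
    unfolding nn_integral_exp_halfline[OF l, symmetric] by (rule nn_integral_cmult) measurable
  also have "\<dots> = ennreal bound" using l bound(1) by (simp add: ennreal_mult[symmetric])
  finally show ?thesis .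
qed

lemma heat_symbol_integrable: "integrable halfline (heat_symbol \<theta>)"
proof (rule integrableI_bounded)
  show "heat_symbol \<theta> \<in> borel_measurable halfline" unfolding heat_symbol_def[abs_def] by measurable
  show "(\<integral>\<^sup>+t. ennreal (norm (heat_symbol \<theta> t)) \<partial>halfline) < \<infinity>"
    using heat_symbol_nn[of \<theta>] by (simp add: le_less_trans)
qed

lemma symbol_eq: "symbol \<theta> = (LINT t|halfline. heat_symbol \<theta> t)"
proof (cases "lam \<theta> = 0")
  case True
  then show ?thesis by (simp add: symbol_def heat_symbol_def)
next
  case False
  then have l: "0 < lam \<theta>" using lam_nonneg[of \<theta>] by simp
  have "(LINT t|halfline. heat_symbol \<theta> t) = (LINT t|halfline. of_real (lam \<theta>) * (of_real (exp (- lam \<theta> * t)) * \<Psi> t))"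
    by (simp add: heat_symbol_def mult.assoc)
  then show ?thesis using False m_eq[OF l] by (simp add: symbol_def)
qed

lemma norm_symbol_le: "norm (symbol \<theta>) \<le> bound"
proof -
  have "ennreal (norm (symbol \<theta>)) \<le> (\<integral>\<^sup>+t. ennreal (norm (heat_symbol \<theta> t)) \<partial>halfline)"
    unfolding symbol_eq by (rule integral_norm_bound_ennreal[OF heat_symbol_integrable])
  also have "\<dots> \<le> ennreal bound" by (rule heat_symbol_nn)
  finally show ?thesis using bound(1) by simp
qed

lemma symbol_measurable [measurable]: "symbol \<in> borel_measurable circ"
proof -
  interpret sigma_finite_measure halfline by (rule sigma_finite_lebesgue_on) simp
  have "(\<lambda>\<theta>. LINT t|halfline. heat_symbol \<theta> t) \<in> borel_measurable circ" by measurable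
  then show ?thesis by (simp add: symbol_eq[abs_def])
qed

definition kernel :: "int \<Rightarrow> complex" where
  "kernel n = inv_fourier symbol n"

lemma symbol_times_integrable:
  assumes [measurable]: "w \<in> borel_measurable circ" and "\<And>\<theta>. norm (w \<theta>) \<le> W"
  shows "integrable circ (\<lambda>\<theta>. symbol \<theta> * w \<theta>)"
proof -
  interpret finite_measure circ by (rule circ_finite)
  have W: "0 \<le> W" using assms(2)[of 0] norm_ge_zero order_trans by blast
  show ?thesis
  proof (rule integrable_const_bound)
    show "AE \<theta> in circ. norm (symbol \<theta> * w \<theta>) \<le> bound * W"
      unfolding norm_mult using assms(2) norm_symbol_le bound(1) by (intro AE_I2 mult_mono) auto
  qed measurable
qed

lemma bdiff_pow_kernel:
  "(bdiff ^^ j) kernel n = 1 / (2 * of_real pi) *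
     (LINT \<theta>|circ. symbol \<theta> * ((1 - cis \<theta>) ^ j * cis (- (of_int n * \<theta>))))"
proof (induction j arbitrary: n)
  case 0
  then show ?case by (simp add: kernel_def inv_fourier_def)
next
  case (Suc j)
  have int: "integrable circ (\<lambda>\<theta>. symbol \<theta> * ((1 - cis \<theta>) ^ j * cis (- (of_int k * \<theta>))))" for k
  proof (rule symbol_times_integrable[where W = "2 ^ j"])
    show "(\<lambda>\<theta>. (1 - cis \<theta>) ^ j * cis (- (of_int k * \<theta>))) \<in> borel_measurable circ"
      unfolding cis_conv_exp by measurable
    have "norm (1 - cis \<theta>) ^ j \<le> 2 ^ j" for \<theta>
      using norm_triangle_ineq4[of 1 "cis \<theta>"] by (intro power_mono) auto
    then show "norm ((1 - cis \<theta>) ^ j * cis (- (of_int k * \<theta>))) \<le> 2 ^ j" for \<theta>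
      by (simp add: norm_mult norm_power)
  qed
  have "(bdiff ^^ Suc j) kernel n = (bdiff ^^ j) kernel n - (bdiff ^^ j) kernel (n - 1)"
    by (simp add: bdiff_def[of "(bdiff ^^ j) kernel"])
  also have "\<dots> = 1 / (2 * of_real pi) * (LINT \<theta>|circ. symbol \<theta> * ((1 - cis \<theta>) ^ j * cis (- (of_int n * \<theta>)))
       - symbol \<theta> * ((1 - cis \<theta>) ^ j * cis (- (of_int (n - 1) * \<theta>))))"
    unfolding Suc by (subst Bochner_Integration.integral_diff[OF int int]) (simp only: right_diff_distrib)
  also have "(\<lambda>\<theta>. symbol \<theta> * ((1 - cis \<theta>) ^ j * cis (- (of_int n * \<theta>)))
       - symbol \<theta> * ((1 - cis \<theta>) ^ j * cis (- (of_int (n - 1) * \<theta>))))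
     = (\<lambda>\<theta>. symbol \<theta> * ((1 - cis \<theta>) ^ Suc j * cis (- (of_int n * \<theta>))))"
  proof
    fix \<theta>
    have "cis (- (of_int (n - 1) * \<theta>)) = cis (- (of_int n * \<theta>)) * cis \<theta>"
      by (simp add: cis_mult algebra_simps)
    then show "symbol \<theta> * ((1 - cis \<theta>) ^ j * cis (- (of_int n * \<theta>)))
       - symbol \<theta> * ((1 - cis \<theta>) ^ j * cis (- (of_int (n - 1) * \<theta>)))
      = symbol \<theta> * ((1 - cis \<theta>) ^ Suc j * cis (- (of_int n * \<theta>)))"
      by (simp add: algebra_simps)
  qed
  finally show ?case .
qed

text \<open>
  The multiplier is a superposition, with density \<open>\<Psi>\<close>, of the time derivatives of the heat semigroup.
\<close>

lemma kernel_Fubini: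
  "(LINT \<theta>|circ. symbol \<theta> * ((1 - cis \<theta>) ^ j * cis (- (of_int n * \<theta>))))
    = (LINT t|halfline. \<Psi> t * (LINT \<theta>|circ. heat_factor j n t (of_real \<theta>)))"
proof -
  interpret P: pair_sigma_finite circ halfline
    by (intro pair_sigma_finite.intro sigma_finite_lebesgue_on) auto
  interpret C: finite_measure circ by (rule circ_finite)
  define w where "w \<theta> = (1 - cis \<theta>) ^ j * cis (- (of_int n * \<theta>))" for \<theta>
  have [measurable]: "w \<in> borel_measurable circ"
    unfolding w_def[abs_def] cis_conv_exp by measurable
  have W: "norm (w \<theta>) \<le> 2 ^ j" for \<theta>
  proof -
    have "norm (1 - cis \<theta>) ^ j \<le> 2 ^ j"
      using norm_triangle_ineq4[of 1 "cis \<theta>"] by (intro power_mono) auto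
    then show ?thesis by (simp add: w_def norm_mult norm_power)
  qed
  define f where "f = (\<lambda>(\<theta>, t). heat_symbol \<theta> t * w \<theta>)"
  have fm [measurable]: "f \<in> borel_measurable (circ \<Otimes>\<^sub>M halfline)"
  proof -
    have "(\<lambda>x. heat_symbol (fst x) (snd x) * w (fst x)) \<in> borel_measurable (circ \<Otimes>\<^sub>M halfline)"
      using heat_symbol_measurable by (intro borel_measurable_times) (simp_all add: case_prod_beta')
    then show ?thesis by (simp add: f_def case_prod_beta')
  qed
  have int_t: "integrable halfline (\<lambda>t. f (\<theta>, t))" for \<theta>
    unfolding f_def using heat_symbol_integrable[of \<theta>] by simp
  have "integrable (circ \<Otimes>\<^sub>M halfline) f"
  proof (rule P.Fubini_integrable[OF fm])
    show "AE \<theta> in circ. integrable halfline (\<lambda>t. f (\<theta>, t))" using int_t by simp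
    show "integrable circ (\<lambda>\<theta>. LINT t|halfline. norm (f (\<theta>, t)))"
    proof (rule C.integrable_const_bound)
      have "norm (LINT t|halfline. norm (f (\<theta>, t))) \<le> bound * 2 ^ j" for \<theta>
      proof -
        have "ennreal (LINT t|halfline. norm (f (\<theta>, t))) = (\<integral>\<^sup>+t. ennreal (norm (f (\<theta>, t))) \<partial>halfline)"
          by (rule nn_integral_eq_integral[symmetric]) (use int_t[of \<theta>] in auto)
        also have "\<dots> = (\<integral>\<^sup>+t. ennreal (norm (heat_symbol \<theta> t)) * ennreal (norm (w \<theta>)) \<partial>halfline)"
          by (simp add: f_def norm_mult ennreal_mult)
        also have "\<dots> = (\<integral>\<^sup>+t. ennreal (norm (heat_symbol \<theta> t)) \<partial>halfline) * ennreal (norm (w \<theta>))"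
          by (rule nn_integral_multc) (use heat_symbol_integrable[of \<theta>] in measurable)
        also have "\<dots> \<le> ennreal bound * ennreal (2 ^ j)"
          by (intro mult_mono heat_symbol_nn ennreal_leI W) auto
        also have "\<dots> = ennreal (bound * 2 ^ j)" using bound(1) by (simp add: ennreal_mult)
        finally have "(LINT t|halfline. norm (f (\<theta>, t))) \<le> bound * 2 ^ j" using bound(1) by simp
        moreover have "0 \<le> (LINT t|halfline. norm (f (\<theta>, t)))" by simp
        ultimately show ?thesis by simp
      qed
      then show "AE \<theta> in circ. norm (LINT t|halfline. norm (f (\<theta>, t))) \<le> bound * 2 ^ j" by simp
    qed measurable
  qed
  then have "(LINT t|halfline. LINT \<theta>|circ. f (\<theta>, t)) = (LINT \<theta>|circ. LINT t|halfline. f (\<theta>, t))"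
    using P.Fubini_integral[of "\<lambda>\<theta> t. f (\<theta>, t)"] by simp
  moreover have "(LINT t|halfline. f (\<theta>, t)) = symbol \<theta> * w \<theta>" for \<theta>
    unfolding f_def symbol_eq by simp
  moreover have "(LINT \<theta>|circ. f (\<theta>, t)) = \<Psi> t * (LINT \<theta>|circ. heat_factor j n t (of_real \<theta>))" for t
  proof -
    have "f (\<theta>, t) = \<Psi> t * heat_factor j n t (of_real \<theta>)" for \<theta>
      by (simp add: f_def heat_symbol_def heat_factor_def w_def lam_def cis_conv_exp algebra_simps
          flip: exp_of_real cos_of_real)
    then show ?thesis by simp
  qed
  ultimately show ?thesis by (simp add: w_def)
qed

text \<open>
  Integrate in time first: \<open>x\<^sup>2 * exp (- (x\<^sup>2 / 24) * t)\<close> integrates to \<open>24\<close>, whatever \<open>x\<close> is. What remains is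
  the integral of \<open>x ^ j * exp (- (\<bar>n\<bar> / 4) * x)\<close>, of order \<open>1 / \<bar>n\<bar> ^ (j + 1)\<close>.
\<close>

lemma kernel_difference_bound:
  "\<exists>C. \<forall>n. norm ((bdiff ^^ j) kernel n) * of_int \<bar>n\<bar> ^ Suc j \<le> C"
proof -
  define D where "D = 4 * (2 * exp 5 :: real) ^ (j + 2)"
  have D: "0 \<le> D" by (simp add: D_def)
  define C where "C = bound * (24 * D * (fact j * 8 ^ Suc j))"
  have "norm ((bdiff ^^ j) kernel n) * of_int \<bar>n\<bar> ^ Suc j \<le> C" for n
  proof (cases "n = 0")
    case True
    then show ?thesis using bound(1) D by (simp add: C_def)
  next
    case False
    define a where "a = real_of_int \<bar>n\<bar> / 4"
    have a: "0 < a" using False by (simp add: a_def)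
    interpret P: pair_sigma_finite "lebesgue_on {0<..<pi}" halfline
      by (intro pair_sigma_finite.intro sigma_finite_lebesgue_on) auto
    define q where "q x t = ennreal (D * (x ^ (j + 2) * exp (- (x\<^sup>2 / 24) * t) * exp (- a * x)))" for x t :: real
    have qm [measurable]: "(\<lambda>(x, t). q x t) \<in> borel_measurable (lebesgue_on {0<..<pi} \<Otimes>\<^sub>M halfline)"
      unfolding q_def by measurable
    define J where "J t = (LINT \<theta>|circ. heat_factor j n t (of_real \<theta>))" for t
    have "ennreal (norm (LINT t|halfline. \<Psi> t * J t)) \<le> (\<integral>\<^sup>+t. ennreal (norm (\<Psi> t * J t)) \<partial>halfline)"
    proof (cases "integrable halfline (\<lambda>t. \<Psi> t * J t)")
      case True then show ?thesis by (rule integral_norm_bound_ennreal)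
    next
      case False then show ?thesis by (simp add: not_integrable_integral_eq)
    qed
    also have "\<dots> \<le> (\<integral>\<^sup>+t. ennreal bound * (\<integral>\<^sup>+x. q x t \<partial>lebesgue_on {0<..<pi}) \<partial>halfline)"
    proof (rule nn_integral_mono_AE)
      show "AE t in halfline. ennreal (norm (\<Psi> t * J t)) \<le> ennreal bound * (\<integral>\<^sup>+x. q x t \<partial>lebesgue_on {0<..<pi})"
        using bound(2)
      proof (rule AE_mp, intro AE_I2 impI)
        fix t assume t: "t \<in> space halfline" and b: "norm (\<Psi> t) \<le> bound"
        then have "0 \<le> t" by simp
        then have "ennreal (norm (J t)) \<le> (\<integral>\<^sup>+x. q x t \<partial>lebesgue_on {0<..<pi})"
          unfolding J_def q_def D_def a_def by (rule heat_kernel_bound)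
        then show "ennreal (norm (\<Psi> t * J t)) \<le> ennreal bound * (\<integral>\<^sup>+x. q x t \<partial>lebesgue_on {0<..<pi})"
          using b unfolding norm_mult ennreal_mult[OF norm_ge_zero norm_ge_zero]
          by (intro mult_mono ennreal_leI) auto
      qed
    qed
    also have "\<dots> = ennreal bound * (\<integral>\<^sup>+t. \<integral>\<^sup>+x. q x t \<partial>lebesgue_on {0<..<pi} \<partial>halfline)"
      by (rule nn_integral_cmult) measurable
    also have "(\<integral>\<^sup>+t. \<integral>\<^sup>+x. q x t \<partial>lebesgue_on {0<..<pi} \<partial>halfline) = (\<integral>\<^sup>+x. \<integral>\<^sup>+t. q x t \<partial>halfline \<partial>lebesgue_on {0<..<pi})"
      by (rule P.Fubini'[OF qm])
    also have "\<dots> = (\<integral>\<^sup>+x. ennreal (24 * D) * ennreal (x ^ j * exp (- a * x)) \<partial>lebesgue_on {0<..<pi})"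
    proof (rule nn_integral_cong)
      fix x assume "x \<in> space (lebesgue_on {0<..<pi})"
      then have x: "0 < x" by simp
      have "(\<integral>\<^sup>+t. q x t \<partial>halfline) = (\<integral>\<^sup>+t. ennreal (D * x ^ (j + 2) * exp (- a * x)) * ennreal (exp (- (x\<^sup>2 / 24) * t)) \<partial>halfline)"
        unfolding q_def using D x by (simp add: ennreal_mult[symmetric] mult_ac)
      also have "\<dots> = ennreal (D * x ^ (j + 2) * exp (- a * x)) * ennreal (1 / (x\<^sup>2 / 24))"
      proof -
        have "0 < x\<^sup>2 / 24" using x by simp
        show ?thesis
          unfolding nn_integral_exp_halfline[OF \<open>0 < x\<^sup>2 / 24\<close>, symmetric] by (rule nn_integral_cmult) measurable
      qed
      also have "\<dots> = ennreal (24 * D) * ennreal (x ^ j * exp (- a * x))"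
        using x D by (simp add: ennreal_mult[symmetric] power_add power2_eq_square field_simps)
      finally show "(\<integral>\<^sup>+t. q x t \<partial>halfline) = ennreal (24 * D) * ennreal (x ^ j * exp (- a * x))" .
    qed
    also have "\<dots> = ennreal (24 * D) * (\<integral>\<^sup>+x. ennreal (x ^ j * exp (- a * x)) \<partial>lebesgue_on {0<..<pi})"
      by (rule nn_integral_cmult) measurable
    also have "ennreal bound * \<dots> \<le> ennreal bound * (ennreal (24 * D) * ennreal (fact j * (2 / a) ^ Suc j))"
      by (intro mult_left_mono nn_integral_power_exp a) auto
    also have "\<dots> = ennreal (bound * (24 * D * (fact j * (2 / a) ^ Suc j)))"
      using bound(1) D a by (simp add: ennreal_mult[symmetric])
    finally have "norm (LINT t|halfline. \<Psi> t * J t) \<le> bound * (24 * D * (fact j * (2 / a) ^ Suc j))"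
      using bound(1) D a by (simp add: ennreal_le_iff)
    moreover have "norm ((bdiff ^^ j) kernel n) \<le> norm (LINT t|halfline. \<Psi> t * J t)"
    proof -
      have "norm ((bdiff ^^ j) kernel n) = 1 / (2 * pi) * norm (LINT t|halfline. \<Psi> t * J t)"
        unfolding bdiff_pow_kernel kernel_Fubini J_def by (simp add: norm_mult norm_divide)
      also have "\<dots> \<le> 1 * norm (LINT t|halfline. \<Psi> t * J t)"
        using pi_ge_two by (intro mult_right_mono) auto
      finally show ?thesis by simp
    qed
    ultimately have "norm ((bdiff ^^ j) kernel n) \<le> bound * (24 * D * (fact j * (2 / a) ^ Suc j))" by linarith
    then have "norm ((bdiff ^^ j) kernel n) * of_int \<bar>n\<bar> ^ Suc j \<le> bound * (24 * D * (fact j * (2 / a) ^ Suc j)) * of_int \<bar>n\<bar> ^ Suc j"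
      by (rule mult_right_mono) simp
    also have "\<dots> = bound * (24 * D * (fact j * (2 / a * of_int \<bar>n\<bar>) ^ Suc j))"
      by (simp only: power_mult_distrib mult.assoc)
    also have "2 / a * of_int \<bar>n\<bar> = 8" using False by (simp add: a_def)
    finally show ?thesis by (simp add: C_def)
  qed
  then show ?thesis by blast
qed

end

section \<open>Norms with values in the extended reals\<close>

lemma epowr_le_iff:
  assumes "0 < a" "0 \<le> r"
  shows "epowr x a \<le> ennreal r \<longleftrightarrow> x \<le> ennreal (r powr (1 / a))"
proof (cases x)
  case (real y)
  have "y powr a \<le> r \<longleftrightarrow> y \<le> r powr (1 / a)"
  proof
    assume "y powr a \<le> r"
    then have "(y powr a) powr (1 / a) \<le> r powr (1 / a)" using assms by (intro powr_mono2) auto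
    then show "y \<le> r powr (1 / a)" using assms real by (simp add: powr_powr)
  next
    assume "y \<le> r powr (1 / a)"
    then have "y powr a \<le> (r powr (1 / a)) powr a" using assms real by (intro powr_mono2) auto
    then show "y powr a \<le> r" using assms by (simp add: powr_powr)
  qed
  then show ?thesis using real assms by (simp add: epowr_def)
next
  case top
  then show ?thesis by (simp add: epowr_def top_unique)
qed

lemma epowr_less_top: "epowr x a < top \<longleftrightarrow> x < top"
  by (simp add: epowr_def top.not_eq_extremum[symmetric])

text \<open>
  Together with the lemmas on norms below, this reduces bounds for norms with values in \<open>[0,\<infinity>]\<close> to bounds for
  finite sums of real numbers.
\<close>

lemma infsum_ennreal_le_iff:
  fixes g :: "'a \<Rightarrow> real"
  assumes "\<And>x. 0 \<le> g x" "0 \<le> c"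
  shows "(\<Sum>\<^sub>\<infinity>x\<in>A. ennreal (g x)) \<le> ennreal c \<longleftrightarrow> (\<forall>F. finite F \<longrightarrow> F \<subseteq> A \<longrightarrow> sum g F \<le> c)"
proof -
  have "(\<Sum>\<^sub>\<infinity>x\<in>A. ennreal (g x)) = (SUP F\<in>{F. finite F \<and> F \<subseteq> A}. \<Sum>x\<in>F. ennreal (g x))"
    by (rule nonneg_infsum_complete) simp
  also have "\<dots> = (SUP F\<in>{F. finite F \<and> F \<subseteq> A}. ennreal (sum g F))"
    using assms by (intro SUP_cong refl) (simp add: sum_ennreal)
  finally show ?thesis using assms by (auto simp: SUP_le_iff ennreal_le_iff)
qed

lemma lp_norm_le_iff:
  assumes "0 < p" "\<And>n. 0 \<le> w n" "0 \<le> C"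
  shows "lp_norm p w f \<le> ennreal C \<longleftrightarrow> (\<forall>F. finite F \<longrightarrow> (\<Sum>n\<in>F. norm (f n) powr p * w n) \<le> C powr p)"
proof -
  have "lp_norm p w f \<le> ennreal C \<longleftrightarrow> (\<Sum>\<^sub>\<infinity>n\<in>UNIV. ennreal (norm (f n) powr p * w n)) \<le> ennreal (C powr p)"
    unfolding lp_norm_def using assms by (subst epowr_le_iff) auto
  also have "\<dots> \<longleftrightarrow> (\<forall>F. finite F \<longrightarrow> (\<Sum>n\<in>F. norm (f n) powr p * w n) \<le> C powr p)"
    using assms by (subst infsum_ennreal_le_iff) auto
  finally show ?thesis .
qed

lemma lp_space_obtain:
  assumes "0 < p" "\<And>n. 0 \<le> w n" "f \<in> lp_space p w"
  obtains C where "0 \<le> C" "lp_norm p w f = ennreal C"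
    "\<And>F. finite F \<Longrightarrow> (\<Sum>n\<in>F. norm (f n) powr p * w n) \<le> C powr p"
proof -
  obtain C where C: "0 \<le> C" "lp_norm p w f = ennreal C"
    using assms(3) unfolding lp_space_def by (cases "lp_norm p w f") auto
  have "lp_norm p w f \<le> ennreal C" by (simp add: C(2))
  then have "\<forall>F. finite F \<longrightarrow> (\<Sum>n\<in>F. norm (f n) powr p * w n) \<le> C powr p"
    by (subst (asm) lp_norm_le_iff[OF assms(1,2) C(1)])
  then show ?thesis using C by (intro that[of C]) auto
qed

lemma lp_spaceI:
  assumes "0 < p" "\<And>n. 0 \<le> w n" "0 \<le> C" "\<And>F. finite F \<Longrightarrow> (\<Sum>n\<in>F. norm (f n) powr p * w n) \<le> C"
  shows "f \<in> lp_space p w"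
proof -
  have "(C powr (1 / p)) powr p = C" using assms by (simp add: powr_powr)
  then have "lp_norm p w f \<le> ennreal (C powr (1 / p))"
    using assms by (subst lp_norm_le_iff) auto
  then show ?thesis unfolding lp_space_def by (simp add: le_less_trans)
qed

lemma lp2_norm_le_iff:
  assumes "0 \<le> C"
  shows "lp_norm 2 unit_weight f \<le> ennreal C \<longleftrightarrow> (\<forall>F. finite F \<longrightarrow> (\<Sum>n\<in>F. (norm (f n))\<^sup>2) \<le> C\<^sup>2)"
  using assms by (subst lp_norm_le_iff) auto

lemma L2_norm_le_iff:
  assumes "0 \<le> C"
  shows "L2_norm_pi \<phi> \<le> ennreal C \<longleftrightarrow> (\<integral>\<^sup>+\<theta>. ennreal ((norm (\<phi> \<theta>))\<^sup>2) \<partial>circ) \<le> ennreal (C\<^sup>2)"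
  unfolding L2_norm_pi_def using assms by (subst epowr_le_iff) auto

lemma tendsto_zero_ennrealI:
  fixes f :: "nat \<Rightarrow> ennreal"
  assumes "\<And>j. f j \<le> ennreal (c j)" "c \<longlonglongrightarrow> 0" "\<And>j. 0 \<le> c j"
  shows "f \<longlonglongrightarrow> 0"
proof (rule tendsto_sandwich[of "\<lambda>_. 0" f sequentially "\<lambda>j. ennreal (c j)"])
  show "(\<lambda>j. ennreal (c j)) \<longlonglongrightarrow> 0" using tendsto_ennrealI[OF assms(2)] by simp
  show "\<forall>\<^sub>F j in sequentially. f j \<le> ennreal (c j)" using assms(1) by simp
qed auto

section \<open>Fourier series of square-summable sequences\<close>

lemma norm_diff_square_le:
  fixes x y :: complex
  shows "(norm (x - y))\<^sup>2 \<le> 2 * (norm (x - z))\<^sup>2 + 2 * (norm (z - y))\<^sup>2"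
proof -
  have "norm (x - y) \<le> norm (x - z) + norm (z - y)" using norm_triangle_ineq[of "x - z" "z - y"] by simp
  then have "(norm (x - y))\<^sup>2 \<le> (norm (x - z) + norm (z - y))\<^sup>2" by (intro power_mono) auto
  also have "\<dots> \<le> 2 * (norm (x - z))\<^sup>2 + 2 * (norm (z - y))\<^sup>2"
    using sum_squares_bound[of "norm (x - z)" "norm (z - y)"] by (simp add: power2_sum)
  finally show ?thesis .
qed

lemma fourier_l1_finite:
  assumes "supported_in f A"
  shows "fourier_l1 f \<theta> = (\<Sum>k\<in>A. f k * cis (of_int k * \<theta>))"
proof -
  have "fourier_l1 f \<theta> = (\<Sum>\<^sub>\<infinity>k\<in>A. f k * cis (of_int k * \<theta>))"
    unfolding fourier_l1_def by (rule infsum_cong_neutral) (use assms in \<open>auto simp: supported_in_def\<close>)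
  then show ?thesis using assms by (simp add: supported_in_def)
qed

lemma cis_measurable [measurable]: "(\<lambda>\<theta>. cis (c * \<theta>)) \<in> borel_measurable circ"
  unfolding cis_conv_exp by measurable

lemma integral_cis: "(LINT \<theta>|circ. cis (of_int k * \<theta>)) = (if k = 0 then 2 * of_real pi else 0)"
proof -
  have "continuous_on {- pi..pi} (\<lambda>\<theta>. cis (of_int k * \<theta>))"
    unfolding cis_conv_exp by (intro continuous_intros)
  from circ_integral_eq(2)[OF this]
  have eq: "(LINT \<theta>|circ. cis (of_int k * \<theta>)) = integral {- pi..pi} (\<lambda>\<theta>. cis (of_int k * \<theta>))" .
  show ?thesis
  proof (cases "k = 0")
    case True
    have "integral {- pi..pi} (\<lambda>\<theta>. 1 :: complex) = 2 * of_real pi"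
      by (subst integral_const_real) (simp add: scaleR_conv_of_real)
    then show ?thesis unfolding eq by (simp add: True)
  next
    case False
    define G where "G z = exp (\<i> * of_int k * z) / (\<i> * of_int k)" for z :: complex
    have "((\<lambda>x. cis (of_int k * x)) has_integral G (of_real pi) - G (of_real (- pi))) {- pi..pi}"
    proof (rule fundamental_theorem_of_calculus)
      fix x :: real
      have "(G has_field_derivative exp (\<i> * of_int k * of_real x)) (at (of_real x))"
        unfolding G_def using False by (auto intro!: derivative_eq_intros)
      moreover have "((\<lambda>x. of_real x) has_vector_derivative (1::complex)) (at x)"
        by (auto intro!: derivative_eq_intros simp: has_vector_derivative_def scaleR_conv_of_real)
      ultimately have "((G \<circ> of_real) has_vector_derivative (1 * exp (\<i> * of_int k * of_real x))) (at x)"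
        by (rule field_vector_diff_chain_at[rotated])
      then show "((\<lambda>x. G (of_real x)) has_vector_derivative cis (of_int k * x)) (at x within {- pi..pi})"
        by (simp add: o_def cis_conv_exp has_vector_derivative_at_within mult.assoc)
    qed simp
    moreover have "G (of_real pi) = G (of_real (- pi))"
    proof -
      have "exp (\<i> * of_int k * of_real pi) = exp (\<i> * of_int k * of_real (- pi))"
        using exp_plus_2pin[of "\<i> * of_int k * of_real (- pi)" k] by (simp add: algebra_simps)
      then show ?thesis by (simp add: G_def)
    qed
    ultimately show ?thesis unfolding eq using False by (simp add: integral_unique)
  qed
qed

lemma circ_integrable_bounded:
  fixes h :: "real \<Rightarrow> complex"
  assumes "h \<in> borel_measurable circ" "\<And>\<theta>. norm (h \<theta>) \<le> W"
  shows "integrable circ h"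
  by (rule finite_measure.integrable_const_bound[OF circ_finite, of _ W]) (use assms in auto)

lemma emeasure_circ: "emeasure circ (space circ) = ennreal (2 * pi)"
  by (simp add: emeasure_restrict_space)

lemma trig_poly_bounded: "norm (\<Sum>k\<in>A. c k * cis (of_int k * \<theta>)) \<le> (\<Sum>k\<in>A. norm (c k))"
  by (rule order_trans[OF norm_sum]) (simp add: norm_mult)

text \<open>
  Expand the square of the difference between \<open>h\<close> and its partial Fourier sum over \<open>F\<close>. For a trigonometric
  polynomial with frequencies in \<open>F\<close> the same computation gives equality.
\<close>

lemma Bessel:
  assumes h [measurable]: "h \<in> borel_measurable circ" and W: "\<And>\<theta>. norm (h \<theta>) \<le> W" and F: "finite F"
  shows "2 * pi * (\<Sum>n\<in>F. (norm (inv_fourier h n))\<^sup>2) \<le> (LINT \<theta>|circ. (norm (h \<theta>))\<^sup>2)"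
    and "(\<And>\<theta>. h \<theta> = (\<Sum>n\<in>F. c n * cis (of_int n * \<theta>))) \<Longrightarrow> (LINT \<theta>|circ. (norm (h \<theta>))\<^sup>2) = 2 * pi * (\<Sum>n\<in>F. (norm (c n))\<^sup>2)"
proof -
  define a where "a n = inv_fourier h n" for n
  define S where "S c \<theta> = (\<Sum>n\<in>F. c n * cis (of_int n * \<theta>))" for c :: "int \<Rightarrow> complex" and \<theta>
  have W0: "0 \<le> W" using W[of 0] norm_ge_zero order_trans by blast
  have S_meas [measurable]: "S c \<in> borel_measurable circ" for c unfolding S_def[abs_def] by measurable
  have S_bd: "norm (S c \<theta>) \<le> (\<Sum>n\<in>F. norm (c n))" for c \<theta>
    unfolding S_def by (rule trig_poly_bounded)
  have h_cis: "(LINT \<theta>|circ. h \<theta> * cis (- (of_int n * \<theta>))) = 2 * of_real pi * a n" for n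
    by (simp add: a_def inv_fourier_def)
  have cis_m: "(\<lambda>\<theta>. cis (- (of_int n * \<theta>))) \<in> borel_measurable circ" for n
    unfolding cis_conv_exp by measurable
  have int1: "integrable circ (\<lambda>\<theta>. h' \<theta> * cis (- (of_int n * \<theta>)))"
    if "h' \<in> borel_measurable circ" "\<And>\<theta>. norm (h' \<theta>) \<le> W'" for h' :: "real \<Rightarrow> complex" and W' n
    by (rule circ_integrable_bounded[where W = W']) (use that cis_m in \<open>auto simp: norm_mult\<close>)
  have cnjS: "cnj (S c \<theta>) = (\<Sum>n\<in>F. cnj (c n) * cis (- (of_int n * \<theta>)))" for c \<theta>
    by (simp add: S_def cis_cnj)
  have pair: "(LINT \<theta>|circ. h' \<theta> * cnj (S c \<theta>)) = (\<Sum>n\<in>F. cnj (c n) * (LINT \<theta>|circ. h' \<theta> * cis (- (of_int n * \<theta>))))"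
    if "h' \<in> borel_measurable circ" "\<And>\<theta>. norm (h' \<theta>) \<le> W'" for h' :: "real \<Rightarrow> complex" and W' c
  proof -
    have "(LINT \<theta>|circ. h' \<theta> * cnj (S c \<theta>)) = (LINT \<theta>|circ. (\<Sum>n\<in>F. cnj (c n) * (h' \<theta> * cis (- (of_int n * \<theta>)))))"
      by (simp add: cnjS sum_distrib_left mult_ac)
    also have "\<dots> = (\<Sum>n\<in>F. LINT \<theta>|circ. cnj (c n) * (h' \<theta> * cis (- (of_int n * \<theta>))))"
      by (rule Bochner_Integration.integral_sum) (intro integrable_mult_right int1[OF that])
    finally show ?thesis by simp
  qed
  have S_cis: "(LINT \<theta>|circ. S c \<theta> * cis (- (of_int n * \<theta>))) = 2 * of_real pi * c n" if "n \<in> F" for n c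
  proof -
    have "(LINT \<theta>|circ. S c \<theta> * cis (- (of_int n * \<theta>))) = (LINT \<theta>|circ. (\<Sum>k\<in>F. c k * cis (of_int (k - n) * \<theta>)))"
      unfolding S_def sum_distrib_right by (simp add: mult.assoc cis_mult algebra_simps)
    also have "\<dots> = (\<Sum>k\<in>F. LINT \<theta>|circ. c k * cis (of_int (k - n) * \<theta>))"
      by (rule Bochner_Integration.integral_sum)
        (intro integrable_mult_right circ_integrable_bounded[where W = 1] cis_measurable, simp)
    also have "\<dots> = (\<Sum>k\<in>F. if k = n then 2 * of_real pi * c k else 0)"
      by (intro sum.cong refl) (simp only: Bochner_Integration.integral_mult_right_zero integral_cis, simp)
    also have "\<dots> = 2 * of_real pi * c n" using that F by simp
    finally show ?thesis .
  qed
  have SS: "(LINT \<theta>|circ. S c \<theta> * cnj (S c \<theta>)) = of_real (2 * pi * (\<Sum>n\<in>F. (norm (c n))\<^sup>2))" for c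
  proof -
    have "(LINT \<theta>|circ. S c \<theta> * cnj (S c \<theta>)) = (\<Sum>n\<in>F. cnj (c n) * (2 * of_real pi * c n))"
      by (subst pair[OF S_meas S_bd]) (simp add: S_cis cong: sum.cong)
    also have "\<dots> = of_real (2 * pi * (\<Sum>n\<in>F. (norm (c n))\<^sup>2))"
      by (simp add: sum_distrib_left complex_norm_square mult_ac del: of_real_power)
    finally show ?thesis .
  qed
  have sqint: "integrable circ (\<lambda>\<theta>. u \<theta> * cnj (v \<theta>))"
    if [measurable]: "u \<in> borel_measurable circ" "v \<in> borel_measurable circ" and "\<And>\<theta>. norm (u \<theta>) \<le> U" "\<And>\<theta>. norm (v \<theta>) \<le> V"
    for u v :: "real \<Rightarrow> complex" and U V
  proof (rule circ_integrable_bounded[where W = "U * V"])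
    have "0 \<le> U" using that(3)[of 0] norm_ge_zero order_trans by blast
    then show "norm (u \<theta> * cnj (v \<theta>)) \<le> U * V" for \<theta>
      unfolding norm_mult complex_mod_cnj by (intro mult_mono that) auto
    show "(\<lambda>\<theta>. u \<theta> * cnj (v \<theta>)) \<in> borel_measurable circ"
      using borel_measurable_continuous_onI[OF continuous_on_cnj[OF continuous_on_id]] by measurable
  qed
  have norm_int: "of_real (LINT \<theta>|circ. (norm (u \<theta>))\<^sup>2) = (LINT \<theta>|circ. u \<theta> * cnj (u \<theta>))" for u
    unfolding integral_complex_of_real[symmetric] by (simp only: complex_norm_square)
  show "(LINT \<theta>|circ. (norm (h \<theta>))\<^sup>2) = 2 * pi * (\<Sum>n\<in>F. (norm (c n))\<^sup>2)"
    if "\<And>\<theta>. h \<theta> = (\<Sum>n\<in>F. c n * cis (of_int n * \<theta>))"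
  proof -
    have "h = S c" using that by (simp add: S_def fun_eq_iff)
    then have "complex_of_real (LINT \<theta>|circ. (norm (h \<theta>))\<^sup>2) = of_real (2 * pi * (\<Sum>n\<in>F. (norm (c n))\<^sup>2))"
      using norm_int[of h] SS[of c] by simp
    then show ?thesis by (simp only: of_real_eq_iff)
  qed
  have hS: "(LINT \<theta>|circ. h \<theta> * cnj (S a \<theta>)) = of_real (2 * pi * (\<Sum>n\<in>F. (norm (a n))\<^sup>2))"
    unfolding pair[OF h W] h_cis
    by (simp add: sum_distrib_left complex_norm_square mult_ac del: of_real_power)
  have Sh: "(LINT \<theta>|circ. S a \<theta> * cnj (h \<theta>)) = of_real (2 * pi * (\<Sum>n\<in>F. (norm (a n))\<^sup>2))"
  proof -
    have "(LINT \<theta>|circ. S a \<theta> * cnj (h \<theta>)) = (LINT \<theta>|circ. cnj (h \<theta> * cnj (S a \<theta>)))"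
      by (simp add: mult.commute)
    also have "\<dots> = cnj (LINT \<theta>|circ. h \<theta> * cnj (S a \<theta>))"
      by (rule Bochner_Integration.integral_cnj)
    finally show ?thesis unfolding hS by simp
  qed
  have "0 \<le> (LINT \<theta>|circ. (norm (h \<theta> - S a \<theta>))\<^sup>2)" by simp
  moreover have "complex_of_real (LINT \<theta>|circ. (norm (h \<theta> - S a \<theta>))\<^sup>2)
     = of_real ((LINT \<theta>|circ. (norm (h \<theta>))\<^sup>2) - 2 * pi * (\<Sum>n\<in>F. (norm (a n))\<^sup>2))"
  proof -
    have "complex_of_real (LINT \<theta>|circ. (norm (h \<theta> - S a \<theta>))\<^sup>2)
       = (LINT \<theta>|circ. (h \<theta> * cnj (h \<theta>) - h \<theta> * cnj (S a \<theta>)) - (S a \<theta> * cnj (h \<theta>) - S a \<theta> * cnj (S a \<theta>)))"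
      unfolding norm_int by (simp add: algebra_simps)
    also have "\<dots> = ((LINT \<theta>|circ. h \<theta> * cnj (h \<theta>)) - (LINT \<theta>|circ. h \<theta> * cnj (S a \<theta>)))
        - ((LINT \<theta>|circ. S a \<theta> * cnj (h \<theta>)) - (LINT \<theta>|circ. S a \<theta> * cnj (S a \<theta>)))"
    proof -
      note i = sqint[OF h h W W] sqint[OF h S_meas W S_bd] sqint[OF S_meas h S_bd W] sqint[OF S_meas S_meas S_bd S_bd]
      show ?thesis
        by (simp only: Bochner_Integration.integral_diff i Bochner_Integration.integrable_diff)
    qed
    also have "\<dots> = of_real ((LINT \<theta>|circ. (norm (h \<theta>))\<^sup>2) - 2 * pi * (\<Sum>n\<in>F. (norm (a n))\<^sup>2))"
      unfolding hS Sh SS norm_int[symmetric] by simp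
    finally show ?thesis .
  qed
  then have "(LINT \<theta>|circ. (norm (h \<theta> - S a \<theta>))\<^sup>2) = (LINT \<theta>|circ. (norm (h \<theta>))\<^sup>2) - 2 * pi * (\<Sum>n\<in>F. (norm (a n))\<^sup>2)"
    by (simp only: of_real_eq_iff)
  ultimately show "2 * pi * (\<Sum>n\<in>F. (norm (inv_fourier h n))\<^sup>2) \<le> (LINT \<theta>|circ. (norm (h \<theta>))\<^sup>2)"
    by (simp add: a_def)
qed

lemma fourier_finite_measurable:
  assumes "supported_in f A"
  shows "fourier_l1 f \<in> borel_measurable circ"
  unfolding fourier_l1_finite[OF assms, abs_def] by measurable

lemma Parseval_finite:
  assumes f: "supported_in f A"
  shows "(LINT \<theta>|circ. (norm (fourier_l1 f \<theta>))\<^sup>2) = 2 * pi * (\<Sum>k\<in>A. (norm (f k))\<^sup>2)"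
    and "(\<integral>\<^sup>+\<theta>. ennreal ((norm (fourier_l1 f \<theta>))\<^sup>2) \<partial>circ) = ennreal (2 * pi * (\<Sum>k\<in>A. (norm (f k))\<^sup>2))"
proof -
  have A: "finite A" using f by (simp add: supported_in_def)
  note m = fourier_finite_measurable[OF f]
  have bd: "norm (fourier_l1 f \<theta>) \<le> (\<Sum>k\<in>A. norm (f k))" for \<theta>
    unfolding fourier_l1_finite[OF f] by (rule trig_poly_bounded)
  show 1: "(LINT \<theta>|circ. (norm (fourier_l1 f \<theta>))\<^sup>2) = 2 * pi * (\<Sum>k\<in>A. (norm (f k))\<^sup>2)"
    by (rule Bessel(2)[OF m bd A]) (rule fourier_l1_finite[OF f])
  have "integrable circ (\<lambda>\<theta>. (norm (fourier_l1 f \<theta>))\<^sup>2)"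
    using m by (intro finite_measure.integrable_const_bound[OF circ_finite, of _ "(\<Sum>k\<in>A. norm (f k))\<^sup>2"])
      (auto intro!: power_mono bd)
  then show "(\<integral>\<^sup>+\<theta>. ennreal ((norm (fourier_l1 f \<theta>))\<^sup>2) \<partial>circ) = ennreal (2 * pi * (\<Sum>k\<in>A. (norm (f k))\<^sup>2))"
    using 1 by (subst nn_integral_eq_integral) auto
qed

lemma fourier_l1_diff_finite:
  assumes "supported_in f A" "supported_in g A"
  shows "fourier_l1 f \<theta> - fourier_l1 g \<theta> = fourier_l1 (\<lambda>n. f n - g n) \<theta>"
proof -
  have "supported_in (\<lambda>n. f n - g n) A" using assms by (auto simp: supported_in_def)
  then show ?thesis using assms by (simp add: fourier_l1_finite sum_subtractf left_diff_distrib)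
qed

lemma l2_tail:
  assumes f: "f \<in> lp_space 2 unit_weight" and e: "0 < e"
  shows "\<exists>A. finite A \<and> (\<forall>F. finite F \<longrightarrow> (\<Sum>n\<in>F. (norm (f n - cut A f n))\<^sup>2) \<le> e)"
proof -
  obtain C where C: "0 \<le> C" "\<And>F. finite F \<Longrightarrow> (\<Sum>n\<in>F. (norm (f n))\<^sup>2) \<le> C\<^sup>2"
    using lp_space_obtain[OF _ _ f] by (metis (no_types, lifting) mult.right_neutral norm_ge_zero
        powr_numeral sum.cong zero_le_one zero_less_numeral)
  define s where "s = (SUP F\<in>{F. finite F}. \<Sum>n\<in>F. (norm (f n))\<^sup>2)"
  have bdd: "bdd_above ((\<lambda>F. \<Sum>n\<in>F. (norm (f n))\<^sup>2) ` {F. finite F})"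
    using C(2) by (auto intro!: bdd_aboveI)
  have "\<exists>A\<in>{F. finite F}. s - e < (\<Sum>n\<in>A. (norm (f n))\<^sup>2)"
    using less_cSUP_iff[OF _ bdd, of "s - e"] e by (auto simp: s_def)
  then obtain A where A: "finite A" "s - e < (\<Sum>n\<in>A. (norm (f n))\<^sup>2)" by blast
  have "(\<Sum>n\<in>F. (norm (f n - cut A f n))\<^sup>2) \<le> e" if F: "finite F" for F
  proof -
    have "(\<Sum>n\<in>F. (norm (f n - cut A f n))\<^sup>2) = (\<Sum>n\<in>F - A. (norm (f n))\<^sup>2)"
      using F by (intro sum.mono_neutral_cong_right) (auto simp: cut_def)
    also have "\<dots> = (\<Sum>n\<in>F \<union> A. (norm (f n))\<^sup>2) - (\<Sum>n\<in>A. (norm (f n))\<^sup>2)"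
      using F A(1) sum.subset_diff[of A "F \<union> A" "\<lambda>n. (norm (f n))\<^sup>2"] by (simp add: Un_Diff)
    also have "(\<Sum>n\<in>F \<union> A. (norm (f n))\<^sup>2) \<le> s"
      unfolding s_def using bdd F A(1) by (intro cSUP_upper) auto
    finally show ?thesis using A(2) by linarith
  qed
  then show ?thesis using A(1) by blast
qed

lemma young_half:
  fixes u e :: real
  assumes "0 < e"
  shows "u \<le> (e + u\<^sup>2 / e) / 2"
  using assms sum_squares_bound[of u e] by (simp add: field_simps power2_eq_square)

lemma nn_integral_young:
  assumes [measurable]: "u \<in> borel_measurable circ" and e: "0 < e"
    and b: "(\<integral>\<^sup>+\<theta>. ennreal ((norm (u \<theta> :: complex))\<^sup>2) \<partial>circ) \<le> ennreal b" and b0: "0 \<le> b"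
  shows "(\<integral>\<^sup>+\<theta>. ennreal (norm (u \<theta>)) \<partial>circ) \<le> ennreal (pi * e + b / (2 * e))"
proof -
  have "(\<integral>\<^sup>+\<theta>. ennreal (norm (u \<theta>)) \<partial>circ) \<le> (\<integral>\<^sup>+\<theta>. ennreal (e / 2) + ennreal (1 / (2 * e)) * ennreal ((norm (u \<theta>))\<^sup>2) \<partial>circ)"
  proof (rule nn_integral_mono)
    fix \<theta>
    have "norm (u \<theta>) \<le> e / 2 + 1 / (2 * e) * (norm (u \<theta>))\<^sup>2"
      using young_half[OF e, of "norm (u \<theta>)"] by (simp add: add_divide_distrib)
    then show "ennreal (norm (u \<theta>)) \<le> ennreal (e / 2) + ennreal (1 / (2 * e)) * ennreal ((norm (u \<theta>))\<^sup>2)"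
      using e by (simp add: ennreal_plus[symmetric] ennreal_mult[symmetric] ennreal_leI del: ennreal_plus)
  qed
  also have "\<dots> = ennreal (e / 2) * emeasure circ (space circ) + ennreal (1 / (2 * e)) * (\<integral>\<^sup>+\<theta>. ennreal ((norm (u \<theta>))\<^sup>2) \<partial>circ)"
    by (subst nn_integral_add) (simp_all add: nn_integral_cmult)
  also have "\<dots> \<le> ennreal (e / 2) * ennreal (2 * pi) + ennreal (1 / (2 * e)) * ennreal b"
    unfolding emeasure_circ by (intro add_mono mult_left_mono b) auto
  also have "\<dots> = ennreal (pi * e + b / (2 * e))"
    using e b0 by (simp add: ennreal_plus[symmetric] ennreal_mult[symmetric] mult.commute del: ennreal_plus)
  finally show ?thesis .
qed

text \<open>
  Truncate \<open>f\<close> so that the \<open>j\<close>-th error is at most \<open>2 powr (- j)\<close> in \<open>\<ell>\<^sup>2\<close>. By Parseval the Fourier sums of the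
  truncations then differ so little that they converge almost everywhere, and Fatou's lemma shows that they
  converge in \<open>L\<^sup>2\<close> as well.
\<close>

lemma Riesz_Fischer:
  assumes f: "f \<in> lp_space 2 unit_weight"
  shows "\<exists>\<phi>. is_fourier_l2 f \<phi>"
proof -
  have "\<forall>j::nat. \<exists>A. finite A \<and> (\<forall>F. finite F \<longrightarrow> (\<Sum>n\<in>F. (norm (f n - cut A f n))\<^sup>2) \<le> (1 / 4) ^ j)"
    using l2_tail[OF f] by simp
  then obtain A where A: "\<And>j. finite (A j)"
    "\<And>j F. finite F \<Longrightarrow> (\<Sum>n\<in>F. (norm (f n - cut (A j) f n))\<^sup>2) \<le> (1 / 4) ^ j"
    by metis
  define g where "g j = cut (A j) f" for j
  define s where "s j = fourier_l1 (g j)" for j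
  have g_supp: "supported_in (g j) (A j)" for j using A(1) by (simp add: g_def)
  have [measurable]: "s j \<in> borel_measurable circ" for j
    unfolding s_def by (rule fourier_finite_measurable[OF g_supp])
  have dist: "(\<integral>\<^sup>+\<theta>. ennreal ((norm (s j \<theta> - s i \<theta>))\<^sup>2) \<partial>circ) \<le> ennreal (8 * pi * (1 / 4) ^ j)" if ij: "j \<le> i" for i j
  proof -
    define U where "U = A i \<union> A j"
    have U: "finite U" using A(1) by (simp add: U_def)
    have gi: "supported_in (g i) U" "supported_in (g j) U"
      using supported_in_mono[OF g_supp _ U] by (auto simp: U_def)
    have d: "supported_in (\<lambda>n. g j n - g i n) U" using gi by (auto simp: supported_in_def)
    have "(\<integral>\<^sup>+\<theta>. ennreal ((norm (s j \<theta> - s i \<theta>))\<^sup>2) \<partial>circ) = ennreal (2 * pi * (\<Sum>n\<in>U. (norm (g j n - g i n))\<^sup>2))"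
      unfolding s_def fourier_l1_diff_finite[OF gi(2,1)] by (rule Parseval_finite(2)[OF d])
    also have "\<dots> \<le> ennreal (2 * pi * (2 * (1 / 4) ^ j + 2 * (1 / 4) ^ i))"
    proof (intro ennreal_leI mult_left_mono)
      have "(\<Sum>n\<in>U. (norm (g j n - g i n))\<^sup>2) \<le> (\<Sum>n\<in>U. 2 * (norm (f n - g j n))\<^sup>2 + 2 * (norm (f n - g i n))\<^sup>2)"
        using norm_diff_square_le by (intro sum_mono) (metis norm_minus_commute)
      also have "\<dots> = 2 * (\<Sum>n\<in>U. (norm (f n - g j n))\<^sup>2) + 2 * (\<Sum>n\<in>U. (norm (f n - g i n))\<^sup>2)"
        by (simp add: sum.distrib sum_distrib_left)
      also have "\<dots> \<le> 2 * (1 / 4) ^ j + 2 * (1 / 4) ^ i"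
        using A(2)[OF U] by (intro add_mono mult_left_mono) (auto simp: g_def)
      finally show "(\<Sum>n\<in>U. (norm (g j n - g i n))\<^sup>2) \<le> 2 * (1 / 4) ^ j + 2 * (1 / 4) ^ i" .
    qed simp
    also have "\<dots> \<le> ennreal (8 * pi * (1 / 4) ^ j)"
    proof (rule ennreal_leI)
      have "(1 / 4 :: real) ^ i \<le> (1 / 4) ^ j" by (rule power_decreasing[OF ij]) auto
      then have "2 * pi * (2 * (1 / 4) ^ j + 2 * (1 / 4) ^ i) \<le> 2 * pi * (2 * (1 / 4) ^ j + 2 * (1 / 4) ^ j)"
        by (intro mult_left_mono add_left_mono) auto
      then show "2 * pi * (2 * (1 / 4) ^ j + 2 * (1 / 4) ^ i) \<le> 8 * pi * (1 / 4) ^ j" by simp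
    qed
    finally show ?thesis .
  qed
  have step: "(\<integral>\<^sup>+\<theta>. ennreal (norm (s (Suc j) \<theta> - s j \<theta>)) \<partial>circ) \<le> ennreal (5 * pi * (1 / 2) ^ j)" for j
  proof -
    have "(\<integral>\<^sup>+\<theta>. ennreal ((norm (s (Suc j) \<theta> - s j \<theta>))\<^sup>2) \<partial>circ) \<le> ennreal (8 * pi * (1 / 4) ^ j)"
      using dist[of j "Suc j"] by (simp add: norm_minus_commute)
    then have "(\<integral>\<^sup>+\<theta>. ennreal (norm (s (Suc j) \<theta> - s j \<theta>)) \<partial>circ)
       \<le> ennreal (pi * (1 / 2) ^ j + 8 * pi * (1 / 4) ^ j / (2 * (1 / 2) ^ j))"
      by (intro nn_integral_young) auto
    also have "pi * (1 / 2) ^ j + 8 * pi * (1 / 4) ^ j / (2 * (1 / 2) ^ j) = 5 * pi * (1 / 2) ^ j"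
    proof -
      have "(1 / 4 :: real) ^ j = (1 / 2) ^ j * (1 / 2) ^ j" by (simp add: power_mult_distrib[symmetric])
      then show ?thesis by simp
    qed
    finally show ?thesis .
  qed
  have "(\<integral>\<^sup>+\<theta>. (\<Sum>j. ennreal (norm (s (Suc j) \<theta> - s j \<theta>))) \<partial>circ) = (\<Sum>j. \<integral>\<^sup>+\<theta>. ennreal (norm (s (Suc j) \<theta> - s j \<theta>)) \<partial>circ)"
    by (rule nn_integral_suminf) measurable
  also have "\<dots> \<le> (\<Sum>j. ennreal (5 * pi * (1 / 2) ^ j))" by (rule suminf_le) (auto intro: step)
  also have "\<dots> = ennreal (\<Sum>j. 5 * pi * (1 / 2) ^ j)"
    by (rule suminf_ennreal2) (auto intro!: summable_mult summable_geometric)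
  finally have "(\<integral>\<^sup>+\<theta>. (\<Sum>j. ennreal (norm (s (Suc j) \<theta> - s j \<theta>))) \<partial>circ) \<noteq> \<infinity>"
    by (metis ennreal_less_top infinity_ennreal_def le_less_trans less_irrefl)
  then have "AE \<theta> in circ. (\<Sum>j. ennreal (norm (s (Suc j) \<theta> - s j \<theta>))) \<noteq> \<infinity>"
    by (intro nn_integral_PInf_AE) measurable
  then have conv: "AE \<theta> in circ. convergent (\<lambda>j. s j \<theta>)"
  proof (rule AE_mp, intro AE_I2 impI)
    fix \<theta> assume "(\<Sum>j. ennreal (norm (s (Suc j) \<theta> - s j \<theta>))) \<noteq> \<infinity>"
    then have "summable (\<lambda>j. norm (s (Suc j) \<theta> - s j \<theta>))"
      by (intro summable_suminf_not_top) auto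
    then have "summable (\<lambda>j. s (Suc j) \<theta> - s j \<theta>)" by (rule summable_norm_cancel)
    then have "convergent (\<lambda>n. \<Sum>j<n. s (Suc j) \<theta> - s j \<theta>)" by (simp add: summable_iff_convergent)
    then have "convergent (\<lambda>n. s n \<theta> - s 0 \<theta>)" unfolding sum_lessThan_telescope[of "\<lambda>j. s j \<theta>"] .
    then have "convergent (\<lambda>n. (s n \<theta> - s 0 \<theta>) + s 0 \<theta>)" by (intro convergent_add convergent_const)
    then show "convergent (\<lambda>n. s n \<theta>)" by simp
  qed
  define \<phi> where "\<phi> \<theta> = lim (\<lambda>j. s j \<theta>)" for \<theta>
  have [measurable]: "\<phi> \<in> borel_measurable circ" unfolding \<phi>_def by measurable
  have lim: "AE \<theta> in circ. (\<lambda>j. s j \<theta>) \<longlonglongrightarrow> \<phi> \<theta>"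
    using conv by (auto simp: \<phi>_def convergent_LIMSEQ_iff)
  have close: "(\<integral>\<^sup>+\<theta>. ennreal ((norm (s j \<theta> - \<phi> \<theta>))\<^sup>2) \<partial>circ) \<le> ennreal (8 * pi * (1 / 4) ^ j)" for j
  proof -
    have "(\<integral>\<^sup>+\<theta>. ennreal ((norm (s j \<theta> - \<phi> \<theta>))\<^sup>2) \<partial>circ) = (\<integral>\<^sup>+\<theta>. liminf (\<lambda>i. ennreal ((norm (s j \<theta> - s i \<theta>))\<^sup>2)) \<partial>circ)"
    proof (rule nn_integral_cong_AE, rule AE_mp[OF lim], intro AE_I2 impI)
      fix \<theta> assume "(\<lambda>j. s j \<theta>) \<longlonglongrightarrow> \<phi> \<theta>"
      then have "(\<lambda>i. ennreal ((norm (s j \<theta> - s i \<theta>))\<^sup>2)) \<longlonglongrightarrow> ennreal ((norm (s j \<theta> - \<phi> \<theta>))\<^sup>2)"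
        by (intro tendsto_ennrealI tendsto_intros)
      from lim_imp_Liminf[OF _ this]
      show "ennreal ((norm (s j \<theta> - \<phi> \<theta>))\<^sup>2) = liminf (\<lambda>i. ennreal ((norm (s j \<theta> - s i \<theta>))\<^sup>2))" by simp
    qed
    also have "\<dots> \<le> liminf (\<lambda>i. \<integral>\<^sup>+\<theta>. ennreal ((norm (s j \<theta> - s i \<theta>))\<^sup>2) \<partial>circ)"
      by (rule nn_integral_liminf) measurable
    also have "\<dots> \<le> limsup (\<lambda>i. \<integral>\<^sup>+\<theta>. ennreal ((norm (s j \<theta> - s i \<theta>))\<^sup>2) \<partial>circ)"
      by (rule Liminf_le_Limsup) simp
    also have "\<dots> \<le> ennreal (8 * pi * (1 / 4) ^ j)"
      by (rule Limsup_bounded) (use dist in \<open>auto simp: eventually_sequentially\<close>)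
    finally show ?thesis .
  qed
  have L2: "\<phi> \<in> L2_pi"
  proof -
    have "(\<integral>\<^sup>+\<theta>. ennreal ((norm (\<phi> \<theta>))\<^sup>2) \<partial>circ)
        \<le> (\<integral>\<^sup>+\<theta>. ennreal 2 * ennreal ((norm (s 0 \<theta> - \<phi> \<theta>))\<^sup>2) + ennreal 2 * ennreal ((norm (s 0 \<theta>))\<^sup>2) \<partial>circ)"
    proof (rule nn_integral_mono)
      fix \<theta>
      have "(norm (\<phi> \<theta>))\<^sup>2 \<le> 2 * (norm (s 0 \<theta> - \<phi> \<theta>))\<^sup>2 + 2 * (norm (s 0 \<theta>))\<^sup>2"
        using norm_diff_square_le[of "\<phi> \<theta>" 0 "s 0 \<theta>"] by (simp add: norm_minus_commute)
      then have "ennreal ((norm (\<phi> \<theta>))\<^sup>2) \<le> ennreal (2 * (norm (s 0 \<theta> - \<phi> \<theta>))\<^sup>2 + 2 * (norm (s 0 \<theta>))\<^sup>2)"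
        by (rule ennreal_leI)
      also have "\<dots> = ennreal 2 * ennreal ((norm (s 0 \<theta> - \<phi> \<theta>))\<^sup>2) + ennreal 2 * ennreal ((norm (s 0 \<theta>))\<^sup>2)"
        by (subst ennreal_plus) (simp_all only: ennreal_mult zero_le_power2 zero_le_numeral mult_nonneg_nonneg)
      finally show "ennreal ((norm (\<phi> \<theta>))\<^sup>2) \<le> ennreal 2 * ennreal ((norm (s 0 \<theta> - \<phi> \<theta>))\<^sup>2) + ennreal 2 * ennreal ((norm (s 0 \<theta>))\<^sup>2)" .
    qed
    also have "\<dots> = ennreal 2 * (\<integral>\<^sup>+\<theta>. ennreal ((norm (s 0 \<theta> - \<phi> \<theta>))\<^sup>2) \<partial>circ) + ennreal 2 * (\<integral>\<^sup>+\<theta>. ennreal ((norm (s 0 \<theta>))\<^sup>2) \<partial>circ)"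
      by (subst nn_integral_add) (simp_all add: nn_integral_cmult)
    also have "\<dots> < top"
      using close[of 0] Parseval_finite(2)[OF g_supp[of 0]]
      by (simp add: s_def ennreal_mult_less_top le_less_trans[OF close[of 0, unfolded s_def]])
    finally have "L2_norm_pi \<phi> < top" unfolding L2_norm_pi_def by (simp add: epowr_less_top)
    then show ?thesis by (simp add: L2_pi_def)
  qed
  have half: "(\<lambda>j. c * (1 / 2 :: real) ^ j) \<longlonglongrightarrow> 0" for c
    using tendsto_mult_right_zero[OF LIMSEQ_power_zero[of "1/2::real"], of c] by simp
  have quarter: "((1 / 2 :: real) ^ j)\<^sup>2 = (1 / 4) ^ j" for j
    by (simp add: power2_eq_square power_mult_distrib[symmetric])
  show ?thesis
  proof (intro exI[of _ \<phi>], unfold is_fourier_l2_def, intro conjI L2 exI[of _ g] allI)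
    show "g j \<in> lp_space 1 unit_weight" for j
    proof (rule lp_spaceI[where C = "\<Sum>n\<in>A j. norm (g j n)"])
      fix F :: "int set" assume "finite F"
      have "(\<Sum>n\<in>F. norm (g j n)) = (\<Sum>n\<in>F \<inter> A j. norm (g j n))"
        using \<open>finite F\<close> g_supp[of j] by (intro sum.mono_neutral_right) (auto simp: supported_in_def)
      also have "\<dots> \<le> (\<Sum>n\<in>A j. norm (g j n))" using A(1) by (intro sum_mono2) auto
      finally show "(\<Sum>n\<in>F. norm (g j n) powr 1 * 1) \<le> (\<Sum>n\<in>A j. norm (g j n))" by simp
    qed (auto intro: sum_nonneg)
    show "(\<lambda>k. lp_norm 2 unit_weight (\<lambda>n. g k n - f n)) \<longlonglongrightarrow> 0"
    proof (rule tendsto_zero_ennrealI[OF _ half[of 1]])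
      show "lp_norm 2 unit_weight (\<lambda>n. g j n - f n) \<le> ennreal (1 * (1 / 2) ^ j)" for j
        using A(2) by (subst lp2_norm_le_iff) (auto simp: quarter g_def norm_minus_commute)
    qed simp
    show "(\<lambda>k. L2_norm_pi (\<lambda>\<theta>. fourier_l1 (g k) \<theta> - \<phi> \<theta>)) \<longlonglongrightarrow> 0"
    proof (rule tendsto_zero_ennrealI[OF _ half[of "sqrt (8 * pi)"]])
      show "L2_norm_pi (\<lambda>\<theta>. fourier_l1 (g j) \<theta> - \<phi> \<theta>) \<le> ennreal (sqrt (8 * pi) * (1 / 2) ^ j)" for j
        using close[of j] by (subst L2_norm_le_iff) (auto simp: power_mult_distrib quarter s_def)
    qed simp
  qed
qed

section \<open>The multiplier as a convolution operator\<close>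

context calderon_zygmund_kernel
begin

text \<open>
  The kernel is the image of the unit sequence at \<open>0\<close>.
\<close>

lemma kernel_square_sum: "\<exists>S\<ge>0. \<forall>F. finite F \<longrightarrow> (\<Sum>n\<in>F. (norm (K n))\<^sup>2) \<le> S"
proof -
  obtain B where B: "0 \<le> B" "\<And>f A F. supported_in f A \<Longrightarrow> finite F \<Longrightarrow>
        (\<Sum>n\<in>F. (norm (conv K f n))\<^sup>2) \<le> B * (\<Sum>k\<in>A. (norm (f k))\<^sup>2)"
    using l2_bounded by blast
  define d where "d k = (if k = 0 then 1 else 0 :: complex)" for k :: int
  have d: "supported_in d {0}" by (simp add: supported_in_def d_def)
  have "conv K d n = K n" for n by (simp add: conv_finite[OF d] d_def)
  then show ?thesis using B(1) B(2)[OF d] by (intro exI[of _ B]) (auto simp: d_def)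
qed

lemma kernel_bounded: "\<exists>M\<ge>0. \<forall>n. norm (K n) \<le> M"
proof -
  obtain S where S: "0 \<le> S" "\<And>F. finite F \<Longrightarrow> (\<Sum>n\<in>F. (norm (K n))\<^sup>2) \<le> S"
    using kernel_square_sum by blast
  have "norm (K n) \<le> sqrt S" for n using S(2)[of "{n}"] by (simp add: real_le_rsqrt)
  then show ?thesis using S(1) by (intro exI[of _ "sqrt S"]) simp
qed

text \<open>
  Young's inequality with the weight \<open>e\<close> in place of Cauchy and Schwarz.
\<close>

lemma conv_square_bound:
  "\<exists>S\<ge>0. \<forall>u e n. 0 < e \<longrightarrow> (\<forall>F. finite F \<longrightarrow> (\<Sum>k\<in>F. (norm (u k))\<^sup>2) \<le> e\<^sup>2) \<longrightarrow>
     (\<lambda>k. norm (K (n - k) * u k)) summable_on UNIV \<and> norm (conv K u n) \<le> S * e"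
proof -
  obtain S where S: "0 \<le> S" "\<And>F. finite F \<Longrightarrow> (\<Sum>n\<in>F. (norm (K n))\<^sup>2) \<le> S"
    using kernel_square_sum by blast
  have "(\<lambda>k. norm (K (n - k) * u k)) summable_on UNIV \<and> norm (conv K u n) \<le> (S + 1) * e"
    if e: "0 < e" and u: "\<And>F. finite F \<Longrightarrow> (\<Sum>k\<in>F. (norm (u k))\<^sup>2) \<le> e\<^sup>2" for u e n
  proof -
    have fin: "(\<Sum>k\<in>F. norm (K (n - k) * u k)) \<le> (S + 1) * e" if F: "finite F" for F
    proof -
      have "(\<Sum>k\<in>F. norm (K (n - k) * u k)) \<le> (\<Sum>k\<in>F. e * (norm (K (n - k)))\<^sup>2 + (norm (u k))\<^sup>2 / e)"
      proof (rule sum_mono)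
        fix k
        have *: "2 * (e * norm (K (n - k))) * norm (u k) \<le> (e * norm (K (n - k)))\<^sup>2 + (norm (u k))\<^sup>2"
          by (rule sum_squares_bound)
        have "norm (K (n - k)) * norm (u k) * e \<le> (e * (norm (K (n - k)))\<^sup>2 + (norm (u k))\<^sup>2 / e) * e"
        proof -
          have "0 \<le> e * norm (K (n - k)) * norm (u k)" using e by simp
          moreover have "(e * (norm (K (n - k)))\<^sup>2 + (norm (u k))\<^sup>2 / e) * e = (e * norm (K (n - k)))\<^sup>2 + (norm (u k))\<^sup>2"
            using e by (simp add: power2_eq_square distrib_right)
          ultimately show ?thesis using * by (simp add: mult_ac)
        qed
        then show "norm (K (n - k) * u k) \<le> e * (norm (K (n - k)))\<^sup>2 + (norm (u k))\<^sup>2 / e"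
          using e by (simp add: norm_mult)
      qed
      also have "\<dots> = e * (\<Sum>k\<in>F. (norm (K (n - k)))\<^sup>2) + (\<Sum>k\<in>F. (norm (u k))\<^sup>2) / e"
        by (simp add: sum.distrib sum_distrib_left sum_divide_distrib)
      also have "(\<Sum>k\<in>F. (norm (K (n - k)))\<^sup>2) = (\<Sum>k\<in>(\<lambda>k. n - k) ` F. (norm (K k))\<^sup>2)"
        by (subst sum.reindex) (auto simp: inj_on_def)
      also have "e * \<dots> + (\<Sum>k\<in>F. (norm (u k))\<^sup>2) / e \<le> e * S + e\<^sup>2 / e"
        using e F by (intro add_mono mult_left_mono divide_right_mono S(2) u) auto
      finally show ?thesis using e by (simp add: power2_eq_square algebra_simps)
    qed
    have abs: "(\<lambda>k. norm (K (n - k) * u k)) summable_on UNIV"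
      by (rule nonneg_bdd_above_summable_on) (use fin in \<open>auto intro!: bdd_aboveI\<close>)
    have "norm (conv K u n) \<le> (\<Sum>\<^sub>\<infinity>k\<in>UNIV. norm (K (n - k) * u k))"
      unfolding conv_def by (rule norm_infsum_bound[OF abs])
    also have "\<dots> \<le> (S + 1) * e" by (rule infsum_le_finite_sums[OF abs]) (use fin in auto)
    finally show ?thesis using abs by simp
  qed
  then show ?thesis using S(1) by (intro exI[of _ "S + 1"]) auto
qed

lemma lp2_sum_bound:
  assumes "f \<in> lp_space 2 unit_weight"
  obtains C where "0 < C" "\<And>F. finite F \<Longrightarrow> (\<Sum>n\<in>F. (norm (f n))\<^sup>2) \<le> C\<^sup>2"
proof -
  obtain C where C: "0 \<le> C" "lp_norm 2 unit_weight f = ennreal C"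
    "\<And>F. finite F \<Longrightarrow> (\<Sum>n\<in>F. norm (f n) powr 2 * 1) \<le> C powr 2"
    by (rule lp_space_obtain[OF _ _ assms]) auto
  have "(\<Sum>n\<in>F. (norm (f n))\<^sup>2) \<le> (C + 1)\<^sup>2" if "finite F" for F
  proof -
    have "(\<Sum>n\<in>F. (norm (f n))\<^sup>2) \<le> C\<^sup>2" using C(3)[OF that] C(1) by simp
    also have "\<dots> \<le> (C + 1)\<^sup>2" using C(1) by (intro power_mono) auto
    finally show ?thesis .
  qed
  then show ?thesis using that[of "C + 1"] C(1) by simp
qed

lemma conv_abs_summable:
  assumes "f \<in> lp_space 2 unit_weight"
  shows "(\<lambda>k. norm (K (n - k) * f k)) summable_on UNIV"
proof -
  obtain C where "0 < C" "\<And>F. finite F \<Longrightarrow> (\<Sum>n\<in>F. (norm (f n))\<^sup>2) \<le> C\<^sup>2"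
    by (rule lp2_sum_bound[OF assms]) blast
  then show ?thesis using conv_square_bound by blast
qed

lemma conv_linear:
  assumes "f \<in> lp_space 2 unit_weight" "g \<in> lp_space 2 unit_weight"
  shows "conv K (\<lambda>k. f k + g k) n = conv K f n + conv K g n" "conv K (\<lambda>k. c * f k) n = c * conv K f n"
proof -
  note s = abs_summable_summable[OF conv_abs_summable[OF assms(1)]] abs_summable_summable[OF conv_abs_summable[OF assms(2)]]
  show "conv K (\<lambda>k. f k + g k) n = conv K f n + conv K g n"
    unfolding conv_def distrib_left by (rule infsum_add[OF s])
  show "conv K (\<lambda>k. c * f k) n = c * conv K f n"
    unfolding conv_def mult.left_commute[of _ c] by (rule infsum_cmult_right) (use s in auto)
qed

lemma conv_cut_tendsto:
  assumes "f \<in> lp_space 2 unit_weight"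
  shows "(\<lambda>N. conv K (cut {- int N..int N} f) n) \<longlonglongrightarrow> conv K f n"
proof -
  have "((\<lambda>k. K (n - k) * f k) has_sum conv K f n) UNIV"
    unfolding conv_def using abs_summable_summable[OF conv_abs_summable[OF assms]] by (rule has_sum_infsum)
  then have lim: "(sum (\<lambda>k. K (n - k) * f k) \<longlongrightarrow> conv K f n) (finite_subsets_at_top UNIV)"
    by (simp add: has_sum_def)
  have "filterlim (\<lambda>N. {- int N..int N}) (finite_subsets_at_top UNIV) sequentially"
    unfolding filterlim_finite_subsets_at_top
  proof (intro allI impI)
    fix X :: "int set" assume "finite X \<and> X \<subseteq> UNIV"
    then have X: "finite X" by simp
    define M where "M = (\<Sum>x\<in>X. nat \<bar>x\<bar>)"
    have M: "nat \<bar>x\<bar> \<le> M" if "x \<in> X" for x unfolding M_def using that X by (intro member_le_sum) auto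
    show "\<forall>\<^sub>F N in sequentially. finite {- int N..int N} \<and> X \<subseteq> {- int N..int N} \<and> {- int N..int N} \<subseteq> UNIV"
      unfolding eventually_sequentially
    proof (intro exI[of _ M] allI impI conjI subsetI)
      fix N x assume "M \<le> N" "x \<in> X"
      then show "x \<in> {- int N..int N}" using M[of x] by auto
    qed auto
  qed
  from filterlim_compose[OF lim this]
  have "(\<lambda>N. \<Sum>k\<in>{- int N..int N}. K (n - k) * f k) \<longlonglongrightarrow> conv K f n" by simp
  moreover have "conv K (cut {- int N..int N} f) n = (\<Sum>k\<in>{- int N..int N}. K (n - k) * f k)" for N
    by (subst conv_finite[of _ "{- int N..int N}"]) (auto simp: cut_def)
  ultimately show ?thesis by simp
qed

end

lemma infsum_diff_eq:
  fixes f g :: "'a \<Rightarrow> complex"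
  assumes "f summable_on A" "g summable_on A"
  shows "infsum (\<lambda>x. f x - g x) A = infsum f A - infsum g A"
  using infsum_add[of f A "\<lambda>x. - g x"] assms by (simp add: infsum_uminus summable_on_uminus)

lemma l1_tail:
  assumes g: "g \<in> lp_space 1 unit_weight" and e: "0 < e"
  shows "\<exists>A. finite A \<and> (\<forall>F. finite F \<longrightarrow> (\<Sum>n\<in>F. norm (g n - cut A g n)) \<le> e) \<and>
     (\<forall>\<theta>. norm (fourier_l1 g \<theta> - fourier_l1 (cut A g) \<theta>) \<le> e)"
proof -
  obtain C where C: "0 \<le> C" "lp_norm 1 unit_weight g = ennreal C"
    "\<And>F. finite F \<Longrightarrow> (\<Sum>n\<in>F. norm (g n) powr 1 * 1) \<le> C powr 1"
    by (rule lp_space_obtain[OF _ _ g]) auto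
  have bd: "(\<Sum>n\<in>F. norm (g n)) \<le> C" if "finite F" for F using C(3)[OF that] C(1) by simp
  have gs: "(\<lambda>n. norm (g n)) summable_on UNIV"
    by (rule nonneg_bdd_above_summable_on) (use bd in \<open>auto intro!: bdd_aboveI\<close>)
  define s where "s = infsum (\<lambda>n. norm (g n)) UNIV"
  have s_ge: "(\<Sum>n\<in>F. norm (g n)) \<le> s" if "finite F" for F
    unfolding s_def by (rule finite_sum_le_infsum[OF gs that]) auto
  have "\<exists>A. finite A \<and> s - e < (\<Sum>n\<in>A. norm (g n))"
  proof (rule ccontr)
    assume "\<not> ?thesis"
    then have "s \<le> s - e" unfolding s_def
      by (intro infsum_le_finite_sums[OF gs]) (auto simp: s_def not_less)
    then show False using e by simp
  qed
  then obtain A where A: "finite A" "s - e < (\<Sum>n\<in>A. norm (g n))" by blast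
  have tail: "(\<Sum>n\<in>F. norm (g n - cut A g n)) \<le> e" if F: "finite F" for F
  proof -
    have "(\<Sum>n\<in>F. norm (g n - cut A g n)) = (\<Sum>n\<in>F - A. norm (g n))"
      using F by (intro sum.mono_neutral_cong_right) (auto simp: cut_def)
    also have "\<dots> = (\<Sum>n\<in>F \<union> A. norm (g n)) - (\<Sum>n\<in>A. norm (g n))"
      using F A(1) sum.subset_diff[of A "F \<union> A" "\<lambda>n. norm (g n)"] by (simp add: Un_Diff)
    also have "(\<Sum>n\<in>F \<union> A. norm (g n)) \<le> s" using F A(1) by (intro s_ge) auto
    finally show ?thesis using A(2) by linarith
  qed
  have "norm (fourier_l1 g \<theta> - fourier_l1 (cut A g) \<theta>) \<le> e" for \<theta>
  proof -
    define c where "c n = cis (of_int n * \<theta>)" for n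
    have s1: "(\<lambda>n. norm (g n * c n)) summable_on UNIV" using gs by (simp add: norm_mult c_def)
    have abs: "(\<lambda>n. norm ((g n - cut A g n) * c n)) summable_on UNIV"
      by (rule nonneg_bdd_above_summable_on) (use tail in \<open>auto intro!: bdd_aboveI simp: norm_mult c_def\<close>)
    have s2: "(\<lambda>n. cut A g n * c n) summable_on UNIV"
      by (rule finite_nonzero_values_imp_summable_on) (rule finite_subset[OF _ A(1)], auto simp: cut_def)
    have "fourier_l1 g \<theta> - fourier_l1 (cut A g) \<theta> = (\<Sum>\<^sub>\<infinity>n\<in>UNIV. (g n - cut A g n) * c n)"
      unfolding fourier_l1_def c_def[symmetric] left_diff_distrib
      by (rule infsum_diff_eq[symmetric, OF abs_summable_summable[OF s1] s2])
    also have "norm \<dots> \<le> (\<Sum>\<^sub>\<infinity>n\<in>UNIV. norm ((g n - cut A g n) * c n))"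
      by (rule norm_infsum_bound[OF abs])
    also have "\<dots> \<le> e"
      by (rule infsum_le_finite_sums[OF abs]) (use tail in \<open>auto simp: norm_mult c_def\<close>)
    finally show ?thesis .
  qed
  then show ?thesis using A(1) tail by blast
qed

lemma fourier_l1_measurable:
  assumes "g \<in> lp_space 1 unit_weight"
  shows "fourier_l1 g \<in> borel_measurable circ"
proof -
  have "\<forall>j::nat. \<exists>A. finite A \<and> (\<forall>\<theta>. norm (fourier_l1 g \<theta> - fourier_l1 (cut A g) \<theta>) \<le> 1 / real (Suc j))"
    using l1_tail[OF assms] by (metis of_nat_0_less_iff zero_less_Suc zero_less_divide_1_iff)
  then obtain A where A: "\<And>j. finite (A j)"
    "\<And>j \<theta>. norm (fourier_l1 g \<theta> - fourier_l1 (cut (A j) g) \<theta>) \<le> 1 / real (Suc j)" by metis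
  show ?thesis
  proof (rule borel_measurable_LIMSEQ_metric)
    show "fourier_l1 (cut (A j) g) \<in> borel_measurable circ" for j
      by (rule fourier_finite_measurable[OF supported_in_cut[OF A(1)]])
    show "(\<lambda>j. fourier_l1 (cut (A j) g) \<theta>) \<longlonglongrightarrow> fourier_l1 g \<theta>" for \<theta>
    proof (rule Lim_transform_bound[of _ "\<lambda>j. 1 / real (Suc j)", THEN LIM_zero_cancel])
      show "\<forall>\<^sub>F j in sequentially. norm (fourier_l1 (cut (A j) g) \<theta> - fourier_l1 g \<theta>) \<le> norm (1 / real (Suc j))"
        using A(2) by (simp add: norm_minus_commute)
      show "(\<lambda>j. 1 / real (Suc j)) \<longlonglongrightarrow> 0" using LIMSEQ_inverse_real_of_nat by (simp add: inverse_eq_divide)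
    qed
  qed
qed

text \<open>
  By definition the transform is a limit of transforms of \<open>\<ell>\<^sup>1\<close> sequences, which are in turn approximated by
  truncations, in \<open>\<ell>\<^sup>2\<close> and, on the transform side, uniformly.
\<close>

lemma fourier_l2_approx:
  assumes "is_fourier_l2 f \<phi>" and e: "0 < e"
  shows "\<exists>g A. supported_in g A \<and> (\<forall>F. finite F \<longrightarrow> (\<Sum>n\<in>F. (norm (f n - g n))\<^sup>2) \<le> e) \<and>
    (\<integral>\<^sup>+\<theta>. ennreal ((norm (\<phi> \<theta> - fourier_l1 g \<theta>))\<^sup>2) \<partial>circ) \<le> ennreal e"
proof -
  obtain G where \<phi>: "\<phi> \<in> L2_pi" and G: "\<And>k. G k \<in> lp_space 1 unit_weight"
    "(\<lambda>k. lp_norm 2 unit_weight (\<lambda>n. G k n - f n)) \<longlonglongrightarrow> 0"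
    "(\<lambda>k. L2_norm_pi (\<lambda>\<theta>. fourier_l1 (G k) \<theta> - \<phi> \<theta>)) \<longlonglongrightarrow> 0"
    using assms(1) unfolding is_fourier_l2_def by blast
  define d where "d = sqrt (e / 4)"
  have d: "0 < d" "d\<^sup>2 = e / 4" using e by (auto simp: d_def)
  have "\<forall>\<^sub>F k in sequentially. lp_norm 2 unit_weight (\<lambda>n. G k n - f n) < ennreal d"
    using order_tendstoD(2)[OF G(2), of "ennreal d"] d by simp
  moreover have "\<forall>\<^sub>F k in sequentially. L2_norm_pi (\<lambda>\<theta>. fourier_l1 (G k) \<theta> - \<phi> \<theta>) < ennreal d"
    using order_tendstoD(2)[OF G(3), of "ennreal d"] d by simp
  ultimately have "\<forall>\<^sub>F k in sequentially. lp_norm 2 unit_weight (\<lambda>n. G k n - f n) < ennreal d \<and>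
      L2_norm_pi (\<lambda>\<theta>. fourier_l1 (G k) \<theta> - \<phi> \<theta>) < ennreal d" by eventually_elim simp
  then obtain k where "lp_norm 2 unit_weight (\<lambda>n. G k n - f n) < ennreal d"
      "L2_norm_pi (\<lambda>\<theta>. fourier_l1 (G k) \<theta> - \<phi> \<theta>) < ennreal d"
    using eventually_happens'[OF sequentially_bot] by blast
  then have k: "lp_norm 2 unit_weight (\<lambda>n. G k n - f n) \<le> ennreal d"
      "L2_norm_pi (\<lambda>\<theta>. fourier_l1 (G k) \<theta> - \<phi> \<theta>) \<le> ennreal d" by simp_all
  have k1: "(\<Sum>n\<in>F. (norm (f n - G k n))\<^sup>2) \<le> e / 4" if "finite F" for F
    using k(1) that d by (subst (asm) lp2_norm_le_iff) (auto simp: norm_minus_commute)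
  have k2: "(\<integral>\<^sup>+\<theta>. ennreal ((norm (\<phi> \<theta> - fourier_l1 (G k) \<theta>))\<^sup>2) \<partial>circ) \<le> ennreal (e / 4)"
    using k(2) d by (subst (asm) L2_norm_le_iff) (auto simp: norm_minus_commute)
  define \<eta> where "\<eta> = sqrt (e / (8 * pi))"
  have \<eta>: "0 < \<eta>" "\<eta>\<^sup>2 = e / (8 * pi)" using e by (auto simp: \<eta>_def)
  obtain A where A: "finite A" "\<And>F. finite F \<Longrightarrow> (\<Sum>n\<in>F. norm (G k n - cut A (G k) n)) \<le> \<eta>"
     "\<And>\<theta>. norm (fourier_l1 (G k) \<theta> - fourier_l1 (cut A (G k)) \<theta>) \<le> \<eta>"
    using l1_tail[OF G(1) \<eta>(1)] by blast
  define g where "g = cut A (G k)"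
  have "(\<Sum>n\<in>F. (norm (f n - g n))\<^sup>2) \<le> e" if F: "finite F" for F
  proof -
    have "(\<Sum>n\<in>F. (norm (f n - g n))\<^sup>2) \<le> (\<Sum>n\<in>F. 2 * (norm (f n - G k n))\<^sup>2 + 2 * (norm (G k n - g n))\<^sup>2)"
      by (intro sum_mono norm_diff_square_le)
    also have "\<dots> = 2 * (\<Sum>n\<in>F. (norm (f n - G k n))\<^sup>2) + 2 * (\<Sum>n\<in>F. (norm (G k n - g n))\<^sup>2)"
      by (simp add: sum.distrib sum_distrib_left)
    also have "(\<Sum>n\<in>F. (norm (G k n - g n))\<^sup>2) \<le> (\<Sum>n\<in>F. norm (G k n - g n))\<^sup>2"
    proof -
      have "L2_set (\<lambda>n. norm (G k n - g n)) F \<le> (\<Sum>n\<in>F. norm (G k n - g n))"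
        by (rule L2_set_le_sum) simp
      then have "(L2_set (\<lambda>n. norm (G k n - g n)) F)\<^sup>2 \<le> (\<Sum>n\<in>F. norm (G k n - g n))\<^sup>2"
        by (intro power_mono) auto
      then show ?thesis by (simp add: L2_set_def sum_nonneg)
    qed
    also have "(\<Sum>n\<in>F. norm (G k n - g n))\<^sup>2 \<le> \<eta>\<^sup>2"
      unfolding g_def by (intro power_mono A(2) F) (auto intro: sum_nonneg)
    also have "2 * (\<Sum>n\<in>F. (norm (f n - G k n))\<^sup>2) + 2 * \<eta>\<^sup>2 \<le> 2 * (e / 4) + 2 * (e / 4)"
    proof (intro add_mono mult_left_mono k1 F)
      have "4 \<le> 8 * pi" using pi_ge_two by simp
      then show "\<eta>\<^sup>2 \<le> e / 4" unfolding \<eta>(2) using e by (intro divide_left_mono) auto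
    qed auto
    finally show ?thesis by simp
  qed
  moreover have "(\<integral>\<^sup>+\<theta>. ennreal ((norm (\<phi> \<theta> - fourier_l1 g \<theta>))\<^sup>2) \<partial>circ) \<le> ennreal e"
  proof -
    have [measurable]: "\<phi> \<in> borel_measurable circ" using \<phi> by (simp add: L2_pi_def)
    have [measurable]: "fourier_l1 (G k) \<in> borel_measurable circ" by (rule fourier_l1_measurable[OF G(1)])
    have "(\<integral>\<^sup>+\<theta>. ennreal ((norm (\<phi> \<theta> - fourier_l1 g \<theta>))\<^sup>2) \<partial>circ)
       \<le> (\<integral>\<^sup>+\<theta>. ennreal 2 * ennreal ((norm (\<phi> \<theta> - fourier_l1 (G k) \<theta>))\<^sup>2) + ennreal (2 * \<eta>\<^sup>2) \<partial>circ)"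
    proof (rule nn_integral_mono)
      fix \<theta>
      have "(norm (fourier_l1 (G k) \<theta> - fourier_l1 g \<theta>))\<^sup>2 \<le> \<eta>\<^sup>2"
        unfolding g_def by (intro power_mono A(3)) simp
      then have "(norm (\<phi> \<theta> - fourier_l1 g \<theta>))\<^sup>2 \<le> 2 * (norm (\<phi> \<theta> - fourier_l1 (G k) \<theta>))\<^sup>2 + 2 * \<eta>\<^sup>2"
        using norm_diff_square_le[of "\<phi> \<theta>" "fourier_l1 g \<theta>" "fourier_l1 (G k) \<theta>"] by linarith
      then have "ennreal ((norm (\<phi> \<theta> - fourier_l1 g \<theta>))\<^sup>2) \<le> ennreal (2 * (norm (\<phi> \<theta> - fourier_l1 (G k) \<theta>))\<^sup>2 + 2 * \<eta>\<^sup>2)"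
        by (rule ennreal_leI)
      also have "\<dots> = ennreal 2 * ennreal ((norm (\<phi> \<theta> - fourier_l1 (G k) \<theta>))\<^sup>2) + ennreal (2 * \<eta>\<^sup>2)"
        by (subst ennreal_plus) (simp_all only: ennreal_mult zero_le_power2 zero_le_numeral mult_nonneg_nonneg)
      finally show "ennreal ((norm (\<phi> \<theta> - fourier_l1 g \<theta>))\<^sup>2)
          \<le> ennreal 2 * ennreal ((norm (\<phi> \<theta> - fourier_l1 (G k) \<theta>))\<^sup>2) + ennreal (2 * \<eta>\<^sup>2)" .
    qed
    also have "\<dots> = ennreal 2 * (\<integral>\<^sup>+\<theta>. ennreal ((norm (\<phi> \<theta> - fourier_l1 (G k) \<theta>))\<^sup>2) \<partial>circ) + ennreal (2 * \<eta>\<^sup>2) * ennreal (2 * pi)"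
      unfolding emeasure_circ[symmetric] by (subst nn_integral_add) (simp_all add: nn_integral_cmult)
    also have "\<dots> \<le> ennreal 2 * ennreal (e / 4) + ennreal (2 * \<eta>\<^sup>2) * ennreal (2 * pi)"
      by (intro add_mono mult_left_mono k2) auto
    also have "\<dots> = ennreal (2 * (e / 4) + 2 * \<eta>\<^sup>2 * (2 * pi))"
    proof -
      have h1: "ennreal 2 * ennreal (e / 4) = ennreal (2 * (e / 4))"
        using e by (intro ennreal_mult[symmetric]) auto
      have h2: "ennreal (2 * \<eta>\<^sup>2) * ennreal (2 * pi) = ennreal (2 * \<eta>\<^sup>2 * (2 * pi))"
        by (intro ennreal_mult[symmetric]) auto
      show ?thesis unfolding h1 h2 by (rule ennreal_plus[symmetric]) (use e in auto)
    qed
    also have "2 * (e / 4) + 2 * \<eta>\<^sup>2 * (2 * pi) = e" unfolding \<eta>(2) by simp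
    finally show ?thesis .
  qed
  ultimately show ?thesis using A(1) by (intro exI[of _ g] exI[of _ A]) (simp add: g_def)
qed

context laplace_type_multiplier
begin

lemma inv_fourier_finite:
  assumes f: "supported_in f A"
  shows "inv_fourier (\<lambda>\<theta>. symbol \<theta> * fourier_l1 f \<theta>) n = conv kernel f n"
proof -
  have A: "finite A" using f by (simp add: supported_in_def)
  have int: "integrable circ (\<lambda>\<theta>. f k * (symbol \<theta> * cis (- (of_int (n - k) * \<theta>))))" for k
  proof -
    have cm: "(\<lambda>\<theta>. cis (- (of_int j * \<theta>))) \<in> borel_measurable circ" for j
      using cis_measurable[of "- of_int j"] by simp
    show ?thesis by (intro integrable_mult_right symbol_times_integrable[where W = 1] cm) simp
  qed
  have "symbol \<theta> * fourier_l1 f \<theta> * cis (- (of_int n * \<theta>)) = (\<Sum>k\<in>A. f k * (symbol \<theta> * cis (- (of_int (n - k) * \<theta>))))" for \<theta>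
  proof -
    have "cis (of_int k * \<theta>) * cis (- (of_int n * \<theta>)) = cis (- (of_int (n - k) * \<theta>))" for k
      by (simp add: cis_mult algebra_simps)
    then show ?thesis unfolding fourier_l1_finite[OF f] sum_distrib_left sum_distrib_right
      by (intro sum.cong refl) (simp add: mult_ac)
  qed
  then have "(LINT \<theta>|circ. symbol \<theta> * fourier_l1 f \<theta> * cis (- (of_int n * \<theta>)))
      = (\<Sum>k\<in>A. LINT \<theta>|circ. f k * (symbol \<theta> * cis (- (of_int (n - k) * \<theta>))))"
    by (simp only:) (rule Bochner_Integration.integral_sum, rule int)
  then show ?thesis
    unfolding inv_fourier_def conv_finite[OF f] kernel_def
    by (simp add: sum_distrib_left sum_divide_distrib mult_ac)
qed

lemma kernel_l2_bounded:
  assumes f: "supported_in f A" and F: "finite F"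
  shows "(\<Sum>n\<in>F. (norm (conv kernel f n))\<^sup>2) \<le> bound\<^sup>2 * (\<Sum>k\<in>A. (norm (f k))\<^sup>2)"
proof -
  define h where "h \<theta> = symbol \<theta> * fourier_l1 f \<theta>" for \<theta>
  note m [measurable] = fourier_finite_measurable[OF f]
  have h [measurable]: "h \<in> borel_measurable circ" unfolding h_def[abs_def] by measurable
  have fb: "norm (fourier_l1 f \<theta>) \<le> (\<Sum>k\<in>A. norm (f k))" for \<theta>
    unfolding fourier_l1_finite[OF f] by (rule trig_poly_bounded)
  have hb: "norm (h \<theta>) \<le> bound * (\<Sum>k\<in>A. norm (f k))" for \<theta>
    unfolding h_def norm_mult by (intro mult_mono norm_symbol_le fb bound(1)) simp
  have int: "integrable circ (\<lambda>\<theta>. (norm (u \<theta>))\<^sup>2)"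
    if [measurable]: "u \<in> borel_measurable circ" and "\<And>\<theta>. norm (u \<theta>) \<le> U" for u :: "real \<Rightarrow> complex" and U
    by (rule finite_measure.integrable_const_bound[OF circ_finite, of _ "U\<^sup>2"])
       (use that in \<open>auto intro!: power_mono\<close>)
  have "2 * pi * (\<Sum>n\<in>F. (norm (inv_fourier h n))\<^sup>2) \<le> (LINT \<theta>|circ. (norm (h \<theta>))\<^sup>2)"
    by (rule Bessel(1)[OF h hb F])
  also have "\<dots> \<le> (LINT \<theta>|circ. bound\<^sup>2 * (norm (fourier_l1 f \<theta>))\<^sup>2)"
  proof (rule integral_mono)
    show "integrable circ (\<lambda>\<theta>. (norm (h \<theta>))\<^sup>2)" by (rule int[OF h hb])
    show "integrable circ (\<lambda>\<theta>. bound\<^sup>2 * (norm (fourier_l1 f \<theta>))\<^sup>2)"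
      by (intro integrable_mult_right int[OF m fb])
    show "(norm (h \<theta>))\<^sup>2 \<le> bound\<^sup>2 * (norm (fourier_l1 f \<theta>))\<^sup>2" for \<theta>
      unfolding h_def norm_mult power_mult_distrib
      by (intro mult_right_mono power_mono norm_symbol_le) auto
  qed
  also have "\<dots> = 2 * pi * (bound\<^sup>2 * (\<Sum>k\<in>A. (norm (f k))\<^sup>2))"
    by (simp add: Parseval_finite(1)[OF f])
  finally have "(\<Sum>n\<in>F. (norm (inv_fourier h n))\<^sup>2) \<le> bound\<^sup>2 * (\<Sum>k\<in>A. (norm (f k))\<^sup>2)" by simp
  moreover have "inv_fourier h n = conv kernel f n" for n
    unfolding h_def by (rule inv_fourier_finite[OF f])
  ultimately show ?thesis by simp
qed

sublocale calderon_zygmund_kernel kernel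
proof
  show "\<exists>C. \<forall>n. norm ((bdiff ^^ j) kernel n) * of_int \<bar>n\<bar> ^ Suc j \<le> C" for j
    by (rule kernel_difference_bound)
  show "\<exists>B\<ge>0. \<forall>f A F. supported_in f A \<longrightarrow> finite F \<longrightarrow>
        (\<Sum>n\<in>F. (norm (conv kernel f n))\<^sup>2) \<le> B * (\<Sum>k\<in>A. (norm (f k))\<^sup>2)"
    using kernel_l2_bounded by (intro exI[of _ "bound\<^sup>2"]) auto
qed

text \<open>
  The number \<open>2 * (1 - cos \<theta>)\<close> vanishes in the interval only at \<open>\<theta> = 0\<close>, a null set.
\<close>

lemma multiplier_op_symbol:
  assumes [measurable]: "\<phi> \<in> borel_measurable circ"
  shows "inv_fourier (\<lambda>\<theta>. m (2 * (1 - cos \<theta>)) * \<phi> \<theta>) = inv_fourier (\<lambda>\<theta>. symbol \<theta> * \<phi> \<theta>)"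
proof
  fix n
  have eq: "m (2 * (1 - cos \<theta>)) = symbol \<theta>" if "\<theta> \<in> space circ" "\<theta> \<noteq> 0" for \<theta>
  proof -
    have "cos \<bar>\<theta>\<bar> < cos 0" by (rule cos_monotone_0_pi) (use that in auto)
    then have "cos \<theta> \<noteq> 1" by simp
    then show ?thesis by (simp add: symbol_def lam_def)
  qed
  have "(\<lambda>\<theta>. if \<theta> = 0 then m 0 else symbol \<theta>) \<in> borel_measurable circ" by measurable
  then have [measurable]: "(\<lambda>\<theta>. m (2 * (1 - cos \<theta>))) \<in> borel_measurable circ"
  proof (rule measurable_cong[THEN iffD1, rotated])
    fix \<theta> assume \<theta>: "\<theta> \<in> space circ"
    show "(if \<theta> = 0 then m 0 else symbol \<theta>) = m (2 * (1 - cos \<theta>))"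
    proof (cases "\<theta> = 0")
      case False
      then show ?thesis unfolding if_not_P[OF False] by (rule eq[symmetric, OF \<theta>])
    qed simp
  qed
  have [measurable]: "(\<lambda>\<theta>. cis (- (of_int n * \<theta>))) \<in> borel_measurable circ"
    using cis_measurable[of "- of_int n"] by simp
  have ae: "AE \<theta> in circ. \<theta> \<noteq> 0"
    by (rule AE_I'[of "{0}"]) (auto simp: null_sets_restrict_space)
  have "(LINT \<theta>|circ. m (2 * (1 - cos \<theta>)) * \<phi> \<theta> * cis (- (of_int n * \<theta>)))
      = (LINT \<theta>|circ. symbol \<theta> * \<phi> \<theta> * cis (- (of_int n * \<theta>)))"
  proof (rule integral_cong_AE)
    show "AE \<theta> in circ. m (2 * (1 - cos \<theta>)) * \<phi> \<theta> * cis (- (of_int n * \<theta>)) = symbol \<theta> * \<phi> \<theta> * cis (- (of_int n * \<theta>))"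
      using ae
    proof (rule AE_mp, intro AE_I2 impI)
      fix \<theta> assume "\<theta> \<in> space circ" "\<theta> \<noteq> 0"
      then show "m (2 * (1 - cos \<theta>)) * \<phi> \<theta> * cis (- (of_int n * \<theta>)) = symbol \<theta> * \<phi> \<theta> * cis (- (of_int n * \<theta>))"
        by (subst eq) auto
    qed
  qed measurable
  then show "inv_fourier (\<lambda>\<theta>. m (2 * (1 - cos \<theta>)) * \<phi> \<theta>) n = inv_fourier (\<lambda>\<theta>. symbol \<theta> * \<phi> \<theta>) n"
    by (simp add: inv_fourier_def)
qed

text \<open>
  For sequences of finite support this is the definition of the Fourier coefficients. Both sides depend
  continuously on \<open>f\<close> in \<open>\<ell>\<^sup>2\<close>, whichever representative the choice in \<open>fourier_l2\<close> selects.
\<close>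

lemma multiplier_op_eq_conv:
  assumes f: "f \<in> lp_space 2 unit_weight"
  shows "multiplier_op m f = conv kernel f"
proof
  fix n
  define \<phi> where "\<phi> = fourier_l2 f"
  have \<phi>: "is_fourier_l2 f \<phi>"
    unfolding \<phi>_def fourier_l2_def using Riesz_Fischer[OF f] by (rule someI_ex)
  have [measurable]: "\<phi> \<in> borel_measurable circ" using \<phi> by (simp add: is_fourier_l2_def L2_pi_def)
  obtain S where S: "0 \<le> S" "\<And>u e n. 0 < e \<Longrightarrow> (\<And>F. finite F \<Longrightarrow> (\<Sum>k\<in>F. (norm (u k))\<^sup>2) \<le> e\<^sup>2) \<Longrightarrow>
     norm (conv kernel u n) \<le> S * e"
    using conv_square_bound by blast
  have close: "norm (inv_fourier (\<lambda>\<theta>. symbol \<theta> * \<phi> \<theta>) n - conv kernel f n) \<le> (bound * 5 + S) * e" if e: "0 < e" for e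
  proof -
    obtain g A where g: "supported_in g A" "\<And>F. finite F \<Longrightarrow> (\<Sum>n\<in>F. (norm (f n - g n))\<^sup>2) \<le> e\<^sup>2"
      "(\<integral>\<^sup>+\<theta>. ennreal ((norm (\<phi> \<theta> - fourier_l1 g \<theta>))\<^sup>2) \<partial>circ) \<le> ennreal (e\<^sup>2)"
      using fourier_l2_approx[OF \<phi>, of "e\<^sup>2"] e by auto
    note [measurable] = fourier_finite_measurable[OF g(1)]
    have nn: "(\<integral>\<^sup>+\<theta>. ennreal (norm (\<phi> \<theta> - fourier_l1 g \<theta>)) \<partial>circ) \<le> ennreal (pi * e + e\<^sup>2 / (2 * e))"
      by (rule nn_integral_young) (use g(3) e in auto)
    also have "\<dots> \<le> ennreal (5 * e)"
      using e pi_less_4 by (intro ennreal_leI) (simp add: power2_eq_square field_simps)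
    finally have nn: "(\<integral>\<^sup>+\<theta>. ennreal (norm (\<phi> \<theta> - fourier_l1 g \<theta>)) \<partial>circ) \<le> ennreal (5 * e)" .
    have cm [measurable]: "(\<lambda>\<theta>. cis (- (of_int n * \<theta>))) \<in> borel_measurable circ"
      using cis_measurable[of "- of_int n"] by simp
    define u where "u \<theta> = symbol \<theta> * (\<phi> \<theta> - fourier_l1 g \<theta>) * cis (- (of_int n * \<theta>))" for \<theta>
    define v where "v \<theta> = symbol \<theta> * fourier_l1 g \<theta> * cis (- (of_int n * \<theta>))" for \<theta>
    have [measurable]: "u \<in> borel_measurable circ" unfolding u_def[abs_def] by measurable
    have u_nn: "(\<integral>\<^sup>+\<theta>. ennreal (norm (u \<theta>)) \<partial>circ) \<le> ennreal (bound * (5 * e))"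
    proof -
      have "(\<integral>\<^sup>+\<theta>. ennreal (norm (u \<theta>)) \<partial>circ) \<le> (\<integral>\<^sup>+\<theta>. ennreal bound * ennreal (norm (\<phi> \<theta> - fourier_l1 g \<theta>)) \<partial>circ)"
        using bound(1) by (intro nn_integral_mono)
          (simp add: u_def norm_mult ennreal_mult[symmetric] ennreal_leI mult_right_mono norm_symbol_le)
      also have "\<dots> = ennreal bound * (\<integral>\<^sup>+\<theta>. ennreal (norm (\<phi> \<theta> - fourier_l1 g \<theta>)) \<partial>circ)"
        by (rule nn_integral_cmult) measurable
      also have "\<dots> \<le> ennreal bound * ennreal (5 * e)" by (intro mult_left_mono nn) simp
      also have "\<dots> = ennreal (bound * (5 * e))" using bound(1) e by (simp add: ennreal_mult)
      finally show ?thesis .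
    qed
    have ui: "integrable circ u"
      by (rule integrableI_bounded) (use u_nn in \<open>auto intro: le_less_trans\<close>)
    have vi: "integrable circ v"
    proof -
      have "integrable circ (\<lambda>\<theta>. symbol \<theta> * (fourier_l1 g \<theta> * cis (- (of_int n * \<theta>))))"
      proof (rule symbol_times_integrable[where W = "\<Sum>k\<in>A. norm (g k)"])
        show "norm (fourier_l1 g \<theta> * cis (- (of_int n * \<theta>))) \<le> (\<Sum>k\<in>A. norm (g k))" for \<theta>
          unfolding norm_mult fourier_l1_finite[OF g(1)] using trig_poly_bounded[of g \<theta> A] by simp
      qed measurable
      then show ?thesis by (simp add: v_def[abs_def] mult.assoc)
    qed
    have "inv_fourier (\<lambda>\<theta>. symbol \<theta> * \<phi> \<theta>) n - conv kernel g n = 1 / (2 * of_real pi) * (LINT \<theta>|circ. u \<theta>)"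
    proof -
      have "(\<lambda>\<theta>. symbol \<theta> * \<phi> \<theta> * cis (- (of_int n * \<theta>))) = (\<lambda>\<theta>. u \<theta> + v \<theta>)"
        by (simp add: u_def v_def algebra_simps fun_eq_iff)
      then have "inv_fourier (\<lambda>\<theta>. symbol \<theta> * \<phi> \<theta>) n = 1 / (2 * of_real pi) * ((LINT \<theta>|circ. u \<theta>) + (LINT \<theta>|circ. v \<theta>))"
        by (simp add: inv_fourier_def Bochner_Integration.integral_add[OF ui vi])
      moreover have "conv kernel g n = 1 / (2 * of_real pi) * (LINT \<theta>|circ. v \<theta>)"
        unfolding inv_fourier_finite[OF g(1), symmetric] by (simp add: inv_fourier_def v_def)
      ultimately show ?thesis by (simp add: distrib_left)
    qed
    then have "norm (inv_fourier (\<lambda>\<theta>. symbol \<theta> * \<phi> \<theta>) n - conv kernel g n) = 1 / (2 * pi) * norm (LINT \<theta>|circ. u \<theta>)"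
      by (simp add: norm_mult norm_divide)
    also have "\<dots> \<le> 1 * norm (LINT \<theta>|circ. u \<theta>)"
      using pi_ge_two by (intro mult_right_mono) auto
    also have "norm (LINT \<theta>|circ. u \<theta>) \<le> bound * (5 * e)"
      using order_trans[OF integral_norm_bound_ennreal[OF ui] u_nn] bound(1) e by simp
    finally have 1: "norm (inv_fourier (\<lambda>\<theta>. symbol \<theta> * \<phi> \<theta>) n - conv kernel g n) \<le> bound * (5 * e)" by simp
    have 2: "norm (conv kernel f n - conv kernel g n) \<le> S * e"
    proof -
      have gs: "(\<lambda>k. kernel (n - k) * g k) summable_on UNIV"
        by (rule finite_nonzero_values_imp_summable_on)
          (rule finite_subset[of _ A], use g(1) in \<open>auto simp: supported_in_def\<close>)
      have "conv kernel f n - conv kernel g n = conv kernel (\<lambda>k. f k - g k) n"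
        unfolding conv_def right_diff_distrib
        by (rule infsum_diff_eq[symmetric, OF abs_summable_summable[OF conv_abs_summable[OF f]] gs])
      then show ?thesis using S(2)[OF e, of "\<lambda>k. f k - g k" n] g(2) by simp
    qed
    have "norm (inv_fourier (\<lambda>\<theta>. symbol \<theta> * \<phi> \<theta>) n - conv kernel f n)
       \<le> norm (inv_fourier (\<lambda>\<theta>. symbol \<theta> * \<phi> \<theta>) n - conv kernel g n) + norm (conv kernel f n - conv kernel g n)"
      using norm_triangle_ineq4[of "inv_fourier (\<lambda>\<theta>. symbol \<theta> * \<phi> \<theta>) n - conv kernel g n" "conv kernel f n - conv kernel g n"] by simp
    then show ?thesis using 1 2 by (simp add: algebra_simps)
  qed
  define z where "z = norm (inv_fourier (\<lambda>\<theta>. symbol \<theta> * \<phi> \<theta>) n - conv kernel f n)"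
  have c: "0 < bound * 5 + S + 1" using bound(1) S(1) by simp
  have "z \<le> 0"
  proof (rule field_le_epsilon)
    fix e :: real assume e: "0 < e"
    have "z \<le> (bound * 5 + S) * (e / (bound * 5 + S + 1))"
      unfolding z_def by (rule close) (use e c in simp)
    also have "\<dots> \<le> e" using e c by (simp add: field_simps)
    finally show "z \<le> 0 + e" by simp
  qed
  then have "inv_fourier (\<lambda>\<theta>. symbol \<theta> * \<phi> \<theta>) n = conv kernel f n" by (simp add: z_def)
  then show "multiplier_op m f n = conv kernel f n"
    unfolding multiplier_op_def \<phi>_def[symmetric] by (subst multiplier_op_symbol) auto
qed

end

section \<open>Extension to weighted spaces\<close>

lemma epowr_ennreal: "0 \<le> x \<Longrightarrow> epowr (ennreal x) a = ennreal (x powr a)"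
  by (simp add: epowr_def)

lemma Ap_weight_nonneg: "Ap_weight p w \<Longrightarrow> 0 \<le> w n"
  by (simp add: Ap_weight_def)

text \<open>
  An interval that contains a zero of the weight and a point of positive mass would make the left-hand side
  of the \<open>A\<^sub>p\<close> condition infinite.
\<close>

lemma Ap_weight_zero_or_positive:
  assumes p: "1 \<le> p" and w: "Ap_weight p w"
  shows "(\<forall>n. w n = 0) \<or> (\<forall>n. 0 < w n)"
proof (rule ccontr)
  assume "\<not> ?thesis"
  then obtain i j where ij: "w i \<noteq> 0" "\<not> 0 < w j" by blast
  have w0: "0 \<le> w n" for n by (rule Ap_weight_nonneg[OF w])
  have wj: "w j = 0" using ij(2) w0[of j] by simp
  have wi: "0 < w i" using ij(1) w0[of i] by simp
  define M where "M = min i j"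
  define N where "N = max i j"
  have MN: "M \<le> N" "i \<in> {M..N}" "j \<in> {M..N}" by (auto simp: M_def N_def)
  have le: "ennreal (w i) \<le> (\<Sum>k=M..N. ennreal (w k))" by (rule member_le_sum) (use MN in auto)
  have "0 < ennreal (w i)" using wi by simp
  from less_le_trans[OF this le] have S: "(\<Sum>k=M..N. ennreal (w k)) \<noteq> 0" by (rule less_imp_neq[symmetric])
  show False
  proof (cases "p = 1")
    case True
    have "inverse (ennreal (w j)) \<le> (SUP k\<in>{M..N}. inverse (ennreal (w k)))" by (rule SUP_upper) (rule MN(3))
    then have sup: "(SUP k\<in>{M..N}. inverse (ennreal (w k))) = top" by (simp add: wj top_unique)
    then have "(\<Sum>k=M..N. ennreal (w k)) * (SUP k\<in>{M..N}. inverse (ennreal (w k))) = top"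
      unfolding sup using S by (simp only: ennreal_mult_top if_False)
    then show False using w MN(1) True unfolding Ap_weight_def by (metis ennreal_less_top leD top.not_eq_extremum)
  next
    case False
    have "epowr (inverse (ennreal (w j))) (1 / (p - 1)) \<le> (\<Sum>k=M..N. epowr (inverse (ennreal (w k))) (1 / (p - 1)))"
      by (rule member_le_sum) (use MN in auto)
    then have "(\<Sum>k=M..N. epowr (inverse (ennreal (w k))) (1 / (p - 1))) = top"
      by (simp add: wj epowr_def top_unique)
    then have "(\<Sum>k=M..N. ennreal (w k)) * epowr (\<Sum>k=M..N. epowr (inverse (ennreal (w k))) (1 / (p - 1))) (p - 1) = top"
      using S by (simp add: epowr_def ennreal_mult_top)
    then show False using w MN(1) False unfolding Ap_weight_def by (metis ennreal_less_top leD top.not_eq_extremum)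
  qed
qed

lemma Ap_weight_real:
  assumes p: "1 < p" and w: "Ap_weight p w" and pos: "\<And>n. 0 < w n"
  shows "\<exists>C>0. \<forall>l r. l \<le> r \<longrightarrow> sum w {l..r} * (\<Sum>x\<in>{l..r}. w x powr (- 1 / (p - 1))) powr (p - 1) \<le> C * of_int (r - l + 1) powr p"
proof -
  obtain C where C: "0 < C" "\<And>M N. M \<le> N \<Longrightarrow> (\<Sum>k=M..N. ennreal (w k))
                * epowr (\<Sum>k=M..N. epowr (inverse (ennreal (w k))) (1 / (p - 1))) (p - 1)
                \<le> ennreal (C * of_int (N - M + 1) powr p)"
    using w p unfolding Ap_weight_def by auto
  have w0: "0 \<le> w n" for n using pos[of n] by simp
  have "sum w {l..r} * (\<Sum>x\<in>{l..r}. w x powr (- 1 / (p - 1))) powr (p - 1) \<le> C * of_int (r - l + 1) powr p"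
    if lr: "l \<le> r" for l r
  proof -
    have inv: "epowr (inverse (ennreal (w k))) (1 / (p - 1)) = ennreal (w k powr (- 1 / (p - 1)))" for k
      using pos[of k] by (simp add: inverse_ennreal epowr_ennreal powr_minus inverse_powr)
    have "ennreal (sum w {l..r} * (\<Sum>x\<in>{l..r}. w x powr (- 1 / (p - 1))) powr (p - 1))
      = (\<Sum>k=l..r. ennreal (w k)) * epowr (\<Sum>k=l..r. epowr (inverse (ennreal (w k))) (1 / (p - 1))) (p - 1)"
      unfolding inv using w0 by (simp add: sum_ennreal epowr_ennreal sum_nonneg ennreal_mult)
    also have "\<dots> \<le> ennreal (C * of_int (r - l + 1) powr p)" by (rule C(2)[OF lr])
    finally show ?thesis using C(1) by (subst (asm) ennreal_le_iff) auto
  qed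
  then show ?thesis using C(1) by blast
qed

lemma A1_weight_real:
  assumes w: "Ap_weight 1 w" and pos: "\<And>n. 0 < w n"
  shows "\<exists>C>0. \<forall>l r x. l \<le> x \<longrightarrow> x \<le> r \<longrightarrow> sum w {l..r} \<le> C * of_int (r - l + 1) * w x"
proof -
  obtain C where C: "0 < C" "\<And>M N. M \<le> N \<Longrightarrow> (\<Sum>k=M..N. ennreal (w k)) * (SUP k\<in>{M..N}. inverse (ennreal (w k)))
                \<le> ennreal (C * of_int (N - M + 1))"
    using w unfolding Ap_weight_def by auto
  have w0: "0 \<le> w n" for n using pos[of n] by simp
  have "sum w {l..r} \<le> C * of_int (r - l + 1) * w x" if x: "l \<le> x" "x \<le> r" for l r x
  proof -
    have "ennreal (sum w {l..r} * inverse (w x)) = (\<Sum>k=l..r. ennreal (w k)) * inverse (ennreal (w x))"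
      using w0 pos[of x] by (simp add: sum_ennreal inverse_ennreal sum_nonneg ennreal_mult)
    also have "\<dots> \<le> (\<Sum>k=l..r. ennreal (w k)) * (SUP k\<in>{l..r}. inverse (ennreal (w k)))"
      by (intro mult_left_mono SUP_upper) (use x in auto)
    also have "\<dots> \<le> ennreal (C * of_int (r - l + 1))" by (rule C(2)) (use x in simp)
    finally have "sum w {l..r} * inverse (w x) \<le> C * of_int (r - l + 1)"
      using C(1) x by (subst (asm) ennreal_le_iff) auto
    then show ?thesis using pos[of x] by (simp add: field_simps)
  qed
  then show ?thesis using C(1) by blast
qed

text \<open>
  Extend from a basis of \<open>V\<close> to a basis of the space of all sequences. For the weight \<open>0\<close> the space \<open>\<ell>\<^sup>p(w)\<close>
  contains all sequences and all its norms vanish, so a linear extension is all that is asked for, and no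
  continuity could single one out.
\<close>

lemma linear_extension_exists:
  fixes T :: "(int \<Rightarrow> complex) \<Rightarrow> int \<Rightarrow> complex"
  assumes lin: "linear_op_on V T"
    and V: "(\<lambda>_. 0) \<in> V" "\<And>f g. f \<in> V \<Longrightarrow> g \<in> V \<Longrightarrow> (\<lambda>n. f n + g n) \<in> V" "\<And>c f. f \<in> V \<Longrightarrow> (\<lambda>n. c * f n) \<in> V"
  shows "\<exists>S. linear_op_on UNIV S \<and> (\<forall>f\<in>V. S f = T f)"
proof -
  define sc where "sc c f = (\<lambda>n. c * f n)" for c :: complex and f :: "int \<Rightarrow> complex"
  interpret vector_space sc
    by standard (auto simp: sc_def plus_fun_def algebra_simps fun_eq_iff)
  interpret pair: vector_space_pair sc sc ..
  obtain B where B: "B \<subseteq> V" "independent B" "V \<subseteq> span B" by (rule maximal_independent_subset)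
  obtain S where S: "Vector_Spaces.linear sc sc S" "\<And>x. x \<in> B \<Longrightarrow> S x = T x"
    using pair.linear_independent_extend[OF B(2)] by blast
  interpret S: Vector_Spaces.linear sc sc S by (rule S(1))
  have T_add: "T (\<lambda>n. f n + g n) = (\<lambda>n. T f n + T g n)" if "f \<in> V" "g \<in> V" for f g
    using lin that unfolding linear_op_on_def by blast
  have T_scale: "T (\<lambda>n. c * f n) = (\<lambda>n. c * T f n)" if "f \<in> V" for c f
    using lin that unfolding linear_op_on_def by blast
  have T0: "T (\<lambda>_. 0) = (\<lambda>_. 0)" using T_scale[OF V(1), of 0] by simp
  have eq: "f \<in> V \<and> S f = T f" if "f \<in> span B" for f
    using that
  proof (induction rule: span_induct_alt)
    case base
    then show ?case using V(1) T0 S.zero by (simp add: zero_fun_def)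
  next
    case (step c x y)
    have x: "x \<in> V" using step(1) B(1) by blast
    have cx: "sc c x \<in> V" using V(3)[OF x] by (simp add: sc_def)
    have y: "y \<in> V" "S y = T y" using step(2) by auto
    have "sc c x + y \<in> V" using V(2)[OF cx y(1)] by (simp add: plus_fun_def)
    moreover have "S (sc c x + y) = T (sc c x + y)"
      using T_add[OF cx y(1)] T_scale[OF x, of c] S(2)[OF step(1)] y(2)
      by (simp add: S.add S.scale) (simp add: plus_fun_def sc_def)
    ultimately show ?case by (rule conjI)
  qed
  have "linear_op_on UNIV S"
    using S.add S.scale unfolding linear_op_on_def by (simp add: plus_fun_def sc_def)
  then show ?thesis using eq B(3) by blast
qed

lemma lp2_closed:
  shows "(\<lambda>_. 0) \<in> lp_space 2 unit_weight"
    and "f \<in> lp_space 2 unit_weight \<Longrightarrow> g \<in> lp_space 2 unit_weight \<Longrightarrow> (\<lambda>n. f n + g n) \<in> lp_space 2 unit_weight"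
    and "f \<in> lp_space 2 unit_weight \<Longrightarrow> (\<lambda>n. c * f n) \<in> lp_space 2 unit_weight"
proof -
  show "(\<lambda>_. 0) \<in> lp_space 2 unit_weight" by (rule lp_spaceI[where C = 0]) auto
next
  assume fg: "f \<in> lp_space 2 unit_weight" "g \<in> lp_space 2 unit_weight"
  obtain C where "0 \<le> C" "lp_norm 2 unit_weight f = ennreal C" and C: "\<And>F. finite F \<Longrightarrow> (\<Sum>n\<in>F. norm (f n) powr 2 * 1) \<le> C powr 2"
    by (rule lp_space_obtain[OF _ _ fg(1)]) auto
  obtain D where "0 \<le> D" "lp_norm 2 unit_weight g = ennreal D" and D: "\<And>F. finite F \<Longrightarrow> (\<Sum>n\<in>F. norm (g n) powr 2 * 1) \<le> D powr 2"
    by (rule lp_space_obtain[OF _ _ fg(2)]) auto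
  show "(\<lambda>n. f n + g n) \<in> lp_space 2 unit_weight"
  proof (rule lp_spaceI[where C = "2 * C powr 2 + 2 * D powr 2"])
    fix F :: "int set" assume F: "finite F"
    have "(\<Sum>n\<in>F. norm (f n + g n) powr 2 * 1) \<le> (\<Sum>n\<in>F. 2 * (norm (f n) powr 2 * 1) + 2 * (norm (g n) powr 2 * 1))"
    proof (rule sum_mono)
      fix n
      show "norm (f n + g n) powr 2 * 1 \<le> 2 * (norm (f n) powr 2 * 1) + 2 * (norm (g n) powr 2 * 1)"
        using norm_diff_square_le[of "f n" "- g n" 0] by simp
    qed
    also have "\<dots> = 2 * (\<Sum>n\<in>F. norm (f n) powr 2 * 1) + 2 * (\<Sum>n\<in>F. norm (g n) powr 2 * 1)"
      by (simp add: sum.distrib sum_distrib_left)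
    also have "\<dots> \<le> 2 * C powr 2 + 2 * D powr 2" using C[OF F] D[OF F] by linarith
    finally show "(\<Sum>n\<in>F. norm (f n + g n) powr 2 * 1) \<le> 2 * C powr 2 + 2 * D powr 2" .
  qed auto
next
  assume f: "f \<in> lp_space 2 unit_weight"
  obtain C where "0 \<le> C" "lp_norm 2 unit_weight f = ennreal C" and C: "\<And>F. finite F \<Longrightarrow> (\<Sum>n\<in>F. norm (f n) powr 2 * 1) \<le> C powr 2"
    by (rule lp_space_obtain[OF _ _ f]) auto
  show "(\<lambda>n. c * f n) \<in> lp_space 2 unit_weight"
  proof (rule lp_spaceI[where C = "(norm c)\<^sup>2 * C powr 2"])
    fix F :: "int set" assume F: "finite F"
    have "(\<Sum>n\<in>F. norm (c * f n) powr 2 * 1) = (norm c)\<^sup>2 * (\<Sum>n\<in>F. norm (f n) powr 2 * 1)"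
      by (simp add: norm_mult power_mult_distrib sum_distrib_left)
    also have "\<dots> \<le> (norm c)\<^sup>2 * C powr 2" by (intro mult_left_mono C F) simp
    finally show "(\<Sum>n\<in>F. norm (c * f n) powr 2 * 1) \<le> (norm c)\<^sup>2 * C powr 2" .
  qed auto
qed

context calderon_zygmund_kernel
begin

text \<open>
  The extension of \<open>T\<close> by truncation.
\<close>

definition limit_conv :: "(int \<Rightarrow> complex) \<Rightarrow> int \<Rightarrow> complex" where
  "limit_conv f n = lim (\<lambda>N. conv K (cut {- int N..int N} f) n)"

lemma limit_conv_eq_conv:
  assumes "f \<in> lp_space 2 unit_weight"
  shows "limit_conv f = conv K f"
  using limI[OF conv_cut_tendsto[OF assms]] by (simp add: limit_conv_def fun_eq_iff)

lemma conv_linear_op: "linear_op_on (lp_space 2 unit_weight) (conv K)"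
  unfolding linear_op_on_def using conv_linear by (simp add: fun_eq_iff)

text \<open>
  A pointwise bound by the weighted norm turns the absolutely convergent norm of \<open>f\<close> into a Cauchy criterion for
  the values at \<open>n\<close>.
\<close>

lemma conv_cut_convergent:
  assumes p: "1 \<le> p" and w: "\<And>n. 0 \<le> w n"
    and pt: "\<And>g A. supported_in g A \<Longrightarrow> norm (conv K g n) powr p \<le> c * (\<Sum>k\<in>A. norm (g k) powr p * w k)"
    and f: "f \<in> lp_space p w"
  shows "(\<lambda>N. conv K (cut {- int N..int N} f) n) \<longlonglongrightarrow> limit_conv f n"
proof -
  define X where "X N = conv K (cut {- int N..int N} f) n" for N
  define I where "I N = {- int N..int N}" for N
  define v where "v k = norm (f k) powr p * w k" for k
  define s where "s N = sum v (I N)" for N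
  have v0: "0 \<le> v k" for k by (simp add: v_def w)
  have pp: "0 < p" using p by simp
  obtain C where "0 \<le> C" "lp_norm p w f = ennreal C" and C: "\<And>F. finite F \<Longrightarrow> (\<Sum>n\<in>F. norm (f n) powr p * w n) \<le> C powr p"
    by (rule lp_space_obtain[OF pp w f]) auto
  have I_mono: "I M \<subseteq> I N" if "M \<le> N" for M N using that by (auto simp: I_def)
  have fin: "finite (I N)" for N by (simp add: I_def)
  have "incseq s" unfolding s_def incseq_def by (intro allI impI sum_mono2 fin I_mono v0)
  moreover have "s N \<le> C powr p" for N unfolding s_def v_def by (rule C[OF fin])
  ultimately obtain L where "s \<longlonglongrightarrow> L" using incseq_convergent[of s "C powr p"] by blast
  then have cau: "Cauchy s" by (rule LIMSEQ_imp_Cauchy)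
  define d where "d = max c 1"
  have d: "0 < d" by (simp add: d_def)
  have diff: "norm (X N - X M) powr p \<le> d * (s N - s M)" if MN: "M \<le> N" for M N
  proof -
    define g where "g = cut (I N - I M) f"
    have g: "supported_in g (I N - I M)" using fin by (simp add: g_def)
    have "cut (I N) f = (\<lambda>k. cut (I M) f k + g k)"
      using I_mono[OF MN] by (auto simp: cut_def g_def fun_eq_iff)
    moreover have "supported_in (cut (I M) f) (I N)" "supported_in g (I N)"
      using I_mono[OF MN] fin by (auto simp: supported_in_def cut_def g_def)
    ultimately have "X N = X M + conv K g n"
      unfolding X_def I_def[symmetric] using conv_add by metis
    then have "norm (X N - X M) powr p = norm (conv K g n) powr p" by simp
    also have "\<dots> \<le> c * (\<Sum>k\<in>I N - I M. norm (g k) powr p * w k)" by (rule pt[OF g])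
    also have "(\<Sum>k\<in>I N - I M. norm (g k) powr p * w k) = sum v (I N - I M)"
      by (simp add: g_def cut_def v_def)
    also have "c * \<dots> \<le> d * sum v (I N - I M)"
      by (intro mult_right_mono) (auto simp: d_def v0 sum_nonneg)
    also have "sum v (I N - I M) = s N - s M"
      unfolding s_def using I_mono[OF MN] fin by (simp add: sum_diff)
    finally show ?thesis .
  qed
  have "Cauchy X"
  proof (rule metric_CauchyI)
    fix e :: real assume e: "0 < e"
    have "0 < e powr p / d" using e d by simp
    then obtain N0 where N0: "\<And>m n. N0 \<le> m \<Longrightarrow> N0 \<le> n \<Longrightarrow> dist (s m) (s n) < e powr p / d"
      using metric_CauchyD[OF cau] by blast
    have less: "dist (X N) (X M) < e" if "N0 \<le> M" "M \<le> N" for M N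
    proof -
      have "norm (X N - X M) powr p \<le> d * (s N - s M)" by (rule diff[OF that(2)])
      also have "\<dots> \<le> d * dist (s N) (s M)" using d by (intro mult_left_mono) (auto simp: dist_real_def)
      also have "\<dots> < d * (e powr p / d)" using N0[of N M] that d by (intro mult_strict_left_mono) auto
      finally have "norm (X N - X M) powr p < e powr p" using d by simp
      then have "norm (X N - X M) < e"
        using powr_mono2[of p e "norm (X N - X M)"] pp e by (metis less_imp_le not_less)
      then show ?thesis by (simp add: dist_norm)
    qed
    show "\<exists>M. \<forall>m\<ge>M. \<forall>n\<ge>M. dist (X m) (X n) < e"
      using less by (metis dist_commute nle_le)
  qed
  then have "convergent X" by (rule Cauchy_convergent)
  then have "X \<longlonglongrightarrow> lim X" by (simp add: convergent_LIMSEQ_iff)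
  then show ?thesis by (simp add: X_def[abs_def] limit_conv_def)
qed

lemma limit_conv_linear:
  assumes lim: "\<And>f n. f \<in> V \<Longrightarrow> (\<lambda>N. conv K (cut {- int N..int N} f) n) \<longlonglongrightarrow> limit_conv f n"
  shows "linear_op_on V limit_conv"
  unfolding linear_op_on_def
proof (intro conjI ballI allI ext)
  fix f g n assume fg: "f \<in> V" "g \<in> V"
  have "conv K (cut {- int N..int N} (\<lambda>n. f n + g n)) n = conv K (cut {- int N..int N} f) n + conv K (cut {- int N..int N} g) n" for N
  proof -
    have "cut {- int N..int N} (\<lambda>n. f n + g n) = (\<lambda>k. cut {- int N..int N} f k + cut {- int N..int N} g k)"
      by (auto simp: cut_def)
    then show ?thesis using conv_add[of "cut {- int N..int N} f" "{- int N..int N}"] by simp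
  qed
  then have "(\<lambda>N. conv K (cut {- int N..int N} (\<lambda>n. f n + g n)) n) \<longlonglongrightarrow> limit_conv f n + limit_conv g n"
    using tendsto_add[OF lim[OF fg(1)] lim[OF fg(2)]] by simp
  then show "limit_conv (\<lambda>n. f n + g n) n = limit_conv f n + limit_conv g n"
    unfolding limit_conv_def by (rule limI)
next
  fix c f n assume f: "f \<in> V"
  have "conv K (cut {- int N..int N} (\<lambda>n. c * f n)) n = c * conv K (cut {- int N..int N} f) n" for N
  proof -
    have "supported_in (cut {- int N..int N} (\<lambda>n. c * f n)) {- int N..int N}" by simp
    then show ?thesis
      by (simp add: conv_finite[of _ "{- int N..int N}"] sum_distrib_left cut_def mult_ac)
  qed
  then have "(\<lambda>N. conv K (cut {- int N..int N} (\<lambda>n. c * f n)) n) \<longlonglongrightarrow> c * limit_conv f n"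
    using tendsto_mult_left[OF lim[OF f]] by simp
  then show "limit_conv (\<lambda>n. c * f n) n = c * limit_conv f n"
    unfolding limit_conv_def by (rule limI)
qed

lemma cut_sum_le:
  assumes "\<And>n. 0 \<le> w n"
  shows "(\<Sum>k\<in>A. norm (cut A f k) powr p * w k) = (\<Sum>k\<in>A. norm (f k) powr p * w k)"
  by (simp add: cut_def)

text \<open>
  The bounds for finite sums pass from the truncations to the pointwise limit.
\<close>

lemma strong_extension:
  assumes p: "1 \<le> p" and w: "\<And>n. 0 < w n" and B: "0 \<le> B"
    and bound: "\<And>f A F. supported_in f A \<Longrightarrow> finite F \<Longrightarrow>
       (\<Sum>n\<in>F. norm (conv K f n) powr p * w n) \<le> B * (\<Sum>k\<in>A. norm (f k) powr p * w k)"
  shows "extends_boundedly (conv K) p w (lp_norm p w)"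
proof -
  have w0: "0 \<le> w n" for n using w[of n] by simp
  have pp: "0 < p" using p by simp
  have pt: "norm (conv K g n) powr p \<le> (B / w n) * (\<Sum>k\<in>A. norm (g k) powr p * w k)" if "supported_in g A" for g A n
    using bound[OF that, of "{n}"] w[of n] by (simp add: field_simps)
  have lim: "(\<lambda>N. conv K (cut {- int N..int N} f) n) \<longlonglongrightarrow> limit_conv f n" if "f \<in> lp_space p w" for f n
    by (rule conv_cut_convergent[OF p w0 pt that])
  have norm: "lp_norm p w (limit_conv f) \<le> ennreal (B powr (1 / p)) * lp_norm p w f" if f: "f \<in> lp_space p w" for f
  proof -
    obtain C where C: "0 \<le> C" "lp_norm p w f = ennreal C"
       "\<And>F. finite F \<Longrightarrow> (\<Sum>n\<in>F. norm (f n) powr p * w n) \<le> C powr p"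
      by (rule lp_space_obtain[OF pp w0 f]) blast
    have "lp_norm p w (limit_conv f) \<le> ennreal (B powr (1 / p) * C)"
    proof (subst lp_norm_le_iff[OF pp w0], simp add: C(1), intro allI impI)
      fix F :: "int set" assume F: "finite F"
      have "(\<lambda>N. \<Sum>n\<in>F. norm (conv K (cut {- int N..int N} f) n) powr p * w n) \<longlonglongrightarrow> (\<Sum>n\<in>F. norm (limit_conv f n) powr p * w n)"
        by (intro tendsto_sum tendsto_mult_right tendsto_powr' tendsto_norm lim f tendsto_const) (use pp in auto)
      moreover have "(\<Sum>n\<in>F. norm (conv K (cut {- int N..int N} f) n) powr p * w n) \<le> B * C powr p" for N
      proof -
        have "(\<Sum>n\<in>F. norm (conv K (cut {- int N..int N} f) n) powr p * w n)
           \<le> B * (\<Sum>k\<in>{- int N..int N}. norm (cut {- int N..int N} f k) powr p * w k)"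
          by (rule bound) (use F in auto)
        also have "\<dots> \<le> B * C powr p"
          unfolding cut_sum_le[OF w0] by (intro mult_left_mono C(3) B) simp
        finally show ?thesis .
      qed
      ultimately have "(\<Sum>n\<in>F. norm (limit_conv f n) powr p * w n) \<le> B * C powr p"
        by (intro LIMSEQ_le_const2) auto
      also have "\<dots> = (B powr (1 / p) * C) powr p" using B C(1) pp by (simp add: powr_mult powr_powr)
      finally show "(\<Sum>n\<in>F. norm (limit_conv f n) powr p * w n) \<le> (B powr (1 / p) * C) powr p" .
    qed
    also have "\<dots> = ennreal (B powr (1 / p)) * lp_norm p w f" using C by (simp add: ennreal_mult)
    finally show ?thesis .
  qed
  show ?thesis
    unfolding extends_boundedly_def
  proof (intro exI[of _ limit_conv] conjI)
    show "linear_op_on (lp_space p w) limit_conv" by (rule limit_conv_linear[OF lim])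
    show "\<forall>f\<in>lp_space 2 unit_weight \<inter> lp_space p w. limit_conv f = conv K f"
      using limit_conv_eq_conv by blast
    show "\<exists>C. \<forall>f\<in>lp_space p w. lp_norm p w (limit_conv f) \<le> ennreal C * lp_norm p w f"
      using norm by blast
  qed
qed

text \<open>
  On a finite set on which the limit exceeds \<open>l\<close>, so does some truncation.
\<close>

lemma weak_extension:
  assumes w: "\<And>n. 0 < w n" and B: "0 \<le> B"
    and bound: "\<And>f A F l. supported_in f A \<Longrightarrow> finite F \<Longrightarrow> 0 < l \<Longrightarrow>
       l * (\<Sum>n\<in>{n\<in>F. l < norm (conv K f n)}. w n) \<le> B * (\<Sum>k\<in>A. norm (f k) * w k)"
  shows "extends_boundedly (conv K) 1 w (weak_l1_norm w)"
proof -
  have w0: "0 \<le> w n" for n using w[of n] by simp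
  have pt: "norm (conv K g n) powr 1 \<le> (B / w n) * (\<Sum>k\<in>A. norm (g k) powr 1 * w k)" if g: "supported_in g A" for g A n
  proof -
    define R where "R = (B / w n) * (\<Sum>k\<in>A. norm (g k) * w k)"
    have R0: "0 \<le> R" using B w0 by (auto simp: R_def intro!: mult_nonneg_nonneg sum_nonneg divide_nonneg_nonneg)
    have "norm (conv K g n) \<le> R"
    proof (rule ccontr)
      assume "\<not> ?thesis"
      then obtain l where l: "R < l" "l < norm (conv K g n)" using dense[of R "norm (conv K g n)"] by auto
      have "{x\<in>{n}. l < norm (conv K g x)} = {n}" using l by auto
      then have "l * w n \<le> B * (\<Sum>k\<in>A. norm (g k) * w k)" using bound[OF g, of "{n}" l] l R0 by simp
      then have "l \<le> R" using w[of n] by (simp add: R_def field_simps)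
      then show False using l by simp
    qed
    then show ?thesis by (simp add: R_def)
  qed
  have lim: "(\<lambda>N. conv K (cut {- int N..int N} f) n) \<longlonglongrightarrow> limit_conv f n" if "f \<in> lp_space 1 w" for f n
    by (rule conv_cut_convergent[OF order_refl w0 pt that])
  have norm: "weak_l1_norm w (limit_conv f) \<le> ennreal B * lp_norm 1 w f" if f: "f \<in> lp_space 1 w" for f
  proof -
    obtain C where C: "0 \<le> C" "lp_norm 1 w f = ennreal C"
       "\<And>F. finite F \<Longrightarrow> (\<Sum>n\<in>F. norm (f n) powr 1 * w n) \<le> C powr 1"
      by (rule lp_space_obtain[OF _ w0 f]) auto
    have "ennreal l * (\<Sum>\<^sub>\<infinity>n\<in>{n. l < norm (limit_conv f n)}. ennreal (w n)) \<le> ennreal (B * C)" if l: "0 < l" for l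
    proof -
      have "(\<Sum>\<^sub>\<infinity>n\<in>{n. l < norm (limit_conv f n)}. ennreal (w n)) \<le> ennreal (B * C / l)"
      proof (subst infsum_ennreal_le_iff[OF w0], simp add: B C(1) l less_imp_le, intro allI impI)
        fix F assume F: "finite F" "F \<subseteq> {n. l < norm (limit_conv f n)}"
        have "\<forall>\<^sub>F N in sequentially. \<forall>n\<in>F. l < norm (conv K (cut {- int N..int N} f) n)"
          using F by (intro eventually_ball_finite ballI order_tendstoD(1)[OF tendsto_norm[OF lim[OF f]]]) auto
        then obtain N where N: "\<forall>n\<in>F. l < norm (conv K (cut {- int N..int N} f) n)"
          using eventually_happens'[OF sequentially_bot] by blast
        then have "{n\<in>F. l < norm (conv K (cut {- int N..int N} f) n)} = F" by auto
        then have "l * sum w F \<le> B * (\<Sum>k\<in>{- int N..int N}. norm (cut {- int N..int N} f k) * w k)"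
          using bound[of "cut {- int N..int N} f" "{- int N..int N}" F l] F(1) l by simp
        also have "\<dots> = B * (\<Sum>k\<in>{- int N..int N}. norm (f k) powr 1 * w k)"
          by (simp add: cut_def)
        also have "\<dots> \<le> B * (C powr 1)" by (intro mult_left_mono C(3) B) simp
        finally have "l * sum w F \<le> B * C" using C(1) by simp
        then show "sum w F \<le> B * C / l" using l by (simp add: field_simps)
      qed
      then have "ennreal l * (\<Sum>\<^sub>\<infinity>n\<in>{n. l < norm (limit_conv f n)}. ennreal (w n)) \<le> ennreal l * ennreal (B * C / l)"
        by (intro mult_left_mono) auto
      also have "\<dots> = ennreal (B * C)" using l B C(1) by (simp add: ennreal_mult[symmetric])
      finally show ?thesis .
    qed
    then have "weak_l1_norm w (limit_conv f) \<le> ennreal (B * C)"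
      unfolding weak_l1_norm_def by (intro SUP_least) auto
    then show ?thesis using B C by (simp add: ennreal_mult)
  qed
  show ?thesis
    unfolding extends_boundedly_def
  proof (intro exI[of _ limit_conv] conjI)
    show "linear_op_on (lp_space 1 w) limit_conv" by (rule limit_conv_linear[OF lim])
    show "\<forall>f\<in>lp_space 2 unit_weight \<inter> lp_space 1 w. limit_conv f = conv K f"
      using limit_conv_eq_conv by blast
    show "\<exists>C. \<forall>f\<in>lp_space 1 w. weak_l1_norm w (limit_conv f) \<le> ennreal C * lp_norm 1 w f"
      using norm by blast
  qed
qed

lemma zero_weight_extension:
  assumes "\<And>f. target_norm f = 0"
  shows "extends_boundedly (conv K) p w target_norm"
proof -
  obtain S where S: "linear_op_on UNIV S" "\<forall>f\<in>lp_space 2 unit_weight. S f = conv K f"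
    using linear_extension_exists[OF conv_linear_op] lp2_closed by blast
  then have "linear_op_on (lp_space p w) S" unfolding linear_op_on_def by blast
  then show ?thesis unfolding extends_boundedly_def using S(2) assms
    by (intro exI[of _ S]) auto
qed

lemma weighted_bounds:
  shows "1 < p \<Longrightarrow> Ap_weight p w \<Longrightarrow> extends_boundedly (conv K) p w (lp_norm p w)"
    and "Ap_weight 1 w \<Longrightarrow> extends_boundedly (conv K) 1 w (weak_l1_norm w)"
proof -
  assume p: "1 < p" and Ap: "Ap_weight p w"
  show "extends_boundedly (conv K) p w (lp_norm p w)"
  proof (cases "\<forall>n. w n = 0")
    case True
    then show ?thesis by (intro zero_weight_extension) (simp add: lp_norm_def epowr_def)
  next
    case False
    then have pos: "0 < w n" for n using Ap_weight_zero_or_positive[OF _ Ap] p by auto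
    obtain C where C: "0 < C" "\<And>l r. l \<le> r \<Longrightarrow> sum w {l..r} * (\<Sum>x\<in>{l..r}. w x powr (- 1 / (p - 1))) powr (p - 1) \<le> C * of_int (r - l + 1) powr p"
      using Ap_weight_real[OF p Ap pos] by blast
    obtain B where B: "0 \<le> B" "\<And>f A F. supported_in f A \<Longrightarrow> finite F \<Longrightarrow>
     (\<Sum>n\<in>F. norm (conv K f n) powr p * w n) \<le> B * (\<Sum>k\<in>A. norm (f k) powr p * w k)"
      using Ap_bound[OF p pos C] by blast
    show ?thesis by (rule strong_extension[OF _ pos B]) (use p in simp)
  qed
next
  assume A1: "Ap_weight 1 w"
  show "extends_boundedly (conv K) 1 w (weak_l1_norm w)"
  proof (cases "\<forall>n. w n = 0")
    case True
    then show ?thesis by (intro zero_weight_extension) (simp add: weak_l1_norm_def)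
  next
    case False
    then have pos: "0 < w n" for n using Ap_weight_zero_or_positive[OF _ A1] by auto
    obtain C where C: "0 < C" "\<And>l r x. l \<le> x \<Longrightarrow> x \<le> r \<Longrightarrow> sum w {l..r} \<le> C * of_int (r - l + 1) * w x"
      using A1_weight_real[OF A1 pos] by blast
    obtain B where B: "0 \<le> B" "\<And>f A F l. supported_in f A \<Longrightarrow> finite F \<Longrightarrow> 0 < l \<Longrightarrow>
           l * (\<Sum>n\<in>{n\<in>F. l < norm (conv K f n)}. w n) \<le> B * (\<Sum>k\<in>A. norm (f k) * w k)"
      using A1_bound[OF pos C] by blast
    show ?thesis by (rule weak_extension[OF pos B])
  qed
qed

end

section \<open>Boundedness on Hardy spaces\<close>

lemma suminf_tail_tendsto:
  fixes f :: "nat \<Rightarrow> real"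
  assumes "summable f"
  shows "(\<lambda>N. \<Sum>j. f (j + N)) \<longlonglongrightarrow> 0"
  unfolding suminf_minus_initial_segment[OF assms]
  using tendsto_diff[OF tendsto_const summable_LIMSEQ[OF assms], of "suminf f"] by simp

lemma hardy_atom_l1:
  assumes p: "0 < p" "p \<le> 1" and b: "hardy_atom p b" and F: "finite F"
  shows "(\<Sum>n\<in>F. norm (b n)) \<le> 1"
proof -
  obtain n0 and R :: nat where b: "supported_in b {n0 - int R..n0 + int R}"
    "\<And>n. norm (b n) \<le> (2 * real R + 1) powr (- 1 / p)" using hardy_atomE[OF p b] by metis
  define I where "I = {n0 - int R..n0 + int R}"
  define L where "L = 2 * real R + 1"
  have L: "1 \<le> L" by (simp add: L_def)
  have card: "real (card I) = L" by (simp add: I_def L_def)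
  have "(\<Sum>n\<in>F. norm (b n)) = (\<Sum>n\<in>F \<inter> I. norm (b n))"
    by (rule sum.mono_neutral_right) (use F b(1) in \<open>auto simp: I_def supported_in_def\<close>)
  also have "\<dots> \<le> (\<Sum>n\<in>I. norm (b n))" by (rule sum_mono2) (auto simp: I_def)
  also have "\<dots> \<le> (\<Sum>n\<in>I. L powr (- 1 / p))" unfolding L_def by (rule sum_mono) (rule b(2))
  also have "\<dots> = L powr 1 * L powr (- 1 / p)" using L by (simp add: card)
  also have "\<dots> = L powr (1 + - 1 / p)" by (simp only: powr_add)
  also have "\<dots> \<le> L powr 0" using p L by (intro powr_mono) auto
  also have "\<dots> = 1" using L by simp
  finally show ?thesis .
qed

text \<open>
  Atoms have \<open>\<ell>\<^sup>1\<close> norm at most one, as \<open>p \<le> 1\<close>.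
\<close>

lemma atom_series_l1:
  assumes p: "0 < p" "p \<le> 1" and \<mu>: "\<And>j. 0 \<le> \<mu> j" "summable \<mu>" and b: "\<And>j. hardy_atom p (b j)"
    and g: "\<And>n. (\<lambda>j. of_real (\<mu> j) * b j n) sums g n" and F: "finite F"
  shows "(\<Sum>n\<in>F. norm (g n)) \<le> suminf \<mu>"
proof -
  have "(\<lambda>N. \<Sum>n\<in>F. norm (\<Sum>j<N. of_real (\<mu> j) * b j n)) \<longlonglongrightarrow> (\<Sum>n\<in>F. norm (g n))"
    using g unfolding sums_def by (intro tendsto_sum tendsto_norm)
  moreover have "(\<Sum>n\<in>F. norm (\<Sum>j<N. of_real (\<mu> j) * b j n)) \<le> suminf \<mu>" for N
  proof -
    have "(\<Sum>n\<in>F. norm (\<Sum>j<N. of_real (\<mu> j) * b j n)) \<le> (\<Sum>n\<in>F. \<Sum>j<N. \<mu> j * norm (b j n))"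
      using \<mu>(1) by (intro sum_mono order_trans[OF norm_sum]) (simp add: norm_mult)
    also have "\<dots> = (\<Sum>j<N. \<mu> j * (\<Sum>n\<in>F. norm (b j n)))"
      by (subst sum.swap) (simp add: sum_distrib_left)
    also have "\<dots> \<le> (\<Sum>j<N. \<mu> j * 1)"
      by (intro sum_mono mult_left_mono hardy_atom_l1[OF p b F] \<mu>(1))
    also have "\<dots> \<le> suminf \<mu>" using \<mu> by (simp add: sum_le_suminf)
    finally show ?thesis .
  qed
  ultimately show ?thesis by (intro LIMSEQ_le_const2) auto
qed

lemma atom_series_remainder_l1:
  assumes p: "0 < p" "p \<le> 1" and \<mu>: "\<And>j. 0 \<le> \<mu> j" "summable \<mu>" and b: "\<And>j. hardy_atom p (b j)"
    and g: "\<And>n. (\<lambda>j. of_real (\<mu> j) * b j n) sums g n" and F: "finite F"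
  shows "(\<Sum>n\<in>F. norm (g n - (\<Sum>j<N. of_real (\<mu> j) * b j n))) \<le> (\<Sum>j. \<mu> (j + N))"
proof (rule atom_series_l1[OF p _ _ _ _ F, where b = "\<lambda>j. b (j + N)"])
  show "(\<lambda>j. of_real (\<mu> (j + N)) * b (j + N) n) sums (g n - (\<Sum>j<N. of_real (\<mu> j) * b j n))" for n
    by (rule sums_split_initial_segment[OF g])
qed (use \<mu> b in auto)

lemma seq_functional_finite:
  assumes "supported_in b A"
  shows "seq_functional b a = (\<Sum>n\<in>A. a n * b n)"
proof -
  have "seq_functional b a = (\<Sum>\<^sub>\<infinity>n\<in>A. a n * b n)"
    unfolding seq_functional_def by (rule infsum_cong_neutral) (use assms in \<open>auto simp: supported_in_def\<close>)
  then show ?thesis using assms by (simp add: supported_in_def)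
qed

lemma lip_norm_bound:
  assumes "lip_norm \<alpha> a \<le> ennreal r" "0 \<le> r" "n \<noteq> m"
  shows "norm (a n - a m) \<le> r * \<bar>of_int (n - m)\<bar> powr \<alpha>"
proof -
  have "ennreal (norm (a n - a m) / \<bar>of_int (n - m)\<bar> powr \<alpha>) \<le> lip_norm \<alpha> a"
    unfolding lip_norm_def by (rule SUP_upper2[of "(n, m)"]) (use assms(3) in auto)
  then have "ennreal (norm (a n - a m) / \<bar>of_int (n - m)\<bar> powr \<alpha>) \<le> ennreal r"
    using assms(1) by (rule order_trans)
  then have "norm (a n - a m) / \<bar>of_int (n - m)\<bar> powr \<alpha> \<le> r" using assms(2) by (simp add: ennreal_le_iff)
  moreover have "0 < \<bar>real_of_int (n - m)\<bar> powr \<alpha>" using assms(3) by simp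
  ultimately show ?thesis by (simp only: pos_divide_le_eq)
qed

text \<open>
  On a ball with \<open>L\<close> points an atom is at most \<open>L powr (- 1 / p)\<close>, and its mean is zero, so \<open>a\<close> may be replaced by \<open>a - a n0\<close>,
  which is at most \<open>r * L powr (1 / p - 1)\<close> there. The powers of \<open>L\<close> cancel.
\<close>

lemma seq_functional_atom:
  assumes p: "0 < p" "p < 1" and b: "hardy_atom p b" and a: "lip_norm (1 / p - 1) a \<le> ennreal r" "0 \<le> r"
  shows "norm (seq_functional b a) \<le> r"
proof -
  have p': "p \<le> 1" using p by simp
  obtain n0 and R :: nat where b: "supported_in b {n0 - int R..n0 + int R}"
    "\<And>n. norm (b n) \<le> (2 * real R + 1) powr (- 1 / p)" "vanishing_moments (moment_count p) b"
    using hardy_atomE[OF p(1) p' b] by metis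
  define I where "I = {n0 - int R..n0 + int R}"
  define L where "L = 2 * real R + 1"
  define \<alpha> where "\<alpha> = 1 / p - 1"
  have \<alpha>: "0 < \<alpha>" using p by (simp add: \<alpha>_def)
  have L: "1 \<le> L" by (simp add: L_def)
  have card: "real (card I) = L" by (simp add: I_def L_def)
  have "0 < moment_count p" using moment_count(1)[OF p(1) p'] by simp
  then have "(\<Sum>n\<in>I. of_int n ^ 0 * b n) = 0"
    using b(3) unfolding I_def vanishing_moments_finite[OF b(1)] by blast
  then have mean: "sum b I = 0" by simp
  have "seq_functional b a = (\<Sum>n\<in>I. a n * b n)" unfolding I_def by (rule seq_functional_finite[OF b(1)])
  also have "\<dots> = (\<Sum>n\<in>I. (a n - a n0) * b n)"
    using mean by (simp add: left_diff_distrib sum_subtractf sum_distrib_left[symmetric])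
  finally have "norm (seq_functional b a) \<le> (\<Sum>n\<in>I. norm ((a n - a n0) * b n))"
    by (simp add: norm_sum)
  also have "\<dots> \<le> (\<Sum>n\<in>I. (r * L powr \<alpha>) * L powr (- 1 / p))"
  proof (rule sum_mono)
    fix n assume n: "n \<in> I"
    have "norm (a n - a n0) \<le> r * L powr \<alpha>"
    proof (cases "n = n0")
      case True
      then show ?thesis using a(2) by simp
    next
      case False
      have "norm (a n - a n0) \<le> r * \<bar>of_int (n - n0)\<bar> powr \<alpha>"
        unfolding \<alpha>_def by (rule lip_norm_bound[OF a False])
      also have "\<dots> \<le> r * L powr \<alpha>"
      proof (intro mult_left_mono powr_mono2 a(2))
        have "\<bar>n - n0\<bar> \<le> int R" using n by (auto simp: I_def)
        then have "\<bar>real_of_int (n - n0)\<bar> \<le> real R" by linarith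
        then show "\<bar>real_of_int (n - n0)\<bar> \<le> L" by (simp add: L_def)
      qed (use \<alpha> in auto)
      finally show ?thesis .
    qed
    moreover have "norm (b n) \<le> L powr (- 1 / p)" unfolding L_def by (rule b(2))
    ultimately show "norm ((a n - a n0) * b n) \<le> (r * L powr \<alpha>) * L powr (- 1 / p)"
      unfolding norm_mult using a(2) by (intro mult_mono) auto
  qed
  also have "\<dots> = r * (L powr 1 * (L powr \<alpha> * L powr (- 1 / p)))" using L by (simp add: card)
  also have "L powr 1 * (L powr \<alpha> * L powr (- 1 / p)) = L powr (1 + (\<alpha> + - 1 / p))"
    by (simp only: powr_add)
  also have "\<dots> = 1" using L by (simp add: \<alpha>_def)
  finally show ?thesis by simp
qed

text \<open>
  Absolute summability of the coefficients upgrades pointwise convergence to the convergence that the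
  definition of the Hardy space asks for. The remainders are bounded by the tails of \<open>suminf \<mu>\<close>, in \<open>\<ell>\<^sup>1\<close> for
  \<open>p = 1\<close> and in the dual of the Lipschitz space for \<open>p < 1\<close>.
\<close>

lemma atomic_rep_intro:
  assumes p: "0 < p" "p \<le> 1" and \<mu>: "\<And>j. 0 \<le> \<mu> j" "summable (\<lambda>j. \<mu> j powr p)"
    and b: "\<And>j. hardy_atom p (b j)" and g: "\<And>n. (\<lambda>j. of_real (\<mu> j) * b j n) sums g n"
  shows "atomic_rep p g \<mu> b"
proof -
  have s: "summable \<mu>" by (rule powr_summable_imp_summable(2)[OF p \<mu>])
  define tail where "tail N = (\<Sum>j. \<mu> (j + N))" for N
  have tail: "tail \<longlonglongrightarrow> 0" unfolding tail_def by (rule suminf_tail_tendsto[OF s])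
  have tail0: "0 \<le> tail N" for N
    unfolding tail_def using s \<mu>(1) by (intro suminf_nonneg) (auto simp: summable_iff_shift)
  have S0: "0 \<le> suminf \<mu>" using s \<mu>(1) by (rule suminf_nonneg)
  show ?thesis
  proof (cases "p = 1")
    case True
    have "g \<in> lp_space 1 unit_weight"
      by (rule lp_spaceI[where C = "suminf \<mu>"]) (use atom_series_l1[OF p \<mu>(1) s b g] S0 in auto)
    moreover have "lp_norm 1 unit_weight (\<lambda>n. g n - (\<Sum>j<N. of_real (\<mu> j) * b j n)) \<le> ennreal (tail N)" for N
      using atom_series_remainder_l1[OF p \<mu>(1) s b g] tail0 by (subst lp_norm_le_iff) (auto simp: tail_def)
    then have "(\<lambda>N. lp_norm 1 unit_weight (\<lambda>n. g n - (\<Sum>j<N. of_real (\<mu> j) * b j n))) \<longlonglongrightarrow> 0"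
      using tail tail0 by (rule tendsto_zero_ennrealI)
    ultimately show ?thesis using True \<mu>(2) b unfolding atomic_rep_def by simp
  next
    case False
    then have p1: "p < 1" using p by simp
    define \<alpha> where "\<alpha> = 1 / p - 1"
    define \<Phi> where "\<Phi> a = (\<Sum>j. of_real (\<mu> j) * seq_functional (b j) a)" for a
    have atom_term: "norm (of_real (\<mu> j) * seq_functional (b j) a) \<le> r * \<mu> j"
      if "lip_norm \<alpha> a \<le> ennreal r" "0 \<le> r" for a r j
      using mult_right_mono[OF seq_functional_atom[OF p(1) p1 b that[unfolded \<alpha>_def]] \<mu>(1)] \<mu>(1)
      by (simp add: norm_mult mult_ac)
    have obt: "\<exists>r\<ge>0. lip_norm \<alpha> a \<le> ennreal r" if "a \<in> lip_space \<alpha>" for a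
      using that unfolding lip_space_def by (cases "lip_norm \<alpha> a") auto
    have summ: "summable (\<lambda>j. of_real (\<mu> j) * seq_functional (b j) a)" if a: "a \<in> lip_space \<alpha>" for a
    proof -
      obtain r where r: "0 \<le> r" "lip_norm \<alpha> a \<le> ennreal r" using obt[OF a] by blast
      show ?thesis
        by (rule summable_comparison_test'[OF summable_mult[OF s, of r]]) (rule atom_term[OF r(2,1)])
    qed
    have supp: "\<exists>A. supported_in (b j) A" for j using hardy_atomE[OF p b[of j]] by metis
    have lin: "seq_functional (b j) (\<lambda>n. f n + h n) = seq_functional (b j) f + seq_functional (b j) h"
      "seq_functional (b j) (\<lambda>n. c * f n) = c * seq_functional (b j) f" for j f h c
    proof -
      obtain A where A: "supported_in (b j) A" using supp by blast
      show "seq_functional (b j) (\<lambda>n. f n + h n) = seq_functional (b j) f + seq_functional (b j) h"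
        by (simp add: seq_functional_finite[OF A] distrib_right sum.distrib)
      show "seq_functional (b j) (\<lambda>n. c * f n) = c * seq_functional (b j) f"
        by (simp add: seq_functional_finite[OF A] sum_distrib_left mult.assoc)
    qed
    have unit: "norm (\<Phi> a - (\<Sum>j<N. of_real (\<mu> j) * seq_functional (b j) a)) \<le> tail N"
      if a: "lip_norm \<alpha> a \<le> 1" for a N
    proof -
      have a': "lip_norm \<alpha> a \<le> ennreal 1" using a by simp
      then have "a \<in> lip_space \<alpha>" unfolding lip_space_def by (simp add: le_less_trans)
      then have "\<Phi> a - (\<Sum>j<N. of_real (\<mu> j) * seq_functional (b j) a)
         = (\<Sum>j. of_real (\<mu> (j + N)) * seq_functional (b (j + N)) a)"
        unfolding \<Phi>_def by (subst suminf_split_initial_segment[OF summ, of a N]) auto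
      also have "norm \<dots> \<le> tail N"
        unfolding tail_def
      proof (rule norm_suminf_le)
        show "norm (of_real (\<mu> (j + N)) * seq_functional (b (j + N)) a) \<le> \<mu> (j + N)" for j
          using atom_term[OF a'] by simp
        show "summable (\<lambda>j. \<mu> (j + N))" using s by (simp add: summable_iff_shift)
      qed
      finally show ?thesis .
    qed
    have conv: "lip_dual_norm \<alpha> (\<lambda>a. \<Phi> a - (\<Sum>j<N. of_real (\<mu> j) * seq_functional (b j) a)) \<le> ennreal (tail N)" for N
      unfolding lip_dual_norm_def using unit by (intro SUP_least) (auto intro!: ennreal_leI)
    have \<Phi>: "\<Phi> \<in> lip_dual \<alpha>"
      unfolding lip_dual_def
    proof (intro CollectI conjI ballI allI)
      fix f h assume "f \<in> lip_space \<alpha>" "h \<in> lip_space \<alpha>"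
      then show "\<Phi> (\<lambda>n. f n + h n) = \<Phi> f + \<Phi> h"
        unfolding \<Phi>_def lin(1) distrib_left by (intro suminf_add[symmetric] summ)
    next
      fix c f assume f: "f \<in> lip_space \<alpha>"
      have "\<Phi> (\<lambda>n. c * f n) = (\<Sum>j. c * (of_real (\<mu> j) * seq_functional (b j) f))"
        unfolding \<Phi>_def lin(2) by (simp add: mult_ac)
      then show "\<Phi> (\<lambda>n. c * f n) = c * \<Phi> f"
        unfolding \<Phi>_def by (simp only: suminf_mult[OF summ[OF f]])
    next
      show "lip_dual_norm \<alpha> \<Phi> < top"
        using conv[of 0] by (simp add: le_less_trans)
    qed
    have "(\<lambda>N. lip_dual_norm \<alpha> (\<lambda>a. \<Phi> a - (\<Sum>j<N. of_real (\<mu> j) * seq_functional (b j) a))) \<longlonglongrightarrow> 0"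
      using conv tail tail0 by (rule tendsto_zero_ennrealI)
    then have "\<exists>\<Phi>\<in>lip_dual \<alpha>. (\<lambda>N. lip_dual_norm \<alpha> (\<lambda>a. \<Phi> a - (\<Sum>j<N. of_real (\<mu> j) * seq_functional (b j) a))) \<longlonglongrightarrow> 0"
      using \<Phi> by (rule bexI)
    then show ?thesis using False \<mu>(2) b g unfolding atomic_rep_def \<alpha>_def by (simp only: if_False) blast
  qed
qed

lemma atomic_sum_hardy:
  assumes p: "0 < p" "p \<le> 1" and g: "atomic_sum p g c"
  shows "g \<in> hardy_space p" "hardy_norm p g \<le> ennreal (c powr (1 / p))"
proof -
  obtain \<mu> b where mb: "\<And>i::nat. 0 \<le> \<mu> i \<and> hardy_atom p (b i)" "summable (\<lambda>i. \<mu> i powr p)"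
     "(\<Sum>i. \<mu> i powr p) \<le> c" "\<And>n. (\<lambda>i. of_real (\<mu> i) * b i n) sums g n"
    using g unfolding atomic_sum_def by blast
  have \<mu>0: "0 \<le> \<mu> i" and b: "hardy_atom p (b i)" for i using mb(1) by auto
  have rep: "atomic_rep p g \<mu> b" by (rule atomic_rep_intro[OF p \<mu>0 mb(2) b mb(4)])
  have "hardy_norm p g \<le> ennreal ((\<Sum>i. \<mu> i powr p) powr (1 / p))"
    unfolding hardy_norm_def by (rule INF_lower2[of "(\<mu>, b)"]) (use rep \<mu>0 in auto)
  also have "\<dots> \<le> ennreal (c powr (1 / p))"
    using p suminf_nonneg[OF mb(2)] by (intro ennreal_leI powr_mono2 mb(3)) auto
  finally show "hardy_norm p g \<le> ennreal (c powr (1 / p))" .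
  \<comment> \<open>Elements of the Hardy space have representations with positive coefficients: vanishing coefficients are
    replaced by a geometric sequence, with the zero atom attached.\<close>
  define \<nu> where "\<nu> i = (if \<mu> i = 0 then (1 / 2) ^ i else \<mu> i)" for i
  define d where "d i = (if \<mu> i = 0 then (\<lambda>_. 0) else b i)" for i
  have \<nu>: "0 < \<nu> i" for i using \<mu>0[of i] unfolding \<nu>_def by (cases "\<mu> i = 0") auto
  have "atomic_rep p g \<nu> d"
  proof (rule atomic_rep_intro[OF p])
    show "0 \<le> \<nu> i" for i using \<nu>[of i] by simp
    have geo: "((1 / 2 :: real) ^ i) powr p = ((1 / 2) powr p) ^ i" for i
      by (simp add: powr_realpow[symmetric] powr_powr mult.commute)
    have "summable (\<lambda>i. \<mu> i powr p + ((1 / 2 :: real) powr p) ^ i)"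
    proof (intro summable_add mb(2) summable_geometric)
      have "(1 / 2 :: real) powr p < 1 powr p" using p by (intro powr_less_mono2) auto
      then show "norm ((1 / 2 :: real) powr p) < 1" by simp
    qed
    then show "summable (\<lambda>i. \<nu> i powr p)"
      by (rule summable_comparison_test') (use p in \<open>auto simp: \<nu>_def geo\<close>)
    show "hardy_atom p (d i)" for i using b hardy_atom_zero[OF p] by (simp add: d_def)
    have "of_real (\<nu> i) * d i n = of_real (\<mu> i) * b i n" for i n by (simp add: \<nu>_def d_def)
    then show "(\<lambda>i. of_real (\<nu> i) * d i n) sums g n" for n using mb(4) by simp
  qed
  then show "g \<in> hardy_space p" unfolding hardy_space_def using \<nu> by blast
qed

lemma atomic_rep_sums:
  assumes p: "p \<le> 1" and rep: "atomic_rep p h \<mu> b"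
  shows "(\<lambda>j. of_real (\<mu> j) * b j n) sums h n"
proof (cases "p = 1")
  case True
  define X where "X N = (\<Sum>j<N. of_real (\<mu> j) * b j n)" for N
  have lim: "(\<lambda>N. lp_norm 1 unit_weight (\<lambda>n. h n - (\<Sum>j<N. of_real (\<mu> j) * b j n))) \<longlonglongrightarrow> 0"
    using rep True unfolding atomic_rep_def by simp
  have "X \<longlonglongrightarrow> h n"
  proof (rule tendstoI)
    fix e :: real assume e: "0 < e"
    have "\<forall>\<^sub>F N in sequentially. lp_norm 1 unit_weight (\<lambda>n. h n - (\<Sum>j<N. of_real (\<mu> j) * b j n)) < ennreal (e / 2)"
      using order_tendstoD(2)[OF lim, of "ennreal (e / 2)"] e by simp
    then show "\<forall>\<^sub>F N in sequentially. dist (X N) (h n) < e"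
    proof eventually_elim
      case (elim N)
      have "\<forall>F. finite F \<longrightarrow> (\<Sum>n\<in>F. norm (h n - (\<Sum>j<N. of_real (\<mu> j) * b j n)) powr 1 * 1) \<le> (e / 2) powr 1"
        using less_imp_le[OF elim] e by (subst (asm) lp_norm_le_iff) auto
      from this[rule_format, of "{n}"] have "norm (h n - X N) \<le> e / 2" using e by (simp add: X_def)
      then show ?case using e by (simp add: dist_norm norm_minus_commute)
    qed
  qed
  then show ?thesis by (simp add: sums_def X_def[abs_def])
next
  case False
  then show ?thesis using rep unfolding atomic_rep_def by simp
qed

context calderon_zygmund_kernel
begin

lemma conv_l1_bound:
  assumes M: "\<And>n. norm (K n) \<le> M" and u: "\<And>F. finite F \<Longrightarrow> (\<Sum>n\<in>F. norm (u n)) \<le> s"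
    and u2: "u \<in> lp_space 2 unit_weight"
  shows "norm (conv K u n) \<le> M * s"
proof -
  have M0: "0 \<le> M" using order_trans[OF norm_ge_zero M[of 0]] .
  have "norm (conv K u n) \<le> (\<Sum>\<^sub>\<infinity>k\<in>UNIV. norm (K (n - k) * u k))"
    unfolding conv_def by (rule norm_infsum_bound[OF conv_abs_summable[OF u2]])
  also have "\<dots> \<le> M * s"
  proof (rule infsum_le_finite_sums[OF conv_abs_summable[OF u2]])
    fix F :: "int set" assume F: "finite F"
    have "(\<Sum>k\<in>F. norm (K (n - k) * u k)) \<le> (\<Sum>k\<in>F. M * norm (u k))"
      unfolding norm_mult by (intro sum_mono mult_right_mono M) simp
    also have "\<dots> \<le> M * s" unfolding sum_distrib_left[symmetric] by (intro mult_left_mono u F M0)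
    finally show "(\<Sum>k\<in>F. norm (K (n - k) * u k)) \<le> M * s" .
  qed
  finally show ?thesis .
qed

lemma l1_bound_lp2:
  assumes "\<And>F. finite F \<Longrightarrow> (\<Sum>n\<in>F. norm (u n)) \<le> s"
  shows "u \<in> lp_space 2 unit_weight"
proof (rule lp_spaceI[where C = "s * s"])
  have s0: "0 \<le> s" using assms[of "{}"] by simp
  then show "0 \<le> s * s" by simp
  fix F :: "int set" assume F: "finite F"
  have "norm (u n) \<le> s" for n using assms[of "{n}"] by simp
  then have "(\<Sum>n\<in>F. norm (u n) powr 2 * 1) \<le> (\<Sum>n\<in>F. s * norm (u n))"
    by (intro sum_mono) (auto simp: power2_eq_square intro!: mult_right_mono)
  also have "\<dots> \<le> s * s" unfolding sum_distrib_left[symmetric] by (intro mult_left_mono assms F s0)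
  finally show "(\<Sum>n\<in>F. norm (u n) powr 2 * 1) \<le> s * s" .
qed auto

text \<open>
  The remainder of the series is small in \<open>\<ell>\<^sup>1\<close> and the kernel is bounded.
\<close>

lemma conv_atom_series:
  assumes p: "0 < p" "p \<le> 1" and \<mu>: "\<And>j. 0 \<le> \<mu> j" "summable \<mu>" and b: "\<And>j. hardy_atom p (b j)"
    and h: "\<And>n. (\<lambda>j. of_real (\<mu> j) * b j n) sums h n"
  shows "(\<lambda>j. of_real (\<mu> j) * conv K (b j) n) sums conv K h n"
proof -
  obtain M where M: "0 \<le> M" "\<And>n. norm (K n) \<le> M" using kernel_bounded by blast
  define tail where "tail N = (\<Sum>j. \<mu> (j + N))" for N
  define u where "u N k = h k - (\<Sum>j<N. of_real (\<mu> j) * b j k)" for N k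
  have u: "(\<Sum>k\<in>F. norm (u N k)) \<le> tail N" if "finite F" for N F
    unfolding u_def tail_def by (rule atom_series_remainder_l1[OF p \<mu> b h that])
  have u2: "u N \<in> lp_space 2 unit_weight" for N by (rule l1_bound_lp2[OF u])
  have a2: "b j \<in> lp_space 2 unit_weight" for j by (rule l1_bound_lp2[OF hardy_atom_l1[OF p b]])
  have part: "(\<lambda>k. \<Sum>j<N. of_real (\<mu> j) * b j k) \<in> lp_space 2 unit_weight \<and>
     conv K (\<lambda>k. \<Sum>j<N. of_real (\<mu> j) * b j k) n = (\<Sum>j<N. of_real (\<mu> j) * conv K (b j) n)" for N
  proof (induction N)
    case 0
    then show ?case using lp2_closed(1) by (simp add: conv_def)
  next
    case (Suc N)
    have s: "(\<lambda>k. of_real (\<mu> N) * b N k) \<in> lp_space 2 unit_weight" by (rule lp2_closed(3)[OF a2])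
    show ?case
      using Suc lp2_closed(2)[OF conjunct1[OF Suc] s] conv_linear(1)[OF conjunct1[OF Suc] s, of n] conv_linear(2)[OF a2 a2]
      by simp
  qed
  have le: "norm ((\<Sum>j<N. of_real (\<mu> j) * conv K (b j) n) - conv K h n) \<le> M * tail N" for N
  proof -
    have "h = (\<lambda>k. (\<Sum>j<N. of_real (\<mu> j) * b j k) + u N k)" by (simp add: u_def)
    then have "conv K h n = (\<Sum>j<N. of_real (\<mu> j) * conv K (b j) n) + conv K (u N) n"
      using conv_linear(1)[OF conjunct1[OF part] u2, of N N n] part[of N] by simp
    then show ?thesis using conv_l1_bound[OF M(2) u u2, of N n] by simp
  qed
  have "(\<lambda>N. M * tail N) \<longlonglongrightarrow> 0"
    unfolding tail_def using tendsto_mult_left[OF suminf_tail_tendsto[OF \<mu>(2)], of M] by simp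
  then have "(\<lambda>N. (\<Sum>j<N. of_real (\<mu> j) * conv K (b j) n) - conv K h n) \<longlonglongrightarrow> 0"
    by (rule Lim_null_comparison[OF always_eventually[OF allI[OF le]]])
  then show ?thesis unfolding sums_def by (rule LIM_zero_cancel)
qed

text \<open>
  The image of an atom is a sum of atoms with a constant that does not depend on the atom. Scaling by the
  coefficients and summing the resulting double series bounds the quasinorm of the image by every
  representation of \<open>h\<close>.
\<close>

lemma hardy_bound:
  assumes p: "0 < p" "p \<le> 1"
  shows "\<exists>C. \<forall>h\<in>hardy_space p. h \<in> lp_space 2 unit_weight \<and> conv K h \<in> hardy_space p \<and>
     hardy_norm p (conv K h) \<le> ennreal C * hardy_norm p h"
proof -
  obtain C where C: "0 \<le> C" "\<And>b. hardy_atom p b \<Longrightarrow> atomic_sum p (conv K b) C"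
    using atom_image[OF p] by blast
  \<comment> \<open>The summand \<open>1\<close> makes \<open>D\<close> positive, which allows dividing by it in \<open>[0,\<infinity>]\<close>.\<close>
  define D where "D = (C + 1) powr (1 / p)"
  have D: "0 < D" using C(1) by (simp add: D_def)
  have rep: "h \<in> lp_space 2 unit_weight \<and> atomic_sum p (conv K h) ((C + 1) * (\<Sum>j. \<mu> j powr p))"
    if \<mu>: "\<And>j. 0 \<le> \<mu> j" and h: "atomic_rep p h \<mu> b" for h \<mu> b
  proof -
    have b: "hardy_atom p (b j)" and s: "summable (\<lambda>j. \<mu> j powr p)" for j
      using h unfolding atomic_rep_def by auto
    have s1: "summable \<mu>" by (rule powr_summable_imp_summable(2)[OF p \<mu> s])
    have sums: "(\<lambda>j. of_real (\<mu> j) * b j n) sums h n" for n by (rule atomic_rep_sums[OF p(2) h])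
    have "h \<in> lp_space 2 unit_weight" by (rule l1_bound_lp2[OF atom_series_l1[OF p \<mu> s1 b sums]])
    moreover have "atomic_sum p (conv K h) (\<Sum>j. \<mu> j powr p * (C + 1))"
    proof (rule atomic_sum_countable[OF p])
      show "atomic_sum p (\<lambda>n. of_real (\<mu> j) * conv K (b j) n) (\<mu> j powr p * (C + 1))" for j
        by (rule atomic_sum_scale[OF p \<mu> atomic_sum_mono[OF C(2)[OF b]]]) simp
      show "summable (\<lambda>j. \<mu> j powr p * (C + 1))" by (rule summable_mult2[OF s])
      show "(\<lambda>j. of_real (\<mu> j) * conv K (b j) n) sums conv K h n" for n
        by (rule conv_atom_series[OF p \<mu> s1 b sums])
    qed
    moreover have "(\<Sum>j. \<mu> j powr p * (C + 1)) = (C + 1) * (\<Sum>j. \<mu> j powr p)"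
      using suminf_mult2[OF s, of "C + 1"] by (simp add: mult.commute)
    ultimately show ?thesis by simp
  qed
  have "h \<in> lp_space 2 unit_weight \<and> conv K h \<in> hardy_space p \<and> hardy_norm p (conv K h) \<le> ennreal D * hardy_norm p h"
    if h: "h \<in> hardy_space p" for h
  proof -
    obtain \<mu> b where \<mu>: "\<And>j. 0 < \<mu> j" "atomic_rep p h \<mu> b"
      using h unfolding hardy_space_def by auto
    have sum: "h \<in> lp_space 2 unit_weight \<and> atomic_sum p (conv K h) ((C + 1) * (\<Sum>j. \<mu> j powr p))"
      by (rule rep[OF less_imp_le[OF \<mu>(1)] \<mu>(2)])
    have "hardy_norm p (conv K h) / ennreal D \<le> hardy_norm p h"
      unfolding hardy_norm_def[of p h]
    proof (rule INF_greatest)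
      fix x assume "x \<in> {(cs, bs). (\<forall>j. 0 \<le> cs j) \<and> atomic_rep p h cs bs}"
      then obtain \<nu> d where x: "x = (\<nu>, d)" "\<And>j. 0 \<le> \<nu> j" "atomic_rep p h \<nu> d" by auto
      define S where "S = (\<Sum>j. \<nu> j powr p)"
      have "summable (\<lambda>j. \<nu> j powr p)" using x(3) unfolding atomic_rep_def by simp
      then have S0: "0 \<le> S" unfolding S_def by (rule suminf_nonneg) simp
      have "atomic_sum p (conv K h) ((C + 1) * S)" using rep[OF x(2,3)] by (simp add: S_def)
      then have "hardy_norm p (conv K h) \<le> ennreal (((C + 1) * S) powr (1 / p))"
        by (rule atomic_sum_hardy(2)[OF p])
      also have "\<dots> = ennreal D * ennreal (S powr (1 / p))"
        using C(1) S0 D by (simp add: D_def powr_mult ennreal_mult[symmetric])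
      finally have "hardy_norm p (conv K h) / ennreal D \<le> ennreal (S powr (1 / p))"
        using D by (intro divide_le_posI_ennreal) auto
      then show "hardy_norm p (conv K h) / ennreal D \<le> (case x of (cs, bs) \<Rightarrow> ennreal ((\<Sum>j. cs j powr p) powr (1 / p)))"
        by (simp add: x(1) S_def)
    qed
    then have "ennreal D * (hardy_norm p (conv K h) / ennreal D) \<le> ennreal D * hardy_norm p h"
      by (rule mult_left_mono) simp
    moreover have "ennreal D * (hardy_norm p (conv K h) / ennreal D) = hardy_norm p (conv K h)"
      unfolding ennreal_times_divide using D
      by (subst mult.commute) (rule ennreal_mult_divide_eq, auto)
    ultimately show ?thesis using sum atomic_sum_hardy(1)[OF p conjunct2[OF sum]] by simp
  qed
  then show ?thesis by blast
qed

end

lemma extends_boundedly_cong: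
  assumes "\<And>f. f \<in> lp_space 2 unit_weight \<Longrightarrow> T f = T' f"
  shows "extends_boundedly T p w target \<longleftrightarrow> extends_boundedly T' p w target"
  using assms unfolding extends_boundedly_def by auto

theorem theorem1p3:
  fixes m \<Psi> :: "real \<Rightarrow> complex"
  assumes "m \<in> Linf_pos"
    and "\<Psi> \<in> Linf_pos"
    and "\<And>l. 0 < l \<Longrightarrow>
           m l = of_real l * (LINT t|lebesgue_on {0<..}. of_real (exp (- l * t)) * \<Psi> t)"
  shows "(\<forall>p \<omega>. 1 < p \<and> Ap_weight p \<omega> \<longrightarrow>
            extends_boundedly (multiplier_op m) p \<omega> (lp_norm p \<omega>)) \<and>
         (\<forall>\<omega>. Ap_weight 1 \<omega> \<longrightarrow>
            extends_boundedly (multiplier_op m) 1 \<omega> (weak_l1_norm \<omega>)) \<and>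
         (\<forall>p. 0 < p \<and> p \<le> 1 \<longrightarrow>
            (\<exists>C::real. \<forall>h \<in> hardy_space p.
               multiplier_op m h \<in> hardy_space p \<and>
               hardy_norm p (multiplier_op m h) \<le> ennreal C * hardy_norm p h))"
proof -
  interpret laplace_type_multiplier m \<Psi>
    by unfold_locales (use assms(2,3) in auto)
  have eq: "extends_boundedly (multiplier_op m) p w target \<longleftrightarrow> extends_boundedly (conv kernel) p w target" for p w target
    by (rule extends_boundedly_cong) (rule multiplier_op_eq_conv)
  show ?thesis
  proof (intro conjI allI impI)
    fix p \<omega> assume "1 < p \<and> Ap_weight p \<omega>"
    then show "extends_boundedly (multiplier_op m) p \<omega> (lp_norm p \<omega>)"
      unfolding eq using weighted_bounds(1) by blast
  next
    fix \<omega> assume "Ap_weight 1 \<omega>"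
    then show "extends_boundedly (multiplier_op m) 1 \<omega> (weak_l1_norm \<omega>)"
      unfolding eq by (rule weighted_bounds(2))
  next
    fix p :: real assume p: "0 < p \<and> p \<le> 1"
    obtain C where C: "\<And>h. h \<in> hardy_space p \<Longrightarrow> h \<in> lp_space 2 unit_weight \<and> conv kernel h \<in> hardy_space p \<and>
     hardy_norm p (conv kernel h) \<le> ennreal C * hardy_norm p h"
      using hardy_bound p by meson
    then show "\<exists>C::real. \<forall>h \<in> hardy_space p. multiplier_op m h \<in> hardy_space p \<and>
               hardy_norm p (multiplier_op m h) \<le> ennreal C * hardy_norm p h"
      using multiplier_op_eq_conv by (intro exI[of _ C]) simp
  qed
qed

end
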